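(* Let $m,n\ge 1$ be integers and $a,b,q,t\in\mathbb C^*$ generic. Then, as functions of $x_1,\dots,x_n,y_1,\dots,y_m\in\mathbb C^*$, $$ \prod_{\substack{1\le i\le n\\1\le j\le m}} \theta(y_j x_i,y_j/x_i;p) = \sum_{\mu\subset m^n} \frac{\Delta_\mu(\frac{t^{n-1}a}{q^m b}\,|\,t^n,q^{-m};q,t;p)} {C^0_{m^n}(t^{n-1}ab,b/a;q,t;p)}\, P^{*(m,n)}_\mu(x_1,\dots,x_n;a,b;q,t;p)\, P^{*(n,m)}_{n^m-\mu'}(\sqrt p/y_1,\dots,\sqrt p/y_m;\sqrt p/a,\sqrt p/b;1/t,1/q;p). $$
   Context: Fix $p\in\mathbb C$, $0<|p|<1$, and a square root $\sqrt p$. $\theta(x;p)=\prod_{k\ge 0}(1-p^kx)(1-p^{k+1}/x)$. Several arguments before the first semicolon of $\theta$ or a $C$ symbol mean the product over the arguments. Partitions are identified with diagrams $\{(i,j):1\le j\le\lambda_i\}$; $\lambda'$ is the conjugate, $m^n$ the partition with $n$ parts equal to $m$; for $\lambda\subset m^n$, $(m^n-\lambda)_i=m-\lambda_{n+1-i}$; $2\lambda^2$ is the partition with $(2\lambda^2)_i=2\lambda_{\lceil i/2\rceil}$. Symbols: $C^0_\lambda(x;q,t;p)=\prod_{(i,j)\in\lambda}\theta(q^{j-1}t^{1-i}x;p)$, $C^-_\lambda(x;q,t;p)=\prod_{(i,j)\in\lambda}\theta(q^{\lambda_i-j}t^{\lambda'_j-i}x;p)$, $C^+_\lambda(x;q,t;p)=\prod_{(i,j)\in\lambda}\theta(q^{\lambda_i+j-1}t^{2-\lambda'_j-i}x;p)$,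 $$\Delta_\lambda(a|\dots b_i\dots;q,t;p)=\prod_i\frac{C^0_\lambda(b_i;q,t;p)}{C^0_\lambda(pqa/b_i;q,t;p)}\cdot\frac{C^0_{2\lambda^2}(pqa;q,t;p)}{C^-_\lambda(pq,t;q,t;p)\,C^+_\lambda(a,pqa/t;q,t;p)}.$$ Interpolation theta functions: a $BC_n$-symmetric theta function of degree $m$ is a holomorphic $f$ on $(\mathbb C^* )^n$ invariant under permutations of the $x_i$ and under each $x_i\mapsto1/x_i$, with $f(px_1,x_2,\dots,x_n)=(px_1^2)^{-m}f(x_1,\dots,x_n)$. For $\lambda\subset m^n$ and generic $a,b,q,t$, $P^{*(m,n)}_\lambda(x_1,\dots,x_n;a,b;q,t;p)$ is the unique $BC_n$-symmetric theta function of degree $m$ such that: (i) for every $\mu\subset m^n$, $\mu\ne\lambda$, it vanishes at the point with $x_i=bq^{m-\mu_i}t^{i-1}$ for $1\le i\le l$ and $x_i=aq^{\mu_i}t^{n-i}$ for $l<i\le n$, where $l_0$ is the largest index with $\mu_{l_0}\ne\lambda_{l_0}$, $l_1$ is the largest index with $\mu_{l_1}=m$ ($0$ if none), and $l=l_1$ if $\mu_{l_0}<\lambda_{l_0}$, $l=l_0$ otherwise; (ii) at $x_i=vt^{n-i}$ its value is $C^0_\lambda(t^{n-1}av,a/v;q,t;p)\,C^0_{m^n-\lambda}(t^{n-1}bv,b/v;q,t;p)$, for a generic $v\in\mathbb C^*$ (the function does not depend on $v$). *)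

theory Defs
  imports "HOL-Analysis.Analysis"
begin

section \<open>Partitions\<close>

text \<open>
  A partition is a function \<open>nat \<Rightarrow> nat\<close> whose parts are its values at \<open>1, 2, \<dots>\<close>; the value at
  \<open>0\<close> is a dummy, kept at \<open>0\<close> so that a partition is represented by exactly one function.
\<close>

definition partitions_in :: "nat \<Rightarrow> nat \<Rightarrow> (nat \<Rightarrow> nat) set"  \<comment> \<open>all \<open>\<mu> \<subset> m\<^sup>n\<close>\<close>
  where "partitions_in m n =
    {\<mu>. (\<forall>i\<in>{1..n}. \<mu> i \<le> m) \<and> (\<forall>i. i \<notin> {1..n} \<longrightarrow> \<mu> i = 0) \<and>
         (\<forall>i j. 1 \<le> i \<and> i \<le> j \<longrightarrow> \<mu> j \<le> \<mu> i)}"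

definition diagram :: "(nat \<Rightarrow> nat) \<Rightarrow> (nat \<times> nat) set"
  where "diagram \<mu> = {(i, j). 1 \<le> i \<and> 1 \<le> j \<and> j \<le> \<mu> i}"

definition conjugate :: "(nat \<Rightarrow> nat) \<Rightarrow> nat \<Rightarrow> nat"
  where "conjugate \<mu> j = (if j = 0 then 0 else card {i. 1 \<le> i \<and> j \<le> \<mu> i})"

definition rectangle :: "nat \<Rightarrow> nat \<Rightarrow> nat \<Rightarrow> nat"  \<comment> \<open>\<open>m\<^sup>n\<close>\<close>
  where "rectangle m n i = (if i \<in> {1..n} then m else 0)"

definition rect_complement :: "nat \<Rightarrow> nat \<Rightarrow> (nat \<Rightarrow> nat) \<Rightarrow> nat \<Rightarrow> nat"  \<comment> \<open>\<open>m\<^sup>n - \<mu>\<close>\<close>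
  where "rect_complement m n \<mu> i = (if i \<in> {1..n} then m - \<mu> (n + 1 - i) else 0)"

definition double_square :: "(nat \<Rightarrow> nat) \<Rightarrow> nat \<Rightarrow> nat"  \<comment> \<open>\<open>2\<mu>\<^sup>2\<close>; \<open>(i + 1) div 2 = \<lceil>i / 2\<rceil>\<close>\<close>
  where "double_square \<mu> i = 2 * \<mu> ((i + 1) div 2)"


section \<open>Theta functions and the \<open>C\<close> and \<open>\<Delta>\<close> symbols\<close>

text \<open>
  A list holds the arguments before the first semicolon; the symbol is the product over them.
\<close>

definition theta :: "complex list \<Rightarrow> complex \<Rightarrow> complex"
  where "theta xs p = (\<Prod>x\<leftarrow>xs. prodinf (\<lambda>k. (1 - p ^ k * x) * (1 - p ^ (k + 1) / x)))"

definition C0 :: "(nat \<Rightarrow> nat) \<Rightarrow> complex list \<Rightarrow> complex \<Rightarrow> complex \<Rightarrow> complex \<Rightarrow> complex"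
  where "C0 \<mu> xs q t p = (\<Prod>x\<leftarrow>xs. \<Prod>(i, j)\<in>diagram \<mu>.
    theta [q powi (int j - 1) * t powi (1 - int i) * x] p)"

definition Cminus :: "(nat \<Rightarrow> nat) \<Rightarrow> complex list \<Rightarrow> complex \<Rightarrow> complex \<Rightarrow> complex \<Rightarrow> complex"
  where "Cminus \<mu> xs q t p = (\<Prod>x\<leftarrow>xs. \<Prod>(i, j)\<in>diagram \<mu>.
    theta [q powi (int (\<mu> i) - int j) * t powi (int (conjugate \<mu> j) - int i) * x] p)"

definition Cplus :: "(nat \<Rightarrow> nat) \<Rightarrow> complex list \<Rightarrow> complex \<Rightarrow> complex \<Rightarrow> complex \<Rightarrow> complex"
  where "Cplus \<mu> xs q t p = (\<Prod>x\<leftarrow>xs. \<Prod>(i, j)\<in>diagram \<mu>.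
    theta [q powi (int (\<mu> i) + int j - 1) * t powi (2 - int (conjugate \<mu> j) - int i) * x] p)"

definition Delta ::
    "(nat \<Rightarrow> nat) \<Rightarrow> complex \<Rightarrow> complex list \<Rightarrow> complex \<Rightarrow> complex \<Rightarrow> complex \<Rightarrow> complex"
  where "Delta \<mu> a bs q t p =
    (\<Prod>b\<leftarrow>bs. C0 \<mu> [b] q t p / C0 \<mu> [p * q * a / b] q t p) *
    (C0 (double_square \<mu>) [p * q * a] q t p /
      (Cminus \<mu> [p * q, t] q t p * Cplus \<mu> [a, p * q * a / t] q t p))"


section \<open>Holomorphic functions on \<open>(\<complex>\<^sup>*)\<^sup>n\<close> and genericity\<close>

text \<open>
  The coordinates are indexed by \<open>1, \<dots>, n\<close>, and points are \<open>undefined\<close> at all other indices, so that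
  equality of points is equality of their coordinates.
\<close>

definition torus :: "nat \<Rightarrow> (nat \<Rightarrow> complex) set"
  where "torus n = {1..n} \<rightarrow>\<^sub>E (- {0})"

text \<open>
  Holomorphy in several variables: joint continuity (in the product topology) together with
  holomorphy in each variable separately.
\<close>

definition holomorphic_on_torus :: "nat \<Rightarrow> ((nat \<Rightarrow> complex) \<Rightarrow> complex) \<Rightarrow> bool"
  where "holomorphic_on_torus n f \<longleftrightarrow>
    continuous_on (torus n) f \<and>
    (\<forall>x\<in>torus n. \<forall>i\<in>{1..n}. (\<lambda>z. f (x(i := z))) holomorphic_on (- {0}))"

text \<open>
  A property holds for generic \<open>a, b, q, t \<in> \<complex>\<^sup>*\<close> if it holds off the zero set of some holomorphic
  function on \<open>(\<complex>\<^sup>*)\<^sup>4\<close> that is not identically zero.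
\<close>

definition generically ::
    "(complex \<Rightarrow> complex \<Rightarrow> complex \<Rightarrow> complex \<Rightarrow> bool) \<Rightarrow> bool"
  where "generically Q \<longleftrightarrow>
    (\<exists>F. holomorphic_on_torus 4 F \<and> (\<exists>z\<in>torus 4. F z \<noteq> 0) \<and>
      (\<forall>z\<in>torus 4. F z \<noteq> 0 \<longrightarrow> Q (z 1) (z 2) (z 3) (z 4)))"


section \<open>Interpolation theta functions\<close>

definition BC_theta :: "complex \<Rightarrow> nat \<Rightarrow> nat \<Rightarrow> ((nat \<Rightarrow> complex) \<Rightarrow> complex) \<Rightarrow> bool"
  where "BC_theta p n m f \<longleftrightarrow>
    holomorphic_on_torus n f \<and>
    (\<forall>x\<in>torus n. \<forall>\<pi>. \<pi> permutes {1..n} \<longrightarrow> f (x \<circ> \<pi>) = f x) \<and>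
    (\<forall>x\<in>torus n. \<forall>i\<in>{1..n}. f (x(i := 1 / x i)) = f x) \<and>
    (\<forall>x\<in>torus n. f (x(1 := p * x 1)) = (p * (x 1)\<^sup>2) powi (- int m) * f x)"

text \<open>The index \<open>l\<close> in the vanishing condition at \<open>\<mu> \<noteq> \<kappa>\<close> for the function indexed by \<open>\<kappa>\<close>.\<close>

definition split_index :: "nat \<Rightarrow> nat \<Rightarrow> (nat \<Rightarrow> nat) \<Rightarrow> (nat \<Rightarrow> nat) \<Rightarrow> nat"
  where "split_index m n \<mu> \<kappa> =
    (let l\<^sub>0 = Max {i\<in>{1..n}. \<mu> i \<noteq> \<kappa> i};
         l\<^sub>1 = Max ({0} \<union> {i\<in>{1..n}. \<mu> i = m})
     in if \<mu> l\<^sub>0 < \<kappa> l\<^sub>0 then l\<^sub>1 else l\<^sub>0)"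

definition vanishing_point ::
    "nat \<Rightarrow> nat \<Rightarrow> (nat \<Rightarrow> nat) \<Rightarrow> (nat \<Rightarrow> nat) \<Rightarrow> complex \<Rightarrow> complex \<Rightarrow> complex \<Rightarrow> complex \<Rightarrow> nat \<Rightarrow> complex"
  where "vanishing_point m n \<mu> \<kappa> a b q t =
    (\<lambda>i\<in>{1..n}. if i \<le> split_index m n \<mu> \<kappa>
                 then b * q ^ (m - \<mu> i) * t ^ (i - 1)
                 else a * q ^ \<mu> i * t ^ (n - i))"

definition is_interpolation_theta ::
    "nat \<Rightarrow> nat \<Rightarrow> (nat \<Rightarrow> nat) \<Rightarrow> complex \<Rightarrow> complex \<Rightarrow> complex \<Rightarrow> complex \<Rightarrow> complex \<Rightarrow>
      ((nat \<Rightarrow> complex) \<Rightarrow> complex) \<Rightarrow> bool"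
  where "is_interpolation_theta m n \<kappa> a b q t p f \<longleftrightarrow>
    BC_theta p n m f \<and>
    (\<forall>\<mu>\<in>partitions_in m n. \<mu> \<noteq> \<kappa> \<longrightarrow> f (vanishing_point m n \<mu> \<kappa> a b q t) = 0) \<and>
    (\<forall>v. v \<noteq> 0 \<longrightarrow>
      f (\<lambda>i\<in>{1..n}. v * t ^ (n - i)) =
        C0 \<kappa> [t ^ (n - 1) * a * v, a / v] q t p *
        C0 (rect_complement m n \<kappa>) [t ^ (n - 1) * b * v, b / v] q t p)"

text \<open>
  \<open>interpolation_theta m n \<kappa> x a b q t p\<close> is \<open>P\<^bsup>*(m,n)\<^esup>\<^sub>\<kappa>(x; a, b; q, t; p)\<close>. Extensionality makes uniqueness as
  a function on \<open>(\<complex>\<^sup>*)\<^sup>n\<close> the same as uniqueness of the HOL function.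
\<close>

definition interpolation_theta ::
    "nat \<Rightarrow> nat \<Rightarrow> (nat \<Rightarrow> nat) \<Rightarrow> (nat \<Rightarrow> complex) \<Rightarrow>
      complex \<Rightarrow> complex \<Rightarrow> complex \<Rightarrow> complex \<Rightarrow> complex \<Rightarrow> complex"
  where "interpolation_theta m n \<kappa> x a b q t p =
    (THE f. f \<in> extensional (torus n) \<and> is_interpolation_theta m n \<kappa> a b q t p f) x"

end

theory Submission
  imports Defs "HOL-Complex_Analysis.Complex_Analysis"
begin

text \<open>
  A symmetric theta function of degree \<open>m\<close> in \<open>n\<close> variables is determined by its values on the
  grid points \<open>a q^i t^j\<close> attached to lattice paths in an \<open>n \<times> m\<close> rectangle.  A first step of the
  path in one direction fixes a variable to \<open>a\<close>, a first step in the other direction divides out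
  the factor vanishing at \<open>a\<close>, and both operations shift \<open>a\<close>.  Applied in both sets of variables,
  this induction shows that the kernel is the sum over all paths, with coefficients \<open>1\<close>, of products
  of two interpolation functions scaled so as to respect the recursion: the difference vanishes on
  two grids because a path and the complementary path of another one cross.

  It remains to compare this scaling with the prescribed one.  The principal specialisation is
  factored with the help of a difference operator that acts on the interpolation functions as a
  scalar times a parameter shift and that reduces to a single term at geometric progressions.  The
  quotient of the two scalings then satisfies first-order recursions in the two kinds of steps, and
  so does the \<open>\<Delta>\<close> symbol.
\<close>

section \<open>Theta functions in one variable\<close>

text \<open>The two defining data of an interpolation function, zeros at certain points and values
  on a geometric progression, do not interact: the recursion along a path controls grid values only.
  Hence the detour through the unnormalised family \<open>P\<close>, in which the normalisation
  survives only as a scalar \<open>gam\<close>. Coefficients \<open>1\<close> are possible because a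
  step that sets an entry of \<open>xs\<close> to \<open>a\<close> is, for the negated path, a step
  that splits off \<open>kern (s / a)\<close> in the dual entries, exactly the factor by which the
  kernel changes at \<open>x = a\<close>. The operator has four parameters: two are \<open>a\<close>
  and \<open>b\<close>, the third may be any start \<open>c\<close> of a progression, and the fourth
  is fixed by a balancing condition. So its eigenvalue equation links the values at \<open>c\<close>
  and at \<open>r * c\<close> for shifted \<open>a\<close>, \<open>b\<close>, and this exhibits as
  many zeros of the specialisation as its degree allows. Genericity is kept finite: a budget
  \<open>M\<close> bounds the exponents of the monomials that must avoid the powers of
  \<open>p\<close>, and induction steps spend it. This is what makes one holomorphic function of
  \<open>a\<close>, \<open>b\<close>, \<open>q\<close>, \<open>t\<close> suffice in the end.\<close>

locale nome =
  fixes p :: complex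
  assumes p_nz [simp]: "p \<noteq> 0" and p_less: "norm p < 1"
begin

text \<open>The two free constants make the family closed under removal of the factor with
  \<open>k = 0\<close>, which isolates the zero of \<open>th\<close> at \<open>1\<close>;
  \<open>th\<close> itself is \<open>theta_prod 1 p\<close>.\<close>

definition theta_prod :: "complex \<Rightarrow> complex \<Rightarrow> complex \<Rightarrow> complex"
  where "theta_prod \<alpha> \<beta> x = prodinf (\<lambda>k. (1 - p ^ k * (\<alpha> * x)) * (1 - p ^ k * (\<beta> / x)))"

definition th :: "complex \<Rightarrow> complex"
  where "th x = theta [x] p"

lemma theta_Cons: "theta (x # xs) p = th x * theta xs p"
  by (simp add: th_def theta_def)

lemma theta_Nil [simp]: "theta [] p = 1"
  by (simp add: theta_def)

lemma th_eq_theta_prod: "th x = theta_prod 1 p x"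
  by (simp add: th_def theta_def theta_prod_def mult.commute)

text \<open>A geometric majorant, uniform in \<open>u\<close> and \<open>v\<close> up to
  \<open>B\<close>. It gives convergence of the product and, on small discs, uniform convergence and
  hence holomorphy.\<close>

lemma factor_bound:
  assumes "norm u \<le> B" "norm v \<le> B" "B \<ge> 0"
  shows "norm ((1 - p ^ k * u) * (1 - p ^ k * v) - 1) \<le> (2 * B + B * B) * norm p ^ k"
proof -
  have n1: "norm p ^ k \<le> 1" by (simp add: p_less power_le_one less_imp_le)
  have "(1 - p ^ k * u) * (1 - p ^ k * v) - 1 = - (p ^ k * u) - p ^ k * v + p ^ k * (p ^ k * (u * v))"
    by (simp add: algebra_simps)
  also have "norm \<dots> \<le> norm (p ^ k * u) + norm (p ^ k * v) + norm (p ^ k * (p ^ k * (u * v)))"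
    by (metis (no_types, lifting) norm_minus_cancel norm_triangle_ineq norm_triangle_ineq4 order_trans add_right_mono)
  also have "\<dots> \<le> norm p ^ k * B + norm p ^ k * B + norm p ^ k * (B * B)"
  proof (intro add_mono)
    show "norm (p ^ k * (p ^ k * (u * v))) \<le> norm p ^ k * (B * B)"
    proof -
      have "norm (p ^ k * (u * v)) \<le> 1 * (B * B)"
        unfolding norm_mult norm_power using n1 assms by (intro mult_mono) auto
      thus ?thesis by (simp add: norm_mult norm_power mult_left_mono)
    qed
  qed (use assms in \<open>auto simp: norm_mult norm_power mult_left_mono\<close>)
  finally show ?thesis by (simp add: algebra_simps)
qed

lemma summable_p: "summable (\<lambda>k. C * norm p ^ k)"
  by (intro summable_mult summable_geometric) (simp add: p_less)

lemma theta_prod_convergent: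
  "convergent_prod (\<lambda>k. (1 - p ^ k * (\<alpha> * x)) * (1 - p ^ k * (\<beta> / x)))"
proof -
  define B where "B = max (norm (\<alpha> * x)) (norm (\<beta> / x))"
  have "summable (\<lambda>k. norm ((1 - p ^ k * (\<alpha> * x)) * (1 - p ^ k * (\<beta> / x)) - 1))"
    by (rule summable_comparison_test[OF _ summable_p[of "2 * B + B * B"]])
       (intro exI[of _ 0] allI impI, simp only: real_norm_def abs_norm_cancel, rule factor_bound, auto simp: B_def le_max_iff_disj)
  thus ?thesis
    by (intro abs_convergent_prod_imp_convergent_prod summable_imp_abs_convergent_prod)
qed

lemma theta_prod_lim:
  "(\<lambda>n. \<Prod>k<n. (1 - p ^ k * (\<alpha> * x)) * (1 - p ^ k * (\<beta> / x))) \<longlonglongrightarrow> theta_prod \<alpha> \<beta> x"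
  using convergent_prod_LIMSEQ[OF theta_prod_convergent[of \<alpha> x \<beta>]]
  by (simp add: LIMSEQ_lessThan_iff_atMost theta_prod_def)

lemma theta_prod_head:
  "theta_prod \<alpha> \<beta> x = (1 - \<alpha> * x) * (1 - \<beta> / x) * theta_prod (p * \<alpha>) (p * \<beta>) x"
proof -
  let ?f = "\<lambda>k. (1 - p ^ k * (\<alpha> * x)) * (1 - p ^ k * (\<beta> / x))"
  have "(\<lambda>n. ?f 0 * (\<Prod>k<n. (1 - p ^ k * (p * \<alpha> * x)) * (1 - p ^ k * (p * \<beta> / x))))
        \<longlonglongrightarrow> ?f 0 * theta_prod (p * \<alpha>) (p * \<beta>) x"
    by (intro tendsto_intros theta_prod_lim)
  moreover have "?f 0 * (\<Prod>k<n. (1 - p ^ k * (p * \<alpha> * x)) * (1 - p ^ k * (p * \<beta> / x))) = (\<Prod>k<Suc n. ?f k)" for n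
    unfolding prod.lessThan_Suc_shift by (simp add: mult_ac)
  ultimately have "(\<lambda>n. \<Prod>k<Suc n. ?f k) \<longlonglongrightarrow> ?f 0 * theta_prod (p * \<alpha>) (p * \<beta>) x"
    by simp
  moreover have "(\<lambda>n. \<Prod>k<Suc n. ?f k) \<longlonglongrightarrow> theta_prod \<alpha> \<beta> x"
    using theta_prod_lim[of \<alpha> x \<beta>] LIMSEQ_Suc by blast
  ultimately show ?thesis using LIMSEQ_unique by fastforce
qed

lemma theta_prod_eq_0_iff:
  "theta_prod \<alpha> \<beta> x = 0 \<longleftrightarrow> (\<exists>k. p ^ k * (\<alpha> * x) = 1 \<or> p ^ k * (\<beta> / x) = 1)"
proof
  assume "theta_prod \<alpha> \<beta> x = 0"
  thus "\<exists>k. p ^ k * (\<alpha> * x) = 1 \<or> p ^ k * (\<beta> / x) = 1"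
    using prodinf_nonzero[OF theta_prod_convergent[of \<alpha> x \<beta>]]
    by (fastforce simp: theta_prod_def)
next
  assume "\<exists>k. p ^ k * (\<alpha> * x) = 1 \<or> p ^ k * (\<beta> / x) = 1"
  then obtain k where k: "(1 - p ^ k * (\<alpha> * x)) * (1 - p ^ k * (\<beta> / x)) = 0" by auto
  have "\<forall>\<^sub>F n in sequentially. (\<Prod>k<n. (1 - p ^ k * (\<alpha> * x)) * (1 - p ^ k * (\<beta> / x))) = 0"
    using eventually_gt_at_top[of k] by eventually_elim (use k in \<open>auto intro!: prod_zero\<close>)
  hence "(\<lambda>n. \<Prod>k<n. (1 - p ^ k * (\<alpha> * x)) * (1 - p ^ k * (\<beta> / x))) \<longlonglongrightarrow> 0"
    by (rule tendsto_eventually)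
  thus "theta_prod \<alpha> \<beta> x = 0" using theta_prod_lim LIMSEQ_unique by blast
qed

lemma theta_prod_holomorphic: "theta_prod \<alpha> \<beta> holomorphic_on (- {0})"
proof (rule holomorphic_uniform_sequence)
  show "(\<lambda>x. \<Prod>k<n. (1 - p ^ k * (\<alpha> * x)) * (1 - p ^ k * (\<beta> / x))) holomorphic_on - {0}" for n
    by (intro holomorphic_intros) auto
next
  fix x :: complex assume "x \<in> - {0}"
  hence x: "x \<noteq> 0" by simp
  define d where "d = norm x / 2"
  have d: "d > 0" using x by (simp add: d_def)
  have lo: "norm y \<ge> d" and hi: "norm y \<le> 3 * d" if "y \<in> cball x d" for y
    using that norm_triangle_ineq2[of x y] norm_triangle_ineq2[of y x]
    by (auto simp: d_def dist_norm norm_minus_commute)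
  have sub: "cball x d \<subseteq> - {0}" using lo d by fastforce
  define B where "B = norm \<alpha> * (3 * d) + norm \<beta> / d"
  have B0: "B \<ge> 0" using d by (simp add: B_def)
  have uc: "uniformly_convergent_on (cball x d)
          (\<lambda>n y. \<Prod>k<n. (1 - p ^ k * (\<alpha> * y)) * (1 - p ^ k * (\<beta> / y)))"
  proof (rule uniformly_convergent_on_prod')
    show "continuous_on (cball x d) (\<lambda>y. (1 - p ^ n * (\<alpha> * y)) * (1 - p ^ n * (\<beta> / y)))" for n
      using sub by (intro continuous_intros) auto
    show "uniformly_convergent_on (cball x d)
        (\<lambda>N y. \<Sum>n<N. norm ((1 - p ^ n * (\<alpha> * y)) * (1 - p ^ n * (\<beta> / y)) - 1))"
    proof (rule Weierstrass_m_test'[OF _ summable_p])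
      fix n y assume y: "y \<in> cball x d"
      have 1: "norm (\<alpha> * y) \<le> B"
        using hi[OF y] d by (auto simp: norm_mult B_def intro!: add_increasing2 mult_left_mono)
      have "norm \<beta> / norm y \<le> norm \<beta> / d" using lo[OF y] d by (intro divide_left_mono mult_pos_pos) auto
      hence 2: "norm (\<beta> / y) \<le> B"
        using d by (auto simp: norm_divide B_def intro!: add_increasing)
      show "norm (norm ((1 - p ^ n * (\<alpha> * y)) * (1 - p ^ n * (\<beta> / y)) - 1)) \<le> (2 * B + B * B) * norm p ^ n"
        using factor_bound[OF 1 2 B0, of n] by simp
    qed
  qed auto
  then obtain g where g: "uniform_limit (cball x d)
          (\<lambda>n y. \<Prod>k<n. (1 - p ^ k * (\<alpha> * y)) * (1 - p ^ k * (\<beta> / y))) g sequentially"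
    by (auto simp: uniformly_convergent_on_def)
  have "g y = theta_prod \<alpha> \<beta> y" if "y \<in> cball x d" for y
    using tendsto_uniform_limitI[OF g that] theta_prod_lim LIMSEQ_unique by blast
  with g have "uniform_limit (cball x d)
          (\<lambda>n y. \<Prod>k<n. (1 - p ^ k * (\<alpha> * y)) * (1 - p ^ k * (\<beta> / y))) (theta_prod \<alpha> \<beta>) sequentially"
    by (metis (no_types, lifting) uniform_limit_cong')
  with d sub show "\<exists>d>0. cball x d \<subseteq> - {0} \<and> uniform_limit (cball x d)
      (\<lambda>n y. \<Prod>k<n. (1 - p ^ k * (\<alpha> * y)) * (1 - p ^ k * (\<beta> / y))) (theta_prod \<alpha> \<beta>) sequentially"
    by blast
qed auto

lemma th_holomorphic: "th holomorphic_on (- {0})"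
  using theta_prod_holomorphic[of 1 p] by (simp add: th_eq_theta_prod[abs_def])

lemma th_holomorphic' [holomorphic_intros]:
  assumes "f holomorphic_on S" "\<And>z. z \<in> S \<Longrightarrow> f z \<noteq> 0"
  shows "(\<lambda>z. th (f z)) holomorphic_on S"
proof -
  have "f ` S \<subseteq> - {0}" using assms(2) by auto
  from holomorphic_on_compose_gen[OF assms(1) th_holomorphic this] show ?thesis by (simp add: o_def)
qed

lemma th_eq_0_iff: 
  assumes "x \<noteq> 0"
  shows "th x = 0 \<longleftrightarrow> (\<exists>k::int. x = p powi k)"
proof -
  have "th x = 0 \<longleftrightarrow> (\<exists>k. x = p powi (- int k) \<or> x = p powi (int k + 1))"
    unfolding th_eq_theta_prod theta_prod_eq_0_iff
    using assms by (intro ex_cong1) (auto simp: power_int_minus field_simps power_int_add)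
  also have "\<dots> \<longleftrightarrow> (\<exists>k::int. x = p powi k)"
  proof
    assume "\<exists>k::int. x = p powi k"
    then obtain k :: int where k: "x = p powi k" by blast
    show "\<exists>k. x = p powi (- int k) \<or> x = p powi (int k + 1)"
    proof (cases "k \<le> 0")
      case True thus ?thesis using k by (intro exI[of _ "nat (-k)"]) auto
    next
      case False thus ?thesis using k by (intro exI[of _ "nat (k-1)"]) auto
    qed
  qed auto
  finally show ?thesis .
qed

lemma th_1 [simp]: "th 1 = 0"
  by (subst th_eq_0_iff) (auto intro: exI[of _ 0])

lemma th_reflect: "x \<noteq> 0 \<Longrightarrow> th (p / x) = th x"
  by (simp add: th_eq_theta_prod theta_prod_def mult_ac)

text \<open>The partial products at \<open>x\<close> and \<open>p * x\<close> differ by one factor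
  at each end, and the factors containing \<open>p ^ n\<close> tend to \<open>1\<close>. The limit
  identity carries a factor \<open>1 - x\<close> to be cancelled, so \<open>x = 1\<close> is treated
  apart.\<close>

lemma th_p_mult:
  assumes "x \<noteq> 0"
  shows "th (p * x) = - th x / x"
proof (cases "x = 1")
  case True
  have "th p = 0" by (subst th_eq_0_iff) (auto intro: exI[of _ 1])
  thus ?thesis using True by simp
next
  case False
  let ?P = "\<lambda>n x. \<Prod>k<n. (1 - p ^ k * (1 * x)) * (1 - p ^ k * (p / x))"
  have eq: "?P n (p * x) * ((1 - x) * (1 - p ^ n * (1 / x))) = ?P n x * ((1 - p ^ n * x) * (1 - 1 / x))" for n
    by (induction n) (use assms in \<open>simp_all add: mult_ac\<close>)
  have lim: "(\<lambda>n. p ^ n) \<longlonglongrightarrow> 0" by (intro LIMSEQ_power_zero) (simp add: p_less)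
  have "(\<lambda>n. ?P n (p * x) * ((1 - x) * (1 - p ^ n * (1 / x)))) \<longlonglongrightarrow> th (p * x) * ((1 - x) * (1 - 0 * (1 / x)))"
    unfolding th_eq_theta_prod by (intro tendsto_intros theta_prod_lim lim)
  moreover have "(\<lambda>n. ?P n x * ((1 - p ^ n * x) * (1 - 1 / x))) \<longlonglongrightarrow> th x * ((1 - 0 * x) * (1 - 1 / x))"
    unfolding th_eq_theta_prod by (intro tendsto_intros theta_prod_lim lim)
  ultimately have "th (p * x) * ((1 - x) * (1 - 0 * (1 / x))) = th x * ((1 - 0 * x) * (1 - 1 / x))"
    unfolding eq using LIMSEQ_unique by blast
  hence "th (p * x) * (1 - x) = (- th x / x) * (1 - x)"
    using assms by (simp add: field_simps)
  moreover have "1 - x \<noteq> 0" using False by simp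
  ultimately show ?thesis using mult_right_cancel by blast
qed

lemma th_inverse: "x \<noteq> 0 \<Longrightarrow> th (1 / x) = - th x / x"
  using th_reflect[of "p * x"] th_p_mult[of x] by simp

lemma th_inverse_0_iff [simp]: "x \<noteq> 0 \<Longrightarrow> th (1 / x) = 0 \<longleftrightarrow> th x = 0"
  by (simp add: th_inverse)

lemma th_p_mult_0_iff [simp]: "x \<noteq> 0 \<Longrightarrow> th (p * x) = 0 \<longleftrightarrow> th x = 0"
  by (simp add: th_p_mult)

lemma th_div_0_iff: "x \<noteq> 0 \<Longrightarrow> y \<noteq> 0 \<Longrightarrow> th (x / y) = 0 \<longleftrightarrow> th (y / x) = 0"
  using th_inverse_0_iff[of "x / y"] by simp

lemma th_deriv: "x \<noteq> 0 \<Longrightarrow> (th has_field_derivative deriv th x) (at x)"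
  by (rule holomorphic_derivI[OF th_holomorphic]) auto

lemma deriv_th_1: "deriv th 1 \<noteq> 0"
proof -
  define E where "E = (\<lambda>x. (1 - p / x) * theta_prod p (p * p) x)"
  have E: "E holomorphic_on - {0}"
    unfolding E_def by (intro holomorphic_intros theta_prod_holomorphic) auto
  have th_E: "th = (\<lambda>x. (1 - x) * E x)"
    by (rule ext) (simp add: th_eq_theta_prod E_def theta_prod_head[of 1 p] mult_ac)
  have p1: "p ^ k * p \<noteq> 1" for k
  proof
    assume "p ^ k * p = 1"
    hence "norm p ^ Suc k = 1" by (metis mult.commute norm_one norm_power power_Suc)
    thus False using p_less power_Suc_less_one[of "norm p" k] by auto
  qed
  have "theta_prod p (p * p) 1 \<noteq> 0"
    unfolding theta_prod_eq_0_iff using p1 p1[of "Suc k" for k] by (auto simp: mult_ac)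
  hence E1: "E 1 \<noteq> 0" using p1[of 0] by (simp add: E_def)
  have "(E has_field_derivative deriv E 1) (at 1)"
    by (rule holomorphic_derivI[OF E]) auto
  hence "((\<lambda>x. (1 - x) * E x) has_field_derivative (1 - 1) * deriv E 1 + (0 - 1) * E 1) (at 1)"
    by (auto intro!: derivative_eq_intros)
  hence "(th has_field_derivative - E 1) (at 1)" unfolding th_E[symmetric] by simp
  hence "deriv th 1 = - E 1" by (rule DERIV_imp_deriv)
  thus ?thesis using E1 by simp
qed

text \<open>Differentiate \<open>th (p * y) = - th y / y\<close> at a zero, where the term with
  \<open>th x\<close> drops out. This carries simplicity of the zero at \<open>1\<close> to all
  powers of \<open>p\<close>.\<close>

lemma deriv_th_p_mult:
  assumes "x \<noteq> 0" "th x = 0"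
  shows "deriv th (p * x) = - deriv th x / (p * x)"
proof -
  have 1: "((\<lambda>y. th (p * y)) has_field_derivative deriv th (p * x) * p) (at x)"
    using assms by (auto intro!: derivative_eq_intros th_deriv DERIV_chain2[where f = th])
  have 2: "((\<lambda>y. - th y / y) has_field_derivative (- deriv th x * x - (- th x) * 1) / (x * x)) (at x)"
    using assms by (auto intro!: derivative_eq_intros th_deriv)
  have "((\<lambda>y. th (p * y)) has_field_derivative (- deriv th x * x - (- th x) * 1) / (x * x)) (at x)"
    by (rule DERIV_cong_ev[THEN iffD1, OF refl _ refl 2])
       (use assms eventually_neq_at_within[of 0 x UNIV] t1_space_nhds[of x 0] in \<open>auto elim!: eventually_mono simp: th_p_mult\<close>)
  with 1 have "deriv th (p * x) * p = (- deriv th x * x - (- th x) * 1) / (x * x)"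
    by (rule DERIV_unique)
  thus ?thesis using assms by (simp add: field_simps)
qed

lemma deriv_th_nonzero:
  assumes "x \<noteq> 0" "th x = 0"
  shows "deriv th x \<noteq> 0"
proof -
  obtain k :: int where k: "x = p powi k" using assms th_eq_0_iff by blast
  have z: "th (p powi k) = 0" for k :: int by (subst th_eq_0_iff) auto
  have s: "deriv th (p powi (k + 1)) = - deriv th (p powi k) / (p * p powi k)" for k :: int
    using deriv_th_p_mult[OF _ z, of k] by (simp add: power_int_add mult.commute)
  have "deriv th (p powi k) \<noteq> 0" for k :: int
  proof (induction k rule: int_induct[where k = 0])
    case (step2 i)
    thus ?case using s[of "i - 1"] by auto
  qed (use s deriv_th_1 in auto)
  thus ?thesis using k by blast
qed

end

section \<open>Quotients of holomorphic functions on the punctured plane\<close>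

lemma connected_punctured_plane: "connected (- {0 :: complex})"
  by (rule connected_punctured_universe) simp

text \<open>Identity theorem on the open set where \<open>g\<close> is nonzero. It serves to cancel
  a factor even at its own zeros, and so to transport functional equations to a quotient.\<close>

lemma holomorphic_mult_eq_0:
  fixes f g :: "complex \<Rightarrow> complex"
  assumes "f holomorphic_on - {0}" "g holomorphic_on - {0}"
    and 0: "\<And>z. z \<noteq> 0 \<Longrightarrow> f z * g z = 0" and "w \<noteq> 0" "g w \<noteq> 0" "z \<noteq> 0"
  shows "f z = 0"
proof (rule analytic_continuation_open[of "(- {0}) \<inter> g -` (- {0})" "- {0}" f "\<lambda>_. 0" z])
  show "open ((- {0}) \<inter> g -` (- {0}))"
    using holomorphic_on_imp_continuous_on[OF assms(2)] by (intro continuous_open_preimage) auto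
  show "(- {0}) \<inter> g -` (- {0}) \<noteq> {}" using assms by auto
  fix y assume "y \<in> (- {0}) \<inter> g -` (- {0})"
  thus "f y = 0" using 0[of y] by auto
qed (use assms connected_punctured_plane in auto)

text \<open>Removable singularities: near a zero \<open>w\<close> of the denominator both functions
  are divided by \<open>z - w\<close>, and simplicity makes the second quotient nonzero. The value
  forced at a zero is the ratio of the derivatives.\<close>

lemma holomorphic_divide_simple_zeros:
  fixes N \<Theta> :: "complex \<Rightarrow> complex"
  assumes N: "N holomorphic_on - {0}" and \<Theta>: "\<Theta> holomorphic_on - {0}"
    and z: "\<And>z. z \<noteq> 0 \<Longrightarrow> \<Theta> z = 0 \<Longrightarrow> N z = 0"
    and simple: "\<And>z. z \<noteq> 0 \<Longrightarrow> \<Theta> z = 0 \<Longrightarrow> deriv \<Theta> z \<noteq> 0"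
  shows "\<exists>h. h holomorphic_on - {0} \<and> (\<forall>z. z \<noteq> 0 \<longrightarrow> N z = \<Theta> z * h z)"
proof -
  define h where "h z = (if \<Theta> z = 0 then deriv N z / deriv \<Theta> z else N z / \<Theta> z)" for z
  have "h field_differentiable at w" if w: "w \<noteq> 0" for w
  proof -
    define F where "F z = (if z = w then deriv N w else (N z - N w) / (z - w))" for z
    define T where "T z = (if z = w then deriv \<Theta> w else (\<Theta> z - \<Theta> w) / (z - w))" for z
    have wi: "w \<in> interior (- {0})" using w by (subst interior_open) auto
    have hF: "F holomorphic_on - {0}" unfolding F_def[abs_def] by (rule pole_lemma[OF N wi])
    have hT: "T holomorphic_on - {0}" unfolding T_def[abs_def] by (rule pole_lemma[OF \<Theta> wi])
    have dF: "F field_differentiable at w" and dT: "T field_differentiable at w"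
      and dN: "N field_differentiable at w" and d\<Theta>: "\<Theta> field_differentiable at w"
      using hF hT N \<Theta> w by (auto intro: holomorphic_on_imp_differentiable_at)
    show ?thesis
    proof (cases "\<Theta> w = 0")
      case True
      have Tw: "T w \<noteq> 0" using simple w True by (simp add: T_def)
      have "open ((- {0}) \<inter> T -` (- {0}))"
        using holomorphic_on_imp_continuous_on[OF hT] by (intro continuous_open_preimage) auto
      hence ev: "\<forall>\<^sub>F z in nhds w. z \<in> (- {0}) \<inter> T -` (- {0})"
        by (rule eventually_nhds_in_open) (use w Tw in auto)
      have ev2: "\<forall>\<^sub>F z in nhds w. F z / T z = h z"
        using ev
      proof eventually_elim
        case (elim z)
        show ?case
        proof (cases "z = w")
          case False
          hence "\<Theta> z \<noteq> 0" using elim True by (auto simp: T_def)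
          thus ?thesis using False True z[OF w True] by (simp add: F_def T_def h_def)
        qed (use True in \<open>simp add: F_def T_def h_def\<close>)
      qed
      obtain D where D: "((\<lambda>z. F z / T z) has_field_derivative D) (at w)"
        using field_differentiable_divide[of "F" w UNIV "T"] dF dT Tw
        unfolding field_differentiable_def by blast
      have "(h has_field_derivative D) (at w)"
        by (rule iffD1[OF DERIV_cong_ev[OF refl ev2 refl] D])
      thus ?thesis unfolding field_differentiable_def by blast
    next
      case False
      have "open ((- {0}) \<inter> \<Theta> -` (- {0}))"
        using holomorphic_on_imp_continuous_on[OF \<Theta>] by (intro continuous_open_preimage) auto
      hence "\<forall>\<^sub>F z in nhds w. z \<in> (- {0}) \<inter> \<Theta> -` (- {0})"
        by (rule eventually_nhds_in_open) (use w False in auto)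
      hence ev2: "\<forall>\<^sub>F z in nhds w. N z / \<Theta> z = h z"
        by eventually_elim (simp add: h_def)
      obtain D where D: "((\<lambda>z. N z / \<Theta> z) has_field_derivative D) (at w)"
        using field_differentiable_divide[of "N" w UNIV "\<Theta>"] dN d\<Theta> False
        unfolding field_differentiable_def by blast
      have "(h has_field_derivative D) (at w)"
        by (rule iffD1[OF DERIV_cong_ev[OF refl ev2 refl] D])
      thus ?thesis unfolding field_differentiable_def by blast
    qed
  qed
  hence "h holomorphic_on - {0}"
    by (auto simp: holomorphic_on_def intro: field_differentiable_at_within)
  moreover have "N z = \<Theta> z * h z" if "z \<noteq> 0" for z
    using z[OF that] by (auto simp: h_def)
  ultimately show ?thesis by blast
qed

section \<open>Even theta functions of degree \<open>m\<close> in one variable\<close>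

context nome
begin

text \<open>The one-variable \<open>BC\<close> condition, with the negative power moved to the other
  side so that no division occurs.\<close>

definition V :: "nat \<Rightarrow> (complex \<Rightarrow> complex) \<Rightarrow> bool"
  where "V m f \<longleftrightarrow> f holomorphic_on - {0} \<and> (\<forall>z. z \<noteq> 0 \<longrightarrow> f (1 / z) = f z) \<and>
    (\<forall>z. z \<noteq> 0 \<longrightarrow> f (p * z) * (p * z\<^sup>2) ^ m = f z)"

text \<open>The basic function of degree 1 in \<open>x\<close>, with zeros at \<open>y\<close> and
  \<open>1 / y\<close> up to powers of \<open>p\<close>. The product side of the theorem consists of
  the factors \<open>kern (y j) (x i)\<close>.\<close>

definition kern :: "complex \<Rightarrow> complex \<Rightarrow> complex"
  where "kern y x = th (y * x) * th (y / x)"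

lemma V_holomorphic: "V m f \<Longrightarrow> f holomorphic_on - {0}"
  and V_inverse: "V m f \<Longrightarrow> z \<noteq> 0 \<Longrightarrow> f (1 / z) = f z"
  and V_p_mult: "V m f \<Longrightarrow> z \<noteq> 0 \<Longrightarrow> f (p * z) * (p * z\<^sup>2) ^ m = f z"
  by (auto simp: V_def)

lemma kern_inverse [simp]: "kern y (1 / x) = kern y x"
  by (simp add: kern_def mult.commute)

lemma kern_self [simp]: "y \<noteq> 0 \<Longrightarrow> kern y y = 0"
  by (simp add: kern_def)

lemma th_flip: "x \<noteq> 0 \<Longrightarrow> y \<noteq> 0 \<Longrightarrow> th (x / y) = - (x / y) * th (y / x)"
  using th_inverse[of "y / x"] by simp

lemma kern_commute: "x \<noteq> 0 \<Longrightarrow> y \<noteq> 0 \<Longrightarrow> kern x y = - (x / y) * kern y x"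
  by (simp add: kern_def th_flip[of x y] mult.commute)

lemma kern_0_commute: "x \<noteq> 0 \<Longrightarrow> y \<noteq> 0 \<Longrightarrow> kern x y = 0 \<longleftrightarrow> kern y x = 0"
  using kern_commute[of x y] by auto

lemma kern_eq_0_iff: "kern y x = 0 \<longleftrightarrow> th (y * x) = 0 \<or> th (y / x) = 0"
  by (simp add: kern_def)

lemma kern_holomorphic [holomorphic_intros]:
  "y \<noteq> 0 \<Longrightarrow> f holomorphic_on S \<Longrightarrow> (\<And>z. z \<in> S \<Longrightarrow> f z \<noteq> 0) \<Longrightarrow> (\<lambda>z. kern y (f z)) holomorphic_on S"
  unfolding kern_def by (intro holomorphic_intros) auto

lemma kern_p_mult:
  assumes "y \<noteq> 0" "z \<noteq> 0"
  shows "kern y (p * z) * (p * z\<^sup>2) = kern y z"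
proof -
  define B where "B = th (y / (p * z))"
  have "th (y / z) = - B / (y / (p * z))"
    using th_p_mult[of "y / (p * z)"] assms by (simp add: B_def)
  hence 1: "th (y / z) = - (p * z / y) * B" by simp
  have 2: "th (y * (p * z)) = - th (y * z) / (y * z)"
    using th_p_mult[of "y * z"] assms by (simp add: mult_ac)
  show ?thesis unfolding kern_def 1 2 B_def[symmetric]
    using assms by (simp add: field_simps power2_eq_square)
qed

lemma V_kern: "y \<noteq> 0 \<Longrightarrow> V (Suc 0) (kern y)"
  unfolding V_def using kern_p_mult by (auto intro!: holomorphic_intros)

lemma V_add: "V m f \<Longrightarrow> V m g \<Longrightarrow> V m (\<lambda>z. f z + g z)"
  by (auto simp: V_def distrib_right intro!: holomorphic_intros)

lemma V_diff: "V m f \<Longrightarrow> V m g \<Longrightarrow> V m (\<lambda>z. f z - g z)"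
  by (auto simp: V_def left_diff_distrib intro!: holomorphic_intros)

lemma V_cmult: "V m f \<Longrightarrow> V m (\<lambda>z. c * f z)"
  by (auto simp: V_def intro!: holomorphic_intros)

lemma V_mult: "V m f \<Longrightarrow> V k g \<Longrightarrow> V (m + k) (\<lambda>z. f z * g z)"
proof -
  assume a: "V m f" "V k g"
  have "f (p * z) * g (p * z) * (p * z\<^sup>2) ^ (m + k) = f z * g z" if "z \<noteq> 0" for z
  proof -
    have "f (p * z) * g (p * z) * (p * z\<^sup>2) ^ (m + k) =
        (f (p * z) * (p * z\<^sup>2) ^ m) * (g (p * z) * (p * z\<^sup>2) ^ k)"
      by (simp only: power_add mult_ac)
    thus ?thesis using a that by (simp add: V_p_mult)
  qed
  thus ?thesis using a by (auto simp: V_def intro!: holomorphic_intros)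
qed

lemma V_const: "V 0 (\<lambda>_. c)"
  by (simp add: V_def)

lemma V_zero: "V m (\<lambda>_. 0)"
  by (simp add: V_def)

text \<open>In degree 0 the function is invariant under \<open>p\<close>, so it is bounded by its
  maximum on a closed annulus; composed with \<open>exp\<close> it is a bounded entire
  function.\<close>

lemma V_0_const:
  assumes V: "V 0 f" and "z \<noteq> 0" "w \<noteq> 0"
  shows "f z = f w"
proof -
  define K where "K = cball 0 1 - ball (0::complex) (norm p)"
  have cK: "compact K" unfolding K_def by (intro compact_diff) auto
  have K0: "K \<subseteq> - {0}" using p_nz by (auto simp: K_def)
  have "compact (f ` K)"
    by (intro compact_continuous_image cK continuous_on_subset[OF _ K0]
        holomorphic_on_imp_continuous_on V_holomorphic[OF V])
  then obtain B where B: "\<And>z. z \<in> K \<Longrightarrow> norm (f z) \<le> B"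
    using compact_imp_bounded bounded_iff by (metis imageI)
  have per: "f (p * z) = f z" if "z \<noteq> 0" for z using V_p_mult[OF V that] by simp
  have perk: "f (p powi k * z) = f z" if "z \<noteq> 0" for z and k :: int
  proof (induction k rule: int_induct[where k = 0])
    case (step1 i)
    thus ?case using per[of "p powi i * z"] that by (simp add: power_int_add mult_ac)
  next
    case (step2 i)
    thus ?case using per[of "p powi (i - 1) * z"] that by (simp add: power_int_diff mult_ac)
  qed auto
  have bd: "norm (f z) \<le> B" if z: "z \<noteq> 0" for z
  proof -
    define l where "l = - ln (norm p)"
    have l: "l > 0" using p_less by (simp add: l_def)
    \<comment> \<open>This power of \<open>p\<close> brings the modulus of
      \<open>p powi k * z\<close> between \<open>norm p\<close> (excluded) and \<open>1\<close>,
      that is, into the annulus \<open>K\<close>.\<close>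
    define k where "k = \<lceil>ln (norm z) / l\<rceil>"
    have "ln (norm p powi k) = k * ln (norm p)"
      by (subst powr_real_of_int'[symmetric]) auto
    hence "ln (norm (p powi k * z)) = - (k * l) + ln (norm z)"
      using z by (simp add: norm_mult norm_power_int ln_mult l_def)
    moreover have "ln (norm z) \<le> k * l" "k * l < ln (norm z) + l"
      using ceiling_correct[of "ln (norm z) / l"] l unfolding k_def
      by (simp_all add: pos_divide_le_eq[symmetric] pos_less_divide_eq[symmetric] add_divide_distrib)
    ultimately have "ln (norm (p powi k * z)) \<le> 0" "ln (norm (p powi k * z)) > ln (norm p)"
      by (auto simp: l_def)
    hence "p powi k * z \<in> K" using z by (auto simp: K_def)
    thus ?thesis using B perk[OF z] by metis
  qed
  have "(f \<circ> exp) holomorphic_on UNIV"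
    by (rule holomorphic_on_compose_gen[OF holomorphic_on_exp V_holomorphic[OF V]]) auto
  hence "(\<lambda>u. f (exp u)) holomorphic_on UNIV" by (simp add: o_def)
  moreover have "bounded (range (\<lambda>u. f (exp u)))" unfolding bounded_iff using bd by (intro exI[of _ B]) simp
  ultimately have "(\<lambda>u. f (exp u)) constant_on UNIV" by (rule Liouville_theorem)
  hence "f (exp (Ln z)) = f (exp (Ln w))" by (metis constant_on_def UNIV_I)
  thus ?thesis using assms by simp
qed

text \<open>The zeros of \<open>kern c\<close> form the two cosets of \<open>c\<close> and
  \<open>1 / c\<close> modulo powers of \<open>p\<close>. They are disjoint because
  \<open>c^2\<close> is no power of \<open>p\<close>, hence all zeros are simple, and the symmetries
  of \<open>f\<close> make it vanish on both.\<close>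

lemma V_divide:
  assumes V: "V (Suc m) f" and c: "c \<noteq> 0" "th (c\<^sup>2) \<noteq> 0" and fc: "f c = 0"
  shows "\<exists>g. V m g \<and> (\<forall>z. z \<noteq> 0 \<longrightarrow> f z = kern c z * g z)"
proof -
  have fp: "f (p * z) = 0 \<longleftrightarrow> f z = 0" if "z \<noteq> 0" for z
    using V_p_mult[OF V that] that by auto
  have z1: "f (c * p powi k) = 0" for k :: int
  proof (induction k rule: int_induct[where k = 0])
    case (step1 i)
    thus ?case using fp[of "c * p powi i"] c by (simp add: power_int_add mult_ac)
  next
    case (step2 i)
    thus ?case using fp[of "c * p powi (i - 1)"] c by (simp add: power_int_diff mult_ac)
  qed (use fc in auto)
  have z2: "f (1 / c * p powi k) = 0" for k :: int
    using V_inverse[OF V, of "c * p powi (- k)"] c z1[of "- k"] by (simp add: power_int_minus field_simps)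
  have zero: "f z = 0" if "z \<noteq> 0" "kern c z = 0" for z
  proof -
    from that consider k :: int where "c * z = p powi k" | k :: int where "c / z = p powi k"
      using th_eq_0_iff[of "c * z"] th_eq_0_iff[of "c / z"] c by (auto simp: kern_eq_0_iff)
    thus ?thesis
    proof cases
      case 1 hence "z = 1 / c * p powi k" using c by (simp add: field_simps)
      thus ?thesis using z2 by simp
    next
      case 2 hence "z = c * p powi (- k)" using that by (simp add: field_simps power_int_minus)
      thus ?thesis using z1 by simp
    qed
  qed
  have simple: "deriv (kern c) z \<noteq> 0" if z: "z \<noteq> 0" "kern c z = 0" for z
  proof -
    have d1: "((\<lambda>z. th (c * z)) has_field_derivative deriv th (c * z) * c) (at z)"
      using z c by (auto intro!: derivative_eq_intros th_deriv DERIV_chain2[where f = th])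
    have d2: "((\<lambda>z. th (c / z)) has_field_derivative deriv th (c / z) * (- c / (z * z))) (at z)"
    proof (rule DERIV_chain2[where f = th])
      show "((\<lambda>z. c / z) has_field_derivative - c / (z * z)) (at z)"
        using z by (auto intro!: derivative_eq_intros)
    qed (use z c th_deriv in auto)
    have "deriv (kern c) z = th (c * z) * (deriv th (c / z) * (- c / (z * z))) + deriv th (c * z) * c * th (c / z)"
      using DERIV_mult'[OF d1 d2] by (intro DERIV_imp_deriv) (simp add: kern_def[abs_def])
    moreover have "\<not> (th (c * z) = 0 \<and> th (c / z) = 0)"
    proof
      assume "th (c * z) = 0 \<and> th (c / z) = 0"
      then obtain k l :: int where "c * z = p powi k" "c / z = p powi l"
        using th_eq_0_iff[of "c * z"] th_eq_0_iff[of "c / z"] c z by auto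
      hence "c\<^sup>2 = p powi (k + l)" using z by (simp add: power_int_add power2_eq_square field_simps)
      thus False using c th_eq_0_iff[of "c\<^sup>2"] by auto
    qed
    ultimately show ?thesis using z c deriv_th_nonzero[of "c * z"] deriv_th_nonzero[of "c / z"]
      by (auto simp: kern_eq_0_iff)
  qed
  obtain h where h: "h holomorphic_on - {0}" and fh: "\<And>z. z \<noteq> 0 \<Longrightarrow> f z = kern c z * h z"
    using holomorphic_divide_simple_zeros[OF V_holomorphic[OF V] V_holomorphic[OF V_kern[OF c(1)]] zero simple]
    by blast
  obtain w where w: "w \<noteq> 0" "kern c w \<noteq> 0"
  proof -
    have "\<exists>w. w \<noteq> 0 \<and> kern c w \<noteq> 0"
    proof (rule ccontr)
      assume "\<not> ?thesis"
      hence a: "kern c z = 0" if "z \<noteq> 0" for z using that by auto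
      hence "deriv (kern c) 1 = deriv (\<lambda>_. 0) 1"
        by (intro deriv_cong_ev eventually_mono[OF t1_space_nhds[of 1 0]]) auto
      thus False using simple[of 1] a by simp
    qed
    thus ?thesis using that by blast
  qed
  have "V m h" unfolding V_def
  proof (intro conjI allI impI h)
    fix z :: complex assume z: "z \<noteq> 0"
    have "(h \<circ> (\<lambda>z. 1 / z)) holomorphic_on - {0}"
      by (rule holomorphic_on_compose_gen[OF _ h]) (auto intro!: holomorphic_intros)
    hence h1: "(\<lambda>z. h (1 / z)) holomorphic_on - {0}" by (simp add: o_def)
    have "(h \<circ> (\<lambda>z. p * z)) holomorphic_on - {0}"
      by (rule holomorphic_on_compose_gen[OF _ h]) (auto intro!: holomorphic_intros)
    hence h2: "(\<lambda>z. h (p * z)) holomorphic_on - {0}" by (simp add: o_def)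
    have "h (1 / z) - h z = 0"
    proof (rule holomorphic_mult_eq_0[of _ "kern c", OF _ V_holomorphic[OF V_kern[OF c(1)]] _ w z])
      fix z :: complex assume z: "z \<noteq> 0"
      show "(h (1 / z) - h z) * kern c z = 0"
        using fh[OF z] fh[of "1 / z"] V_inverse[OF V z] z by (auto simp: algebra_simps)
    qed (use h h1 in \<open>auto intro!: holomorphic_intros\<close>)
    thus "h (1 / z) = h z" by simp
    have "h (p * z) * (p * z\<^sup>2) ^ m - h z = 0"
    proof (rule holomorphic_mult_eq_0[of _ "kern c", OF _ V_holomorphic[OF V_kern[OF c(1)]] _ w z])
      fix z :: complex assume z: "z \<noteq> 0"
      have "kern c z * h z = kern c (p * z) * h (p * z) * (p * z\<^sup>2) ^ Suc m"
        using fh[OF z] fh[of "p * z"] V_p_mult[OF V z] z by simp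
      also have "\<dots> = kern c z * (h (p * z) * (p * z\<^sup>2) ^ m)"
        unfolding kern_p_mult[OF c(1) z, symmetric] by (simp only: power_Suc mult_ac)
      finally show "(h (p * z) * (p * z\<^sup>2) ^ m - h z) * kern c z = 0"
        by (auto simp: algebra_simps)
    qed (use h h2 in \<open>auto intro!: holomorphic_intros\<close>)
    thus "h (p * z) * (p * z\<^sup>2) ^ m = h z" by simp
  qed
  thus ?thesis using fh by blast
qed

text \<open>Pairwise independent modulo inversion and the lattice \<open>p\<^sup>\<int>\<close>, avoiding its two-torsion.\<close>

fun ok :: "complex list \<Rightarrow> bool" where
  "ok [] = True"
| "ok (x # xs) = (x \<noteq> 0 \<and> th (x\<^sup>2) \<noteq> 0 \<and> (\<forall>y\<in>set xs. kern x y \<noteq> 0) \<and> ok xs)"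

lemma ok_nonzero: "ok xs \<Longrightarrow> x \<in> set xs \<Longrightarrow> x \<noteq> 0"
  by (induction xs) auto

lemma ok_append: "ok (xs @ ys) \<longleftrightarrow> ok xs \<and> ok ys \<and> (\<forall>x\<in>set xs. \<forall>y\<in>set ys. kern x y \<noteq> 0)"
  by (induction xs) auto

lemma ok_mset: "mset xs = mset ys \<Longrightarrow> ok xs \<Longrightarrow> ok ys"
proof (induction xs arbitrary: ys)
  case (Cons x xs)
  have "x \<in> set ys" using Cons.prems(1) by (metis list.set_intros(1) mset_eq_setD)
  then obtain us vs where ys: "ys = us @ x # vs" by (meson split_list)
  hence ys2: "mset xs = mset (us @ vs)" using Cons.prems(1) by simp
  note ys = ys ys2
  have "ok (us @ vs)" using Cons.IH[OF ys2] Cons.prems(2) by simp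
  moreover have "set xs = set us \<union> set vs" using ys(2) by (metis mset_eq_setD set_append)
  moreover have "kern u x \<noteq> 0" if "u \<in> set xs" for u
    using Cons.prems(2) that kern_0_commute[of u x] ok_nonzero[of xs u] by auto
  ultimately show ?case
    using Cons.prems(2) unfolding ys(1) ok_append by auto
qed auto

text \<open>Each zero splits off one factor and lowers the degree by one, until a constant of degree
  0 is left. Independence of the points keeps the remaining zeros in the quotient.\<close>

lemma V_zeros:
  assumes "V (length zs) f" "ok zs" "\<And>z. z \<in> set zs \<Longrightarrow> f z = 0"
  shows "\<exists>C. \<forall>u. u \<noteq> 0 \<longrightarrow> f u = C * (\<Prod>z\<leftarrow>zs. kern z u)"
  using assms
proof (induction zs arbitrary: f)
  case Nil
  hence "f u = f 1 * 1" if "u \<noteq> 0" for u using V_0_const[of f u 1] that by simp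
  thus ?case unfolding list.map prod_list.Nil by blast
next
  case (Cons z zs)
  obtain g where g: "V (length zs) g" "\<And>u. u \<noteq> 0 \<Longrightarrow> f u = kern z u * g u"
    using V_divide[of "length zs" f z] Cons by auto
  have "g y = 0" if "y \<in> set zs" for y
    using g(2)[of y] Cons.prems that ok_nonzero[of zs y] by auto
  with Cons.IH[OF g(1)] Cons.prems(2) obtain C where "\<forall>u. u \<noteq> 0 \<longrightarrow> g u = C * (\<Prod>z\<leftarrow>zs. kern z u)"
    by auto
  thus ?case using g(2) by auto
qed

lemma countable_th_zeros: "countable {x. x \<noteq> 0 \<and> th x = 0}"
proof (rule countable_subset)
  show "{x. x \<noteq> 0 \<and> th x = 0} \<subseteq> range (\<lambda>k::int. p powi k)" using th_eq_0_iff by auto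
qed auto

text \<open>Only countably many points are excluded, since the zeros of \<open>th\<close> are the
  powers of \<open>p\<close>.\<close>

lemma generic_point: "\<exists>z. z \<noteq> 0 \<and> th (z\<^sup>2) \<noteq> 0 \<and> (\<forall>y\<in>set ys. y \<noteq> 0 \<longrightarrow> kern y z \<noteq> 0)"
proof -
  let ?Z = "{x. x \<noteq> 0 \<and> th x = 0}"
  let ?B = "{0} \<union> (\<Union>w\<in>?Z. {z. z\<^sup>2 = w}) \<union> (\<Union>y\<in>set ys. (\<lambda>w. w / y) ` ?Z \<union> (\<lambda>w. y / w) ` ?Z)"
  have fin: "finite {z::complex. z\<^sup>2 = w}" for w
  proof (rule finite_subset)
    show "{z. z\<^sup>2 = w} \<subseteq> {csqrt w, - csqrt w}"
      by auto (metis csqrt_unique power2_csqrt power2_eq_iff)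
  qed auto
  have "countable ?B"
    by (intro countable_Un countable_UN countable_th_zeros countable_image countable_finite[OF fin] countable_finite[OF finite_set])
       auto
  hence "\<not> UNIV \<subseteq> ?B" using countable_subset[of UNIV ?B] uncountable_UNIV_complex by blast
  then obtain z where z: "z \<notin> ?B" by blast
  have z0: "z \<noteq> 0" using z by blast
  have "kern y z \<noteq> 0" if y: "y \<in> set ys" "y \<noteq> 0" for y
  proof
    assume "kern y z = 0"
    hence "y * z \<in> ?Z \<or> y / z \<in> ?Z" using z0 y(2) by (simp add: kern_eq_0_iff)
    hence "(y * z) / y \<in> (\<lambda>w. w / y) ` ?Z \<or> y / (y / z) \<in> (\<lambda>w. y / w) ` ?Z" by blast
    hence "z \<in> (\<lambda>w. w / y) ` ?Z \<union> (\<lambda>w. y / w) ` ?Z" using y(2) z0 by simp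
    thus False using z y(1) by blast
  qed
  moreover have "th (z\<^sup>2) \<noteq> 0" using z by auto
  ultimately show ?thesis using z by auto
qed

text \<open>The excluded points are the zeros of a single nontrivial holomorphic function
  \<open>T\<close>, so the identity theorem applies.\<close>

lemma V_generic_zero:
  assumes V: "V m h" and 0: "\<And>z. z \<noteq> 0 \<Longrightarrow> th (z\<^sup>2) \<noteq> 0 \<Longrightarrow> (\<forall>y\<in>set ys. kern y z \<noteq> 0) \<Longrightarrow> h z = 0"
    and ys: "0 \<notin> set ys" and z: "z \<noteq> 0"
  shows "h z = 0"
proof -
  obtain w where w: "w \<noteq> 0" "th (w\<^sup>2) \<noteq> 0" "\<forall>y\<in>set ys. kern y w \<noteq> 0"
    using generic_point[of ys] ys by (metis)
  define T where "T z = th (z\<^sup>2) * (\<Prod>y\<leftarrow>ys. kern y z)" for z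
  have "(\<lambda>z. \<Prod>y\<leftarrow>ys. kern y z) holomorphic_on - {0}"
    using ys by (induction ys) (auto intro!: holomorphic_intros)
  hence "T holomorphic_on - {0}" unfolding T_def[abs_def] by (intro holomorphic_intros) auto
  moreover have "h z * T z = 0" if "z \<noteq> 0" for z
  proof (cases "th (z\<^sup>2) \<noteq> 0 \<and> (\<forall>y\<in>set ys. kern y z \<noteq> 0)")
    case False
    thus ?thesis by (force simp: T_def prod_list_zero_iff)
  qed (use 0[OF that] in simp)
  moreover have "T w \<noteq> 0" using w by (auto simp: T_def prod_list_zero_iff)
  ultimately show ?thesis
    using holomorphic_mult_eq_0[OF V_holomorphic[OF V] _ _ w(1) _ z] by blast
qed

end

section \<open>Lattice paths and symmetric theta functions\<close>

lemma prod_list_map_mset: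
  fixes f :: "'a \<Rightarrow> 'b :: comm_monoid_mult"
  assumes "mset xs = mset ys"
  shows "(\<Prod>x\<leftarrow>xs. f x) = (\<Prod>x\<leftarrow>ys. f x)"
  by (metis assms mset_map prod_mset_prod_list)

text \<open>A partition inside a rectangle is encoded by its boundary path, read from the last row upwards:
  \<open>True\<close> ends a row, \<open>False\<close> ends a column.  Reversing the word is the complement in the rectangle,
  negating all its letters is the complement of the conjugate.\<close>

abbreviation nR :: "bool list \<Rightarrow> nat" where "nR w \<equiv> count_list w True"
abbreviation nC :: "bool list \<Rightarrow> nat" where "nC w \<equiv> count_list w False"

definition words :: "nat \<Rightarrow> nat \<Rightarrow> bool list set"
  where "words m n = {w. nC w = m \<and> nR w = n}"

lemma length_word: "length w = nC w + nR w"
  by (induction w) auto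

lemma words_finite [simp]: "finite (words m n)"
proof (rule finite_subset)
  show "words m n \<subseteq> {w. set w \<subseteq> UNIV \<and> length w = m + n}"
    by (auto simp: words_def length_word)
qed (rule finite_lists_length_eq, auto)

lemma words_0_right: "words m 0 = {replicate m False}"
proof -
  have "w = replicate (nC w) False" if "nR w = 0" for w
    using that by (induction w) (auto split: if_splits)
  moreover have "nR (replicate m False) = 0" "nC (replicate m False) = m"
    by (induction m) auto
  ultimately show ?thesis by (auto simp: words_def)
qed

lemma words_0_left: "words 0 n = {replicate n True}"
proof -
  have "w = replicate (nR w) True" if "nC w = 0" for w
    using that by (induction w) (auto split: if_splits)
  moreover have "nC (replicate n True) = 0" "nR (replicate n True) = n"
    by (induction n) auto
  ultimately show ?thesis by (auto simp: words_def)
qed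

lemma words_Suc_Suc:
  "words (Suc m) (Suc n) = (#) True ` words (Suc m) n \<union> (#) False ` words m (Suc n)"
proof (intro set_eqI)
  fix w show "w \<in> words (Suc m) (Suc n) \<longleftrightarrow> w \<in> (#) True ` words (Suc m) n \<union> (#) False ` words m (Suc n)"
    by (cases w; cases "hd w") (auto simp: words_def image_iff)
qed

lemma True_Cons_words [simp]: "True # w \<in> words m n \<longleftrightarrow> (\<exists>n'. n = Suc n' \<and> w \<in> words m n')"
  and False_Cons_words [simp]: "False # w \<in> words m n \<longleftrightarrow> (\<exists>m'. m = Suc m' \<and> w \<in> words m' n)"
  by (auto simp: words_def)

lemma sum_words_Suc_Suc:
  fixes F :: "bool list \<Rightarrow> complex"
  shows "(\<Sum>w\<in>words (Suc m) (Suc n). F w) =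
    (\<Sum>w\<in>words (Suc m) n. F (True # w)) + (\<Sum>w\<in>words m (Suc n). F (False # w))"
  unfolding words_Suc_Suc by (subst sum.union_disjoint) (auto simp: sum.reindex)

lemma map_Not_words [simp]: "map Not w \<in> words m n \<longleftrightarrow> w \<in> words n m"
proof -
  have "nC (map Not w) = nR w \<and> nR (map Not w) = nC w" by (induction w) auto
  thus ?thesis by (auto simp: words_def)
qed

lemma map_Not_Not [simp]: "map Not (map Not w) = w"
  by (induction w) auto

lemma rev_words [simp]: "rev w \<in> words m n \<longleftrightarrow> w \<in> words m n"
  by (simp add: words_def)

text \<open>Lattice paths with a common origin whose end points are on the same antidiagonal but swapped
  in order: at their last common point before the swap, one goes up and the other goes right.\<close>

lemma paths_cross:
  assumes "length v = length w" "nC v < nC w"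
  shows "\<exists>v1 v2 w1 w2. v = v1 @ True # v2 \<and> w = w1 @ False # w2 \<and> nC v1 = nC w1 \<and> nR v1 = nR w1"
  using assms
proof (induction v arbitrary: w rule: rev_induct)
  case (snoc x v w')
  then obtain y w where w': "w' = w @ [y]" "length w = length v"
    by (metis length_append_singleton length_Suc_conv_rev)
  show ?case
  proof (cases "nC v < nC w")
    case True
    from snoc.IH[OF w'(2)[symmetric] True] show ?thesis unfolding w'(1) by (metis append_Cons append_assoc)
  next
    case False
    hence "nC v = nC w" "x" "\<not> y" using snoc.prems(2) w'(1) by (cases x; cases y; simp)+
    moreover have "nR v = nR w" using w'(2) length_word[of v] length_word[of w] calculation by simp
    ultimately show ?thesis unfolding w'(1) by (metis (full_types))
  qed
qed auto

text \<open>Each \<open>True\<close> step records the current position. Read from the last row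
  upwards, the recorded points are \<open>a * q ^ \<mu> i * t ^ (n - i)\<close>, the coordinates
  based at \<open>a\<close> of the vanishing points.\<close>

fun pts :: "complex \<Rightarrow> complex \<Rightarrow> complex \<Rightarrow> bool list \<Rightarrow> complex list" where
  "pts a q t [] = []"
| "pts a q t (True # w) = a # pts (a * t) q t w"
| "pts a q t (False # w) = pts (a * q) q t w"

lemma length_pts [simp]: "length (pts a q t w) = nR w"
  by (induction a q t w rule: pts.induct) auto

lemma pts_append: "pts a q t (v @ w) = pts a q t v @ pts (a * q ^ nC v * t ^ nR v) q t w"
  by (induction a q t v rule: pts.induct) (auto simp: mult_ac)

lemma pts_elem: "x \<in> set (pts a q t w) \<Longrightarrow> \<exists>i j. i \<le> nC w \<and> j < nR w \<and> x = a * q ^ i * t ^ j"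
proof (induction a q t w rule: pts.induct)
  case (2 a q t w)
  show ?case
  proof (cases "x = a")
    case True thus ?thesis by (intro exI[of _ 0]) auto
  next
    case False
    then obtain i j where "i \<le> nC w" "j < nR w" "x = a * t * q ^ i * t ^ j" using 2 by auto
    thus ?thesis by (intro exI[of _ i] exI[of _ "Suc j"]) auto
  qed
next
  case (3 a q t w)
  then obtain i j where "i \<le> nC w" "j < nR w" "x = a * q * q ^ i * t ^ j" by auto
  thus ?case by (intro exI[of _ "Suc i"] exI[of _ j]) auto
qed auto

lemma pts_nonzero: "a \<noteq> 0 \<Longrightarrow> q \<noteq> 0 \<Longrightarrow> t \<noteq> 0 \<Longrightarrow> 0 \<notin> set (pts a q t w)"
  using pts_elem[of 0 a q t w] by auto

section \<open>Symmetric functions in several variables that vanish on grids\<close>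

context nome
begin

text \<open>\<open>GW S\<close> is the weakening of \<open>W\<close> below to lists in general position relative to \<open>S\<close>.  It is stable
  under division by \<open>\<Prod>x. kern a x\<close>, where the quotient has junk values if \<open>kern a x = 0\<close>.\<close>

definition GW :: "complex list \<Rightarrow> nat \<Rightarrow> nat \<Rightarrow> (complex list \<Rightarrow> complex) \<Rightarrow> bool"
  where "GW S n m F \<longleftrightarrow>
    (\<forall>xs ys. length xs = n \<longrightarrow> ok (xs @ S) \<longrightarrow> mset ys = mset xs \<longrightarrow> F ys = F xs) \<and>
    (\<forall>xs. Suc (length xs) = n \<longrightarrow> ok (xs @ S) \<longrightarrow>
      (\<exists>h. V m h \<and> (\<forall>z. ok (z # xs @ S) \<longrightarrow> F (z # xs) = h z)))"

text \<open>Working form of the \<open>BC\<close> symmetric theta functions of degree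
  \<open>m\<close> in \<open>n\<close> variables: lists instead of points, symmetry, and a condition
  on the first entry only. Joint continuity is not demanded; it is recovered from
  \<open>W_expand\<close>.\<close>

definition W :: "nat \<Rightarrow> nat \<Rightarrow> (complex list \<Rightarrow> complex) \<Rightarrow> bool"
  where "W n m f \<longleftrightarrow>
    (\<forall>xs ys. length xs = n \<longrightarrow> 0 \<notin> set xs \<longrightarrow> mset ys = mset xs \<longrightarrow> f ys = f xs) \<and>
    (\<forall>xs. Suc (length xs) = n \<longrightarrow> 0 \<notin> set xs \<longrightarrow> V m (\<lambda>z. f (z # xs)))"

lemma GW_mset: "GW S n m F \<Longrightarrow> length xs = n \<Longrightarrow> ok (xs @ S) \<Longrightarrow> mset ys = mset xs \<Longrightarrow> F ys = F xs"
  unfolding GW_def by blast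

lemma GW_head:
  assumes "GW S n m F" "Suc (length xs) = n" "ok (xs @ S)"
  obtains h where "V m h" "\<And>z. ok (z # xs @ S) \<Longrightarrow> F (z # xs) = h z"
  using assms unfolding GW_def by blast

lemma W_mset: "W n m f \<Longrightarrow> length xs = n \<Longrightarrow> 0 \<notin> set xs \<Longrightarrow> mset ys = mset xs \<Longrightarrow> f ys = f xs"
  unfolding W_def by blast

lemma W_head: "W n m f \<Longrightarrow> Suc (length xs) = n \<Longrightarrow> 0 \<notin> set xs \<Longrightarrow> V m (\<lambda>z. f (z # xs))"
  unfolding W_def by blast

lemma ok_imp_nonzero: "ok (xs @ S) \<Longrightarrow> 0 \<notin> set xs"
  using ok_nonzero by fastforce

lemma W_imp_GW: "W n m f \<Longrightarrow> GW S n m f"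
  unfolding W_def GW_def using ok_imp_nonzero by blast

lemma ok_shift: "ok (xs @ a # S) \<longleftrightarrow> ok (a # xs @ S)"
  by (intro iffI; erule ok_mset[rotated]; simp)

lemma ok_swap: "ok (x # y # xs) \<longleftrightarrow> ok (y # x # xs)"
  by (intro iffI; erule ok_mset[rotated]; simp)

text \<open>The fixed value \<open>a\<close> joins the list \<open>S\<close>, so that the remaining
  entries stay independent of it.\<close>

lemma GW_restrict:
  assumes F: "GW S (Suc n) m F"
  shows "GW (a # S) n m (\<lambda>xs. F (a # xs))"
  unfolding GW_def
proof (intro conjI allI impI)
  fix xs ys :: "complex list" assume "length xs = n" "ok (xs @ a # S)" "mset ys = mset xs"
  thus "F (a # ys) = F (a # xs)" by (intro GW_mset[OF F]) (auto simp del: ok.simps simp: ok_shift)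
next
  fix xs :: "complex list" assume xs: "Suc (length xs) = n" "ok (xs @ a # S)"
  obtain h where h: "V m h" "\<And>z. ok (z # (a # xs) @ S) \<Longrightarrow> F (z # a # xs) = h z"
    using GW_head[OF F, of "a # xs"] xs by (auto simp del: ok.simps simp: ok_shift)
  have "F (a # z # xs) = h z" if "ok (z # xs @ a # S)" for z
  proof -
    have o: "ok (a # z # xs @ S)" using that ok_shift[of "z # xs" a S] by (simp del: ok.simps)
    hence "F (a # z # xs) = F (z # a # xs)" using xs by (intro GW_mset[OF F]) (auto simp del: ok.simps simp: ok_swap)
    thus ?thesis using h(2)[of z] o by (simp del: ok.simps add: ok_swap)
  qed
  thus "\<exists>h. V m h \<and> (\<forall>z. ok (z # xs @ a # S) \<longrightarrow> F (a # z # xs) = h z)" using h(1) by blast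
qed

text \<open>One-variable division in the first entry: the function \<open>h\<close> that represents
  \<open>F\<close> there vanishes at \<open>a\<close>, because \<open>a # xs\<close> is itself in
  general position relative to \<open>S\<close>.\<close>

lemma GW_divide:
  assumes F: "GW S n (Suc m) F" and a: "a \<noteq> 0" "th (a\<^sup>2) \<noteq> 0"
    and 0: "\<And>xs. Suc (length xs) = n \<Longrightarrow> ok (xs @ a # S) \<Longrightarrow> F (a # xs) = 0"
  shows "GW (a # S) n m (\<lambda>xs. F xs / (\<Prod>x\<leftarrow>xs. kern a x))"
  unfolding GW_def
proof (intro conjI allI impI)
  fix xs ys :: "complex list" assume "length xs = n" "ok (xs @ a # S)" and m: "mset ys = mset xs"
  hence "F ys = F xs" by (intro GW_mset[OF F]) (auto simp: ok_shift)
  thus "F ys / (\<Prod>x\<leftarrow>ys. kern a x) = F xs / (\<Prod>x\<leftarrow>xs. kern a x)"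
    by (simp only: prod_list_map_mset[OF m])
next
  fix xs :: "complex list" assume xs: "Suc (length xs) = n" "ok (xs @ a # S)"
  obtain h where h: "V (Suc m) h" "\<And>z. ok (z # xs @ S) \<Longrightarrow> F (z # xs) = h z"
    using GW_head[OF F xs(1)] xs(2) by (auto simp: ok_shift)
  have "h a = 0" using h(2)[of a] 0[OF xs] xs(2) by (simp add: ok_shift)
  then obtain g where g: "V m g" "\<And>z. z \<noteq> 0 \<Longrightarrow> h z = kern a z * g z"
    using V_divide[OF h(1) a] by blast
  have "F (z # xs) / (\<Prod>x\<leftarrow>z # xs. kern a x) = 1 / (\<Prod>x\<leftarrow>xs. kern a x) * g z" if o: "ok (z # xs @ a # S)" for z
  proof -
    have z: "z \<noteq> 0" "kern a z \<noteq> 0" using o a(1) kern_0_commute[of a z] by auto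
    have "ok (z # xs @ S)" using o by (auto simp: ok_shift)
    thus ?thesis using h(2)[of z] g(2)[OF z(1)] z by simp
  qed
  thus "\<exists>h. V m h \<and> (\<forall>z. ok (z # xs @ a # S) \<longrightarrow> F (z # xs) / (\<Prod>x\<leftarrow>z # xs. kern a x) = h z)"
    using V_cmult[OF g(1)] by blast
qed

text \<open>The entries are freed from independence of \<open>a\<close> one at a time, each by the
  identity theorem in that entry. In the induction the entries \<open>us\<close> are still
  independent of \<open>a\<close>, while \<open>vs\<close> are arbitrary.\<close>

lemma GW_dense:
  assumes F: "GW S n m F" and a: "ok (a # S)"
    and 0: "\<And>xs. length xs = n \<Longrightarrow> ok (xs @ a # S) \<Longrightarrow> F xs = 0"
    and xs: "length xs = n" "ok (xs @ S)"
  shows "F xs = 0"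
proof -
  have "F (us @ vs) = 0" if "length (us @ vs) = n" "ok ((us @ vs) @ S)" "\<forall>u\<in>set us. kern u a \<noteq> 0" for us vs
    using that
  proof (induction vs arbitrary: us)
    case Nil
    thus ?case using a ok_nonzero kern_0_commute by (intro 0) (auto simp: ok_append)
  next
    case (Cons v vs)
    have o: "ok ((us @ vs) @ S)" using Cons.prems(2) by (auto simp: ok_append)
    obtain h where h: "V m h" "\<And>z. ok (z # (us @ vs) @ S) \<Longrightarrow> F (z # us @ vs) = h z"
      using GW_head[OF F _ o] Cons.prems(1) by auto
    have nz: "0 \<notin> set (us @ vs @ S @ [a])" using o a ok_nonzero[of "(us @ vs) @ S"] by auto
    have "h z = 0" if z: "z \<noteq> 0" "th (z\<^sup>2) \<noteq> 0" "\<forall>y\<in>set (us @ vs @ S @ [a]). kern y z \<noteq> 0" for z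
    proof -
      have "kern z y \<noteq> 0" if "y \<in> set (us @ vs @ S @ [a])" for y
        using z that nz kern_0_commute[of z y] by metis
      moreover from this have "ok (((z # us) @ vs) @ S)" using o z by auto
      ultimately have "F ((z # us) @ vs) = 0" using Cons.prems by (intro Cons.IH) auto
      thus ?thesis using h(2)[of z] \<open>ok (((z # us) @ vs) @ S)\<close> by simp
    qed
    moreover have v: "v \<noteq> 0" using Cons.prems(2) ok_nonzero[of "(us @ v # vs) @ S" v] by auto
    ultimately have "h v = 0" using V_generic_zero[OF h(1) _ nz v] by blast
    moreover have "ok (v # (us @ vs) @ S)"
      using ok_mset[of "(us @ v # vs) @ S" "v # (us @ vs) @ S"] Cons.prems(2) by (simp del: ok.simps)
    ultimately have "F (v # us @ vs) = 0" using h(2) by metis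
    thus ?case using GW_mset[OF F Cons.prems(1,2), of "v # us @ vs"] by simp
  qed
  from this[of "[]" xs] show ?thesis using xs by simp
qed

lemma W_zero:
  assumes f: "W n m f" and 0: "\<And>xs. length xs = n \<Longrightarrow> ok xs \<Longrightarrow> f xs = 0"
    and xs: "length xs = n" "0 \<notin> set xs"
  shows "f xs = 0"
proof -
  have "f (us @ vs) = 0" if "length (us @ vs) = n" "ok us" "0 \<notin> set vs" for us vs
    using that
  proof (induction vs arbitrary: us)
    case Nil thus ?case using 0 by simp
  next
    case (Cons v vs)
    have nz: "0 \<notin> set (us @ vs)" "0 \<notin> set us" "v \<noteq> 0" using Cons.prems ok_nonzero[of us] by auto
    have "f (z # us @ vs) = 0" if z: "z \<noteq> 0" "th (z\<^sup>2) \<noteq> 0" "\<forall>y\<in>set us. kern y z \<noteq> 0" for z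
    proof -
      have "\<forall>y\<in>set us. kern z y \<noteq> 0" using z nz kern_0_commute[of z] by metis
      thus ?thesis using Cons.IH[of "z # us"] Cons.prems z by auto
    qed
    hence "f (v # us @ vs) = 0"
      using V_generic_zero[OF W_head[OF f _ nz(1)] _ nz(2,3)] Cons.prems(1) by auto
    thus ?case using W_mset[OF f Cons.prems(1), of "v # us @ vs"] nz by auto
  qed
  from this[of "[]" xs] show ?thesis using xs by simp
qed

text \<open>The common step of all uniqueness inductions. Once \<open>F\<close> vanishes with an
  entry equal to \<open>a\<close>, it can be divided by the product of \<open>kern a x\<close>. The
  hypothesis \<open>G\<close> speaks of every function of lower degree that vanishes where
  \<open>F\<close> does, so that its users need not handle the quotient. In degree 0 there is no
  quotient, but \<open>F\<close> is constant in its first entry.\<close>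

lemma GW_step:
  assumes F: "GW S (Suc n) m F" and a: "ok (a # S)"
    and 0: "\<And>xs. length xs = n \<Longrightarrow> ok (xs @ a # S) \<Longrightarrow> F (a # xs) = 0"
    and G: "\<And>m' G xs. m = Suc m' \<Longrightarrow> GW (a # S) (Suc n) m' G \<Longrightarrow>
      (\<And>ys. F ys = 0 \<Longrightarrow> G ys = 0) \<Longrightarrow> length xs = Suc n \<Longrightarrow> ok (xs @ a # S) \<Longrightarrow> G xs = 0"
    and xs: "length xs = Suc n" "ok (xs @ S)"
  shows "F xs = 0"
proof (rule GW_dense[OF F a _ xs])
  fix xs :: "complex list" assume xs: "length xs = Suc n" "ok (xs @ a # S)"
  show "F xs = 0"
  proof (cases m)
    case 0
    obtain z ys where ys: "xs = z # ys" using xs(1) by (cases xs) auto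
    have o1: "ok (ys @ a # S)" using xs(2) by (simp add: ys)
    have o4: "ok (a # ys @ S)" using o1 by (simp only: ok_shift)
    have o3: "ok (z # ys @ S)" using xs(2) by (auto simp: ys ok_append)
    have o: "ok (ys @ a # S)" "ok (ys @ S)" "ok (z # ys @ S)" "ok (a # ys @ S)"
      using o1 o3 o4 by auto
    obtain h where h: "V m h" "\<And>z. ok (z # ys @ S) \<Longrightarrow> F (z # ys) = h z"
      using GW_head[OF F _ o(2)] xs(1) ys by auto
    have "h a = 0" using h(2)[OF o(4)] assms(3)[OF _ o(1)] xs(1) ys by simp
    moreover have "h z = h a" using h(1) o(3,4) unfolding 0 by (intro V_0_const[of h]) auto
    ultimately show ?thesis using h(2)[OF o(3)] ys by simp
  next
    case (Suc m')
    have a': "a \<noteq> 0" "th (a\<^sup>2) \<noteq> 0" using a by auto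
    have "GW (a # S) (Suc n) m' (\<lambda>xs. F xs / (\<Prod>x\<leftarrow>xs. kern a x))"
      using F 0 unfolding Suc by (intro GW_divide a') auto
    from G[OF Suc this _ xs] have "F xs / (\<Prod>x\<leftarrow>xs. kern a x) = 0" by simp
    moreover have "kern a x \<noteq> 0" if "x \<in> set xs" for x
      using xs(2) that a'(1) ok_nonzero[OF xs(2), of x] kern_0_commute[of a x] by (auto simp: ok_append)
    hence "(\<Prod>x\<leftarrow>xs. kern a x) \<noteq> 0" by (auto simp: prod_list_zero_iff)
    ultimately show ?thesis by simp
  qed
qed

text \<open>\<open>M\<close> is a budget: inductions shift the base points by \<open>q\<close> and
  \<open>t\<close>, and every shift spends a part of the range of exponents. A finite range keeps
  the condition equivalent to the nonvanishing of finitely many theta values.\<close>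

definition gq :: "nat \<Rightarrow> complex \<Rightarrow> complex \<Rightarrow> bool"
  where "gq M q t \<longleftrightarrow> q \<noteq> 0 \<and> t \<noteq> 0 \<and>
    (\<forall>i j. \<bar>i\<bar> \<le> int M \<longrightarrow> \<bar>j\<bar> \<le> int M \<longrightarrow> (i, j) \<noteq> (0, 0) \<longrightarrow> th (q powi i * t powi j) \<noteq> 0)"

definition ng :: "nat \<Rightarrow> complex \<Rightarrow> complex \<Rightarrow> complex \<Rightarrow> bool"
  where "ng M q t x \<longleftrightarrow> x \<noteq> 0 \<and>
    (\<forall>i j. \<bar>i\<bar> \<le> int M \<longrightarrow> \<bar>j\<bar> \<le> int M \<longrightarrow> th (q powi i * t powi j * x) \<noteq> 0)"

lemma gq_nz: "gq M q t \<Longrightarrow> q \<noteq> 0" "gq M q t \<Longrightarrow> t \<noteq> 0"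
  by (auto simp: gq_def)

lemma gq_mono: "gq M q t \<Longrightarrow> N \<le> M \<Longrightarrow> gq N q t"
  by (force simp: gq_def)

lemma ng_mono: "ng M q t x \<Longrightarrow> N \<le> M \<Longrightarrow> ng N q t x"
  by (force simp: ng_def)

lemma ngD: "ng M q t x \<Longrightarrow> \<bar>i\<bar> \<le> int M \<Longrightarrow> \<bar>j\<bar> \<le> int M \<Longrightarrow> th (q powi i * t powi j * x) \<noteq> 0"
  by (simp add: ng_def)

lemma gqD: "gq M q t \<Longrightarrow> \<bar>i\<bar> \<le> int M \<Longrightarrow> \<bar>j\<bar> \<le> int M \<Longrightarrow> (i, j) \<noteq> (0, 0) \<Longrightarrow> th (q powi i * t powi j) \<noteq> 0"
  by (simp add: gq_def)

lemma ng_shift: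
  assumes "ng M q t x" "gq K q t" "\<bar>k\<bar> + int N \<le> int M" "\<bar>l\<bar> + int N \<le> int M" "y = q powi k * t powi l * x"
  shows "ng N q t y"
  unfolding ng_def
proof (intro conjI allI impI)
  fix i j assume "\<bar>i\<bar> \<le> int N" "\<bar>j\<bar> \<le> int N"
  hence "th (q powi (i + k) * t powi (j + l) * x) \<noteq> 0" using assms by (intro ngD[of M]) auto
  thus "th (q powi i * t powi j * y) \<noteq> 0"
    using gq_nz[OF assms(2)] by (simp add: assms(5) power_int_add mult_ac)
qed (use assms gq_nz in \<open>auto simp: ng_def\<close>)

lemma ng_inverse:
  assumes "ng M q t x" "gq K q t"
  shows "ng M q t (1 / x)"
  unfolding ng_def
proof (intro conjI allI impI)
  fix i j assume "\<bar>i\<bar> \<le> int M" "\<bar>j\<bar> \<le> int M"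
  hence "th (q powi (- i) * t powi (- j) * x) \<noteq> 0" using assms by (intro ngD[of M]) auto
  moreover have "q powi (- i) * t powi (- j) * x = x / (q powi i * t powi j)"
    using gq_nz[OF assms(2)] by (simp add: power_int_minus field_simps)
  ultimately have "th (q powi i * t powi j / x) \<noteq> 0"
    using gq_nz[OF assms(2)] assms(1) th_div_0_iff[of x "q powi i * t powi j"] by (auto simp: ng_def)
  thus "th (q powi i * t powi j * (1 / x)) \<noteq> 0" by simp
qed (use assms in \<open>auto simp: ng_def\<close>)

lemma ng_p:
  assumes "ng M q t x" "gq K q t"
  shows "ng M q t (p * x)"
  unfolding ng_def
proof (intro conjI allI impI)
  fix i j assume "\<bar>i\<bar> \<le> int M" "\<bar>j\<bar> \<le> int M"
  hence "th (q powi i * t powi j * x) \<noteq> 0" using assms by (intro ngD[of M]) auto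
  hence "th (p * (q powi i * t powi j * x)) \<noteq> 0"
    using gq_nz[OF assms(2)] assms(1) by (subst th_p_mult_0_iff) (auto simp: ng_def)
  thus "th (q powi i * t powi j * (p * x)) \<noteq> 0" by (simp only: mult_ac not_False_eq_True)
qed (use assms in \<open>auto simp: ng_def\<close>)

definition gen :: "nat \<Rightarrow> complex \<Rightarrow> complex \<Rightarrow> complex \<Rightarrow> complex \<Rightarrow> bool"
  where "gen M a b q t \<longleftrightarrow> a \<noteq> 0 \<and> b \<noteq> 0 \<and> gq M q t \<and> ng M q t (a\<^sup>2) \<and> ng M q t (b\<^sup>2) \<and>
     ng M q t (a * b) \<and> ng M q t (a / b)"

lemma gen_nz: "gen M a b q t \<Longrightarrow> a \<noteq> 0 \<and> b \<noteq> 0 \<and> q \<noteq> 0 \<and> t \<noteq> 0"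
  by (auto simp: gen_def gq_def)

lemma gen_mono: "gen M a b q t \<Longrightarrow> N \<le> M \<Longrightarrow> gen N a b q t"
  using ng_mono gq_mono by (auto simp: gen_def)

text \<open>The shift moves \<open>a^2\<close> by \<open>q^2\<close> and the mixed monomials by one
  \<open>q\<close>, so the exponent bound drops by 2.\<close>

lemma gen_shift_q:
  assumes g: "gen (M + 2) a b q t"
  shows "gen M (a * q) b q t"
proof -
  note G = g[unfolded gen_def]
  note gq = conjunct1[OF conjunct2[OF conjunct2[OF G]]]
  have "ng M q t ((a * q)\<^sup>2)"
    by (rule ng_shift[of "M + 2" q t "a\<^sup>2" _ 2 _ 0, OF _ gq]) (use G in \<open>auto simp: power2_eq_square\<close>)
  moreover have "ng M q t (a * q * b)"
    by (rule ng_shift[of "M + 2" q t "a * b" _ 1 _ 0, OF _ gq]) (use G in auto)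
  moreover have "ng M q t (a * q / b)"
    by (rule ng_shift[of "M + 2" q t "a / b" _ 1 _ 0, OF _ gq]) (use G in auto)
  ultimately show ?thesis
    using G gq_nz[OF gq] gq_mono[OF gq, of M] ng_mono[of "M + 2" q t "b\<^sup>2" M] by (auto simp: gen_def)
qed

lemma gen_shift_t:
  assumes g: "gen (M + 2) a b q t"
  shows "gen M (a * t) b q t"
proof -
  note G = g[unfolded gen_def]
  note gq = conjunct1[OF conjunct2[OF conjunct2[OF G]]]
  have "ng M q t ((a * t)\<^sup>2)"
    by (rule ng_shift[of "M + 2" q t "a\<^sup>2" _ 0 _ 2, OF _ gq]) (use G in \<open>auto simp: power2_eq_square\<close>)
  moreover have "ng M q t (a * t * b)"
    by (rule ng_shift[of "M + 2" q t "a * b" _ 0 _ 1, OF _ gq]) (use G in auto)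
  moreover have "ng M q t (a * t / b)"
    by (rule ng_shift[of "M + 2" q t "a / b" _ 0 _ 1, OF _ gq]) (use G in auto)
  ultimately show ?thesis
    using G gq_nz[OF gq] gq_mono[OF gq, of M] ng_mono[of "M + 2" q t "b\<^sup>2" M] by (auto simp: gen_def)
qed

lemma pts_replicate_False [simp]: "pts a q t (replicate m False) = []"
  by (induction m arbitrary: a) auto

lemma ngD_nat:
  assumes "ng M q t x" "i \<le> M" "j \<le> M"
  shows "th (q ^ i * t ^ j * x) \<noteq> 0"
  using ngD[OF assms(1), of "int i" "int j"] assms(2,3) by simp

lemma gqD_nat:
  assumes "gq M q t" "i \<le> M" "j \<le> M" "(i, j) \<noteq> (0, 0)"
  shows "th (q ^ i * t ^ j) \<noteq> 0"
  using gqD[OF assms(1), of "int i" "int j"] assms(2-4) by simp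

lemma kern_nonzero_grid:
  assumes "ng M q t (u * v)" "ng M q t (u / v)" "gq K q t" "i \<le> M" "j \<le> M"
  shows "kern (u * q ^ i * t ^ j) v \<noteq> 0"
proof -
  have "th (q ^ i * t ^ j * (u * v)) \<noteq> 0" "th (q ^ i * t ^ j * (u / v)) \<noteq> 0"
    by (rule ngD_nat[OF assms(1,4,5)], rule ngD_nat[OF assms(2,4,5)])
  thus ?thesis by (simp add: kern_def mult_ac)
qed

lemma kern_nonzero_grid_self:
  assumes "ng M q t (u\<^sup>2)" "gq M q t" "i \<le> M" "j \<le> M" "(i, j) \<noteq> (0, 0)"
  shows "kern (u * q ^ i * t ^ j) u \<noteq> 0"
proof -
  have "u \<noteq> 0" using assms(1) by (auto simp: ng_def)
  have "th (q ^ i * t ^ j * (u\<^sup>2)) \<noteq> 0" "th (q ^ i * t ^ j) \<noteq> 0"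
    by (rule ngD_nat[OF assms(1,3,4)], rule gqD_nat[OF assms(2-5)])
  thus ?thesis using \<open>u \<noteq> 0\<close> by (simp add: kern_def mult_ac power2_eq_square)
qed

lemma ng_th_nonzero: "ng M q t x \<Longrightarrow> th x \<noteq> 0"
  using ngD[of M q t x 0 0] by simp

lemma ng_sq_shift_q: "ng (M + 2) q t (a\<^sup>2) \<Longrightarrow> gq K q t \<Longrightarrow> ng M q t ((a * q)\<^sup>2)"
  by (rule ng_shift[where k = 2 and l = 0]) (auto simp: power2_eq_square)

lemma ng_sq_shift_t: "ng (M + 2) q t (a\<^sup>2) \<Longrightarrow> gq K q t \<Longrightarrow> ng M q t ((a * t)\<^sup>2)"
  by (rule ng_shift[where k = 0 and l = 2]) (auto simp: power2_eq_square)

text \<open>Paths that begin with \<open>True\<close> have \<open>a\<close> as first point and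
  control the restriction to \<open>a\<close>; paths that begin with \<open>False\<close> live on
  the grid based at \<open>a * q\<close> and control the quotient. The hypothesis on
  \<open>S\<close> keeps the values already fixed independent of the grid still to be
  visited.\<close>

lemma GW_pts_zero:
  assumes "gq M q t" "ng M q t (a\<^sup>2)" "2 * (m + n) \<le> M" and "a \<noteq> 0"
    and "\<And>y i j. y \<in> set S \<Longrightarrow> i \<le> m \<Longrightarrow> j \<le> n \<Longrightarrow> kern (a * q ^ i * t ^ j) y \<noteq> 0"
    and "GW S n m F" "\<And>w. w \<in> words m n \<Longrightarrow> F (pts a q t w) = 0"
    and "length xs = n" "ok (xs @ S)"
  shows "F xs = 0"
  using assms
proof (induction "m + n" arbitrary: m n a S F M xs rule: less_induct)
  case less
  note q0 = gq_nz[OF less.prems(1)]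
  show ?case
  proof (cases n)
    case 0
    have "F (pts a q t (replicate m False)) = 0"
      by (rule less.prems(7)) (simp add: 0 words_0_right)
    thus ?thesis using less.prems(8) 0 by simp
  next
    case (Suc n')
    have okS: "ok S" using less.prems(9) by (auto simp: ok_append)
    have th2: "th (a\<^sup>2) \<noteq> 0" using less.prems(2) ng_th_nonzero by blast
    have kaS: "kern a y \<noteq> 0" if "y \<in> set S" for y using less.prems(5)[OF that, of 0 0] by simp
    have okaS: "ok (a # S)" using okS th2 less.prems(4) kaS by auto
    have M2: "M - 2 + 2 = M" "2 * (m + n') \<le> M - 2" using less.prems(3) Suc by auto
    have gq2: "gq (M - 2) q t" using gq_mono[OF less.prems(1)] by simp
    show ?thesis
    proof (rule GW_step[where n = n' and S = S and F = F and a = a and m = m])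
      show "GW S (Suc n') m F" using less.prems(6) Suc by simp
      show "ok (a # S)" by fact
      fix xs :: "complex list" assume xs: "length xs = n'" "ok (xs @ a # S)"
      show "F (a # xs) = 0"
      proof (rule less.hyps[where m = m and n = n' and a = "a * t" and S = "a # S" and F = "\<lambda>xs. F (a # xs)" and M = "M - 2"])
        show "ng (M - 2) q t ((a * t)\<^sup>2)" using less.prems(1,2) M2 by (intro ng_sq_shift_t) auto
        show "GW (a # S) n' m (\<lambda>xs. F (a # xs))" using less.prems(6) Suc by (intro GW_restrict) auto
        fix w assume "w \<in> words m n'"
        thus "F (a # pts (a * t) q t w) = 0" using less.prems(7)[of "True # w"] Suc by simp
      next
        fix y i j assume y: "y \<in> set (a # S)" and ij: "i \<le> m" "j \<le> n'"
        have "kern (a * q ^ i * t ^ Suc j) y \<noteq> 0"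
        proof (cases "y \<in> set S")
          case True thus ?thesis using ij Suc by (intro less.prems(5)) auto
        next
          case False
          thus ?thesis using kern_nonzero_grid_self[OF less.prems(2,1), of i "Suc j"] ij Suc less.prems(3) y by auto
        qed
        thus "kern (a * t * q ^ i * t ^ j) y \<noteq> 0" by (simp add: mult_ac)
      qed (use xs M2 gq2 less.prems(4) q0 Suc in auto)
    next
      fix m' G and xs :: "complex list"
      assume m: "m = Suc m'" and G: "GW (a # S) (Suc n') m' G" and F0: "\<And>ys. F ys = 0 \<Longrightarrow> G ys = 0"
        and xs: "length xs = Suc n'" "ok (xs @ a # S)"
      show "G xs = 0"
      proof (rule less.hyps[where m = m' and n = n and a = "a * q" and S = "a # S" and F = G and M = "M - 2"])
        show "ng (M - 2) q t ((a * q)\<^sup>2)" using less.prems(1,2) M2 by (intro ng_sq_shift_q) auto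
        fix w assume "w \<in> words m' n"
        thus "G (pts (a * q) q t w) = 0" using less.prems(7)[of "False # w"] m by (intro F0) simp
      next
        fix y i j assume y: "y \<in> set (a # S)" and ij: "i \<le> m'" "j \<le> n"
        have "kern (a * q ^ Suc i * t ^ j) y \<noteq> 0"
        proof (cases "y \<in> set S")
          case True thus ?thesis using ij m by (intro less.prems(5)) auto
        next
          case False
          thus ?thesis using kern_nonzero_grid_self[OF less.prems(2,1), of "Suc i" j] ij m less.prems(3) y by auto
        qed
        thus "kern (a * q * q ^ i * t ^ j) y \<noteq> 0" by (simp add: mult_ac)
      qed (use xs M2 gq2 less.prems(3,4) q0 Suc G m in auto)
    qed (use less.prems Suc in auto)
  qed
qed

text \<open>The restriction to \<open>a\<close> vanishes by assumption, and the quotient has degree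
  one less, so the complete grid at \<open>b\<close> in that degree finishes it. In this form a
  \<open>True\<close> step determines an interpolation function.\<close>

lemma GW_two_grids_zero:
  assumes g: "gq M q t" "ng M q t (b\<^sup>2)" "2 * (m + n) \<le> M" "b \<noteq> 0"
    and k: "\<And>y i j. y \<in> set (a # S) \<Longrightarrow> i \<le> m \<Longrightarrow> j \<le> Suc n \<Longrightarrow> kern (b * q ^ i * t ^ j) y \<noteq> 0"
    and F: "GW S (Suc n) m F" and a: "ok (a # S)"
    and 0: "\<And>xs. length xs = n \<Longrightarrow> ok (xs @ a # S) \<Longrightarrow> F (a # xs) = 0"
    and 1: "\<And>w m'. m = Suc m' \<Longrightarrow> w \<in> words m' (Suc n) \<Longrightarrow> F (pts b q t w) = 0"
    and xs: "length xs = Suc n" "ok (xs @ S)"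
  shows "F xs = 0"
proof (rule GW_step[OF F a 0 _ xs])
  fix m' G and xs :: "complex list"
  assume m: "m = Suc m'" and G: "GW (a # S) (Suc n) m' G" and F0: "\<And>ys. F ys = 0 \<Longrightarrow> G ys = 0"
    and xs: "length xs = Suc n" "ok (xs @ a # S)"
  show "G xs = 0"
    using g m by (intro GW_pts_zero[OF g(1,2) _ g(4) k G F0[OF 1[OF m]] xs]) auto
qed

section \<open>Closure properties of the symmetric class and interpolation on a grid\<close>

lemma V_cong: "V m f \<Longrightarrow> (\<And>z. z \<noteq> 0 \<Longrightarrow> f z = g z) \<Longrightarrow> V m g"
  unfolding V_def by (auto intro: holomorphic_transform[of f])

lemma W_cong:
  assumes f: "W n m f" and fg: "\<And>xs. length xs = n \<Longrightarrow> 0 \<notin> set xs \<Longrightarrow> g xs = f xs"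
  shows "W n m g"
  unfolding W_def
proof (intro conjI allI impI)
  fix xs ys :: "complex list" assume x: "length xs = n" "0 \<notin> set xs" "mset ys = mset xs"
  have "length ys = n" "0 \<notin> set ys" using x by (metis size_mset, metis mset_eq_setD)
  thus "g ys = g xs" using fg W_mset[OF f x] x by simp
next
  fix xs :: "complex list" assume "Suc (length xs) = n" "0 \<notin> set xs"
  thus "V m (\<lambda>z. g (z # xs))" by (intro V_cong[OF W_head[OF f]]) (auto intro!: fg[symmetric])
qed

lemma W_add:
  assumes f: "W n m f" and g: "W n m g"
  shows "W n m (\<lambda>xs. f xs + g xs)"
  unfolding W_def
proof (intro conjI allI impI)
  fix xs ys :: "complex list" assume x: "length xs = n" "0 \<notin> set xs" "mset ys = mset xs"
  show "f ys + g ys = f xs + g xs" by (simp only: W_mset[OF f x] W_mset[OF g x])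
qed (intro V_add W_head[OF f] W_head[OF g])

lemma W_cmult:
  assumes f: "W n m f"
  shows "W n m (\<lambda>xs. c * f xs)"
  unfolding W_def
proof (intro conjI allI impI)
  fix xs ys :: "complex list" assume x: "length xs = n" "0 \<notin> set xs" "mset ys = mset xs"
  show "c * f ys = c * f xs" by (simp only: W_mset[OF f x])
qed (intro V_cmult W_head[OF f])

lemma W_diff: "W n m f \<Longrightarrow> W n m g \<Longrightarrow> W n m (\<lambda>xs. f xs - g xs)"
  using W_add[of n m f "\<lambda>xs. (-1) * g xs", OF _ W_cmult] by simp

lemma W_null: "W n m (\<lambda>xs. 0)"
  by (simp add: W_def V_zero)

lemma W_sum: "(\<And>i. i \<in> I \<Longrightarrow> W n m (f i)) \<Longrightarrow> W n m (\<lambda>xs. \<Sum>i\<in>I. f i xs)"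
  by (induction I rule: infinite_finite_induct) (auto intro: W_null W_add)

lemma W_one: "W n 0 (\<lambda>xs. 1)"
  by (simp add: W_def V_const)

lemma W_kern_mult:
  assumes "W n m f" "a \<noteq> 0"
  shows "W n (Suc m) (\<lambda>xs. (\<Prod>x\<leftarrow>xs. kern a x) * f xs)"
  unfolding W_def
proof (intro conjI allI impI)
  fix xs ys :: "complex list" assume x: "length xs = n" "0 \<notin> set xs" "mset ys = mset xs"
  show "(\<Prod>x\<leftarrow>ys. kern a x) * f ys = (\<Prod>x\<leftarrow>xs. kern a x) * f xs"
    by (simp only: W_mset[OF assms(1) x] prod_list_map_mset[OF x(3)])
next
  fix xs :: "complex list" assume x: "Suc (length xs) = n" "0 \<notin> set xs"
  have "V (Suc 0 + m) (\<lambda>z. kern a z * ((\<Prod>x\<leftarrow>xs. kern a x) * f (z # xs)))"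
    by (intro V_mult V_kern V_cmult W_head[OF assms(1)] x assms)
  thus "V (Suc m) (\<lambda>z. (\<Prod>x\<leftarrow>z # xs. kern a x) * f (z # xs))" by (simp add: mult_ac)
qed

text \<open>The product side of the theorem in list form, with the \<open>x\<close> in the first
  list and the \<open>y\<close> in the second.\<close>

definition KK :: "complex list \<Rightarrow> complex list \<Rightarrow> complex"
  where "KK xs ys = (\<Prod>x\<leftarrow>xs. \<Prod>y\<leftarrow>ys. kern y x)"

lemma KK_Cons_left: "KK (x # xs) ys = (\<Prod>y\<leftarrow>ys. kern y x) * KK xs ys"
  by (simp add: KK_def)

lemma KK_Cons_right: "KK xs (y # ys) = (\<Prod>x\<leftarrow>xs. kern y x) * KK xs ys"
  by (induction xs) (auto simp: KK_def mult_ac)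

lemma KK_Nil [simp]: "KK [] ys = 1" "KK xs [] = 1"
  by (simp_all add: KK_def) (induction xs; simp)

lemma W_KK: "0 \<notin> set ys \<Longrightarrow> W n (length ys) (\<lambda>xs. KK xs ys)"
  by (induction ys) (auto simp: KK_Cons_right intro!: W_one W_kern_mult)

lemma W_restrict:
  assumes "W (Suc n) m f" "a \<noteq> 0"
  shows "W n m (\<lambda>xs. f (a # xs))"
  unfolding W_def
proof (intro conjI allI impI)
  fix xs ys :: "complex list" assume x: "length xs = n" "0 \<notin> set xs" "mset ys = mset xs"
  thus "f (a # ys) = f (a # xs)" using assms by (intro W_mset[OF assms(1)]) auto
next
  fix xs :: "complex list" assume x: "Suc (length xs) = n" "0 \<notin> set xs"
  have "V m (\<lambda>z. f (z # a # xs))" using x assms by (intro W_head[OF assms(1)]) auto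
  thus "V m (\<lambda>z. f (a # z # xs))"
    by (rule V_cong) (use x assms in \<open>auto intro!: W_mset[OF assms(1)]\<close>)
qed

text \<open>The matrix of these products is invertible because it is block triangular. The second
  list comes from the same grid with \<open>q\<close> and \<open>t\<close> exchanged and contains
  \<open>a\<close> when its path starts with \<open>False\<close>; the first list contains
  \<open>a\<close> when its path starts with \<open>True\<close>. So one off-diagonal block is zero,
  and the diagonal blocks are smaller instances up to nonzero factors.\<close>

lemma pts_interpolate:
  assumes "gq M q t" "ng M q t (a\<^sup>2)" "2 * (m + n) \<le> M"
  shows "\<exists>\<gamma>. \<forall>w'\<in>words m n. (\<Sum>w\<in>words m n. \<gamma> w * KK (pts a q t w') (pts a t q (map Not w))) = val w'"
  using assms
proof (induction "m + n" arbitrary: m n a M val rule: less_induct)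
  case less
  note q0 = gq_nz[OF less.prems(1)]
  have a0: "a \<noteq> 0" using less.prems(2) by (auto simp: ng_def)
  consider "m = 0" | "n = 0" | m' n' where "m = Suc m'" "n = Suc n'" by (metis not0_implies_Suc)
  thus ?case
  proof cases
    case 1
    show ?thesis unfolding 1 words_0_left by (intro exI[of _ val]) simp
  next
    case 2
    show ?thesis unfolding 2 words_0_right by (intro exI[of _ val]) simp
  next
    case 3
    define Y where "Y a w = pts a t q (map Not w)" for a w
    have M2: "M - 2 + 2 = M" "2 * (m + n') \<le> M - 2" "2 * (m' + n) \<le> M - 2" using less.prems(3) 3 by auto
    have gq2: "gq (M - 2) q t" using gq_mono[OF less.prems(1)] by simp
    have kY: "(\<Prod>y\<leftarrow>Y (a * t) w. kern y a) \<noteq> 0" if w: "w \<in> words m n'" for w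
    proof -
      have "kern y a \<noteq> 0" if y0: "y \<in> set (Y (a * t) w)" for y
      proof -
        have "map Not w \<in> words n' m" using w by simp
        hence nw: "nC (map Not w) = n'" "nR (map Not w) = m" unfolding words_def by blast+
        obtain i j where "i \<le> nC (map Not w)" "j < nR (map Not w)" and y: "y = a * t * t ^ i * q ^ j"
          using pts_elem[OF y0[unfolded Y_def]] by blast
        hence ij: "Suc i \<le> M" "j \<le> M" using nw less.prems(3) 3 by simp_all
        have "kern (a * q ^ j * t ^ Suc i) a \<noteq> 0"
          by (rule kern_nonzero_grid_self[OF less.prems(2,1) ij(2,1)]) simp
        moreover have "y = a * q ^ j * t ^ Suc i" unfolding y by simp
        ultimately show ?thesis by simp
      qed
      thus ?thesis by (auto simp: prod_list_zero_iff)
    qed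
    have kX: "(\<Prod>x\<leftarrow>pts (a * q) q t w. kern a x) \<noteq> 0" if w: "w \<in> words m' n" for w
    proof -
      have "kern a x \<noteq> 0" if x: "x \<in> set (pts (a * q) q t w)" for x
      proof -
        have nw: "nC w = m'" "nR w = n" using w unfolding words_def by blast+
        obtain i j where "i \<le> nC w" "j < nR w" and xe: "x = a * q * q ^ i * t ^ j"
          using pts_elem[OF x] by blast
        hence ij: "Suc i \<le> M" "j \<le> M" using nw less.prems(3) 3 by simp_all
        have "kern (a * q ^ Suc i * t ^ j) a \<noteq> 0"
          by (rule kern_nonzero_grid_self[OF less.prems(2,1) ij]) simp
        moreover have xe': "x = a * q ^ Suc i * t ^ j" unfolding xe by simp
        moreover have "x \<noteq> 0" using a0 q0 xe by simp
        ultimately show ?thesis using a0 kern_0_commute by blast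
      qed
      thus ?thesis by (auto simp: prod_list_zero_iff)
    qed
    obtain \<gamma>1 where g1: "\<And>w'. w' \<in> words m n' \<Longrightarrow>
        (\<Sum>w\<in>words m n'. \<gamma>1 w * KK (pts (a * t) q t w') (Y (a * t) w)) = val (True # w')"
      using less.hyps[of m n' "M - 2" "a * t" "\<lambda>w. val (True # w)"] ng_sq_shift_t[of "M - 2" q t a] M2 less.prems gq2 3
      unfolding Y_def by auto
    \<comment> \<open>The coefficients of paths starting with \<open>True\<close> are solved first,
      at the points that contain \<open>a\<close>. Then \<open>r\<close> is the residual at the
      other points, which the second block must match after division by the factors
      \<open>kern a x\<close>.\<close>
    define d where "d w = \<gamma>1 w / (\<Prod>y\<leftarrow>Y (a * t) w. kern y a)" for w
    define r where "r w' = (val (False # w') - (\<Sum>w\<in>words m n'. d w * KK (pts (a * q) q t w') (Y (a * t) w))) /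
        (\<Prod>x\<leftarrow>pts (a * q) q t w'. kern a x)" for w'
    obtain \<gamma>2 where g2: "\<And>w'. w' \<in> words m' n \<Longrightarrow>
        (\<Sum>w\<in>words m' n. \<gamma>2 w * KK (pts (a * q) q t w') (Y (a * q) w)) = r w'"
      using less.hyps[of m' n "M - 2" "a * q" r] ng_sq_shift_q[of "M - 2" q t a] M2 less.prems gq2 3
      unfolding Y_def by auto
    define \<gamma> where "\<gamma> w = (if hd w then d (tl w) else \<gamma>2 (tl w))" for w
    show ?thesis
    proof (intro exI[of _ \<gamma>] ballI)
      fix w' assume w': "w' \<in> words m n"
      have eq: "(\<Sum>w\<in>words m n. \<gamma> w * KK (pts a q t w') (pts a t q (map Not w))) =
          (\<Sum>w\<in>words m n'. d w * KK (pts a q t w') (Y (a * t) w)) +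
          (\<Sum>w\<in>words m' n. \<gamma>2 w * KK (pts a q t w') (a # Y (a * q) w))"
        using 3 by (simp add: sum_words_Suc_Suc \<gamma>_def Y_def)
      from w' 3 consider v where "w' = True # v" "v \<in> words m n'" | v where "w' = False # v" "v \<in> words m' n"
        by (auto simp: words_Suc_Suc)
      thus "(\<Sum>w\<in>words m n. \<gamma> w * KK (pts a q t w') (pts a t q (map Not w))) = val w'"
      proof cases
        case (1 v)
        have "d w * KK (pts a q t w') (Y (a * t) w) = \<gamma>1 w * KK (pts (a * t) q t v) (Y (a * t) w)"
          if "w \<in> words m n'" for w
          using kY[OF that] by (simp add: 1 KK_Cons_left d_def)
        moreover have "KK (pts a q t w') (a # Y (a * q) w) = 0" for w
          using a0 by (simp add: 1 KK_Cons_left)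
        ultimately show ?thesis unfolding eq using g1[OF 1(2)] 1(1) by simp
      next
        case (2 v)
        have "(\<Sum>w\<in>words m' n. \<gamma>2 w * KK (pts a q t w') (a # Y (a * q) w)) =
          (\<Prod>x\<leftarrow>pts (a * q) q t v. kern a x) * r v"
          unfolding g2[OF 2(2), symmetric] by (simp add: 2 KK_Cons_right sum_distrib_left mult_ac)
        thus ?thesis unfolding eq using kX[OF 2(2)] by (simp add: 2 r_def)
      qed
    qed
  qed
qed

text \<open>Coefficients exist for any grid values, and the grid values determine the function. The
  expansion replaces an abstract function by a finite sum of products over the single entries; it is
  used to extend functions by a further entry and to prove joint continuity.\<close>

lemma W_expand:
  assumes g: "gq M q t" "ng M q t (a\<^sup>2)" "2 * (m + n) \<le> M" and f: "W n m f"
  obtains \<gamma> where "\<And>xs. length xs = n \<Longrightarrow> 0 \<notin> set xs \<Longrightarrow>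
    f xs = (\<Sum>w\<in>words m n. \<gamma> w * KK xs (pts a t q (map Not w)))"
proof -
  have a0: "a \<noteq> 0" using g by (auto simp: ng_def)
  obtain \<gamma> where \<gamma>: "\<And>w'. w' \<in> words m n \<Longrightarrow>
      (\<Sum>w\<in>words m n. \<gamma> w * KK (pts a q t w') (pts a t q (map Not w))) = f (pts a q t w')"
    using pts_interpolate[OF g, of "\<lambda>w. f (pts a q t w)"] by blast
  define d where "d xs = f xs - (\<Sum>w\<in>words m n. \<gamma> w * KK xs (pts a t q (map Not w)))" for xs
  have "W n m (\<lambda>xs. KK xs (pts a t q (map Not w)))" if "w \<in> words m n" for w
    using W_KK[OF pts_nonzero[OF a0 gq_nz(2,1)[OF g(1)]], of n "map Not w"] that map_Not_words[of w n m]
    by (auto simp: words_def)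
  hence d: "W n m d" unfolding d_def by (intro W_diff f W_sum W_cmult)
  have "d xs = 0" if "length xs = n" "ok xs" for xs
    by (rule GW_pts_zero[OF g a0 _ W_imp_GW[OF d], of "[]"]) (use that \<gamma> in \<open>auto simp: d_def\<close>)
  hence "d xs = 0" if "length xs = n" "0 \<notin> set xs" for xs using W_zero[OF d _ that] by blast
  thus ?thesis using that[of \<gamma>] by (auto simp: d_def)
qed

end

section \<open>Interpolation functions and the kernel\<close>

context nome
begin

text \<open>The interpolation functions in the scaling in which both recursion steps have coefficient \<open>1\<close>.\<close>

fun IntN :: "bool list \<Rightarrow> complex \<Rightarrow> complex \<Rightarrow> complex \<Rightarrow> complex \<Rightarrow> (complex list \<Rightarrow> complex) \<Rightarrow> bool" where
  "IntN [] a b q t f \<longleftrightarrow> f [] = 1"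
| "IntN (False # w) a b q t f \<longleftrightarrow> (\<exists>g. IntN w (a * q) b q t g \<and>
     (\<forall>xs. length xs = nR w \<longrightarrow> 0 \<notin> set xs \<longrightarrow> f xs = (\<Prod>x\<leftarrow>xs. kern a x) * g xs))"
| "IntN (True # w) a b q t f \<longleftrightarrow> W (Suc (nR w)) (nC w) f \<and> IntN w (a * t) b q t (\<lambda>xs. f (a # xs)) \<and>
     (\<forall>w' m'. nC w = Suc m' \<longrightarrow> w' \<in> words m' (Suc (nR w)) \<longrightarrow> f (pts b q t w') = 0)"

lemma IntN_W: "IntN w a b q t f \<Longrightarrow> a \<noteq> 0 \<Longrightarrow> q \<noteq> 0 \<Longrightarrow> t \<noteq> 0 \<Longrightarrow> W (nR w) (nC w) f"
proof (induction w arbitrary: a f)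
  case Nil
  thus ?case by (auto simp: W_def V_const)
next
  case (Cons c w)
  show ?case
  proof (cases c)
    case True thus ?thesis using Cons.prems by simp
  next
    case False
    then obtain g where g: "IntN w (a * q) b q t g"
      and fg: "\<And>xs. length xs = nR w \<Longrightarrow> 0 \<notin> set xs \<Longrightarrow> f xs = (\<Prod>x\<leftarrow>xs. kern a x) * g xs"
      using Cons.prems by auto
    have "W (nR w) (nC w) g" using Cons.IH[OF g] Cons.prems by auto
    from W_cong[OF W_kern_mult[OF this Cons.prems(2)] fg] show ?thesis using False by simp
  qed
qed

lemma IntN_cong:
  assumes "IntN w a b q t f" "a \<noteq> 0" "b \<noteq> 0" "q \<noteq> 0" "t \<noteq> 0"
    and "\<And>xs. length xs = nR w \<Longrightarrow> 0 \<notin> set xs \<Longrightarrow> g xs = f xs"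
  shows "IntN w a b q t g"
  using assms
proof (induction w arbitrary: a f g)
  case (Cons c w)
  show ?case
  proof (cases c)
    case True
    have W: "W (Suc (nR w)) (nC w) f" and r: "IntN w (a * t) b q t (\<lambda>xs. f (a # xs))"
      and z: "\<And>w' m'. nC w = Suc m' \<Longrightarrow> w' \<in> words m' (Suc (nR w)) \<Longrightarrow> f (pts b q t w') = 0"
      using Cons.prems True by auto
    have "W (Suc (nR w)) (nC w) g" using Cons.prems(6) True by (intro W_cong[OF W]) auto
    moreover have "IntN w (a * t) b q t (\<lambda>xs. g (a # xs))"
      by (rule Cons.IH[OF r]) (use Cons.prems True in auto)
    moreover have "g (pts b q t w') = 0" if "nC w = Suc m'" "w' \<in> words m' (Suc (nR w))" for w' m'
      using z[OF that] Cons.prems(6)[of "pts b q t w'"] that pts_nonzero[of b q t w'] Cons.prems(3-5) True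
      by (auto simp: words_def)
    ultimately show ?thesis using True by simp
  next
    case False
    thus ?thesis using Cons.prems by auto
  qed
qed auto

lemma gen_dest:
  assumes "gen M a b q t"
  shows "a \<noteq> 0" "b \<noteq> 0" "gq M q t" "ng M q t (a\<^sup>2)" "ng M q t (b\<^sup>2)" "ng M q t (a * b)" "ng M q t (b * a)"
    "ng M q t (a / b)" "ng M q t (b / a)" "q \<noteq> 0" "t \<noteq> 0"
  using assms gen_nz[OF assms] ng_inverse[of M q t "a / b" M] by (auto simp: gen_def mult.commute)

lemma gen_kern_ba:
  assumes "gen M a b q t" "i \<le> M" "j \<le> M"
  shows "kern (b * q ^ i * t ^ j) a \<noteq> 0"
  using kern_nonzero_grid[OF gen_dest(7,9,3)[OF assms(1)] assms(2,3)] .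

lemma W_two_grids_zero:
  assumes g: "gen M a b q t" "2 * (m + n) \<le> M" and f: "W (Suc n) m f"
    and 0: "\<And>xs. length xs = n \<Longrightarrow> 0 \<notin> set xs \<Longrightarrow> f (a # xs) = 0"
    and 1: "\<And>w m'. m = Suc m' \<Longrightarrow> w \<in> words m' (Suc n) \<Longrightarrow> f (pts b q t w) = 0"
    and xs: "length xs = Suc n" "0 \<notin> set xs"
  shows "f xs = 0"
proof (rule W_zero[OF f _ xs])
  note G = gen_dest[OF g(1)]
  fix xs :: "complex list" assume xs: "length xs = Suc n" "ok xs"
  have "m = 0 \<or> m \<noteq> 0" by blast
  show "f xs = 0"
  \<comment> \<open>With degree 0 and no further entry the bound admits \<open>M = 0\<close>,
    whereas the general argument uses exponents up to \<open>j = 1\<close>.\<close>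
  proof (cases "m = 0 \<and> n = 0")
    case True
    obtain z where z: "xs = [z]" using xs(1) True by (cases xs) auto
    have "V 0 (\<lambda>z. f [z])" using W_head[OF f, of "[]"] True by simp
    from V_0_const[OF this, of z a] show ?thesis using 0[of "[]"] xs(2) z G True by auto
  next
    case False
    hence M1: "Suc 0 \<le> M" using g(2) by auto
    show ?thesis
    proof (rule GW_two_grids_zero[where S = "[]" and a = a and b = b and q = q and t = t and m = m and M = M and n = n])
      show "ok [a]" using G ng_th_nonzero by auto
      show "f (a # xs) = 0" if "length xs = n" "ok (xs @ [a])" for xs
        using 0 that ok_imp_nonzero by blast
      show "kern (b * q ^ i * t ^ j) y \<noteq> 0" if "y \<in> set [a]" "i \<le> m" "j \<le> Suc n" for y i j
        using gen_kern_ba[OF g(1), of i j] that g(2) False by auto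
    qed (use G g(2) W_imp_GW[OF f] 1 xs in auto)
  qed
qed

lemma IntN_unique:
  assumes "gen M a b q t" "2 * length w \<le> M" "IntN w a b q t f" "IntN w a b q t g"
    and "length xs = nR w" "0 \<notin> set xs"
  shows "f xs = g xs"
  using assms
proof (induction w arbitrary: a f g xs M)
  case (Cons c w)
  have M: "M - 2 + 2 = M" "2 * length w \<le> M - 2" using Cons.prems(2) by auto
  note G = gen_dest[OF Cons.prems(1)]
  show ?case
  proof (cases c)
    case True
    define d where "d xs = f xs - g xs" for xs
    have W: "W (Suc (nR w)) (nC w) d" unfolding d_def using Cons.prems True by (intro W_diff) auto
    have "d xs = 0"
    proof (rule W_two_grids_zero[OF Cons.prems(1) _ W])
      show "2 * (nC w + nR w) \<le> M" using Cons.prems(2) length_word[of w] by simp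
      show "d (a # xs) = 0" if "length xs = nR w" "0 \<notin> set xs" for xs
        using Cons.IH[OF gen_shift_t[of "M - 2"] M(2), of a "\<lambda>xs. f (a # xs)" "\<lambda>xs. g (a # xs)" xs] Cons.prems M(1) True that
        by (simp add: d_def)
    qed (use Cons.prems True in \<open>auto simp: d_def\<close>)
    thus ?thesis by (simp add: d_def)
  next
    case False
    obtain f' g' where "IntN w (a * q) b q t f'" "IntN w (a * q) b q t g'"
      and "f xs = (\<Prod>x\<leftarrow>xs. kern a x) * f' xs" "g xs = (\<Prod>x\<leftarrow>xs. kern a x) * g' xs"
      using Cons.prems False by auto
    thus ?thesis
      using Cons.IH[OF gen_shift_q[of "M - 2"] M(2), of a f' g' xs] Cons.prems M(1) False by simp
  qed
qed auto

text \<open>A \<open>True\<close> step asks for a prescribed restriction to \<open>a\<close> and for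
  zeros on the grid at \<open>b\<close>. The restriction is extended by inserting \<open>a\<close>
  in its expansion into products; the values on the second grid are then corrected by a multiple of
  the product of \<open>kern a x\<close>, which is invisible on the restriction.\<close>

lemma IntN_exists:
  assumes "gen M a b q t" "2 * length w \<le> M"
  shows "\<exists>f. IntN w a b q t f"
  using assms
proof (induction w arbitrary: a M)
  case Nil thus ?case by (auto intro!: exI[of _ "\<lambda>_. 1"])
next
  case (Cons c w)
  have M: "M - 2 + 2 = M" "2 * length w \<le> M - 2" using Cons.prems(2) by auto
  note G = gen_dest[OF Cons.prems(1)]
  show ?case
  proof (cases c)
    case False
    obtain g where "IntN w (a * q) b q t g"
      using Cons.IH[OF gen_shift_q[of "M - 2"] M(2)] Cons.prems M(1) by auto
    thus ?thesis using False by (intro exI[of _ "\<lambda>xs. (\<Prod>x\<leftarrow>xs. kern a x) * g xs"]) auto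
  next
    case True
    define m n where "m = nC w" and "n = nR w"
    have mn: "2 * (m + n) \<le> M - 2" using M(2) length_word[of w] by (simp add: m_def n_def)
    have g': "gen (M - 2) (a * t) b q t" using gen_shift_t[of "M - 2" a b q t] Cons.prems M(1) by simp
    note G' = gen_dest[OF g']
    obtain g where g: "IntN w (a * t) b q t g" using Cons.IH[OF g' M(2)] by blast
    have Wg: "W n m g" using IntN_W[OF g] G' by (simp add: m_def n_def)
    obtain \<gamma> where \<gamma>: "\<And>xs. length xs = n \<Longrightarrow> 0 \<notin> set xs \<Longrightarrow>
        g xs = (\<Sum>w\<in>words m n. \<gamma> w * KK xs (pts (a * t) t q (map Not w)))"
      using W_expand[OF G'(3,4) mn Wg] by blast
    have len: "length (pts (a * t) t q (map Not w)) = m" if "w \<in> words m n" for w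
    proof -
      have "map Not w \<in> words n m" using that by simp
      thus ?thesis unfolding words_def by simp
    qed
    have nz: "(\<Prod>y\<leftarrow>pts (a * t) t q (map Not w). kern y a) \<noteq> 0" if w: "w \<in> words m n" for w
    proof -
      have "kern y a \<noteq> 0" if y: "y \<in> set (pts (a * t) t q (map Not w))" for y
      proof -
        have "map Not w \<in> words n m" using w by simp
        hence nw: "nC (map Not w) = n" "nR (map Not w) = m" unfolding words_def by blast+
        obtain i j where "i \<le> nC (map Not w)" "j < nR (map Not w)" and y: "y = a * t * t ^ i * q ^ j"
          using pts_elem[OF y] by blast
        hence ij: "Suc i \<le> M" "j \<le> M" using nw mn M by simp_all
        have "kern (a * q ^ j * t ^ Suc i) a \<noteq> 0"
          by (rule kern_nonzero_grid_self[OF G(4,3) ij(2,1)]) simp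
        moreover have "y = a * q ^ j * t ^ Suc i" unfolding y by simp
        ultimately show ?thesis by simp
      qed
      thus ?thesis by (auto simp: prod_list_zero_iff)
    qed
    \<comment> \<open>Inserting the entry \<open>a\<close> multiplies each product by a nonzero
      constant, which is divided out in advance.\<close>
    define f0 where "f0 xs = (\<Sum>w\<in>words m n. \<gamma> w / (\<Prod>y\<leftarrow>pts (a * t) t q (map Not w). kern y a) *
        KK xs (pts (a * t) t q (map Not w)))" for xs
    have f0a: "f0 (a # xs) = g xs" if xs: "length xs = n" "0 \<notin> set xs" for xs
      unfolding f0_def \<gamma>[OF xs] by (rule sum.cong) (use nz in \<open>auto simp: KK_Cons_left\<close>)
    have "W (Suc n) m (\<lambda>xs. KK xs (pts (a * t) t q (map Not w)))" if w: "w \<in> words m n" for w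
      using W_KK[OF pts_nonzero[OF G'(1,11,10)], of "Suc n" "map Not w"] len[OF w] by simp
    hence Wf0: "W (Suc n) m f0" unfolding f0_def by (intro W_sum W_cmult)
    have "\<exists>f. W (Suc n) m f \<and> (\<forall>xs. f (a # xs) = f0 (a # xs)) \<and>
      (\<forall>w' m'. m = Suc m' \<longrightarrow> w' \<in> words m' (Suc n) \<longrightarrow> f (pts b q t w') = 0)"
    proof (cases m)
      case 0 thus ?thesis using Wf0 by blast
    next
      case (Suc m')
      have mn': "2 * (m' + Suc n) \<le> M" using mn Suc M by simp
      obtain \<delta> where \<delta>: "\<And>w'. w' \<in> words m' (Suc n) \<Longrightarrow>
          (\<Sum>w\<in>words m' (Suc n). \<delta> w * KK (pts b q t w') (pts b t q (map Not w))) =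
          f0 (pts b q t w') / (\<Prod>x\<leftarrow>pts b q t w'. kern a x)"
        using pts_interpolate[OF G(3,5) mn', of "\<lambda>w'. f0 (pts b q t w') / (\<Prod>x\<leftarrow>pts b q t w'. kern a x)"]
        by blast
      define h where "h xs = (\<Sum>w\<in>words m' (Suc n). \<delta> w * KK xs (pts b t q (map Not w)))" for xs
      have len': "length (pts b t q (map Not w)) = m'" if "w \<in> words m' (Suc n)" for w
      proof -
        have "map Not w \<in> words (Suc n) m'" using that by simp
        thus ?thesis unfolding words_def by simp
      qed
      have "W (Suc n) m' (\<lambda>xs. KK xs (pts b t q (map Not w)))" if w: "w \<in> words m' (Suc n)" for w
        using W_KK[OF pts_nonzero[OF G(2,11,10)], of "Suc n" "map Not w"] len'[OF w] by simp
      hence Wh: "W (Suc n) m' h" unfolding h_def by (intro W_sum W_cmult)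
      define f where "f xs = f0 xs - (\<Prod>x\<leftarrow>xs. kern a x) * h xs" for xs
      have "W (Suc n) m f" unfolding f_def using W_kern_mult[OF Wh G(1)] Wf0 Suc by (intro W_diff) auto
      moreover have "f (a # xs) = f0 (a # xs)" for xs using G(1) by (simp add: f_def)
      moreover have "f (pts b q t w') = 0" if w': "w' \<in> words m' (Suc n)" for w'
      proof -
        have "kern a x \<noteq> 0" if x: "x \<in> set (pts b q t w')" for x
        proof -
          have nw: "nC w' = m'" "nR w' = Suc n" using w' unfolding words_def by blast+
          obtain i j where ij: "i \<le> nC w'" "j < nR w'" and xe: "x = b * q ^ i * t ^ j"
            using pts_elem[OF x] by blast
          have "kern x a \<noteq> 0" unfolding xe by (rule gen_kern_ba[OF Cons.prems(1)]) (use ij nw mn' in auto)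
          moreover have "x \<noteq> 0" using xe G by simp
          ultimately show ?thesis using G(1) kern_0_commute by blast
        qed
        hence "(\<Prod>x\<leftarrow>pts b q t w'. kern a x) \<noteq> 0" by (auto simp: prod_list_zero_iff)
        thus ?thesis using \<delta>[OF w'] by (simp add: f_def h_def)
      qed
      ultimately show ?thesis using Suc by auto
    qed
    then obtain f where f: "W (Suc n) m f" "\<And>xs. f (a # xs) = f0 (a # xs)"
      "\<And>w' m'. m = Suc m' \<Longrightarrow> w' \<in> words m' (Suc n) \<Longrightarrow> f (pts b q t w') = 0" by blast
    have "IntN w (a * t) b q t (\<lambda>xs. f (a # xs))"
      by (rule IntN_cong[OF g]) (use G f0a f(2) in \<open>auto simp: n_def\<close>)
    thus ?thesis using f True by (auto simp: m_def n_def)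
  qed
qed

text \<open>For generic parameters \<open>IntN_unique\<close> shows that the choice matters only at
  lists of wrong length or with a zero entry.\<close>

definition P :: "complex \<Rightarrow> complex \<Rightarrow> complex \<Rightarrow> complex \<Rightarrow> bool list \<Rightarrow> complex list \<Rightarrow> complex"
  where "P a b q t w = (SOME f. IntN w a b q t f)"

lemma P_IntN: "gen M a b q t \<Longrightarrow> 2 * length w \<le> M \<Longrightarrow> IntN w a b q t (P a b q t w)"
  unfolding P_def by (rule someI_ex[OF IntN_exists])

lemma P_True_Cons:
  assumes g: "gen M a b q t" "2 * Suc (length w) \<le> M" and xs: "length xs = nR w" "0 \<notin> set xs"
  shows "P a b q t (True # w) (a # xs) = P (a * t) b q t w xs"
proof -
  have M: "M - 2 + 2 = M" "2 * length w \<le> M - 2" using g by auto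
  have g': "gen (M - 2) (a * t) b q t" using gen_shift_t[of "M - 2" a b q t] g M by simp
  have "IntN w (a * t) b q t (\<lambda>xs. P a b q t (True # w) (a # xs))"
    using P_IntN[OF g(1), of "True # w"] g(2) by simp
  from IntN_unique[OF g' M(2) this P_IntN[OF g' M(2)] xs] show ?thesis .
qed

lemma P_False_Cons:
  assumes g: "gen M a b q t" "2 * Suc (length w) \<le> M" and xs: "length xs = nR w" "0 \<notin> set xs"
  shows "P a b q t (False # w) xs = (\<Prod>x\<leftarrow>xs. kern a x) * P (a * q) b q t w xs"
proof -
  have M: "M - 2 + 2 = M" "2 * length w \<le> M - 2" using g by auto
  have g': "gen (M - 2) (a * q) b q t" using gen_shift_q[of "M - 2" a b q t] g M by simp
  obtain h where h: "IntN w (a * q) b q t h" "P a b q t (False # w) xs = (\<Prod>x\<leftarrow>xs. kern a x) * h xs"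
    using P_IntN[OF g(1), of "False # w"] g(2) xs by auto
  thus ?thesis using IntN_unique[OF g' M(2) h(1) P_IntN[OF g' M(2)] xs] by simp
qed

text \<open>In degree 0 the first entry can be moved to \<open>a\<close> without changing the value,
  after which the recursion removes it.\<close>

lemma IntN_degree_0:
  assumes "IntN w a b q t f" "nC w = 0" "a \<noteq> 0" "q \<noteq> 0" "t \<noteq> 0" "length xs = nR w" "0 \<notin> set xs"
  shows "f xs = 1"
  using assms
proof (induction w arbitrary: a f xs)
  case (Cons c w)
  hence c: c by (cases c) auto
  obtain z ys where xs: "xs = z # ys" using Cons.prems(6) c by (cases xs) auto
  have "V 0 (\<lambda>z. f (z # ys))"
    using W_head[of "Suc (nR w)" "nC w" f ys] Cons.prems c xs by auto
  from V_0_const[OF this, of z a] have "f xs = f (a # ys)" using Cons.prems xs by auto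
  also have "\<dots> = 1" using Cons.IH[of "a * t" "\<lambda>xs. f (a # xs)" ys] Cons.prems c xs by auto
  finally show ?case .
qed auto

lemma IntN_no_variables: "IntN w a b q t f \<Longrightarrow> nR w = 0 \<Longrightarrow> f [] = 1"
proof (induction w arbitrary: a f)
  case (Cons c w)
  thus ?case by (cases c) auto
qed auto

lemma ng_swap_inverse:
  assumes "ng M q t x" "gq K q t"
  shows "ng M (1 / t) (1 / q) (1 / x)"
proof -
  have "ng M q t (1 / x)" by (rule ng_inverse[OF assms])
  show ?thesis unfolding ng_def
  proof (intro conjI allI impI)
    fix i j assume "\<bar>i\<bar> \<le> int M" "\<bar>j\<bar> \<le> int M"
    hence "th (q powi (- j) * t powi (- i) * (1 / x)) \<noteq> 0" using \<open>ng M q t (1 / x)\<close> by (intro ngD) auto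
    thus "th ((1 / t) powi i * (1 / q) powi j * (1 / x)) \<noteq> 0"
      by (simp add: power_int_minus power_int_divide_distrib field_simps)
  qed (use assms in \<open>auto simp: ng_def\<close>)
qed

lemma gq_swap_inverse:
  assumes "gq M q t"
  shows "gq M (1 / t) (1 / q)"
  unfolding gq_def
proof (intro conjI allI impI)
  fix i j assume "\<bar>i\<bar> \<le> int M" "\<bar>j\<bar> \<le> int M" "(i, j) \<noteq> (0, 0)"
  hence "th (q powi (- j) * t powi (- i)) \<noteq> 0" using assms by (intro gqD) auto
  thus "th ((1 / t) powi i * (1 / q) powi j) \<noteq> 0"
    by (simp add: power_int_minus power_int_divide_distrib field_simps)
qed (use gq_nz[OF assms] in auto)

text \<open>These are the parameters of the second interpolation function in the theorem. Inversion
  and multiplication by \<open>p\<close> both preserve being no power of \<open>p\<close>, so no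
  budget is spent.\<close>

lemma gen_dual:
  assumes g: "gen M a b q t" and s: "s\<^sup>2 = p"
  shows "gen M (s / a) (s / b) (1 / t) (1 / q)"
proof -
  note G = gen_dest[OF g]
  have s0: "s \<noteq> 0" using s by auto
  have gq': "gq M (1 / t) (1 / q)" by (rule gq_swap_inverse[OF G(3)])
  have 1: "ng M (1 / t) (1 / q) (p * (1 / x))" if "ng M q t x" for x
    by (rule ng_p[OF ng_swap_inverse[OF that G(3)] gq'])
  have e: "p * (1 / a\<^sup>2) = (s / a)\<^sup>2" "p * (1 / b\<^sup>2) = (s / b)\<^sup>2" "p * (1 / (a * b)) = (s / a) * (s / b)"
    "1 / (a / b) = (s / a) / (s / b)"
    using s[symmetric] s0 by (simp_all add: power2_eq_square field_simps)
  show ?thesis unfolding gen_def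
    using 1[OF G(4), unfolded e] 1[OF G(5), unfolded e] 1[OF G(6), unfolded e]
      ng_swap_inverse[OF G(8,3), unfolded e] gq' G(1,2) s0 by simp
qed

text \<open>The product side in the variables \<open>z = s / y\<close>, where \<open>s\<close> is a
  square root of \<open>p\<close>; written this way both lists play the same role.\<close>

definition cauchy_kernel :: "complex \<Rightarrow> complex list \<Rightarrow> complex list \<Rightarrow> complex"
  where "cauchy_kernel s xs zs = (\<Prod>x\<leftarrow>xs. \<Prod>z\<leftarrow>zs. th (s * x / z) * th (s / (x * z)))"

lemma cauchy_factor_left: "z \<noteq> 0 \<Longrightarrow> th (s * x / z) * th (s / (x * z)) = kern (s / z) x"
  by (simp add: kern_def mult_ac)

text \<open>The reflection \<open>th (p / x) = th x\<close> turns \<open>s * x / z\<close> into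
  \<open>s * z / x\<close> because \<open>s^2 = p\<close>. This symmetry is where the square root of
  \<open>p\<close> in the theorem comes from.\<close>

lemma cauchy_factor_right:
  assumes "s\<^sup>2 = p" "x \<noteq> 0" "z \<noteq> 0"
  shows "th (s * x / z) * th (s / (x * z)) = kern (s / x) z"
proof -
  have "s \<noteq> 0" using assms by auto
  hence "p / (s * x / z) = s / x * z" using assms by (simp add: power2_eq_square field_simps)
  hence "th (s * x / z) = th (s / x * z)" using th_reflect[of "s * x / z"] assms \<open>s \<noteq> 0\<close> by simp
  thus ?thesis by (simp add: kern_def)
qed

lemma cauchy_kernel_commute: "cauchy_kernel s xs (z # zs) = (\<Prod>x\<leftarrow>xs. th (s * x / z) * th (s / (x * z))) * cauchy_kernel s xs zs"
  by (induction xs) (auto simp: cauchy_kernel_def mult_ac)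

lemma cauchy_kernel_left:
  assumes "s \<noteq> 0" "0 \<notin> set zs"
  shows "cauchy_kernel s xs zs = KK xs (map (\<lambda>z. s / z) zs)"
proof -
  have "cauchy_kernel s xs [] = 1" by (induction xs) (auto simp: cauchy_kernel_def)
  thus ?thesis using assms
    by (induction zs) (auto simp: cauchy_kernel_commute KK_Cons_right cauchy_factor_left)
qed

lemma cauchy_kernel_right:
  assumes "s\<^sup>2 = p" "0 \<notin> set xs" "0 \<notin> set zs"
  shows "cauchy_kernel s xs zs = KK zs (map (\<lambda>x. s / x) xs)"
proof -
  have "(\<Prod>z\<leftarrow>zs. th (s * x / z) * th (s / (x * z))) = (\<Prod>z\<leftarrow>zs. kern (s / x) z)" if "x \<noteq> 0" for x
    by (intro arg_cong[of _ _ prod_list] map_cong refl cauchy_factor_right[OF assms(1) that])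
       (use assms(3) in auto)
  thus ?thesis using assms(2)
    by (induction xs) (auto simp: KK_Cons_right cauchy_kernel_def)
qed

text \<open>Negating \<open>w\<close> gives a path from the same origin and of the same length as
  \<open>v\<close> that takes one more \<open>False\<close> step, so the two paths cross. At the
  crossing \<open>v\<close> records a point \<open>x\<close> and \<open>w\<close> records
  \<open>s / x\<close>, and the factor of this pair contains \<open>th 1\<close>.\<close>

lemma cauchy_kernel_grids:
  assumes s: "s \<noteq> 0" "b \<noteq> 0" "q \<noteq> 0" "t \<noteq> 0" and v: "v \<in> words m (Suc n)" and w: "w \<in> words n (Suc m)"
  shows "cauchy_kernel s (pts b q t v) (pts (s / b) (1 / t) (1 / q) w) = 0"
proof -
  have *: "nC (map Not u) = nR u" "nR (map Not u) = nC u" for u by (induction u) auto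
  have "length v = length (map Not w)" "nC v < nC (map Not w)"
    using v w * length_word[of v] length_word[of w] by (auto simp: words_def)
  then obtain v1 v2 w1 w2 where vw: "v = v1 @ True # v2" "map Not w = w1 @ False # w2" "nC v1 = nC w1" "nR v1 = nR w1"
    using paths_cross by blast
  have "w = map Not (map Not w)" by (rule map_Not_Not[symmetric])
  also have "\<dots> = map Not w1 @ True # map Not w2" unfolding vw(2) by simp
  finally have w': "w = map Not w1 @ True # map Not w2" .
  define x where "x = b * q ^ nC v1 * t ^ nR v1"
  have x: "x \<in> set (pts b q t v)" unfolding vw(1) pts_append x_def by simp
  have "s / b * (1 / t) ^ nR w1 * (1 / q) ^ nC w1 = s / x"
    using s by (simp add: x_def vw power_one_over field_simps)
  hence z: "s / x \<in> set (pts (s / b) (1 / t) (1 / q) w)" unfolding w' pts_append * by simp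
  have "x \<noteq> 0" using s by (simp add: x_def)
  hence e: "th (s * x / (s / x)) * th (s / (x * (s / x))) = 0" using s by simp
  have e2: "(\<Prod>z\<leftarrow>pts (s / b) (1 / t) (1 / q) w. th (s * x / z) * th (s / (x * z))) = 0"
    unfolding prod_list_zero_iff set_map by (rule image_eqI[of _ _ "s / x"]) (use e z in auto)
  show ?thesis unfolding cauchy_kernel_def prod_list_zero_iff[of "map _ (pts b q t v)"] set_map
  proof (rule image_eqI)
    show "x \<in> set (pts b q t v)" by fact
  qed (rule e2[symmetric])
qed

lemma W_cauchy_left: "s \<noteq> 0 \<Longrightarrow> 0 \<notin> set zs \<Longrightarrow> W n (length zs) (\<lambda>xs. cauchy_kernel s xs zs)"
  using W_KK[of "map (\<lambda>z. s / z) zs" n] by (auto simp: cauchy_kernel_left image_iff)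

text \<open>The difference \<open>R\<close> lies in the symmetric class in either list. With an
  \<open>x\<close> equal to \<open>a\<close>, or a \<open>z\<close> equal to \<open>s / a\<close>,
  it vanishes by induction: one block of summands dies, and in the other the factors split off by
  the recursion are those split off by the kernel. On the product of the grids at \<open>b\<close>
  and \<open>s / b\<close> the kernel vanishes by crossing, and each summand vanishes because
  exactly one of the two paths starts with \<open>True\<close>.\<close>

theorem cauchy_identity:
  assumes "gen M a b q t" "2 * (m + n) \<le> M" and s: "s\<^sup>2 = p"
    and "length xs = n" "0 \<notin> set xs" "length zs = m" "0 \<notin> set zs"
  shows "cauchy_kernel s xs zs =
    (\<Sum>w\<in>words m n. P a b q t w xs * P (s / a) (s / b) (1 / t) (1 / q) (map Not w) zs)"
  using assms(1,2,4-)
proof (induction "m + n" arbitrary: m n a M xs zs rule: less_induct)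
  case less
  note G = gen_dest[OF less.prems(1)]
  note gd = gen_dual[OF less.prems(1) s]
  note Gd = gen_dest[OF gd]
  have s0: "s \<noteq> 0" using s by auto
  consider "m = 0" | "n = 0" | m' n' where "m = Suc m'" "n = Suc n'" by (metis not0_implies_Suc)
  thus ?case
  proof cases
    case 1
    have nr: "nR (replicate n True) = n" "nC (replicate n True) = 0"
      "nC (replicate n False) = n" "nR (replicate n False) = 0" by (induction n) auto
    have "P a b q t (replicate n True) xs = 1"
      by (rule IntN_degree_0[OF P_IntN[OF less.prems(1)]]) (use less.prems G nr in auto)
    moreover have "P (s / a) (s / b) (1 / t) (1 / q) (replicate n False) [] = 1"
      by (rule IntN_no_variables[OF P_IntN[OF gd]]) (use less.prems nr in auto)
    moreover have "zs = []" using less.prems 1 by simp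
    moreover have "cauchy_kernel s xs [] = 1" by (induction xs) (auto simp: cauchy_kernel_def)
    ultimately show ?thesis by (simp add: 1 words_0_left)
  next
    case 2
    have nr: "nR (replicate m True) = m" "nC (replicate m True) = 0"
      "nC (replicate m False) = m" "nR (replicate m False) = 0" by (induction m) auto
    have "P (s / a) (s / b) (1 / t) (1 / q) (replicate m True) zs = 1"
      by (rule IntN_degree_0[OF P_IntN[OF gd]]) (use less.prems Gd nr in auto)
    moreover have "P a b q t (replicate m False) [] = 1"
      by (rule IntN_no_variables[OF P_IntN[OF less.prems(1)]]) (use less.prems nr in auto)
    moreover have "xs = []" using less.prems 2 by simp
    ultimately show ?thesis by (simp add: 2 words_0_right cauchy_kernel_def)
  next
    case 3
    have M2: "M - 2 + 2 = M" "2 * (m + n') \<le> M - 2" "2 * (m' + n) \<le> M - 2" using less.prems(2) 3 by auto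
    let ?P = "P a b q t" and ?Q = "\<lambda>w. P (s / a) (s / b) (1 / t) (1 / q) (map Not w)"
    define R where "R xs zs = cauchy_kernel s xs zs - (\<Sum>w\<in>words m n. ?P w xs * ?Q w zs)" for xs zs
    have split: "(\<Sum>w\<in>words m n. F w) = (\<Sum>w\<in>words m n'. F (True # w)) + (\<Sum>w\<in>words m' n. F (False # w))"
      for F :: "bool list \<Rightarrow> complex"
      unfolding 3 by (rule sum_words_Suc_Suc)
    have lw: "2 * length w \<le> M" if "w \<in> words m n" for w
      using that less.prems(2) by (auto simp: words_def length_word)
    have W1: "W n m (\<lambda>xs. R xs zs)" if zs: "length zs = m" "0 \<notin> set zs" for zs
    proof -
      have "W n m (\<lambda>xs. \<Sum>w\<in>words m n. ?Q w zs * ?P w xs)"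
      proof (intro W_sum W_cmult)
        fix w assume w: "w \<in> words m n"
        show "W n m (?P w)" using IntN_W[OF P_IntN[OF less.prems(1) lw[OF w]]] G w by (auto simp: words_def)
      qed
      hence "W n m (\<lambda>xs. cauchy_kernel s xs zs - (\<Sum>w\<in>words m n. ?Q w zs * ?P w xs))"
        using W_cauchy_left[OF s0 zs(2), of n] zs(1) by (intro W_diff) auto
      thus ?thesis unfolding R_def by (simp only: mult.commute)
    qed
    have W2: "W m n (\<lambda>zs. R xs zs)" if xs: "length xs = n" "0 \<notin> set xs" for xs
    proof -
      have "W m n (\<lambda>zs. \<Sum>w\<in>words m n. ?P w xs * ?Q w zs)"
      proof (intro W_sum W_cmult)
        fix w assume w: "w \<in> words m n"
        have "map Not w \<in> words n m" using w by simp
        thus "W m n (?Q w)" using IntN_W[OF P_IntN[OF gd], of "map Not w"] lw[OF w] Gd unfolding words_def by auto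
      qed
      moreover have "W m n (\<lambda>zs. cauchy_kernel s xs zs)"
      proof (rule W_cong)
        have "0 \<notin> set (map (\<lambda>x. s / x) xs)" using xs(2) s0 by auto
        from W_KK[OF this, of m] show "W m n (\<lambda>zs. KK zs (map (\<lambda>x. s / x) xs))" using xs(1) by simp
      qed (rule cauchy_kernel_right[OF s xs(2)])
      ultimately show ?thesis unfolding R_def by (intro W_diff)
    qed
    have Ra: "R (a # xs) zs = 0" if xs: "length xs = n'" "0 \<notin> set xs" and zs: "length zs = m" "0 \<notin> set zs" for xs zs
    proof -
      have ga: "gen (M - 2) (a * t) b q t" using gen_shift_t[of "M - 2" a b q t] less.prems(1) M2 by simp
      have 1: "?P (True # w) (a # xs) * ?Q (True # w) zs =
          (\<Prod>z\<leftarrow>zs. kern (s / a) z) * (P (a * t) b q t w xs * P (s / (a * t)) (s / b) (1 / t) (1 / q) (map Not w) zs)"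
        if w: "w \<in> words m n'" for w
      proof -
        have "map Not w \<in> words n' m" using w by simp
        hence "nR (map Not w) = m" unfolding words_def by blast
        moreover have "2 * Suc (length w) \<le> M" using w less.prems(2) 3 by (auto simp: words_def length_word)
        moreover have "s / a * (1 / t) = s / (a * t)" by simp
        ultimately show ?thesis
          using P_True_Cons[OF less.prems(1), of w xs] P_False_Cons[OF gd, of "map Not w" zs] w xs zs
          by (simp add: words_def)
      qed
      have 2: "?P (False # w) (a # xs) * ?Q (False # w) zs = 0" if w: "w \<in> words m' n" for w
      proof -
        have "?P (False # w) (a # xs) = (\<Prod>x\<leftarrow>a # xs. kern a x) * P (a * q) b q t w (a # xs)"
          by (rule P_False_Cons[OF less.prems(1)])
             (use w xs G(1) less.prems(2) 3 in \<open>auto simp: words_def length_word\<close>)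
        thus ?thesis using G(1) by simp
      qed
      have "(\<Sum>w\<in>words m n. ?P w (a # xs) * ?Q w zs) = (\<Prod>z\<leftarrow>zs. kern (s / a) z) *
          (\<Sum>w\<in>words m n'. P (a * t) b q t w xs * P (s / (a * t)) (s / b) (1 / t) (1 / q) (map Not w) zs)"
        unfolding split sum_distrib_left
        using sum.cong[OF refl 1, of "words m n'"] sum.neutral[of "words m' n", OF ballI[OF 2]] by simp
      also have "\<dots> = (\<Prod>z\<leftarrow>zs. kern (s / a) z) * cauchy_kernel s xs zs"
        using less.hyps[OF _ ga M2(2) xs zs] 3 by simp
      also have "(\<Prod>z\<leftarrow>zs. kern (s / a) z) = (\<Prod>z\<leftarrow>zs. th (s * a / z) * th (s / (a * z)))"
        using zs G by (intro arg_cong[of _ _ prod_list] map_cong refl cauchy_factor_right[OF s, symmetric]) auto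
      finally show ?thesis by (simp add: R_def cauchy_kernel_def)
    qed
    have Rb: "R xs (s / a # zs) = 0" if xs: "length xs = n" "0 \<notin> set xs" and zs: "length zs = m'" "0 \<notin> set zs" for xs zs
    proof -
      have ga: "gen (M - 2) (a * q) b q t" using gen_shift_q[of "M - 2" a b q t] less.prems(1) M2 by simp
      have 1: "?P (False # w) xs * ?Q (False # w) (s / a # zs) =
          (\<Prod>x\<leftarrow>xs. kern a x) * (P (a * q) b q t w xs * P (s / (a * q)) (s / b) (1 / t) (1 / q) (map Not w) zs)"
        if w: "w \<in> words m' n" for w
      proof -
        have "map Not w \<in> words n m'" using w by simp
        hence "nR (map Not w) = m'" unfolding words_def by blast
        moreover have "2 * Suc (length w) \<le> M" using w less.prems(2) 3 by (auto simp: words_def length_word)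
        moreover have "s / a * (1 / q) = s / (a * q)" by simp
        ultimately show ?thesis
          using P_False_Cons[OF less.prems(1), of w xs] P_True_Cons[OF gd, of "map Not w" zs] w xs zs
          by (simp add: words_def)
      qed
      have 2: "?P (True # w) xs * ?Q (True # w) (s / a # zs) = 0" if w: "w \<in> words m n'" for w
      proof -
        have "map Not w \<in> words n' m" using w by simp
        hence "nR (map Not w) = m" unfolding words_def by blast
        hence "P (s / a) (s / b) (1 / t) (1 / q) (False # map Not w) (s / a # zs) =
            (\<Prod>z\<leftarrow>s / a # zs. kern (s / a) z) * P (s / a * (1 / t)) (s / b) (1 / t) (1 / q) (map Not w) (s / a # zs)"
          by (intro P_False_Cons[OF gd])
             (use w zs G(1) s0 less.prems(2) 3 length_word[of w] in \<open>auto simp: words_def\<close>)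
        thus ?thesis using G(1) s0 by simp
      qed
      have "(\<Sum>w\<in>words m n. ?P w xs * ?Q w (s / a # zs)) = (\<Prod>x\<leftarrow>xs. kern a x) *
          (\<Sum>w\<in>words m' n. P (a * q) b q t w xs * P (s / (a * q)) (s / b) (1 / t) (1 / q) (map Not w) zs)"
        unfolding split sum_distrib_left
        using sum.cong[OF refl 1, of "words m' n"] sum.neutral[of "words m n'", OF ballI[OF 2]] by simp
      also have "\<dots> = (\<Prod>x\<leftarrow>xs. kern a x) * cauchy_kernel s xs zs"
        using less.hyps[OF _ ga M2(3) xs zs] 3 by simp
      also have "(\<Prod>x\<leftarrow>xs. kern a x) = (\<Prod>x\<leftarrow>xs. th (s * x / (s / a)) * th (s / (x * (s / a))))"
        using s0 G cauchy_factor_left[of "s / a" s] by (intro arg_cong[of _ _ prod_list] map_cong) auto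
      finally show ?thesis by (simp add: R_def cauchy_kernel_commute)
    qed
    have RR: "R (pts b q t v) (pts (s / b) (1 / t) (1 / q) u) = 0"
      if v: "v \<in> words m' (Suc n')" and u: "u \<in> words n' (Suc m')" for u v
    proof -
      have 0: "?P w (pts b q t v) * ?Q w (pts (s / b) (1 / t) (1 / q) u) = 0" if w: "w \<in> words m n" for w
      proof -
        from w 3 consider w' where "w = True # w'" "w' \<in> words m n'" | w' where "w = False # w'" "w' \<in> words m' n"
          by (auto simp: words_Suc_Suc)
        thus ?thesis
        proof cases
          case (1 w')
          have "?P w (pts b q t v) = 0"
            using P_IntN[OF less.prems(1) lw[OF w]] 1 v 3 by (auto simp: words_def)
          thus ?thesis by simp
        next
          case (2 w')
          have "map Not w' \<in> words n m'" using 2 by simp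
          hence "nR (map Not w') = m'" "nC (map Not w') = n" unfolding words_def by blast+
          hence "?Q w (pts (s / b) (1 / t) (1 / q) u) = 0"
            using P_IntN[OF gd, of "map Not w"] lw[OF w] 2(1) u 3 by auto
          thus ?thesis by simp
        qed
      qed
      have "(\<Sum>w\<in>words m n. ?P w (pts b q t v) * ?Q w (pts (s / b) (1 / t) (1 / q) u)) = 0"
        by (intro sum.neutral ballI 0)
      moreover have "cauchy_kernel s (pts b q t v) (pts (s / b) (1 / t) (1 / q) u) = 0"
        using cauchy_kernel_grids[OF s0 _ _ _ v u] G by auto
      ultimately show ?thesis by (simp add: R_def)
    qed
    \<comment> \<open>The two-grid lemma is used twice: in \<open>x\<close>, with \<open>z\<close>
      on its grid at \<open>s / b\<close>, from \<open>Ra\<close> and \<open>RR\<close>; then in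
      \<open>z\<close>, for arbitrary \<open>x\<close>, from \<open>Rb\<close> and
      \<open>R1\<close>.\<close>
    have R1: "R xs (pts (s / b) (1 / t) (1 / q) u) = 0"
      if u: "u \<in> words n' (Suc m')" and xs: "length xs = n" "0 \<notin> set xs" for u xs
    proof -
      have l: "length (pts (s / b) (1 / t) (1 / q) u) = m" "0 \<notin> set (pts (s / b) (1 / t) (1 / q) u)"
        using u 3 pts_nonzero[of "s / b" "1 / t" "1 / q" u] Gd by (auto simp: words_def)
      show ?thesis
        by (rule W_two_grids_zero[OF less.prems(1) _ _ Ra[OF _ _ l] RR[OF _ u], where m = m])
           (use less.prems(2) W1[OF l] 3 xs in auto)
    qed
    have "R xs zs = 0"
      by (rule W_two_grids_zero[OF gd _ _ Rb R1, where m = n and n = m'])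
         (use less.prems W2 3 in auto)
    thus ?thesis by (simp add: R_def)
  qed
qed

end

section \<open>The difference operator\<close>

lemma prod_list_mult:
  fixes f g :: "'a \<Rightarrow> 'b :: comm_monoid_mult"
  shows "(\<Prod>x\<leftarrow>xs. f x * g x) = (\<Prod>x\<leftarrow>xs. f x) * (\<Prod>x\<leftarrow>xs. g x)"
  by (induction xs) (auto simp: mult_ac)

section \<open>Sums over the choices between an entry and its inverse\<close>

fun sgs :: "complex list \<Rightarrow> complex list list" where
  "sgs [] = [[]]"
| "sgs (x # xs) = map ((#) x) (sgs xs) @ map ((#) (1 / x)) (sgs xs)"

abbreviation eqinv :: "complex \<Rightarrow> complex \<Rightarrow> bool" where "eqinv u v \<equiv> u = v \<or> u = 1 / v"

lemma sgs_eqinv: "ys \<in> set (sgs xs) \<Longrightarrow> list_all2 eqinv ys xs"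
  by (induction xs arbitrary: ys) auto

lemma sgs_length: "ys \<in> set (sgs xs) \<Longrightarrow> length ys = length xs"
  using sgs_eqinv list_all2_lengthD by blast

lemma eqinv_elem: "list_all2 eqinv ys xs \<Longrightarrow> y \<in> set ys \<Longrightarrow> \<exists>x\<in>set xs. eqinv y x"
  by (induction rule: list_all2_induct) auto

lemma sgs_elem: "ys \<in> set (sgs xs) \<Longrightarrow> y \<in> set ys \<Longrightarrow> \<exists>x\<in>set xs. eqinv y x"
  by (rule eqinv_elem[OF sgs_eqinv])

lemma sgs_nonzero: "ys \<in> set (sgs xs) \<Longrightarrow> 0 \<notin> set xs \<Longrightarrow> 0 \<notin> set ys"
  using sgs_elem[of ys xs 0] by auto

definition sgsum :: "(complex list \<Rightarrow> complex) \<Rightarrow> complex list \<Rightarrow> complex"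
  where "sgsum G xs = (\<Sum>ys\<leftarrow>sgs xs. G ys)"

lemma sgsum_Nil [simp]: "sgsum G [] = G []"
  by (simp add: sgsum_def)

lemma sgsum_Cons: "sgsum G (x # xs) = sgsum (\<lambda>ys. G (x # ys)) xs + sgsum (\<lambda>ys. G (1 / x # ys)) xs"
  by (simp add: sgsum_def o_def)

lemma sgsum_cong: "(\<And>ys. ys \<in> set (sgs xs) \<Longrightarrow> G ys = H ys) \<Longrightarrow> sgsum G xs = sgsum H xs"
  unfolding sgsum_def by (intro arg_cong[of _ _ sum_list] map_cong) auto

lemma sgsum_cmult: "sgsum (\<lambda>ys. c * G ys) xs = c * sgsum G xs"
  unfolding sgsum_def by (rule sum_list_const_mult)

lemma sgsum_move:
  assumes "\<And>ys zs. length ys = length (us @ x # vs) \<Longrightarrow> 0 \<notin> set ys \<Longrightarrow> mset zs = mset ys \<Longrightarrow> G zs = G ys"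
    and "0 \<notin> set (us @ x # vs)"
  shows "sgsum G (us @ x # vs) = sgsum G (x # us @ vs)"
  using assms
proof (induction us arbitrary: G)
  case (Cons u us)
  have 1: "sgsum (\<lambda>ys. G (u' # ys)) (us @ x # vs) = sgsum (\<lambda>ys. G (u' # ys)) (x # us @ vs)" if "u' \<noteq> 0" for u'
    using Cons.prems that by (intro Cons.IH) auto
  have 2: "sgsum (\<lambda>ys. G (u' # x' # ys)) (us @ vs) = sgsum (\<lambda>ys. G (x' # u' # ys)) (us @ vs)"
    if "u' \<noteq> 0" "x' \<noteq> 0" for u' x'
  proof (rule sgsum_cong)
    fix ys assume "ys \<in> set (sgs (us @ vs))"
    thus "G (u' # x' # ys) = G (x' # u' # ys)"
      using Cons.prems that sgs_length[of ys "us @ vs"] sgs_nonzero[of ys "us @ vs"] by (intro Cons.prems(1)) auto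
  qed
  have "u \<noteq> 0" "x \<noteq> 0" using Cons.prems by auto
  thus ?case using 1[of u] 1[of "1 / u"] 2[of u x] 2[of u "1 / x"] 2[of "1 / u" x] 2[of "1 / u" "1 / x"]
    by (simp add: sgsum_Cons)
qed auto

lemma sgsum_mset:
  assumes "\<And>ys zs. length ys = length xs \<Longrightarrow> 0 \<notin> set ys \<Longrightarrow> mset zs = mset ys \<Longrightarrow> G zs = G ys"
    and "0 \<notin> set xs" "mset xs' = mset xs"
  shows "sgsum G xs' = sgsum G xs"
  using assms
proof (induction xs arbitrary: G xs')
  case (Cons x xs)
  have "x \<in> set xs'" using Cons.prems(3) by (metis list.set_intros(1) mset_eq_setD)
  then obtain us vs where xs': "xs' = us @ x # vs" by (meson split_list)
  hence m: "mset (us @ vs) = mset xs" using Cons.prems(3) by simp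
  hence ln: "length (us @ vs) = length xs" "set (us @ vs) = set xs" by (metis size_mset, metis mset_eq_setD)
  have "sgsum G xs' = sgsum G (x # us @ vs)"
    unfolding xs' by (rule sgsum_move, rule Cons.prems(1)) (use ln Cons.prems(2) in auto)
  also have "\<dots> = sgsum G (x # xs)" unfolding sgsum_Cons
    using Cons.prems by (intro arg_cong2[of _ _ _ _ "(+)"] Cons.IH m) auto
  finally show ?case .
qed auto

fun strg :: "complex \<Rightarrow> complex \<Rightarrow> nat \<Rightarrow> complex list" where
  "strg v t 0 = []"
| "strg v t (Suc n) = v # strg (v * t) t n"

lemma length_strg [simp]: "length (strg v t n) = n"
  by (induction n arbitrary: v) auto

text \<open>Grid points from an arbitrary list of exponents. The sign choices of the operator alter
  exponents one by one, which words would not express directly.\<close>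

fun apt :: "complex \<Rightarrow> complex \<Rightarrow> complex \<Rightarrow> nat list \<Rightarrow> complex list" where
  "apt b q t [] = []"
| "apt b q t (k # ks) = b * q ^ k # apt (b * t) q t ks"

lemma apt_map_Suc: "apt b q t (map Suc ks) = apt (b * q) q t ks"
  by (induction ks arbitrary: b) (auto simp: mult_ac)

text \<open>The parts of the partition in ascending order, from the last row upwards and including
  zero parts.\<close>

fun exps :: "bool list \<Rightarrow> nat list" where
  "exps [] = []"
| "exps (True # w) = 0 # exps w"
| "exps (False # w) = map Suc (exps w)"

lemma length_exps [simp]: "length (exps w) = nR w"
  by (induction w rule: exps.induct) auto

lemma exps_le: "k \<in> set (exps w) \<Longrightarrow> k \<le> nC w"
  by (induction w arbitrary: k rule: exps.induct) auto

lemma sorted_exps: "sorted (exps w)"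
  by (induction w rule: exps.induct) (auto simp: sorted_map intro: sorted_wrt_mono_rel[rotated])

lemma pts_eq_apt: "pts b q t w = apt b q t (exps w)"
  by (induction w arbitrary: b rule: exps.induct) (auto simp: apt_map_Suc)

lemma exps_surj:
  assumes "sorted ks" "\<And>k. k \<in> set ks \<Longrightarrow> k \<le> M"
  shows "\<exists>w\<in>words M (length ks). exps w = ks"
  using assms
proof (induction "M + length ks" arbitrary: M ks rule: less_induct)
  case less
  show ?case
  proof (cases ks)
    case Nil
    have "exps (replicate M False) = []" by (induction M) auto
    thus ?thesis using Nil by (auto simp: words_0_right)
  next
    case (Cons k ks')
    show ?thesis
    proof (cases "k = 0")
      case True
      obtain w where "w \<in> words M (length ks')" "exps w = ks'"
        using less.hyps[of M ks'] less.prems Cons by auto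
      thus ?thesis using Cons True by (intro bexI[of _ "True # w"]) auto
    next
      case False
      hence pos: "k > 0" if "k \<in> set ks" for k using less.prems(1) Cons that by fastforce
      define ls where "ls = map (\<lambda>k. k - 1) ks"
      have ks: "ks = map Suc ls" using pos by (auto simp: ls_def intro: map_idI[symmetric])
      obtain M' where M: "M = Suc M'" using less.prems(2)[of k] False Cons by (cases M) auto
      obtain w where "w \<in> words M' (length ls)" "exps w = ls"
        using less.hyps[of M' ls] less.prems M ks by (auto simp: sorted_map)
      thus ?thesis using ks M by (intro bexI[of _ "False # w"]) auto
    qed
  qed
qed

section \<open>The operator on recursion steps, progressions and grids\<close>

context nome
begin

text \<open>The single-variable factor of a difference operator of type \<open>BC\<close> with four
  free parameters; \<open>Bc\<close> is the factor that couples two variables.\<close>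

definition Ac :: "complex \<Rightarrow> complex \<Rightarrow> complex \<Rightarrow> complex \<Rightarrow> complex \<Rightarrow> complex"
  where "Ac a b c d y = th (a * y) * th (b * y) * th (c * y) * th (d * y) / th (y\<^sup>2)"

definition Bc :: "complex \<Rightarrow> complex \<Rightarrow> complex"
  where "Bc t z = th (t * z) / th z"

fun Bprod :: "complex \<Rightarrow> complex list \<Rightarrow> complex" where
  "Bprod t [] = 1"
| "Bprod t (y # ys) = (\<Prod>y'\<leftarrow>ys. Bc t (y * y')) * Bprod t ys"

definition coef :: "complex \<Rightarrow> complex \<Rightarrow> complex \<Rightarrow> complex \<Rightarrow> complex \<Rightarrow> complex list \<Rightarrow> complex"
  where "coef a b c d t ys = (\<Prod>y\<leftarrow>ys. Ac a b c d y) * Bprod t ys"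

text \<open>A sum over all choices of \<open>y \<in> {x, 1 / x}\<close> in each variable; with \<open>q = r\<^sup>2\<close> it shifts by a square root of \<open>q\<close>.\<close>

definition D :: "complex \<Rightarrow> complex \<Rightarrow> complex \<Rightarrow> complex \<Rightarrow> complex \<Rightarrow> complex \<Rightarrow>
    (complex list \<Rightarrow> complex) \<Rightarrow> complex list \<Rightarrow> complex"
  where "D a b c d t r f = sgsum (\<lambda>ys. coef a b c d t ys * f (map ((*) r) ys))"

lemma coef_Cons: "coef a b c d t (y # ys) = Ac a b c d y * (\<Prod>y'\<leftarrow>ys. Bc t (y * y')) * coef a b c d t ys"
  by (simp add: coef_def mult_ac)

lemma coef_Nil [simp]: "coef a b c d t [] = 1"
  by (simp add: coef_def)

lemma Bprod_move: "Bprod t (us @ y # vs) = Bprod t (y # us @ vs)"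
  by (induction us) (auto simp: mult_ac)

lemma Bprod_mset: "mset ys = mset zs \<Longrightarrow> Bprod t ys = Bprod t zs"
proof (induction ys arbitrary: zs)
  case (Cons y ys)
  have "y \<in> set zs" using Cons.prems by (metis list.set_intros(1) mset_eq_setD)
  then obtain us vs where zs: "zs = us @ y # vs" by (meson split_list)
  hence m: "mset ys = mset (us @ vs)" using Cons.prems by simp
  show ?case unfolding zs Bprod_move by (simp only: Bprod.simps Cons.IH[OF m] prod_list_map_mset[OF m])
qed auto

lemma coef_mset:
  assumes m: "mset ys = mset zs"
  shows "coef a b c d t ys = coef a b c d t zs"
  unfolding coef_def by (simp only: Bprod_mset[OF m] prod_list_map_mset[OF m])

lemma D_swap_ac: "D a b c d t r f = D c b a d t r f"
proof -
  have "Ac a b c d = Ac c b a d" by (auto simp: Ac_def mult_ac)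
  thus ?thesis unfolding D_def coef_def by simp
qed

lemma W_eqinv:
  assumes "W n m f" "list_all2 eqinv us vs" "length us = n" "0 \<notin> set vs"
  shows "f us = f vs"
  using assms
proof (induction n arbitrary: us vs f)
  case (Suc n)
  obtain u us' v vs' where e: "us = u # us'" "vs = v # vs'" "eqinv u v" "list_all2 eqinv us' vs'" "length us' = n"
    using Suc.prems(2,3) by (cases us; cases vs) auto
  have "\<forall>u\<in>set us'. u \<noteq> 0" using e(4) Suc.prems(4) unfolding e(2) by (induction rule: list_all2_induct) auto
  hence us0: "0 \<notin> set us'" by auto
  have v: "v \<noteq> 0" "0 \<notin> set vs'" using Suc.prems(4) e(2) by auto
  have "f (u # us') = f (v # us')"
    using e(3) V_inverse[OF W_head[OF Suc.prems(1)], of us' v] e(5) us0 v by auto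
  also have "\<dots> = f (v # vs')" by (rule Suc.IH[OF W_restrict[OF Suc.prems(1) v(1)] e(4,5) v(2)])
  finally show ?case by (simp add: e)
qed auto

text \<open>\<open>Bc t (a * y)\<close> is also the coupling between an entry \<open>a\<close> and
  \<open>y\<close>, so an entry fixed at \<open>a\<close> acts on the others like the parameter
  shift from \<open>a\<close> to \<open>a * t\<close>.\<close>

lemma coef_shift:
  assumes "\<And>y. y \<in> set ys \<Longrightarrow> th (a * y) \<noteq> 0"
  shows "coef (a * t) b c d t ys = (\<Prod>y\<leftarrow>ys. Bc t (a * y)) * coef a b c d t ys"
proof -
  have "Ac (a * t) b c d y = Bc t (a * y) * Ac a b c d y" if "y \<in> set ys" for y
    using assms[OF that] by (simp add: Ac_def Bc_def mult_ac)
  hence "(\<Prod>y\<leftarrow>ys. Ac (a * t) b c d y) = (\<Prod>y\<leftarrow>ys. Bc t (a * y) * Ac a b c d y)"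
    by (intro arg_cong[of _ _ prod_list] map_cong) auto
  thus ?thesis by (simp add: coef_def prod_list_mult mult_ac)
qed

text \<open>The choice \<open>1 / a\<close> for the first entry contributes \<open>th 1 = 0\<close>;
  the couplings of the surviving choice \<open>a\<close> are absorbed in the shift of the parameter
  by \<open>t\<close>.\<close>

lemma D_head:
  assumes "a \<noteq> 0" "th (a\<^sup>2) \<noteq> 0" "\<And>x. x \<in> set xs \<Longrightarrow> kern a x \<noteq> 0"
  shows "D a b c d t r f (a # xs) = th (a * b) * th (a * c) * th (a * d) * D (a * t) b c d t r (\<lambda>xs. f (r * a # xs)) xs"
proof -
  have A: "Ac a b c d a = th (a * b) * th (a * c) * th (a * d)"
    using assms(2) by (simp add: Ac_def power2_eq_square mult_ac)
  have A': "Ac a b c d (1 / a) = 0" using assms(1) by (simp add: Ac_def)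
  have nz: "th (a * y) \<noteq> 0" if "ys \<in> set (sgs xs)" "y \<in> set ys" for ys y
    using sgs_elem[OF that] assms(3) by (auto simp: kern_def)
  have "sgsum (\<lambda>ys. coef a b c d t (a # ys) * f (map ((*) r) (a # ys))) xs =
      sgsum (\<lambda>ys. th (a * b) * th (a * c) * th (a * d) * (coef (a * t) b c d t ys * f (r * a # map ((*) r) ys))) xs"
    by (rule sgsum_cong) (use nz in \<open>simp add: coef_Cons A coef_shift mult_ac\<close>)
  thus ?thesis by (simp add: D_def sgsum_Cons sgsum_cmult coef_Cons A' sgsum_def[of "\<lambda>_. 0"])
qed

text \<open>In \<open>kern (r * a) (r * y)\<close> the factor \<open>th (a * r^2 * y)\<close> trades
  places with the factor \<open>th (a * y)\<close> of the coefficient. What remains is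
  \<open>kern a y\<close>, which is the same for \<open>y\<close> and \<open>1 / y\<close> and
  leaves the sum, times a coefficient with \<open>a\<close> shifted by \<open>r^2\<close>.\<close>

lemma D_kern:
  assumes "r \<noteq> 0" "0 \<notin> set xs" and f: "\<And>ys. length ys = length xs \<Longrightarrow> 0 \<notin> set ys \<Longrightarrow> f ys = (\<Prod>y\<leftarrow>ys. kern (r * a) y) * g ys"
  shows "D a b c d t r f xs = (\<Prod>x\<leftarrow>xs. kern a x) * D (a * r\<^sup>2) b c d t r g xs"
proof -
  have "coef a b c d t ys * f (map ((*) r) ys) = (\<Prod>x\<leftarrow>xs. kern a x) * (coef (a * r\<^sup>2) b c d t ys * g (map ((*) r) ys))"
    if ys: "ys \<in> set (sgs xs)" for ys
  proof -
    have y0: "0 \<notin> set ys" using sgs_nonzero[OF ys assms(2)] .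
    have 1: "(\<Prod>x\<leftarrow>xs. kern a x) = (\<Prod>y\<leftarrow>ys. kern a y)"
      using sgs_eqinv[OF ys] by (induction rule: list_all2_induct) auto
    have "f (map ((*) r) ys) = (\<Prod>y\<leftarrow>map ((*) r) ys. kern (r * a) y) * g (map ((*) r) ys)"
      by (rule f) (use y0 assms(1) sgs_length[OF ys] in auto)
    hence 2: "f (map ((*) r) ys) = (\<Prod>y\<leftarrow>ys. kern (r * a) (r * y)) * g (map ((*) r) ys)"
      by (simp add: o_def)
    have "Ac a b c d y * kern (r * a) (r * y) = Ac (a * r\<^sup>2) b c d y * kern a y" for y
      using assms(1) by (simp add: Ac_def kern_def power2_eq_square mult_ac)
    hence "(\<Prod>y\<leftarrow>ys. Ac a b c d y * kern (r * a) (r * y)) = (\<Prod>y\<leftarrow>ys. Ac (a * r\<^sup>2) b c d y * kern a y)" by simp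
    hence "(\<Prod>y\<leftarrow>ys. Ac a b c d y) * (\<Prod>y\<leftarrow>ys. kern (r * a) (r * y)) = (\<Prod>y\<leftarrow>ys. Ac (a * r\<^sup>2) b c d y) * (\<Prod>y\<leftarrow>ys. kern a y)"
      by (simp only: prod_list_mult)
    thus ?thesis unfolding 1 2 coef_def by (simp add: mult_ac)
  qed
  thus ?thesis unfolding D_def sgsum_cmult[symmetric] by (intro sgsum_cong)
qed

text \<open>For a progression that starts at the parameter \<open>c\<close>, the reduction
  \<open>D_head\<close>, with \<open>c\<close> in the role of \<open>a\<close>, applies to every
  entry in turn, so a single choice of signs survives.\<close>

lemma D_string:
  assumes "ok (strg c t n)"
  shows "D a b c d t r f (strg c t n) = (\<Prod>i<n. th (c * t ^ i * a) * th (c * t ^ i * b) * th (c * t ^ i * d)) * f (strg (r * c) t n)"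
  using assms
proof (induction n arbitrary: c f)
  case 0 thus ?case by (simp add: D_def)
next
  case (Suc n)
  have "D a b c d t r f (strg c t (Suc n)) = D c b a d t r f (c # strg (c * t) t n)"
    by (simp add: D_swap_ac)
  also have "\<dots> = th (c * b) * th (c * a) * th (c * d) * D (c * t) b a d t r (\<lambda>xs. f (r * c # xs)) (strg (c * t) t n)"
    by (rule D_head) (use Suc.prems in auto)
  also have "D (c * t) b a d t r (\<lambda>xs. f (r * c # xs)) (strg (c * t) t n) = D a b (c * t) d t r (\<lambda>xs. f (r * c # xs)) (strg (c * t) t n)"
    by (simp add: D_swap_ac)
  also have "\<dots> = (\<Prod>i<n. th (c * t * t ^ i * a) * th (c * t * t ^ i * b) * th (c * t * t ^ i * d)) * f (r * c # strg (r * (c * t)) t n)"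
    by (rule Suc.IH) (use Suc.prems in auto)
  finally show ?case by (simp add: prod.lessThan_Suc_shift mult_ac del: prod.lessThan_Suc)
qed

text \<open>Modulo inversion, the choice \<open>y\<close> keeps the exponent after the shift by
  \<open>r\<close>, and the choice \<open>1 / y\<close> lowers it by one. Of two equal neighbouring
  exponents the second cannot be lowered alone, since the coupling would be
  \<open>th (t * (1 / t)) = 0\<close> up to a factor; so the exponents stay sorted. The bound
  \<open>k0\<close> with the sign condition on the head makes this inductive.\<close>

lemma apt_signs:
  assumes "sorted ks" "\<And>k. k \<in> set ks \<Longrightarrow> k0 \<le> k" "ys \<in> set (sgs (apt b q t ks))"
    and "\<And>k ks'. ks = k # ks' \<Longrightarrow> k = k0 \<Longrightarrow> hd ys = b * q ^ k"
    and "Bprod t ys \<noteq> 0" "b \<noteq> 0" "t \<noteq> 0" "r \<noteq> 0" "q = r\<^sup>2"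
  shows "\<exists>ks'. length ks' = length ks \<and> sorted ks' \<and> (\<forall>k\<in>set ks'. k0 \<le> k) \<and> list_all2 (\<le>) ks' ks \<and>
    list_all2 eqinv (map ((*) r) ys) (apt (r * b) q t ks')"
  using assms(1-6)
proof (induction ks arbitrary: k0 ys b)
  case (Cons k ks)
  have q0: "q \<noteq> 0" using assms(8,9) by simp
  obtain y ys' where y: "ys = y # ys'" "ys' \<in> set (sgs (apt (b * t) q t ks))" "y = b * q ^ k \<or> y = 1 / (b * q ^ k)"
    using Cons.prems(3) by auto
  have B: "Bprod t ys' \<noteq> 0" "\<And>y'. y' \<in> set ys' \<Longrightarrow> Bc t (y * y') \<noteq> 0"
    using Cons.prems(5) y(1) by (auto simp: prod_list_zero_iff)
  show ?case
  proof (cases "y = b * q ^ k")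
    case True
    have "\<exists>ks'. length ks' = length ks \<and> sorted ks' \<and> (\<forall>l\<in>set ks'. k \<le> l) \<and> list_all2 (\<le>) ks' ks \<and>
        list_all2 eqinv (map ((*) r) ys') (apt (r * (b * t)) q t ks')"
    proof (rule Cons.IH)
      fix l ls assume ls: "ks = l # ls" "l = k"
      obtain z zs where z: "ys' = z # zs" "z = b * t * q ^ k \<or> z = 1 / (b * t * q ^ k)"
        using y(2) ls by auto
      moreover have "z = 1 / (b * t * q ^ k) \<Longrightarrow> z = b * t * q ^ k"
        using B(2)[of z] True z(1) assms(7) Cons.prems(6) q0 by (simp add: Bc_def field_simps)
      ultimately show "hd ys' = b * t * q ^ l" using ls by auto
    qed (use Cons.prems y(2) B(1) assms(7) in auto)
    then obtain ks' where ks': "length ks' = length ks" "sorted ks'" "\<forall>l\<in>set ks'. k \<le> l" "list_all2 (\<le>) ks' ks"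
      "list_all2 eqinv (map ((*) r) ys') (apt (r * (b * t)) q t ks')" by blast
    show ?thesis
      by (rule exI[of _ "k # ks'"])
         (use ks' Cons.prems(2)[of k] True y(1) in \<open>auto simp: mult.assoc\<close>)
  next
    case False
    hence yk: "y = 1 / (b * q ^ k)" "k \<noteq> k0" using y Cons.prems(4) by auto
    hence k0: "k0 < k" using Cons.prems(2)[of k] by simp
    then obtain k' where k': "k = Suc k'" by (cases k) auto
    have "\<exists>ks'. length ks' = length ks \<and> sorted ks' \<and> (\<forall>l\<in>set ks'. k' \<le> l) \<and> list_all2 (\<le>) ks' ks \<and>
        list_all2 eqinv (map ((*) r) ys') (apt (r * (b * t)) q t ks')"
      by (rule Cons.IH) (use Cons.prems y(2) B(1) assms(7) k' in auto)
    then obtain ks' where ks': "length ks' = length ks" "sorted ks'" "\<forall>l\<in>set ks'. k' \<le> l" "list_all2 (\<le>) ks' ks"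
      "list_all2 eqinv (map ((*) r) ys') (apt (r * (b * t)) q t ks')" by blast
    have "r * y = 1 / (r * b * q ^ k')"
      using Cons.prems(6) assms(8) unfolding yk k' assms(9) by (simp add: power2_eq_square field_simps)
    thus ?thesis
      by (intro exI[of _ "k' # ks'"])
         (use ks' k0 k' y(1) in \<open>auto simp: mult.assoc\<close>)
  qed
qed auto

text \<open>Every nonzero term evaluates \<open>f\<close>, up to inversion of entries, at a point of
  the grid based at \<open>r * b\<close>, where \<open>f\<close> vanishes. An initial exponent 0
  cannot be lowered, as the coefficient would contain \<open>th (b * (1 / b))\<close>.\<close>

lemma D_pts_zero:
  assumes f: "W n m f" and z: "\<And>v. v \<in> words M' n \<Longrightarrow> f (pts (r * b) q t v) = 0"
    and w: "w \<in> words M' n" and nz: "b \<noteq> 0" "t \<noteq> 0" "r \<noteq> 0" "q = r\<^sup>2"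
  shows "D a b c d t r f (pts b q t w) = 0"
proof -
  have "coef a b c d t ys * f (map ((*) r) ys) = 0" if ys: "ys \<in> set (sgs (pts b q t w))" for ys
  proof (rule ccontr)
    assume "coef a b c d t ys * f (map ((*) r) ys) \<noteq> 0"
    hence c: "coef a b c d t ys \<noteq> 0" and fn: "f (map ((*) r) ys) \<noteq> 0" by auto
    have A: "Ac a b c d y \<noteq> 0" if "y \<in> set ys" for y
      using c that by (auto simp: coef_def prod_list_zero_iff)
    have "\<exists>ks'. length ks' = length (exps w) \<and> sorted ks' \<and> (\<forall>k\<in>set ks'. 0 \<le> k) \<and> list_all2 (\<le>) ks' (exps w) \<and>
      list_all2 eqinv (map ((*) r) ys) (apt (r * b) q t ks')"
    proof (rule apt_signs[OF sorted_exps _ _ _ _ nz])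
      show ys': "ys \<in> set (sgs (apt b q t (exps w)))" using ys by (simp add: pts_eq_apt)
      fix k ks' assume k: "exps w = k # ks'" "k = 0"
      obtain y zs where y: "ys = y # zs" "y = b \<or> y = 1 / b" using ys' k by auto
      have "y \<noteq> 1 / b" using A[of y] y(1) nz(1) by (auto simp: Ac_def)
      thus "hd ys = b * q ^ k" using y k by auto
    qed (use c in \<open>auto simp: coef_def\<close>)
    then obtain ks' where ks': "length ks' = nR w" "sorted ks'" "list_all2 (\<le>) ks' (exps w)"
      "list_all2 eqinv (map ((*) r) ys) (apt (r * b) q t ks')" by auto
    have "k \<le> M'" if k: "k \<in> set ks'" for k
    proof -
      obtain i where "i < length ks'" "k = ks' ! i" using k by (metis in_set_conv_nth)
      hence "k \<le> exps w ! i" "exps w ! i \<in> set (exps w)" using ks'(3) by (auto simp: list_all2_conv_all_nth)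
      thus ?thesis using exps_le[of _ w] w by (fastforce simp: words_def)
    qed
    then obtain v where v: "v \<in> words M' (nR w)" "exps v = ks'" using exps_surj[OF ks'(2)] ks'(1) by metis
    have "f (map ((*) r) ys) = f (pts (r * b) q t v)"
    proof (rule W_eqinv[OF f])
      show "list_all2 eqinv (map ((*) r) ys) (pts (r * b) q t v)" using ks'(4) v by (simp add: pts_eq_apt)
      show "length (map ((*) r) ys) = n" using sgs_length[OF ys] w by (simp add: words_def)
      show "0 \<notin> set (pts (r * b) q t v)" using nz by (intro pts_nonzero) auto
    qed
    thus False using z[of v] v(1) w fn by (auto simp: words_def)
  qed
  hence "D a b c d t r f (pts b q t w) = sgsum (\<lambda>_. 0) (pts b q t w)" unfolding D_def by (intro sgsum_cong)
  thus ?thesis by (simp add: sgsum_def)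
qed

end

lemma holomorphic_on_sum_list:
  "(\<And>i. i \<in> set L \<Longrightarrow> (\<lambda>z. F i z) holomorphic_on S) \<Longrightarrow> (\<lambda>z. \<Sum>i\<leftarrow>L. F i z) holomorphic_on S"
  by (induction L) (auto intro!: holomorphic_intros)

lemma holomorphic_on_prod_list:
  "(\<And>i. i \<in> set L \<Longrightarrow> (\<lambda>z. F i z) holomorphic_on S) \<Longrightarrow> (\<lambda>z. \<Prod>i\<leftarrow>L. F i z) holomorphic_on S"
  by (induction L) (auto intro!: holomorphic_intros)

lemma prod_list_map_cong:
  "(\<And>x. x \<in> set xs \<Longrightarrow> f x = g x) \<Longrightarrow> (\<Prod>x\<leftarrow>xs. f x) = (\<Prod>x\<leftarrow>xs. g x)"
  by (rule arg_cong[of _ _ prod_list]) simp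

lemma prod_list_const_power: "(\<Prod>x\<leftarrow>xs. c) = (c :: 'a :: comm_monoid_mult) ^ length xs"
  by (induction xs) auto

context nome
begin

lemma V_divide_list:
  assumes "V (m + length zs) f" "ok zs" "\<And>z. z \<in> set zs \<Longrightarrow> f z = 0"
  shows "\<exists>g. V m g \<and> (\<forall>u. u \<noteq> 0 \<longrightarrow> f u = (\<Prod>z\<leftarrow>zs. kern z u) * g u)"
  using assms
proof (induction zs arbitrary: f)
  case (Cons z zs)
  obtain g where g: "V (m + length zs) g" "\<And>u. u \<noteq> 0 \<Longrightarrow> f u = kern z u * g u"
    using V_divide[of "m + length zs" f z] Cons by auto
  have "g y = 0" if "y \<in> set zs" for y
    using g(2)[of y] Cons.prems that ok_nonzero[of zs y] by auto
  with Cons.IH[OF g(1)] Cons.prems(2) obtain h where "V m h" "\<And>u. u \<noteq> 0 \<Longrightarrow> g u = (\<Prod>z\<leftarrow>zs. kern z u) * h u"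
    by auto
  thus ?case using g(2) by (intro exI[of _ h]) auto
qed auto

text \<open>An even quotient by \<open>th (z\<^sup>2)\<close>: the numerator vanishes automatically at all two-torsion points.\<close>

lemma V_antisymmetric_divide:
  assumes N: "N holomorphic_on - {0}"
    and inv: "\<And>z. z \<noteq> 0 \<Longrightarrow> N (1 / z) * z ^ (2 * k + 2) = - N z"
    and per: "\<And>z. z \<noteq> 0 \<Longrightarrow> N (p * z) * (p * z ^ (2 * k + 4) * (p * z\<^sup>2) ^ m) = N z"
  shows "\<exists>h. V (m + k) h \<and> (\<forall>z. z \<noteq> 0 \<longrightarrow> N z = z ^ k * th (z\<^sup>2) * h z)"
proof -
  have Np: "N (p * z) = 0 \<longleftrightarrow> N z = 0" if "z \<noteq> 0" for z
    using per[OF that] that by auto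
  have Nk: "N (p powi l * z) = 0 \<longleftrightarrow> N z = 0" if "z \<noteq> 0" for l :: int and z
  proof (induction l rule: int_induct[where k = 0])
    case (step1 i)
    thus ?case using Np[of "p powi i * z"] that by (simp add: power_int_add mult_ac)
  next
    case (step2 i)
    thus ?case using Np[of "p powi (i - 1) * z"] that by (simp add: power_int_diff mult_ac)
  qed auto
  have zero: "N z = 0" if z: "z \<noteq> 0" "th (z\<^sup>2) = 0" for z
  proof -
    obtain j :: int where j: "z\<^sup>2 = p powi j" using z th_eq_0_iff[of "z\<^sup>2"] by auto
    \<comment> \<open>Up to a power of \<open>p\<close> only \<open>z^2 = 1\<close> and
      \<open>z^2 = p\<close> are left. There \<open>inv\<close>, alone or combined with
      \<open>per\<close>, yields \<open>N w = - N w\<close>.\<close>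
    define l where "l = j div 2"
    define w where "w = p powi (- l) * z"
    have w0: "w \<noteq> 0" using z by (simp add: w_def)
    have zw: "z = p powi l * w" by (simp add: w_def power_int_minus)
    have w2: "w\<^sup>2 = p powi (j - 2 * l)"
    proof -
      have "w\<^sup>2 = p powi (- l) * p powi (- l) * p powi j" unfolding w_def power_mult_distrib j by (simp add: power2_eq_square)
      also have "\<dots> = p powi (- l + - l + j)"
        by (subst power_int_add, simp, subst power_int_add, simp, rule refl)
      finally show ?thesis by simp
    qed
    have "N w = 0"
    proof (cases "j - 2 * l = 0")
      case True
      hence "w\<^sup>2 = 1" using w2 by simp
      hence "w * w = 1" by (simp only: power2_eq_square)
      hence "1 / w = w" using w0 by (simp add: field_simps)
      moreover have "w ^ (2 * k + 2) = 1"
        using \<open>w\<^sup>2 = 1\<close> power_mult[of w 2 "Suc k"] by simp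
      ultimately show ?thesis using inv[OF w0] by (simp add: eq_neg_iff_add_eq_0)
    next
      case False
      hence "j - 2 * l = 1" unfolding l_def by presburger
      hence w2': "w\<^sup>2 = p" using w2 by simp
      hence pw: "p * (1 / w) = w" using w0 by (simp add: power2_eq_square field_simps)
      have "p * (1 / w)\<^sup>2 = 1" using w2' by (simp add: power_divide)
      hence "N w * (p * (1 / w) ^ (2 * k + 4)) = N (1 / w)" using per[of "1 / w"] w0 pw by simp
      hence "N w * (p * (1 / w) ^ (2 * k + 4)) * w ^ (2 * k + 2) = - N w" using inv[OF w0] by simp
      moreover have "p * (1 / w) ^ (2 * k + 4) * w ^ (2 * k + 2) = 1"
      proof -
        have "w ^ (2 * k + 4) = w ^ (2 * k + 2) * w\<^sup>2"
          by (simp only: power_add) (simp add: power4_eq_xxxx power2_eq_square mult_ac)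
        thus ?thesis using w0 w2' by (simp add: power_divide)
      qed
      ultimately have "N w = - N w" by (metis (no_types, lifting) mult.assoc mult.right_neutral)
      thus ?thesis by (simp add: eq_neg_iff_add_eq_0)
    qed
    thus ?thesis using Nk[OF w0, of l] zw by simp
  qed
  define \<Theta> where "\<Theta> z = th (z\<^sup>2)" for z :: complex
  have h\<Theta>: "\<Theta> holomorphic_on - {0}" unfolding \<Theta>_def[abs_def] by (intro holomorphic_intros) auto
  have "deriv \<Theta> z \<noteq> 0" if z: "z \<noteq> 0" "\<Theta> z = 0" for z
  proof -
    have "((\<lambda>z. z\<^sup>2) has_field_derivative 2 * z) (at z)" by (auto intro!: derivative_eq_intros)
    from DERIV_chain2[OF th_deriv this] have "(\<Theta> has_field_derivative deriv th (z\<^sup>2) * (2 * z)) (at z)"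
      using z by (simp add: \<Theta>_def[abs_def])
    hence "deriv \<Theta> z = deriv th (z\<^sup>2) * (2 * z)" by (rule DERIV_imp_deriv)
    thus ?thesis using deriv_th_nonzero[of "z\<^sup>2"] z by (simp add: \<Theta>_def)
  qed
  then obtain g where g: "g holomorphic_on - {0}" "\<And>z. z \<noteq> 0 \<Longrightarrow> N z = \<Theta> z * g z"
    using holomorphic_divide_simple_zeros[OF N h\<Theta>] zero unfolding \<Theta>_def by blast
  define h where "h z = g z / z ^ k" for z
  have hh: "h holomorphic_on - {0}" unfolding h_def[abs_def] using g(1) by (intro holomorphic_intros) auto
  have Nh: "N z = z ^ k * \<Theta> z * h z" if "z \<noteq> 0" for z using g(2)[OF that] that by (simp add: h_def)
  obtain w where w: "w \<noteq> 0" "\<Theta> w \<noteq> 0" using generic_point[of "[]"] unfolding \<Theta>_def by auto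
  have c1: "(\<lambda>z. h (1 / z)) holomorphic_on - {0}"
  proof -
    have "(h \<circ> (\<lambda>z. 1 / z)) holomorphic_on - {0}"
      by (rule holomorphic_on_compose_gen[OF _ hh]) (auto intro!: holomorphic_intros)
    thus ?thesis by (simp add: o_def)
  qed
  have c2: "(\<lambda>z. h (p * z)) holomorphic_on - {0}"
  proof -
    have "(h \<circ> (\<lambda>z. p * z)) holomorphic_on - {0}"
      by (rule holomorphic_on_compose_gen[OF _ hh]) (auto intro!: holomorphic_intros)
    thus ?thesis by (simp add: o_def)
  qed
  have "V (m + k) h" unfolding V_def
  proof (intro conjI allI impI hh)
    fix z :: complex assume z: "z \<noteq> 0"
    have "h (1 / z) - h z = 0"
    proof (rule holomorphic_mult_eq_0[of _ \<Theta>, OF _ h\<Theta> _ w z])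
      fix z :: complex assume z: "z \<noteq> 0"
      have t: "\<Theta> (1 / z) = - \<Theta> z / z\<^sup>2" using th_inverse[of "z\<^sup>2"] z by (simp add: \<Theta>_def power_one_over)
      have "z ^ (2 * k + 2) = z ^ k * z ^ k * z\<^sup>2" by (simp only: mult_2 power_add)
      hence "z ^ k * \<Theta> z * h (1 / z) = z ^ k * \<Theta> z * h z"
        using inv[OF z] Nh[OF z] Nh[of "1 / z"] z unfolding t by (simp add: power_one_over field_simps)
      thus "(h (1 / z) - h z) * \<Theta> z = 0" using z by auto
    qed (use c1 hh in \<open>auto intro!: holomorphic_intros\<close>)
    thus "h (1 / z) = h z" by simp
    have "h (p * z) * (p * z\<^sup>2) ^ (m + k) - h z = 0"
    proof (rule holomorphic_mult_eq_0[of _ \<Theta>, OF _ h\<Theta> _ w z])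
      fix z :: complex assume z: "z \<noteq> 0"
      have t: "\<Theta> (p * z) = \<Theta> z / (p * z ^ 4)"
      proof -
        have "(p * z)\<^sup>2 = p * (p * z\<^sup>2)" by (simp add: power2_eq_square mult_ac)
        hence "\<Theta> (p * z) = - th (p * z\<^sup>2) / (p * z\<^sup>2)"
          using th_p_mult[of "p * z\<^sup>2"] z by (simp add: \<Theta>_def)
        also have "th (p * z\<^sup>2) = - \<Theta> z / z\<^sup>2" using th_p_mult[of "z\<^sup>2"] z by (simp add: \<Theta>_def)
        finally show ?thesis by (simp add: power2_eq_square power4_eq_xxxx mult_ac)
      qed
      have e: "z ^ (2 * k + 4) = z ^ k * z ^ k * z ^ 4" by (simp only: mult_2 power_add)
      have e2: "(p * z\<^sup>2) ^ (m + k) = (p * z\<^sup>2) ^ m * (p ^ k * (z ^ k * z ^ k))"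
        by (simp add: power_add power_mult_distrib power2_eq_square)
      have "z ^ k * \<Theta> z * (h (p * z) * (p * z\<^sup>2) ^ (m + k)) = (p * z) ^ k * \<Theta> (p * z) * h (p * z) * (p * z ^ (2 * k + 4) * (p * z\<^sup>2) ^ m)"
        unfolding t e e2 using z by (simp add: power_mult_distrib[of p z])
      also have "\<dots> = z ^ k * \<Theta> z * h z"
        using per[OF z] Nh[OF z] Nh[of "p * z"] z by simp
      finally show "(h (p * z) * (p * z\<^sup>2) ^ (m + k) - h z) * \<Theta> z = 0" using z by auto
    qed (use c2 hh in \<open>auto intro!: holomorphic_intros\<close>)
    thus "h (p * z) * (p * z\<^sup>2) ^ (m + k) = h z" by simp
  qed
  thus ?thesis using Nh unfolding \<Theta>_def by blast
qed

section \<open>Regularity of the operator: its apparent poles cancel\<close>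

context
  fixes a b c d t r :: complex and m k :: nat and f :: "complex list \<Rightarrow> complex" and xs :: "complex list"
  assumes nz: "a \<noteq> 0" "b \<noteq> 0" "c \<noteq> 0" "d \<noteq> 0" "t \<noteq> 0" "r \<noteq> 0"
    and bal: "a * b * c * d * t ^ k * (r\<^sup>2) ^ m = p"
    and f: "W (Suc k) m f" and xs: "length xs = k" "ok xs"
begin

definition "\<alpha> z = th (a * z) * th (b * z) * th (c * z) * th (d * z)"

text \<open>The part of a summand that depends on its first entry \<open>z\<close>, multiplied by
  the common denominator \<open>Th\<close>: the numerators of \<open>Ac\<close> and of the couplings
  of \<open>z\<close>, with the factors \<open>th (z / y)\<close> left over from
  \<open>Th\<close>.\<close>

definition "Sy ys z = \<alpha> z * (\<Prod>y\<leftarrow>ys. th (t * z * y) * th (z / y)) * f (r * z # map ((*) r) ys)"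

definition "Mx z = sgsum (\<lambda>ys. coef a b c d t ys * Sy ys z) xs"

text \<open>Common denominator of all summands in the first entry. It is unchanged when entries of
  \<open>ys\<close> are inverted, and odd under \<open>z\<close> to \<open>1 / z\<close> up to a
  power of \<open>z\<close>.\<close>

definition "Th ys z = th (z\<^sup>2) * (\<Prod>y\<leftarrow>ys. th (z * y) * th (z / y))"

lemma xs0: "0 \<notin> set xs"
  using xs(2) ok_nonzero by blast

lemma Sy_holomorphic:
  assumes "0 \<notin> set ys" "length ys = k"
  shows "Sy ys holomorphic_on - {0}"
proof -
  have "V m (\<lambda>z. f (z # map ((*) r) ys))" using assms nz by (intro W_head[OF f]) auto
  from V_holomorphic[OF this] have 1: "(\<lambda>z. f (z # map ((*) r) ys)) holomorphic_on - {0}" .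
  have "((\<lambda>z. f (z # map ((*) r) ys)) \<circ> (\<lambda>z. r * z)) holomorphic_on - {0}"
    by (rule holomorphic_on_compose_gen[OF _ 1]) (use nz in \<open>auto intro!: holomorphic_intros\<close>)
  hence 2: "(\<lambda>z. f (r * z # map ((*) r) ys)) holomorphic_on - {0}" by (simp add: o_def)
  have "(\<lambda>z. \<Prod>y\<leftarrow>ys. th (t * z * y) * th (z / y)) holomorphic_on - {0}"
  proof (rule holomorphic_on_prod_list)
    fix y assume "y \<in> set ys"
    hence "y \<noteq> 0" using assms by auto
    thus "(\<lambda>z. th (t * z * y) * th (z / y)) holomorphic_on - {0}" using nz by (intro holomorphic_intros) auto
  qed
  thus ?thesis unfolding Sy_def[abs_def] \<alpha>_def using nz 2 by (intro holomorphic_intros) auto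
qed

lemma Mx_holomorphic: "Mx holomorphic_on - {0}"
  unfolding Mx_def[abs_def] sgsum_def
  using sgs_nonzero[OF _ xs0] sgs_length xs(1) by (intro holomorphic_on_sum_list holomorphic_intros Sy_holomorphic) auto

text \<open>Each theta factor brings its own multiplier; together the parameters form the product
  that \<open>bal\<close> equates with \<open>p\<close>, so all summands have one and the same
  multiplier.\<close>

lemma Sy_p_mult:
  assumes z: "z \<noteq> 0" and ys: "0 \<notin> set ys" "length ys = k"
  shows "Sy ys (p * z) * (p * z ^ (2 * k + 4) * (p * z\<^sup>2) ^ m) = Sy ys z"
proof -
  have s: "th (a' * (p * z)) = - th (a' * z) / (a' * z)" if "a' \<noteq> 0" for a'
    using th_p_mult[of "a' * z"] that z by (simp add: mult_ac)
  have 1: "\<alpha> (p * z) * (a * b * c * d * z ^ 4) = \<alpha> z"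
    using nz z unfolding \<alpha>_def by (simp add: s power4_eq_xxxx)
  have 2: "(\<Prod>y\<leftarrow>ys. th (t * (p * z) * y) * th (p * z / y)) * (t * z\<^sup>2) ^ k = (\<Prod>y\<leftarrow>ys. th (t * z * y) * th (z / y))"
  proof -
    have "th (t * (p * z) * y) * th (p * z / y) * (t * z\<^sup>2) = th (t * z * y) * th (z / y)" if "y \<in> set ys" for y
    proof -
      have y: "y \<noteq> 0" using that ys by auto
      have e: "t * (p * z) * y = (t * y) * (p * z)" "p * z / y = (1 / y) * (p * z)" by simp_all
      have "th (t * (p * z) * y) = - th (t * y * z) / (t * y * z)" "th (p * z / y) = - th (1 / y * z) / (1 / y * z)"
        unfolding e using nz y by (intro s; simp)+
      thus ?thesis using y z nz by (simp add: power2_eq_square mult_ac)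
    qed
    hence "(\<Prod>y\<leftarrow>ys. th (t * (p * z) * y) * th (p * z / y) * (t * z\<^sup>2)) = (\<Prod>y\<leftarrow>ys. th (t * z * y) * th (z / y))"
      by (rule prod_list_map_cong)
    thus ?thesis by (simp only: prod_list_mult prod_list_const_power ys power_mult_distrib)
  qed
  have "V m (\<lambda>z. f (z # map ((*) r) ys))" using ys nz by (intro W_head[OF f]) auto
  from V_p_mult[OF this, of "r * z"] have 3: "f (r * (p * z) # map ((*) r) ys) * (p * (r * z)\<^sup>2) ^ m = f (r * z # map ((*) r) ys)"
    using nz z by (simp add: mult_ac)
  have "p * z ^ (2 * k + 4) * (p * z\<^sup>2) ^ m = (a * b * c * d * z ^ 4) * (t * z\<^sup>2) ^ k * (p * (r * z)\<^sup>2) ^ m"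
  proof -
    have e: "z ^ (2 * k + 4) = z ^ 4 * (z\<^sup>2) ^ k" by (simp add: power_add power_mult)
    show ?thesis unfolding e by (subst bal[symmetric]) (simp add: power_mult_distrib mult_ac)
  qed
  hence "Sy ys (p * z) * (p * z ^ (2 * k + 4) * (p * z\<^sup>2) ^ m) =
      (\<alpha> (p * z) * (a * b * c * d * z ^ 4)) *
      ((\<Prod>y\<leftarrow>ys. th (t * (p * z) * y) * th (p * z / y)) * (t * z\<^sup>2) ^ k) *
      (f (r * (p * z) # map ((*) r) ys) * (p * (r * z)\<^sup>2) ^ m)"
    unfolding Sy_def by (simp only: mult_ac)
  thus ?thesis unfolding 1 2 3 by (simp add: Sy_def)
qed

lemma Mx_p_mult: "z \<noteq> 0 \<Longrightarrow> Mx (p * z) * (p * z ^ (2 * k + 4) * (p * z\<^sup>2) ^ m) = Mx z"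
  unfolding Mx_def sgsum_cmult[symmetric] mult.commute[of "sgsum _ _"]
proof (rule sgsum_cong)
  fix ys assume z: "z \<noteq> 0" and ys: "ys \<in> set (sgs xs)"
  have "coef a b c d t ys * (Sy ys (p * z) * (p * z ^ (2 * k + 4) * (p * z\<^sup>2) ^ m)) = coef a b c d t ys * Sy ys z"
    using Sy_p_mult[OF z sgs_nonzero[OF ys xs0]] sgs_length[OF ys] xs(1) by simp
  thus "p * z ^ (2 * k + 4) * (p * z\<^sup>2) ^ m * (coef a b c d t ys * Sy ys (p * z)) = coef a b c d t ys * Sy ys z"
    by (simp only: mult_ac)
qed

lemma Th_inverse: "z \<noteq> 0 \<Longrightarrow> 0 \<notin> set ys \<Longrightarrow> Th ys (1 / z) * z ^ (2 * length ys + 2) = - Th ys z"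
proof -
  assume z: "z \<noteq> 0" and ys: "0 \<notin> set ys"
  have "th (1 / z * y) * th (1 / z / y) * z\<^sup>2 = th (z * y) * th (z / y)" if "y \<in> set ys" for y
  proof -
    have y: "y \<noteq> 0" using that ys by auto
    have "th (1 / z * y) = - (y / z) * th (z / y)" "th (1 / z / y) = - th (z * y) / (z * y)"
      using th_flip[of y z] th_inverse[of "z * y"] z y by simp_all
    thus ?thesis using z y by (simp add: power2_eq_square)
  qed
  hence "(\<Prod>y\<leftarrow>ys. th (1 / z * y) * th (1 / z / y) * z\<^sup>2) = (\<Prod>y\<leftarrow>ys. th (z * y) * th (z / y))"
    by (rule prod_list_map_cong)
  hence "(\<Prod>y\<leftarrow>ys. th (1 / z * y) * th (1 / z / y)) * (z\<^sup>2) ^ length ys = (\<Prod>y\<leftarrow>ys. th (z * y) * th (z / y))"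
    by (simp add: prod_list_mult prod_list_const_power)
  moreover have "th ((1 / z)\<^sup>2) * z\<^sup>2 = - th (z\<^sup>2)"
    using th_inverse[of "z\<^sup>2"] z by (simp add: power_one_over)
  moreover have "Th ys (1 / z) * z ^ (2 * length ys + 2) =
      (th ((1 / z)\<^sup>2) * z\<^sup>2) * ((\<Prod>y\<leftarrow>ys. th (1 / z * y) * th (1 / z / y)) * (z\<^sup>2) ^ length ys)"
    by (simp only: Th_def power_add power_mult) (simp only: mult_ac)
  ultimately show ?thesis by (simp add: Th_def)
qed

lemma coef_Th:
  assumes w: "th (w\<^sup>2) \<noteq> 0" "\<And>y. y \<in> set ys \<Longrightarrow> th (w * y) \<noteq> 0"
  shows "coef a b c d t (w # ys) * f (map ((*) r) (w # ys)) * Th ys w = coef a b c d t ys * Sy ys w"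
proof -
  have "Ac a b c d w * th (w\<^sup>2) = \<alpha> w" using w(1) by (simp add: Ac_def \<alpha>_def)
  moreover have "(\<Prod>y\<leftarrow>ys. Bc t (w * y)) * (\<Prod>y\<leftarrow>ys. th (w * y) * th (w / y)) = (\<Prod>y\<leftarrow>ys. th (t * w * y) * th (w / y))"
    unfolding prod_list_mult[symmetric]
    by (rule prod_list_map_cong) (use w(2) in \<open>simp add: Bc_def mult_ac\<close>)
  moreover have "coef a b c d t (w # ys) * f (map ((*) r) (w # ys)) * Th ys w =
      coef a b c d t ys * ((Ac a b c d w * th (w\<^sup>2)) *
      ((\<Prod>y\<leftarrow>ys. Bc t (w * y)) * (\<Prod>y\<leftarrow>ys. th (w * y) * th (w / y))) * f (r * w # map ((*) r) ys))"
    by (simp only: coef_Cons Th_def list.map mult_ac)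
  ultimately show ?thesis by (simp add: Sy_def)
qed

lemma Th_sgs: "ys \<in> set (sgs xs) \<Longrightarrow> Th ys z = Th xs z"
  using sgs_eqinv[of ys xs]
proof -
  assume "ys \<in> set (sgs xs)"
  hence "list_all2 eqinv ys xs" by (rule sgs_eqinv)
  hence "(\<Prod>y\<leftarrow>ys. th (z * y) * th (z / y)) = (\<Prod>y\<leftarrow>xs. th (z * y) * th (z / y))"
    by (induction rule: list_all2_induct) auto
  thus ?thesis by (simp add: Th_def)
qed

text \<open>The two choices for the first entry produce \<open>Mx z\<close> and
  \<open>Mx (1 / z)\<close>; the minus sign is the oddness of \<open>Th\<close>.\<close>

lemma D_times_Th:
  assumes o: "ok (z # xs)"
  shows "D a b c d t r f (z # xs) * Th xs z = Mx z - z ^ (2 * k + 2) * Mx (1 / z)"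
proof -
  have z: "z \<noteq> 0" using o by simp
  have *: "sgsum (\<lambda>ys. coef a b c d t (w # ys) * f (map ((*) r) (w # ys))) xs * Th xs w = Mx w" if "w = z \<or> w = 1 / z" for w
  proof -
    have w2: "th (w\<^sup>2) \<noteq> 0" using that o th_inverse_0_iff[of "z\<^sup>2"] z by (auto simp: power_one_over)
    have wy: "th (w * y) \<noteq> 0" if ys: "ys \<in> set (sgs xs)" "y \<in> set ys" for ys y
    proof -
      obtain x where x: "x \<in> set xs" "eqinv y x" using sgs_elem[OF ys] by blast
      have "kern z x \<noteq> 0" "x \<noteq> 0" using o x xs0 by auto
      thus ?thesis using x(2) \<open>w = z \<or> w = 1 / z\<close> z th_div_0_iff[of x z] th_inverse_0_iff[of "z * x"]
        by (auto simp: kern_def)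
    qed
    show ?thesis unfolding Mx_def mult.commute[of "sgsum _ _"] sgsum_cmult[symmetric]
    proof (rule sgsum_cong)
      fix ys assume ys: "ys \<in> set (sgs xs)"
      show "Th xs w * (coef a b c d t (w # ys) * f (map ((*) r) (w # ys))) = coef a b c d t ys * Sy ys w"
      proof -
        have "coef a b c d t (w # ys) * f (map ((*) r) (w # ys)) * Th ys w = coef a b c d t ys * Sy ys w"
          by (rule coef_Th[OF w2 wy[OF ys]])
        thus ?thesis unfolding Th_sgs[OF ys] by (simp only: mult_ac)
      qed
    qed
  qed
  have "Th xs z = - (z ^ (2 * k + 2) * Th xs (1 / z))"
    using Th_inverse[OF z xs0] xs(1) by (simp add: mult_ac)
  hence "D a b c d t r f (z # xs) * Th xs z =
      sgsum (\<lambda>ys. coef a b c d t (z # ys) * f (map ((*) r) (z # ys))) xs * Th xs z -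
      z ^ (2 * k + 2) * (sgsum (\<lambda>ys. coef a b c d t (1 / z # ys) * f (map ((*) r) (1 / z # ys))) xs * Th xs (1 / z))"
    unfolding D_def sgsum_Cons by (simp add: algebra_simps)
  thus ?thesis using *[of z] *[of "1 / z"] by simp
qed

text \<open>Cancellation of the apparent pole at \<open>z = x\<close>. Terms in which both entries
  make the same choice contain \<open>th 1\<close>; the two kinds with opposite choices are
  exchanged, since \<open>f\<close> is symmetric in the entries \<open>r * x\<close> and
  \<open>r * (1 / x)\<close>.\<close>

lemma Mx_antisymmetric_at:
  assumes x: "x \<in> set xs"
  shows "Mx x = x ^ (2 * k + 2) * Mx (1 / x)"
proof -
  obtain us vs where "xs = us @ x # vs" using x by (meson split_list)
  hence m: "mset xs = mset (x # us @ vs)" by simp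
  define xs' where "xs' = us @ vs"
  note m = m[folded xs'_def]
  have k: "k = Suc (length xs')" using m xs(1) by (metis length_Cons size_mset)
  have o: "ok (x # xs')" using ok_mset[OF m xs(2)] .
  have x0: "x \<noteq> 0" "0 \<notin> set xs'" using o ok_nonzero[of xs'] by auto
  have Sm: "coef a b c d t zs * Sy zs z = coef a b c d t ys * Sy ys z"
    if ys: "length ys = k" "0 \<notin> set ys" "mset zs = mset ys" and "z \<noteq> 0" for ys zs z
  proof -
    have "f (r * z # map ((*) r) zs) = f (r * z # map ((*) r) ys)"
      using ys that nz by (intro W_mset[OF f]) (auto simp: image_iff)
    thus ?thesis by (simp only: coef_mset[OF ys(3)] Sy_def prod_list_map_mset[OF ys(3)])
  qed
  have Mz: "Mx z = sgsum (\<lambda>ys. coef a b c d t (x # ys) * Sy (x # ys) z) xs' +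
      sgsum (\<lambda>ys. coef a b c d t (1 / x # ys) * Sy (1 / x # ys) z) xs'" if "z \<noteq> 0" for z
  proof -
    note z0 = that
    have "Mx z = sgsum (\<lambda>ys. coef a b c d t ys * Sy ys z) (x # xs')"
      unfolding Mx_def
    proof (rule sgsum_mset)
      show "coef a b c d t zs * Sy zs z = coef a b c d t ys * Sy ys z"
        if "length ys = length (x # xs')" "0 \<notin> set ys" "mset zs = mset ys" for ys zs
        by (rule Sm) (use that k z0 in auto)
    qed (use x0 m in auto)
    thus ?thesis by (simp add: sgsum_Cons)
  qed
  have Z: "Sy (x # ys) x = 0" "Sy (1 / x # ys) (1 / x) = 0" for ys
    using x0 by (simp_all add: Sy_def)
  have "Mx x = sgsum (\<lambda>ys. coef a b c d t (1 / x # ys) * Sy (1 / x # ys) x) xs'"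
    using Mz[of x] x0 Z by (simp add: sgsum_def)
  also have "\<dots> = sgsum (\<lambda>ys. x ^ (2 * k + 2) * (coef a b c d t (x # ys) * Sy (x # ys) (1 / x))) xs'"
  proof (rule sgsum_cong)
    fix ys assume ys: "ys \<in> set (sgs xs')"
    have y0: "0 \<notin> set ys" using sgs_nonzero[OF ys x0(2)] .
    have ly: "length ys = length xs'" using sgs_length[OF ys] .
    have nzy: "th (x * y) \<noteq> 0" "th (y / x) \<noteq> 0" "y \<noteq> 0" if y: "y \<in> set ys" for y
    proof -
      obtain w where w: "w \<in> set xs'" "eqinv y w" using sgs_elem[OF ys y] by blast
      have "kern x w \<noteq> 0" "w \<noteq> 0" using o w x0 by auto
      thus "th (x * y) \<noteq> 0" "th (y / x) \<noteq> 0" "y \<noteq> 0"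
        using w(2) x0(1) th_div_0_iff[of x w] th_inverse_0_iff[of "w * x"] by (auto simp: kern_def mult_ac)
    qed
    have P: "(\<Prod>y\<leftarrow>ys. Bc t (1 / x * y)) * (\<Prod>y\<leftarrow>ys. th (t * x * y) * th (x / y)) =
        (x\<^sup>2) ^ length ys * ((\<Prod>y\<leftarrow>ys. Bc t (x * y)) * (\<Prod>y\<leftarrow>ys. th (t * (1 / x) * y) * th (1 / x / y)))"
      unfolding prod_list_const_power[symmetric] prod_list_mult[symmetric]
    proof (rule prod_list_map_cong)
      fix y assume y: "y \<in> set ys"
      have "th (x / y) = - (x / y) * th (y / x)" "th (1 / x / y) = - th (x * y) / (x * y)"
        using th_flip[of x y] th_inverse[of "x * y"] x0 nzy[OF y] by simp_all
      thus "Bc t (1 / x * y) * (th (t * x * y) * th (x / y)) =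
          x\<^sup>2 * (Bc t (x * y) * (th (t * (1 / x) * y) * th (1 / x / y)))"
        using nzy[OF y] x0 by (simp add: Bc_def power2_eq_square mult_ac)
    qed
    have A: "Ac a b c d (1 / x) * (\<alpha> x * th (x\<^sup>2)) = x ^ 4 * (Ac a b c d x * (\<alpha> (1 / x) * th (1 / x\<^sup>2)))"
    proof -
      have "th (1 / x\<^sup>2) = - th (x\<^sup>2) / x\<^sup>2" using th_inverse[of "x\<^sup>2"] x0 by simp
      moreover have "th (x\<^sup>2) \<noteq> 0" using o by simp
      ultimately show ?thesis using x0 unfolding Ac_def \<alpha>_def
        by (simp add: power_one_over power2_eq_square power4_eq_xxxx mult_ac)
    qed
    have F: "f (r * (1 / x) # map ((*) r) (x # ys)) = f (r * x # map ((*) r) (1 / x # ys))"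
      using x0 y0 nz ly k by (intro W_mset[OF f]) (auto simp: image_iff)
    have e: "x ^ (2 * k + 2) = x ^ 4 * (x\<^sup>2) ^ length ys"
      by (simp add: k ly power_add power_mult power4_eq_xxxx power2_eq_square power_mult_distrib mult_ac)
    have "coef a b c d t (1 / x # ys) * Sy (1 / x # ys) x =
        coef a b c d t ys * th t * (Ac a b c d (1 / x) * (\<alpha> x * th (x\<^sup>2))) *
        ((\<Prod>y\<leftarrow>ys. Bc t (1 / x * y)) * (\<Prod>y\<leftarrow>ys. th (t * x * y) * th (x / y))) * f (r * x # map ((*) r) (1 / x # ys))"
      using x0 by (simp add: coef_Cons Sy_def power2_eq_square mult_ac)
    also have "\<dots> = x ^ (2 * k + 2) * (coef a b c d t ys * th t * (Ac a b c d x * (\<alpha> (1 / x) * th (1 / x\<^sup>2))) *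
        ((\<Prod>y\<leftarrow>ys. Bc t (x * y)) * (\<Prod>y\<leftarrow>ys. th (t * (1 / x) * y) * th (1 / x / y))) * f (r * (1 / x) # map ((*) r) (x # ys)))"
      unfolding A P F e by (simp only: mult_ac)
    also have "\<dots> = x ^ (2 * k + 2) * (coef a b c d t (x # ys) * Sy (x # ys) (1 / x))"
      using x0 by (simp add: coef_Cons Sy_def power2_eq_square mult_ac)
    finally show "coef a b c d t (1 / x # ys) * Sy (1 / x # ys) x =
        x ^ (2 * k + 2) * (coef a b c d t (x # ys) * Sy (x # ys) (1 / x))" .
  qed
  also have "\<dots> = x ^ (2 * k + 2) * sgsum (\<lambda>ys. coef a b c d t (x # ys) * Sy (x # ys) (1 / x)) xs'"
    by (rule sgsum_cmult)
  also have "sgsum (\<lambda>ys. coef a b c d t (x # ys) * Sy (x # ys) (1 / x)) xs' = Mx (1 / x)"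
    using Mz[of "1 / x"] x0 Z by (simp add: sgsum_def)
  finally show ?thesis .
qed

text \<open>The antisymmetric numerator \<open>N\<close> is divided by
  \<open>z ^ k * th (z^2)\<close>, which leaves degree \<open>m + k\<close>, and then by the
  \<open>k\<close> factors \<open>kern x z\<close> for the entries of \<open>xs\<close>, which
  leaves degree \<open>m\<close>.\<close>

lemma D_head_V: "\<exists>h. V m h \<and> (\<forall>z. ok (z # xs) \<longrightarrow> D a b c d t r f (z # xs) = h z)"
proof -
  define N where "N z = Mx z - z ^ (2 * k + 2) * Mx (1 / z)" for z
  have "(Mx \<circ> (\<lambda>z. 1 / z)) holomorphic_on - {0}"
    by (rule holomorphic_on_compose_gen[OF _ Mx_holomorphic]) (auto intro!: holomorphic_intros)
  hence "(\<lambda>z. Mx (1 / z)) holomorphic_on - {0}" by (simp add: o_def)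
  hence hN: "N holomorphic_on - {0}" unfolding N_def[abs_def] by (intro holomorphic_intros Mx_holomorphic)
  have inv: "N (1 / z) * z ^ (2 * k + 2) = - N z" if z: "z \<noteq> 0" for z
    using z by (simp add: N_def power_one_over algebra_simps)
  have per: "N (p * z) * (p * z ^ (2 * k + 4) * (p * z\<^sup>2) ^ m) = N z" if z: "z \<noteq> 0" for z
  proof -
    have pz: "1 / (p * z) \<noteq> 0" "p * (1 / (p * z)) = 1 / z" using z by simp_all
    have M1: "Mx (1 / (p * z)) = Mx (1 / z) * (p * (1 / (p * z)) ^ (2 * k + 4) * (p * (1 / (p * z))\<^sup>2) ^ m)"
      using Mx_p_mult[OF pz(1)] unfolding pz(2) by simp
    have i1: "p * (1 / (p * z))\<^sup>2 = 1 / (p * z\<^sup>2)" by (simp add: power2_eq_square)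
    have i2: "(p * z) ^ (2 * k + 2) * (p * (1 / (p * z)) ^ (2 * k + 4)) * (p * z ^ (2 * k + 4)) = z ^ (2 * k + 2)"
      using z by (simp add: power_divide power_mult_distrib power_add power2_eq_square power4_eq_xxxx field_simps)
    have "(p * z) ^ (2 * k + 2) * Mx (1 / (p * z)) * (p * z ^ (2 * k + 4) * (p * z\<^sup>2) ^ m) =
        ((p * z) ^ (2 * k + 2) * (p * (1 / (p * z)) ^ (2 * k + 4)) * (p * z ^ (2 * k + 4))) *
        ((1 / (p * z\<^sup>2)) ^ m * (p * z\<^sup>2) ^ m) * Mx (1 / z)"
      unfolding M1 i1 by (simp only: mult_ac)
    also have "(1 / (p * z\<^sup>2)) ^ m * (p * z\<^sup>2) ^ m = 1" using z by (simp flip: power_mult_distrib)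
    finally have "(p * z) ^ (2 * k + 2) * Mx (1 / (p * z)) * (p * z ^ (2 * k + 4) * (p * z\<^sup>2) ^ m) = z ^ (2 * k + 2) * Mx (1 / z)"
      unfolding i2 by simp
    thus ?thesis using Mx_p_mult[OF z] unfolding N_def left_diff_distrib by simp
  qed
  obtain g where g: "V (m + k) g" "\<And>z. z \<noteq> 0 \<Longrightarrow> N z = z ^ k * th (z\<^sup>2) * g z"
    using V_antisymmetric_divide[OF hN inv per] by blast
  have "g x = 0" if x: "x \<in> set xs" for x
  proof -
    have "N x = 0" using Mx_antisymmetric_at[OF x] by (simp add: N_def)
    moreover have "x \<noteq> 0" using x xs0 by auto
    moreover have "th (x\<^sup>2) \<noteq> 0" using xs(2) x by (induction xs) auto
    ultimately show ?thesis using g(2)[of x] by simp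
  qed
  then obtain h where h: "V m h" "\<And>u. u \<noteq> 0 \<Longrightarrow> g u = (\<Prod>z\<leftarrow>xs. kern z u) * h u"
    using V_divide_list[of m xs g] g(1) xs by auto
  have "D a b c d t r f (z # xs) = (\<Prod>x\<leftarrow>xs. - x) * h z" if o: "ok (z # xs)" for z
  proof -
    have z: "z \<noteq> 0" using o by simp
    have T: "Th xs z * (\<Prod>x\<leftarrow>xs. - x) = th (z\<^sup>2) * (z ^ k * (\<Prod>x\<leftarrow>xs. kern x z))"
    proof -
      have "th (z * x) * th (z / x) * (- x) = z * kern x z" if "x \<in> set xs" for x
      proof -
        have "x \<noteq> 0" using that xs0 by auto
        thus ?thesis using th_flip[of z x] z by (simp add: kern_def mult_ac)
      qed
      hence "(\<Prod>x\<leftarrow>xs. th (z * x) * th (z / x) * (- x)) = (\<Prod>x\<leftarrow>xs. z * kern x z)"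
        by (rule prod_list_map_cong)
      hence "(\<Prod>x\<leftarrow>xs. th (z * x) * th (z / x)) * (\<Prod>x\<leftarrow>xs. - x) = z ^ k * (\<Prod>x\<leftarrow>xs. kern x z)"
        by (simp only: prod_list_mult prod_list_const_power xs(1))
      thus ?thesis unfolding Th_def by (simp only: mult.assoc)
    qed
    have T0: "Th xs z \<noteq> 0"
    proof -
      have "th (z * x) * th (z / x) \<noteq> 0" if "x \<in> set xs" for x
        using o that by (auto simp: kern_def)
      thus ?thesis using o by (auto simp: Th_def prod_list_zero_iff)
    qed
    have "D a b c d t r f (z # xs) * Th xs z = z ^ k * th (z\<^sup>2) * ((\<Prod>x\<leftarrow>xs. kern x z) * h z)"
      using D_times_Th[OF o] g(2)[OF z] h(2)[OF z] by (simp add: N_def)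
    also have "\<dots> = (\<Prod>x\<leftarrow>xs. - x) * h z * Th xs z" using T by (simp add: mult_ac)
    finally show ?thesis using T0 by simp
  qed
  thus ?thesis using V_cmult[OF h(1)] by blast
qed

end

lemma GW_D:
  assumes "a \<noteq> 0" "b \<noteq> 0" "c \<noteq> 0" "d \<noteq> 0" "t \<noteq> 0" "r \<noteq> 0"
    and "a * b * c * d * t ^ k * (r\<^sup>2) ^ m = p" and f: "W (Suc k) m f"
  shows "GW [] (Suc k) m (D a b c d t r f)"
  unfolding GW_def
proof (intro conjI allI impI)
  fix xs ys :: "complex list" assume xs: "length xs = Suc k" "ok (xs @ [])" "mset ys = mset xs"
  show "D a b c d t r f ys = D a b c d t r f xs" unfolding D_def
  proof (rule sgsum_mset)
    fix us vs :: "complex list" assume u: "length us = length xs" "0 \<notin> set us" "mset vs = mset us"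
    have "f (map ((*) r) vs) = f (map ((*) r) us)"
      using u xs(1) assms(6) by (intro W_mset[OF f]) auto
    thus "coef a b c d t vs * f (map ((*) r) vs) = coef a b c d t us * f (map ((*) r) us)"
      by (simp only: coef_mset[OF u(3)])
  qed (use xs ok_nonzero in auto)
qed (use D_head_V[OF assms] in auto)

text \<open>The operator sends the function with parameters \<open>r * a\<close>,
  \<open>r * b\<close> to a scalar times the one with \<open>a\<close>, \<open>b\<close>. Along the
  path, \<open>D_kern\<close> treats a \<open>False\<close> step and \<open>D_head\<close> a
  \<open>True\<close> step; each shifts \<open>a\<close> as the recursion does and preserves the
  balancing product. For a \<open>True\<close> step both sides also vanish on the grid at
  \<open>b\<close>, and the two-grid lemma identifies them.\<close>

lemma D_IntN:
  assumes "gen M a b q t" "gen M (r * a) (r * b) q t" "2 * length w \<le> M"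
    and "c \<noteq> 0" "d \<noteq> 0" "q = r\<^sup>2" "a * b * c * d * t ^ nR w * q ^ nC w = p * t"
    and "IntN w (r * a) (r * b) q t f" "IntN w a b q t g" "length xs = nR w" "ok xs"
  shows "D a b c d t r f xs = (\<Prod>x\<leftarrow>pts a q t w. th (x * b) * th (x * c) * th (x * d)) * g xs"
  using assms(1-3,7-)
proof (induction w arbitrary: a f g xs M)
  case Nil thus ?case by (simp add: D_def)
next
  case (Cons l w)
  have M: "M - 2 + 2 = M" "2 * length w \<le> M - 2" using Cons.prems(3) by auto
  note G = gen_dest[OF Cons.prems(1)]
  have r0: "r \<noteq> 0" using G(10) assms(6) by auto
  note G' = gen_dest[OF Cons.prems(2)]
  show ?case
  proof (cases l)
    case False
    obtain f' where f': "IntN w (r * a * q) (r * b) q t f'"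
        "\<And>xs. length xs = nR w \<Longrightarrow> 0 \<notin> set xs \<Longrightarrow> f xs = (\<Prod>x\<leftarrow>xs. kern (r * a) x) * f' xs"
      using Cons.prems(5) False by auto
    obtain g' where g': "IntN w (a * q) b q t g'"
        "\<And>xs. length xs = nR w \<Longrightarrow> 0 \<notin> set xs \<Longrightarrow> g xs = (\<Prod>x\<leftarrow>xs. kern a x) * g' xs"
      using Cons.prems(6) False by auto
    have x0: "0 \<notin> set xs" using Cons.prems(8) ok_nonzero by blast
    have l: "length xs = nR w" using Cons.prems(7) False by simp
    have "D a b c d t r f xs = (\<Prod>x\<leftarrow>xs. kern a x) * D (a * r\<^sup>2) b c d t r f' xs"
      by (rule D_kern[OF r0 x0]) (use f'(2) l in auto)
    also have "D (a * r\<^sup>2) b c d t r f' xs = (\<Prod>x\<leftarrow>pts (a * q) q t w. th (x * b) * th (x * c) * th (x * d)) * g' xs"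
      unfolding assms(6)[symmetric]
    proof (rule Cons.IH[OF _ _ M(2)])
      show "gen (M - 2) (a * q) b q t" using gen_shift_q[of "M - 2"] Cons.prems(1) M by simp
      show "gen (M - 2) (r * (a * q)) (r * b) q t" using gen_shift_q[of "M - 2" "r * a"] Cons.prems(2) M by (simp add: mult.assoc)
      show "IntN w (r * (a * q)) (r * b) q t f'" using f'(1) by (simp add: mult.assoc)
      show "a * q * b * c * d * t ^ nR w * q ^ nC w = p * t" using Cons.prems(4) False by (simp add: mult_ac)
    qed (use g' l Cons.prems(8) in auto)
    finally show ?thesis using False g'(2)[OF l x0] by (simp add: mult_ac)
  next
    case True
    define m n where "m = nC w" and "n = nR w"
    have W: "W (Suc n) m f" "W (Suc n) m g" and If: "IntN w (r * a * t) (r * b) q t (\<lambda>xs. f (r * a # xs))"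
      and Ig: "IntN w (a * t) b q t (\<lambda>xs. g (a # xs))"
      and zf: "\<And>w' m'. m = Suc m' \<Longrightarrow> w' \<in> words m' (Suc n) \<Longrightarrow> f (pts (r * b) q t w') = 0"
      and zg: "\<And>w' m'. m = Suc m' \<Longrightarrow> w' \<in> words m' (Suc n) \<Longrightarrow> g (pts b q t w') = 0"
      using Cons.prems(5,6) True by (auto simp: m_def n_def)
    define e where "e = (\<Prod>x\<leftarrow>pts a q t (l # w). th (x * b) * th (x * c) * th (x * d))"
    define F where "F xs = D a b c d t r f xs - e * g xs" for xs
    have "a * b * c * d * t ^ n * (r\<^sup>2) ^ m = p"
      using Cons.prems(4) True G(11) assms(6) by (simp add: m_def n_def mult.assoc)
    hence GD: "GW [] (Suc n) m (D a b c d t r f)"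
      using G r0 assms(4,5) W(1) by (intro GW_D) auto
    have GF: "GW [] (Suc n) m F" unfolding GW_def
    proof (intro conjI allI impI)
      fix xs ys :: "complex list" assume x: "length xs = Suc n" "ok (xs @ [])" "mset ys = mset xs"
      show "F ys = F xs"
        unfolding F_def by (simp only: GW_mset[OF GD x] GW_mset[OF W_imp_GW[OF W(2)] x])
    next
      fix xs :: "complex list" assume x: "Suc (length xs) = Suc n" "ok (xs @ [])"
      obtain h where h: "V m h" "\<And>z. ok (z # xs @ []) \<Longrightarrow> D a b c d t r f (z # xs) = h z"
        using GW_head[OF GD x] by blast
      have "V m (\<lambda>z. h z - e * g (z # xs))"
        using x ok_nonzero[of xs] by (intro V_diff h V_cmult W_head[OF W(2)]) auto
      thus "\<exists>h. V m h \<and> (\<forall>z. ok (z # xs @ []) \<longrightarrow> F (z # xs) = h z)"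
        by (intro exI[of _ "\<lambda>z. h z - e * g (z # xs)"]) (auto simp: F_def h(2) simp del: ok.simps)
    qed
    have "F xs = 0"
    proof (rule GW_two_grids_zero[where S = "[]" and a = a and b = b and q = q and t = t and m = m and M = M and n = n])
      show "ok [a]" using G ng_th_nonzero by auto
      show mn: "2 * (m + n) \<le> M" using M length_word[of w] by (simp add: m_def n_def)
      have M1: "Suc n \<le> M" "m \<le> M" using Cons.prems(3) length_word[of w] by (auto simp: m_def n_def)
      show "kern (b * q ^ i * t ^ j) y \<noteq> 0" if "y \<in> set [a]" "i \<le> m" "j \<le> Suc n" for y i j
        using gen_kern_ba[OF Cons.prems(1), of i j] that M1 by auto
      show "F (a # xs) = 0" if x: "length xs = n" "ok (xs @ [a])" for xs
      proof -
        have o: "ok (a # xs)" using x(2) ok_shift[of xs a "[]"] by simp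
        have "D a b c d t r f (a # xs) = th (a * b) * th (a * c) * th (a * d) * D (a * t) b c d t r (\<lambda>xs. f (r * a # xs)) xs"
          by (rule D_head) (use o in auto)
        also have "D (a * t) b c d t r (\<lambda>xs. f (r * a # xs)) xs =
            (\<Prod>x\<leftarrow>pts (a * t) q t w. th (x * b) * th (x * c) * th (x * d)) * g (a # xs)"
        proof (rule Cons.IH[OF _ _ M(2)])
          show "gen (M - 2) (a * t) b q t" using gen_shift_t[of "M - 2"] Cons.prems(1) M by simp
          show "gen (M - 2) (r * (a * t)) (r * b) q t" using gen_shift_t[of "M - 2" "r * a"] Cons.prems(2) M by (simp add: mult.assoc)
          show "IntN w (r * (a * t)) (r * b) q t (\<lambda>xs. f (r * a # xs))" using If by (simp add: mult.assoc)
          show "a * t * b * c * d * t ^ nR w * q ^ nC w = p * t" using Cons.prems(4) True by (simp add: mult_ac)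
        qed (use Ig x o in \<open>auto simp: n_def\<close>)
        finally show ?thesis using True by (simp add: F_def e_def)
      qed
      show "F (pts b q t v) = 0" if v: "m = Suc m'" "v \<in> words m' (Suc n)" for v m'
        using D_pts_zero[OF W(1) zf[OF v(1)] v(2) G(2,11) r0 assms(6)] zg[OF v] by (simp add: F_def)
    qed (use G GF Cons.prems True in \<open>auto simp: n_def\<close>)
    thus ?thesis by (simp add: F_def e_def)
  qed
qed

end

section \<open>The principal specialisation\<close>

text \<open>The boxes of the diagram as pairs of column and row, both counted from 0, the rows from
  the last one upwards.\<close>

fun bxw :: "bool list \<Rightarrow> (nat \<times> nat) list" where
  "bxw [] = []"
| "bxw (True # w) = map (\<lambda>(j, s). (j, Suc s)) (bxw w)"
| "bxw (False # w) = map (\<lambda>s. (0, s)) [0..<nR w] @ map (\<lambda>(j, s). (Suc j, s)) (bxw w)"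

text \<open>The column lengths, that is, the parts of the conjugate partition including zero
  parts.\<close>

fun hts :: "bool list \<Rightarrow> nat list" where
  "hts [] = []"
| "hts (True # w) = hts w"
| "hts (False # w) = nR w # hts w"

lemma length_hts [simp]: "length (hts w) = nC w"
  by (induction w rule: hts.induct) auto

lemma hts_le: "h \<in> set (hts w) \<Longrightarrow> h \<le> nR w"
  by (induction w rule: hts.induct) auto

lemma hts_nth_le: "k < nC w \<Longrightarrow> hts w ! k \<le> nR w"
  using hts_le[of "hts w ! k" w] by simp

lemma set_bxw: "(j, s) \<in> set (bxw w) \<longleftrightarrow> s < nR w \<and> j < exps w ! s"
proof (induction w arbitrary: j s rule: bxw.induct)
  case (2 w)
  show ?case by (cases s) (auto simp: image_iff 2 split: prod.splits)
next
  case (3 w)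
  show ?case by (cases j) (auto simp: image_iff 3 split: prod.splits)
qed auto

lemma distinct_bxw: "distinct (bxw w)"
proof (induction w rule: bxw.induct)
  case (2 w) thus ?case by (auto simp: distinct_map inj_on_def)
next
  case (3 w) thus ?case by (auto simp: distinct_map inj_on_def)
qed auto

lemma length_bxw: "length (bxw w) = sum_list (exps w)"
proof (induction w rule: bxw.induct)
  case (3 w)
  have "sum_list (map Suc ks) = length ks + sum_list ks" for ks :: "nat list" by (induction ks) auto
  thus ?case using 3 by simp
qed auto

lemma exps_snoc: "exps (w @ [True]) = exps w @ [nC w]" "exps (w @ [False]) = exps w"
  by (induction w rule: exps.induct) auto

lemma exps_rev: "exps (rev w) = map (\<lambda>k. nC w - k) (rev (exps w))"
proof (induction w rule: exps.induct)
  case (3 w)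
  show ?case by (simp add: exps_snoc 3 rev_map o_def)
qed (auto simp: exps_snoc)

lemma exps_rev_nth: "s < nR w \<Longrightarrow> exps (rev w) ! s = nC w - exps w ! (nR w - 1 - s)"
  by (simp add: exps_rev rev_nth)

text \<open>\<open>rev w\<close> is the complement in the rectangle, so the boxes of both fill it.
  This number is also the degree of the principal specialisation.\<close>

lemma length_bxw_rev: "length (bxw w) + length (bxw (rev w)) = nC w * nR w"
proof -
  have "sum_list ks + sum_list (map (\<lambda>k. m - k) (rev ks)) = m * length ks" if "\<forall>k\<in>set ks. k \<le> m" for ks and m :: nat
    using that by (induction ks) auto
  thus ?thesis using exps_le by (simp add: length_bxw exps_rev)
qed

lemma hts_snoc: "hts (w @ [True]) = map Suc (hts w)" "hts (w @ [False]) = hts w @ [0]"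
  by (induction w rule: hts.induct) auto

lemma hts_rev: "hts (rev w) = map (\<lambda>h. nR w - h) (rev (hts w))"
proof (induction w rule: hts.induct)
  case (2 w)
  have "map Suc (map (\<lambda>h. nR w - h) (rev (hts w))) = map (\<lambda>h. Suc (nR w) - h) (rev (hts w))"
    using hts_le by (auto simp: Suc_diff_le)
  thus ?case by (simp add: hts_snoc 2)
qed (auto simp: hts_snoc)

lemma hts_rev_nth: "k < nC w \<Longrightarrow> hts (rev w) ! k = nR w - hts w ! (nC w - 1 - k)"
  by (simp add: hts_rev rev_nth)

lemma mset_bxw_snoc_True: "mset (bxw (w @ [True])) = mset (bxw w) + mset (map (\<lambda>j. (j, nR w)) [0..<nC w])"
proof (induction w rule: bxw.induct)
  case (2 w)
  have "mset (bxw ((True # w) @ [True])) = image_mset (\<lambda>(j, s). (j, Suc s)) (mset (bxw (w @ [True])))" by simp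
  thus ?case unfolding 2 by (simp add: image_mset.compositionality o_def)
next
  case (3 w)
  have "mset (map (\<lambda>(j, s). (Suc j, s)) (bxw (w @ [True]))) = image_mset (\<lambda>(j, s). (Suc j, s)) (mset (bxw (w @ [True])))" by simp
  also have "\<dots> = mset (map (\<lambda>(j, s). (Suc j, s)) (bxw w)) + mset (map (\<lambda>j. (Suc j, nR w)) [0..<nC w])"
    unfolding 3 by (simp add: image_mset.compositionality o_def)
  finally have e: "mset (map (\<lambda>(j, s). (Suc j, s)) (bxw (w @ [True]))) = \<dots>" .
  have u: "map (\<lambda>j. (j, nR w)) [0..<Suc (nC w)] = (0, nR w) # map (\<lambda>j. (Suc j, nR w)) [0..<nC w]"
    by (subst upt_conv_Cons) (simp_all add: map_Suc_upt[symmetric] o_def del: upt_Suc)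
  show ?case using e by (simp add: u atLeastLessThanSuc del: upt_Suc)
qed auto

lemma mset_bxw_snoc_False: "mset (bxw (w @ [False])) = mset (bxw w)"
proof (induction w rule: bxw.induct)
  case (2 w)
  have "mset (bxw ((True # w) @ [False])) = image_mset (\<lambda>(j, s). (j, Suc s)) (mset (bxw (w @ [False])))" by simp
  thus ?case unfolding 2 by simp
next
  case (3 w)
  have "mset (map (\<lambda>(j, s). (Suc j, s)) (bxw (w @ [False]))) = image_mset (\<lambda>(j, s). (Suc j, s)) (mset (bxw (w @ [False])))" by simp
  thus ?case unfolding 3 by simp
qed auto

definition prodB :: "bool list \<Rightarrow> (nat \<Rightarrow> nat \<Rightarrow> complex) \<Rightarrow> complex"
  where "prodB w G = (\<Prod>x\<leftarrow>bxw w. G (fst x) (snd x))"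

lemma prodB_Nil [simp]: "prodB [] G = 1"
  by (simp add: prodB_def)

lemma prodB_True: "prodB (True # w) G = prodB w (\<lambda>j s. G j (Suc s))"
  by (simp add: prodB_def o_def case_prod_beta)

lemma prodB_False: "prodB (False # w) G = (\<Prod>s<nR w. G 0 s) * prodB w (\<lambda>j s. G (Suc j) s)"
proof -
  have "(\<Prod>s\<leftarrow>[0..<n]. g s) = (\<Prod>s<n. g s)" for n and g :: "nat \<Rightarrow> complex"
    by (induction n) (auto simp: mult_ac)
  thus ?thesis by (simp add: prodB_def o_def case_prod_beta)
qed

lemma prodB_snoc_True: "prodB (w @ [True]) G = prodB w G * (\<Prod>j<nC w. G j (nR w))"
proof -
  have "(\<Prod>s\<leftarrow>[0..<n]. g s) = (\<Prod>s<n. g s)" for n and g :: "nat \<Rightarrow> complex"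
    by (induction n) (auto simp: mult_ac)
  hence "(\<Prod>x\<leftarrow>bxw w @ map (\<lambda>j. (j, nR w)) [0..<nC w]. G (fst x) (snd x)) = prodB w G * (\<Prod>j<nC w. G j (nR w))"
    by (simp add: prodB_def o_def)
  moreover have "mset (bxw (w @ [True])) = mset (bxw w @ map (\<lambda>j. (j, nR w)) [0..<nC w])"
    by (simp add: mset_bxw_snoc_True)
  ultimately show ?thesis unfolding prodB_def[of "w @ [True]"] by (metis prod_list_map_mset)
qed

lemma prodB_snoc_False: "prodB (w @ [False]) G = prodB w G"
  unfolding prodB_def by (rule prod_list_map_mset[OF mset_bxw_snoc_False])

lemma prodB_mult: "prodB w (\<lambda>j s. G j s * H j s) = prodB w G * prodB w H"
  unfolding prodB_def by (simp add: case_prod_beta prod_list_mult)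

lemma prodB_cong: "(\<And>j s. s < nR w \<Longrightarrow> j < exps w ! s \<Longrightarrow> G j s = H j s) \<Longrightarrow> prodB w G = prodB w H"
  unfolding prodB_def by (rule prod_list_map_cong) (auto simp: set_bxw)

lemma prodB_nonzero: "(\<And>j s. s < nR w \<Longrightarrow> j < exps w ! s \<Longrightarrow> G j s \<noteq> 0) \<Longrightarrow> prodB w G \<noteq> 0"
  unfolding prodB_def by (auto simp: prod_list_zero_iff set_bxw)

lemma exps_nth_le: "s < nR w \<Longrightarrow> exps w ! s \<le> nC w"
  by (rule exps_le) simp

text \<open>Column \<open>k\<close> occupies the consecutive rows from
  \<open>nR w - hts w ! k\<close> to \<open>nR w - 1\<close>, so a shift of the row index by one
  alters its product only at the two ends.\<close>

lemma prodB_telescope: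
  "prodB w G * (\<Prod>k<nC w. G k (nR w)) = prodB w (\<lambda>j s. G j (Suc s)) * (\<Prod>k<nC w. G k (nR w - hts w ! k))"
proof (induction w arbitrary: G rule: bxw.induct)
  case (2 w)
  have "(\<Prod>k<nC w. G k (Suc (nR w) - hts w ! k)) = (\<Prod>k<nC w. G k (Suc (nR w - hts w ! k)))"
    by (rule prod.cong) (auto simp: Suc_diff_le hts_nth_le)
  thus ?case using "2.IH"[of "\<lambda>j s. G j (Suc s)"] by (simp add: prodB_True)
next
  case (3 w)
  have "(\<Prod>s<n. g s) * g n = (\<Prod>s<n. g (Suc s)) * g 0" for n and g :: "nat \<Rightarrow> complex"
    by (induction n) (auto simp: mult_ac)
  hence e: "(\<Prod>s<nR w. G 0 s) * G 0 (nR w) = (\<Prod>s<nR w. G 0 (Suc s)) * G 0 0" .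
  have "prodB (False # w) G * (\<Prod>k<nC (False # w). G k (nR (False # w))) =
     ((\<Prod>s<nR w. G 0 s) * G 0 (nR w)) * (prodB w (\<lambda>j s. G (Suc j) s) * (\<Prod>k<nC w. G (Suc k) (nR w)))"
    by (simp add: prodB_False prod.lessThan_Suc_shift mult_ac del: prod.lessThan_Suc)
  also have "\<dots> = ((\<Prod>s<nR w. G 0 (Suc s)) * G 0 0) *
     (prodB w (\<lambda>j s. G (Suc j) (Suc s)) * (\<Prod>k<nC w. G (Suc k) (nR w - hts w ! k)))"
    unfolding e "3.IH"[of "\<lambda>j s. G (Suc j) s"] ..
  also have "\<dots> = prodB (False # w) (\<lambda>j s. G j (Suc s)) * (\<Prod>k<nC (False # w). G k (nR (False # w) - hts (False # w) ! k))"
    by (simp add: prodB_False prod.lessThan_Suc_shift mult_ac del: prod.lessThan_Suc)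
  finally show ?case .
qed auto

lemma strg_nth: "i < n \<Longrightarrow> strg v t n ! i = v * t ^ i"
proof (induction n arbitrary: v i)
  case (Suc n) thus ?case by (cases i) (auto simp: mult_ac)
qed auto

lemma strg_elem: "x \<in> set (strg v t n) \<Longrightarrow> \<exists>i<n. x = v * t ^ i"
  by (metis in_set_conv_nth length_strg strg_nth)

lemma strg_nonzero: "v \<noteq> 0 \<Longrightarrow> t \<noteq> 0 \<Longrightarrow> 0 \<notin> set (strg v t n)"
  using strg_elem[of 0 v t n] by auto

lemma prod_strg: "(\<Prod>x\<leftarrow>strg v t n. g x) = (\<Prod>i<n. g (v * t ^ i))"
  by (induction n arbitrary: v) (auto simp: prod.lessThan_Suc_shift mult_ac simp del: prod.lessThan_Suc)

lemma strg_snoc: "strg v t (Suc n) = strg v t n @ [v * t ^ n]"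
proof (induction n arbitrary: v)
  case (Suc n)
  have "strg v t (Suc (Suc n)) = v # strg (v * t) t (Suc n)" by (rule strg.simps(2))
  also have "strg (v * t) t (Suc n) = strg (v * t) t n @ [v * t * t ^ n]" by (rule Suc.IH)
  finally show ?case by (simp add: mult.assoc)
qed simp

lemma apt_elem: "x \<in> set (apt b q t ks) \<Longrightarrow> \<exists>i<length ks. x = b * q ^ (ks ! i) * t ^ i"
proof (induction ks arbitrary: b)
  case (Cons k ks)
  show ?case
  proof (cases "x = b * q ^ k")
    case True thus ?thesis by (intro exI[of _ 0]) auto
  next
    case False
    then obtain i where "i < length ks" "x = b * t * q ^ (ks ! i) * t ^ i" using Cons by auto
    thus ?thesis by (intro exI[of _ "Suc i"]) (auto simp: mult_ac)
  qed
qed auto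

section \<open>Zeros of the principal specialisation\<close>

context nome
begin

lemma ok_strg:
  assumes "c \<noteq> 0" "t \<noteq> 0" "\<And>i. i \<le> 2 * n \<Longrightarrow> th (c\<^sup>2 * t ^ i) \<noteq> 0" "\<And>i. 0 < i \<Longrightarrow> i \<le> n \<Longrightarrow> th (t ^ i) \<noteq> 0"
  shows "ok (strg c t n)"
  using assms
proof (induction n arbitrary: c)
  case (Suc n)
  have "th ((c * t)\<^sup>2 * t ^ i) \<noteq> 0" if "i \<le> 2 * n" for i
    using Suc.prems(3)[of "Suc (Suc i)"] that by (simp add: power2_eq_square mult_ac)
  hence "ok (strg (c * t) t n)" using Suc.prems by (intro Suc.IH) auto
  moreover have "kern c y \<noteq> 0" if y: "y \<in> set (strg (c * t) t n)" for y
  proof -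
    obtain i where i: "i < n" "y = c * t * t ^ i" using strg_elem[OF y] by blast
    have "th (c * y) \<noteq> 0" using Suc.prems(3)[of "Suc i"] i by (simp add: power2_eq_square mult_ac)
    moreover have "th (1 / (t * t ^ i)) \<noteq> 0" using Suc.prems(2) Suc.prems(4)[of "Suc i"] i(1) by (subst th_inverse_0_iff) auto
    hence "th (c / y) \<noteq> 0" using i Suc.prems(1) by simp
    ultimately show ?thesis by (simp add: kern_def)
  qed
  ultimately show ?case using Suc.prems(1) Suc.prems(3)[of 0] by simp
qed auto

text \<open>Both parameters are multiplied by a square root of \<open>q\<close>: their products move
  by \<open>q\<close> and their quotient not at all, so only 1 is spent.\<close>

lemma gen_shift_r:
  assumes g: "gen (Suc M) a b q t" and r: "q = r\<^sup>2"
  shows "gen M (r * a) (r * b) q t"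
proof -
  note G = gen_dest[OF g]
  have r0: "r \<noteq> 0" using G(10) r by auto
  have "ng M q t ((r * a)\<^sup>2)" by (rule ng_shift[OF G(4,3), where k = 1 and l = 0]) (auto simp: r power_mult_distrib)
  moreover have "ng M q t ((r * b)\<^sup>2)" by (rule ng_shift[OF G(5,3), where k = 1 and l = 0]) (auto simp: r power_mult_distrib)
  moreover have "ng M q t ((r * a) * (r * b))" by (rule ng_shift[OF G(6,3), where k = 1 and l = 0]) (auto simp: r power2_eq_square mult_ac)
  moreover have "ng M q t ((r * a) / (r * b))" using ng_mono[OF G(8), of M] r0 by simp
  ultimately show ?thesis using G(1,2) r0 gq_mono[OF G(3), of M] by (simp add: gen_def)
qed

definition psi :: "complex \<Rightarrow> complex \<Rightarrow> complex \<Rightarrow> complex \<Rightarrow> bool list \<Rightarrow> complex \<Rightarrow> complex"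
  where "psi a b q t w v = P a b q t w (strg v t (nR w))"

text \<open>The parameter \<open>c\<close> of the operator is taken as the start of the progression,
  where the operator reduces to one term; \<open>d\<close> is what the balancing condition then
  forces.\<close>

lemma psi_eigen:
  assumes g: "gen (Suc M) a b q t" "2 * length w \<le> M" and r: "q = r\<^sup>2" and c: "c \<noteq> 0"
    and d: "d = p * t / (a * b * c * t ^ nR w * q ^ nC w)" and o: "ok (strg c t (nR w))"
  shows "(\<Prod>x\<leftarrow>pts a q t w. th (x * b) * th (x * c) * th (x * d)) * psi a b q t w c =
    (\<Prod>i<nR w. th (c * t ^ i * a) * th (c * t ^ i * b) * th (c * t ^ i * d)) * psi (r * a) (r * b) q t w (r * c)"
proof -
  note G = gen_dest[OF g(1)]
  have g': "gen M a b q t" using gen_mono[OF g(1)] by simp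
  have gr: "gen M (r * a) (r * b) q t" by (rule gen_shift_r[OF g(1) r])
  have "d \<noteq> 0" "a * b * c * d * t ^ nR w * q ^ nC w = p * t" using G c by (auto simp: d)
  from D_IntN[OF g' gr g(2) c this(1) r this(2) P_IntN[OF gr g(2)] P_IntN[OF g' g(2)] _ o]
    D_string[OF o, of a b d r "P (r * a) (r * b) q t w"]
  show ?thesis by (simp add: psi_def)
qed

lemma ngD_diff:
  assumes "ng M q t x" "gq K q t" "i \<le> M" "i' \<le> M" "j \<le> M" "j' \<le> M"
  shows "th (q ^ i * t ^ j * x / (q ^ i' * t ^ j')) \<noteq> 0"
proof -
  have "th (q powi (int i - int i') * t powi (int j - int j') * x) \<noteq> 0"
    using assms by (intro ngD[OF assms(1)]) auto
  thus ?thesis using gq_nz[OF assms(2)] by (simp add: power_int_diff mult_ac)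
qed

lemma gqD_diff:
  assumes "gq M q t" "i \<le> M" "i' \<le> M" "j \<le> M" "j' \<le> M" "i \<noteq> i' \<or> j \<noteq> j'"
  shows "th (q ^ i * t ^ j / (q ^ i' * t ^ j')) \<noteq> 0"
proof -
  have "th (q powi (int i - int i') * t powi (int j - int j')) \<noteq> 0"
    using assms by (intro gqD[OF assms(1)]) auto
  thus ?thesis using gq_nz[OF assms(1)] by (simp add: power_int_diff mult_ac)
qed

text \<open>Every box yields a zero, by induction on its column. In the eigenvalue equation at
  \<open>c = 1 / (e * q ^ j * t ^ s)\<close> the right-hand side is 0: for \<open>j = 0\<close> by
  the factor with \<open>i = s\<close>, otherwise because \<open>r * c\<close> is the point of
  column \<open>j - 1\<close> for the parameters \<open>r * a\<close>, \<open>r * b\<close>. The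
  eigenvalue is nonzero because the box lies in the diagram (\<open>e = a\<close>) or in its
  complement (\<open>e = b\<close>).\<close>

lemma psi_zero:
  assumes g: "gen M a b q t" "4 * length w + 4 + j \<le> M" and s: "s < nR w"
    and e: "(e = a \<and> j < exps w ! s) \<or> (e = b \<and> j < exps (rev w) ! s)"
  shows "psi a b q t w (1 / (e * q ^ j * t ^ s)) = 0"
  using g e
proof (induction j arbitrary: a b e M)
  \<comment> \<open>The induction step for all parameters at once, since it is used at
    \<open>a\<close>, \<open>b\<close> with a premise at \<open>r * a\<close>, \<open>r * b\<close>;
    the assumption \<open>0\<close> stands for the induction hypothesis.\<close>
  have step: "psi a b q t w (1 / (e * q ^ j * t ^ s)) = 0"
    if g: "gen M a b q t" "4 * length w + 4 + j \<le> M"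
      and e: "(e = a \<and> j < exps w ! s) \<or> (e = b \<and> j < exps (rev w) ! s)"
      and r: "q = r\<^sup>2" and 0: "j = 0 \<or> psi (r * a) (r * b) q t w (r * (1 / (e * q ^ j * t ^ s))) = 0"
    for a b e M j r
  proof -
    note G = gen_dest[OF g(1)]
    define c where "c = 1 / (e * q ^ j * t ^ s)"
    have e0: "e \<noteq> 0" and ng: "ng M q t (e\<^sup>2)" using e G by auto
    have c0: "c \<noteq> 0" using e0 G by (simp add: c_def)
    have jm: "j < nC w" using e exps_nth_le[OF s] exps_nth_le[of s "rev w"] s by auto
    have lw: "length w = nC w + nR w" by (rule length_word)
    have o: "ok (strg c t (nR w))"
    proof (rule ok_strg[OF c0 G(11)])
      fix i assume "i \<le> 2 * nR w"
      hence "th (q ^ 0 * t ^ i * (1 / e\<^sup>2) / (q ^ (2 * j) * t ^ (2 * s))) \<noteq> 0"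
        using g(2) jm s lw by (intro ngD_diff[OF ng_inverse[OF ng G(3)] G(3)]) auto
      moreover have "q ^ 0 * t ^ i * (1 / e\<^sup>2) / (q ^ (2 * j) * t ^ (2 * s)) = c\<^sup>2 * t ^ i"
        by (simp add: c_def power_divide power_mult_distrib power_mult power2_eq_square mult_ac)
      ultimately show "th (c\<^sup>2 * t ^ i) \<noteq> 0" by simp
    next
      fix i assume "0 < i" "i \<le> nR w"
      thus "th (t ^ i) \<noteq> 0" using gqD_nat[OF G(3), of 0 i] g(2) lw by simp
    qed
    define d where "d = p * t / (a * b * c * t ^ nR w * q ^ nC w)"
    have "th (x * b) * th (x * c) * th (x * d) \<noteq> 0" if x: "x \<in> set (pts a q t w)" for x
    proof -
      obtain s' where s': "s' < nR w" and xe: "x = a * q ^ (exps w ! s') * t ^ s'"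
        using apt_elem[of x a q t "exps w"] x by (auto simp: pts_eq_apt)
      define k where "k = exps w ! s'"
      have k: "k \<le> nC w" unfolding k_def by (rule exps_nth_le[OF s'])
      have "th (q ^ k * t ^ s' * (a * b)) \<noteq> 0" using k s' g(2) lw by (intro ngD_nat[OF G(6)]) auto
      hence 1: "th (x * b) \<noteq> 0" by (simp add: xe k_def mult_ac)
      have 2: "th (x * c) \<noteq> 0"
      proof (cases "e = a \<and> j < exps w ! s")
        case True
        hence "th (q ^ k * t ^ s' / (q ^ j * t ^ s)) \<noteq> 0"
          using k s' s jm g(2) lw by (intro gqD_diff[OF G(3)]) (auto simp: k_def)
        moreover have "q ^ k * t ^ s' / (q ^ j * t ^ s) = x * c" using True G by (simp add: xe c_def k_def)
        ultimately show ?thesis by simp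
      next
        case False
        hence "e = b" using e by blast
        have "th (q ^ k * t ^ s' * (a / b) / (q ^ j * t ^ s)) \<noteq> 0"
          using k s' s jm g(2) lw by (intro ngD_diff[OF G(8,3)]) auto
        moreover have "q ^ k * t ^ s' * (a / b) / (q ^ j * t ^ s) = x * c"
          using G by (simp add: xe c_def k_def \<open>e = b\<close> field_simps)
        ultimately show ?thesis by simp
      qed
      \<comment> \<open>For \<open>e = b\<close> the quotient is a monomial in \<open>q\<close> and
        \<open>t\<close>. It could be trivial only if row \<open>nR w - 1 - s\<close> of
        \<open>w\<close> had \<open>nC w - j\<close> boxes; then row \<open>s\<close> of the
        complement would have just \<open>j\<close> boxes and could not contain column
        \<open>j\<close>.\<close>
      have xd: "x * d = p * (q ^ (k + j) * t ^ (s' + s + 1) * (e / b) / (q ^ nC w * t ^ nR w))"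
        using G e0 by (simp add: xe d_def c_def k_def power_add field_simps)
      have "th (q ^ (k + j) * t ^ (s' + s + 1) * (e / b) / (q ^ nC w * t ^ nR w)) \<noteq> 0"
      proof (cases "e = b \<and> j < exps (rev w) ! s")
        case True
        have "k + j \<noteq> nC w \<or> s' + s + 1 \<noteq> nR w"
        proof (rule ccontr)
          assume "\<not> ?thesis"
          hence "k + j = nC w" "s' = nR w - 1 - s" by auto
          moreover from this have "j < nC w - k" using True exps_rev_nth[OF s] by (simp add: k_def)
          ultimately show False by linarith
        qed
        hence "th (q ^ (k + j) * t ^ (s' + s + 1) / (q ^ nC w * t ^ nR w)) \<noteq> 0"
          using k s' s jm g(2) lw by (intro gqD_diff[OF G(3)]) auto
        thus ?thesis using True G by simp
      next
        case False
        hence "e = a" using e by blast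
        show ?thesis unfolding \<open>e = a\<close>
          by (rule ngD_diff[OF G(8,3)]) (use k s' s jm g(2) lw in auto)
      qed
      hence "th (x * d) \<noteq> 0" unfolding xd using G e0 by (subst th_p_mult_0_iff) auto
      with 1 2 show ?thesis by simp
    qed
    hence E: "(\<Prod>x\<leftarrow>pts a q t w. th (x * b) * th (x * c) * th (x * d)) \<noteq> 0"
      by (auto simp: prod_list_zero_iff)
    have M1: "Suc (M - 1) = M" "2 * length w \<le> M - 1" using g(2) by auto
    have "(\<Prod>x\<leftarrow>pts a q t w. th (x * b) * th (x * c) * th (x * d)) * psi a b q t w c =
      (\<Prod>i<nR w. th (c * t ^ i * a) * th (c * t ^ i * b) * th (c * t ^ i * d)) * psi (r * a) (r * b) q t w (r * c)"
      by (rule psi_eigen[OF _ M1(2) r c0 d_def o]) (use g(1) M1 in simp)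
    also have "\<dots> = 0"
    proof (cases "j = 0")
      case True
      have "c * t ^ s * e = 1" using True e0 G by (simp add: c_def)
      hence "th (c * t ^ s * a) * th (c * t ^ s * b) * th (c * t ^ s * d) = 0" using e by auto
      hence "(\<Prod>i<nR w. th (c * t ^ i * a) * th (c * t ^ i * b) * th (c * t ^ i * d)) = 0"
        using s by (intro prod_zero) auto
      thus ?thesis by simp
    next
      case False thus ?thesis using 0 by (simp add: c_def)
    qed
    finally show ?thesis using E by (simp add: c_def)
  qed
  {
    case (0 a b e M)
    obtain r where r: "q = r\<^sup>2" by (metis power2_csqrt)
    show ?case by (rule step[OF 0 r]) simp
  next
    case (Suc j a b e M)
    obtain r where r: "q = r\<^sup>2" by (metis power2_csqrt)
    note G = gen_dest[OF Suc.prems(1)]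
    have r0: "r \<noteq> 0" using G(10) r by auto
    have M1: "Suc (M - 1) = M" "4 * length w + 4 + j \<le> M - 1" using Suc.prems(2) by auto
    have "psi (r * a) (r * b) q t w (1 / (r * e * q ^ j * t ^ s)) = 0"
      by (rule Suc.IH[OF gen_shift_r[of "M - 1", OF _ r] M1(2)]) (use Suc.prems M1 in auto)
    moreover have "1 / (r * e * q ^ j * t ^ s) = r * (1 / (e * q ^ Suc j * t ^ s))"
      using r0 by (simp add: r power2_eq_square field_simps)
    ultimately show ?case by (intro step[OF Suc.prems r]) simp
  }
qed

end

lemma map_strg: "map ((*) c) (strg v t n) = strg (c * v) t n"
  by (induction n arbitrary: v) (auto simp: mult_ac)

lemma apt_replicate: "apt b q t (replicate n k) = strg (b * q ^ k) t n"
  by (induction n arbitrary: b) (auto simp: mult_ac)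

lemma prod_power_double: "(\<Prod>i<Suc n. (t :: complex) ^ (2 * i)) = t ^ (Suc n * n)"
proof (induction n)
  case (Suc n)
  have "(\<Prod>i<Suc (Suc n). t ^ (2 * i)) = t ^ (Suc n * n) * t ^ (2 * Suc n)"
    unfolding prod.lessThan_Suc[of _ "Suc n"] Suc ..
  also have "\<dots> = t ^ (Suc (Suc n) * Suc n)"
    unfolding power_add[symmetric] by (rule arg_cong[of _ _ "(^) t"]) simp
  finally show ?case .
qed simp

lemma strg_inverse:
  assumes "v \<noteq> 0" "t \<noteq> 0"
  shows "list_all2 eqinv (rev (strg (1 / (v * t ^ n)) t (Suc n))) (strg v t (Suc n))"
  unfolding list_all2_conv_all_nth
proof (intro conjI allI impI)
  fix i assume "i < length (rev (strg (1 / (v * t ^ n)) t (Suc n)))"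
  hence i: "i < Suc n" by simp
  have "rev (strg (1 / (v * t ^ n)) t (Suc n)) ! i = strg (1 / (v * t ^ n)) t (Suc n) ! (n - i)"
    using i by (subst rev_nth) (auto simp del: strg.simps)
  also have "\<dots> = 1 / (v * t ^ n) * t ^ (n - i)" by (rule strg_nth) simp
  also have "\<dots> = 1 / (v * t ^ i)"
  proof -
    have "t ^ n = t ^ (n - i) * t ^ i" using i by (simp flip: power_add)
    thus ?thesis using assms by simp
  qed
  finally show "eqinv (rev (strg (1 / (v * t ^ n)) t (Suc n)) ! i) (strg v t (Suc n) ! i)"
    using strg_nth[OF i, of v t] by simp
qed simp

context nome
begin

lemma W_p_mult_all:
  assumes "W n m f" "length xs = n" "0 \<notin> set xs"
  shows "f (map ((*) p) xs) * (\<Prod>x\<leftarrow>xs. (p * x\<^sup>2) ^ m) = f xs"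
  using assms
proof (induction n arbitrary: f xs)
  case (Suc n)
  obtain x ys where xs: "xs = x # ys" using Suc.prems(2) by (cases xs) auto
  have x: "x \<noteq> 0" "0 \<notin> set ys" "length ys = n" using Suc.prems xs by auto
  have "V m (\<lambda>z. f (z # map ((*) p) ys))" by (rule W_head[OF Suc.prems(1)]) (use x in auto)
  from V_p_mult[OF this x(1)] have 1: "f (p * x # map ((*) p) ys) * (p * x\<^sup>2) ^ m = f (x # map ((*) p) ys)" .
  have 2: "f (x # map ((*) p) ys) * (\<Prod>x\<leftarrow>ys. (p * x\<^sup>2) ^ m) = f (x # ys)"
    by (rule Suc.IH[OF W_restrict[OF Suc.prems(1) x(1)] x(3,2)])
  show ?case unfolding xs using 1 2 by (simp add: mult.assoc[symmetric])
qed auto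

lemma ok_map:
  assumes "distinct ps" "\<And>x. x \<in> set ps \<Longrightarrow> g x \<noteq> 0 \<and> th ((g x)\<^sup>2) \<noteq> 0"
    and "\<And>x y. x \<in> set ps \<Longrightarrow> y \<in> set ps \<Longrightarrow> x \<noteq> y \<Longrightarrow> kern (g x) (g y) \<noteq> 0"
  shows "ok (map g ps)"
  using assms by (induction ps) auto

text \<open>The product of the two \<open>C0\<close> symbols of the normalisation (see
  \<open>psi0_C0\<close>), written over boxes so that each box exhibits its zero.\<close>

definition psi0 :: "complex \<Rightarrow> complex \<Rightarrow> complex \<Rightarrow> complex \<Rightarrow> bool list \<Rightarrow> complex \<Rightarrow> complex"
  where "psi0 a b q t w v =
    prodB w (\<lambda>j s. th (a * q ^ j * t ^ s * v) * th (a * q ^ j * t ^ s / (t ^ (nR w - 1) * v))) *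
    prodB (rev w) (\<lambda>j s. th (b * q ^ j * t ^ s * v) * th (b * q ^ j * t ^ s / (t ^ (nR w - 1) * v)))"

text \<open>With \<open>\<tau>\<^sup>2 = t ^ n\<close> the progression is centred, and inverting
  \<open>u\<close> inverts and reverses it. Its \<open>n + 1\<close> entries contribute
  \<open>nC w\<close> each to the degree, and the powers of \<open>t\<close> in their multipliers
  are absorbed by \<tau>.\<close>

lemma psi_V:
  assumes g: "gen M a b q t" "2 * length w \<le> M" and n: "nR w = Suc n" and \<tau>: "\<tau>\<^sup>2 = t ^ n"
  shows "V (nC w * nR w) (\<lambda>u. psi a b q t w (u / \<tau>))"
  unfolding V_def
proof (intro conjI allI impI)
  note G = gen_dest[OF g(1)]
  have \<tau>0: "\<tau> \<noteq> 0" using \<tau> G(11) by auto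
  have W: "W (Suc n) (nC w) (P a b q t w)" using IntN_W[OF P_IntN[OF g]] G n by simp
  have lw: "2 * (nC w + Suc n) \<le> M" using g(2) n length_word[of w] by simp
  obtain \<gamma> where \<gamma>: "\<And>xs. length xs = Suc n \<Longrightarrow> 0 \<notin> set xs \<Longrightarrow>
      P a b q t w xs = (\<Sum>v\<in>words (nC w) (Suc n). \<gamma> v * KK xs (pts a t q (map Not v)))"
    using W_expand[OF G(3,4) lw W] by blast
  show "(\<lambda>u. psi a b q t w (u / \<tau>)) holomorphic_on - {0}"
  proof (rule holomorphic_transform)
    show "(\<lambda>u. \<Sum>v\<in>words (nC w) (Suc n). \<gamma> v * (\<Prod>i<Suc n. \<Prod>y\<leftarrow>pts a t q (map Not v). kern y (u / \<tau> * t ^ i))) holomorphic_on - {0}"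
    proof (intro holomorphic_intros holomorphic_on_prod_list)
      fix v y assume "y \<in> set (pts a t q (map Not v))"
      thus "y \<noteq> 0" using pts_nonzero[OF G(1,11,10)] by metis
    qed (use \<tau>0 G in auto)
    fix u :: complex assume "u \<in> - {0}"
    hence "0 \<notin> set (strg (u / \<tau>) t (Suc n))" using \<tau>0 G by (intro strg_nonzero) auto
    thus "(\<Sum>v\<in>words (nC w) (Suc n). \<gamma> v * (\<Prod>i<Suc n. \<Prod>y\<leftarrow>pts a t q (map Not v). kern y (u / \<tau> * t ^ i))) =
        psi a b q t w (u / \<tau>)"
      using \<gamma>[of "strg (u / \<tau>) t (Suc n)"] unfolding psi_def n KK_def prod_strg by simp
  qed
  fix u :: complex assume u: "u \<noteq> 0"
  define v where "v = u / \<tau>"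
  have v0: "v \<noteq> 0" using u \<tau>0 by (simp add: v_def)
  have nz: "0 \<notin> set (strg x t (Suc n))" if "x \<noteq> 0" for x using that G by (intro strg_nonzero) auto
  have "v * t ^ n = u * \<tau>" unfolding \<tau>[symmetric] using \<tau>0 by (simp add: v_def power2_eq_square)
  hence e: "1 / u / \<tau> = 1 / (v * t ^ n)" by simp
  have "P a b q t w (strg (1 / (v * t ^ n)) t (Suc n)) = P a b q t w (rev (strg (1 / (v * t ^ n)) t (Suc n)))"
    using v0 G by (intro W_mset[OF W, symmetric] nz length_strg) auto
  also have "\<dots> = P a b q t w (strg v t (Suc n))"
    by (rule W_eqinv[OF W strg_inverse[OF v0 G(11)] _ nz[OF v0]]) (simp only: length_rev length_strg)
  finally show "psi a b q t w (1 / u / \<tau>) = psi a b q t w (u / \<tau>)"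
    unfolding psi_def n e v_def .
  have 1: "P a b q t w (map ((*) p) (strg v t (Suc n))) * (\<Prod>x\<leftarrow>strg v t (Suc n). (p * x\<^sup>2) ^ nC w) = P a b q t w (strg v t (Suc n))"
    by (rule W_p_mult_all[OF W length_strg nz[OF v0]])
  have "(\<Prod>x\<leftarrow>strg v t (Suc n). (p * x\<^sup>2) ^ nC w) = (\<Prod>i<Suc n. (p * v\<^sup>2) * t ^ (2 * i)) ^ nC w"
    unfolding prod_strg prod_power_distrib
    by (rule prod.cong) (auto simp: power_mult_distrib power_mult mult_ac power_even_eq)
  also have "(\<Prod>i<Suc n. (p * v\<^sup>2) * t ^ (2 * i)) = (p * v\<^sup>2) ^ Suc n * t ^ (Suc n * n)"
    unfolding prod.distrib prod_power_double by (simp only: prod_constant card_lessThan power_mult_distrib)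
  also have "t ^ (Suc n * n) = (t ^ n) ^ Suc n"
    unfolding power_mult[symmetric] by (simp only: mult.commute)
  also have "(p * v\<^sup>2) ^ Suc n * (t ^ n) ^ Suc n = (p * v\<^sup>2 * t ^ n) ^ Suc n"
    by (rule power_mult_distrib[symmetric])
  also have "p * v\<^sup>2 * t ^ n = p * u\<^sup>2"
    unfolding \<tau>[symmetric] v_def using \<tau>0 by (simp add: power_divide)
  finally have 2: "(\<Prod>x\<leftarrow>strg v t (Suc n). (p * x\<^sup>2) ^ nC w) = (p * u\<^sup>2) ^ (nC w * nR w)"
    by (simp only: power_mult[symmetric] n mult.commute)
  have "strg (p * u / \<tau>) t (Suc n) = map ((*) p) (strg v t (Suc n))"
    unfolding map_strg v_def by (simp only: times_divide_eq_right)
  thus "psi a b q t w (p * u / \<tau>) * (p * u\<^sup>2) ^ (nC w * nR w) = psi a b q t w (u / \<tau>)"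
    using 1[unfolded 2] unfolding psi_def n v_def by (simp del: strg.simps)
qed

text \<open>The boxes of \<open>w\<close> and \<open>rev w\<close> give \<open>nC w * nR w\<close>
  independent zeros, which equals the degree, so only a constant is free.\<close>

lemma psi_proportional:
  assumes g: "gen M a b q t" "6 * length w + 4 \<le> M"
  shows "\<exists>C. \<forall>v. v \<noteq> 0 \<longrightarrow> psi a b q t w v = C * psi0 a b q t w v"
proof (cases "nR w")
  case 0
  have "bxw w = []" "bxw (rev w) = []" using length_bxw_rev[of w] 0 by auto
  thus ?thesis using 0 by (auto simp: psi_def psi0_def prodB_def)
next
  case (Suc n)
  note G = gen_dest[OF g(1)]
  obtain \<tau> where \<tau>: "\<tau>\<^sup>2 = t ^ n" by (metis power2_csqrt)
  have \<tau>0: "\<tau> \<noteq> 0" using \<tau> G(11) by auto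
  have lw: "length w = nC w + nR w" by (rule length_word)
  define F where "F u = psi a b q t w (u / \<tau>)" for u
  have V: "V (nC w * nR w) F" unfolding F_def by (rule psi_V[OF g(1) _ Suc \<tau>]) (use g(2) in simp)
  define ps where "ps = map Inl (bxw w) @ map Inr (bxw (rev w))"
  define z where "z x = (case x of Inl (j, s) \<Rightarrow> a * q ^ j * t ^ s / \<tau> | Inr (j, s) \<Rightarrow> b * q ^ j * t ^ s / \<tau>)" for x
  have jm: "j < nC w" if "(j, s) \<in> set (bxw w) \<or> (j, s) \<in> set (bxw (rev w))" for j s
    using that exps_nth_le[of s w] exps_nth_le[of s "rev w"] by (auto simp: set_bxw)
  have sn: "s < nR w" if "(j, s) \<in> set (bxw w) \<or> (j, s) \<in> set (bxw (rev w))" for j s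
    using that by (auto simp: set_bxw)
  have zz: "\<exists>e j s. (e = a \<or> e = b) \<and> j < nC w \<and> s < nR w \<and> z x = e * q ^ j * t ^ s / \<tau> \<and>
      (e = a \<and> x = Inl (j, s) \<and> (j, s) \<in> set (bxw w) \<or> e = b \<and> x = Inr (j, s) \<and> (j, s) \<in> set (bxw (rev w)))"
    if "x \<in> set ps" for x
    using that jm sn unfolding ps_def z_def by (force split: sum.splits)
  have q2: "(e * q ^ j * t ^ s / \<tau>) * (e' * q ^ j' * t ^ s' / \<tau>) = q ^ (j + j') * t ^ (s + s') * (e * e') / (q ^ 0 * t ^ n)"
    for e e' j j' s s'
    using \<tau>0 unfolding \<tau>[symmetric] by (simp add: power_add power2_eq_square mult_ac)
  have qd: "(e * q ^ j * t ^ s / \<tau>) / (e' * q ^ j' * t ^ s' / \<tau>) = q ^ j * t ^ s * (e / e') / (q ^ j' * t ^ s')"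
    for e e' j j' s s'
    using \<tau>0 by (simp add: field_simps)
  have ee: "ng M q t (e * e')" if "e = a \<or> e = b" "e' = a \<or> e' = b" for e e'
    using that G by (auto simp: power2_eq_square)
  have "ok (map z ps)"
  proof (rule ok_map)
    show "distinct ps" unfolding ps_def by (auto simp: distinct_map distinct_bxw)
  next
    fix x assume "x \<in> set ps"
    from zz[OF this] obtain e j s where x: "e = a \<or> e = b" "j < nC w" "s < nR w" "z x = e * q ^ j * t ^ s / \<tau>" by blast
    have "th (q ^ (j + j) * t ^ (s + s) * (e * e) / (q ^ 0 * t ^ n)) \<noteq> 0"
      by (rule ngD_diff[OF ee G(3)]) (use x g(2) lw Suc in auto)
    hence "th ((z x)\<^sup>2) \<noteq> 0" unfolding x power2_eq_square q2 .
    moreover have "z x \<noteq> 0" using x G \<tau>0 by auto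
    ultimately show "z x \<noteq> 0 \<and> th ((z x)\<^sup>2) \<noteq> 0" by blast
  next
    fix x y assume "x \<in> set ps" "y \<in> set ps" and xy: "x \<noteq> y"
    from zz[OF this(1)] zz[OF this(2)] obtain e j s e' j' s' where
      x: "e = a \<or> e = b" "j < nC w" "s < nR w" "z x = e * q ^ j * t ^ s / \<tau>"
        "e = a \<and> x = Inl (j, s) \<or> e = b \<and> x = Inr (j, s)" and
      y: "e' = a \<or> e' = b" "j' < nC w" "s' < nR w" "z y = e' * q ^ j' * t ^ s' / \<tau>"
        "e' = a \<and> y = Inl (j', s') \<or> e' = b \<and> y = Inr (j', s')" by blast
    have "th (q ^ (j + j') * t ^ (s + s') * (e * e') / (q ^ 0 * t ^ n)) \<noteq> 0"
      by (rule ngD_diff[OF ee G(3)]) (use x y g(2) lw Suc in auto)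
    hence 1: "th (z x * z y) \<noteq> 0" unfolding x(4) y(4) q2 .
    have "th (q ^ j * t ^ s * (e / e') / (q ^ j' * t ^ s')) \<noteq> 0"
    proof (cases "e = e'")
      case True
      have ab: "a \<noteq> b"
      proof
        assume "a = b"
        hence "th 1 \<noteq> 0" using ngD_nat[OF G(8), of 0 0] G by simp
        thus False by simp
      qed
      have "j \<noteq> j' \<or> s \<noteq> s'" using x(5) y(5) xy True ab by auto
      hence "th (q ^ j * t ^ s / (q ^ j' * t ^ s')) \<noteq> 0"
        by (intro gqD_diff[OF G(3)]) (use x y g(2) lw in auto)
      moreover have "e' \<noteq> 0" using y(1) G by auto
      ultimately show ?thesis using True by simp
    next
      case False
      hence "ng M q t (e / e')" using x(1) y(1) G by auto
      thus ?thesis by (rule ngD_diff[OF _ G(3)]) (use x y g(2) lw in auto)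
    qed
    hence "th (z x / z y) \<noteq> 0" unfolding x(4) y(4) qd .
    thus "kern (z x) (z y) \<noteq> 0" using 1 by (simp add: kern_def)
  qed
  moreover have "F y = 0" if y: "y \<in> set (map z ps)" for y
  proof -
    obtain x where "x \<in> set ps" "y = z x" using y by auto
    with zz obtain e j s where x: "j < nC w" "s < nR w" "y = e * q ^ j * t ^ s / \<tau>"
      "e = a \<and> (j, s) \<in> set (bxw w) \<or> e = b \<and> (j, s) \<in> set (bxw (rev w))" by metis
    have e0: "e \<noteq> 0" using x(4) G by auto
    have "F y = F (1 / y)" using V_inverse[OF V, of y] x e0 G \<tau>0 by simp
    also have "\<dots> = psi a b q t w (1 / (e * q ^ j * t ^ s))"
      using \<tau>0 by (simp add: F_def x(3))
    also have "\<dots> = 0"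
      by (rule psi_zero[OF g(1) _ x(2)]) (use x g(2) lw in \<open>auto simp: set_bxw\<close>)
    finally show ?thesis .
  qed
  moreover have "length (map z ps) = nC w * nR w" using length_bxw_rev[of w] by (simp add: ps_def)
  ultimately obtain C where C: "\<And>u. u \<noteq> 0 \<Longrightarrow> F u = C * (\<Prod>y\<leftarrow>map z ps. kern y u)"
    using V_zeros[of "map z ps" F] V by auto
  have "psi a b q t w v = C * psi0 a b q t w v" if v: "v \<noteq> 0" for v
  proof -
    have k: "kern (e / \<tau>) (v * \<tau>) = th (e * v) * th (e / (t ^ n * v))" for e
      using \<tau>0 unfolding kern_def \<tau>[symmetric] by (simp add: power2_eq_square mult_ac)
    have "psi a b q t w v = F (v * \<tau>)" using \<tau>0 by (simp add: F_def)
    also have "\<dots> = C * (\<Prod>y\<leftarrow>map z ps. kern y (v * \<tau>))" using C v \<tau>0 by simp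
    also have "(\<Prod>y\<leftarrow>map z ps. kern y (v * \<tau>)) = psi0 a b q t w v"
      by (simp add: ps_def psi0_def prodB_def Suc z_def o_def case_prod_beta k)
    finally show ?thesis .
  qed
  thus ?thesis by blast
qed

text \<open>The quotient of the two scalings for \<open>True # w\<close> and \<open>w\<close>; it comes from evaluating the interpolation
  function of \<open>True # w\<close> at \<open>z\<close> followed by a geometric progression, which as a function of \<open>z\<close> has
  the zeros \<open>b * q ^ k\<close>, both at \<open>z = a\<close> and where \<open>z\<close> continues the progression.\<close>

definition kap :: "complex \<Rightarrow> complex \<Rightarrow> complex \<Rightarrow> complex \<Rightarrow> bool list \<Rightarrow> complex"
  where "kap a b q t w = (\<Prod>k<nC w. th (a * b * q ^ k) * th (q ^ (nC w - 1 - k) * t ^ (hts w ! k) * b / a) *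
    th (q ^ k * t ^ (Suc (nR w) - hts w ! k)) / th (q ^ k * t ^ Suc (nR w)))"

text \<open>Only \<open>True\<close> steps contribute, since a \<open>False\<close> step changes
  both scalings by the same factor (see \<open>psi0_False\<close>).\<close>

fun gam :: "complex \<Rightarrow> complex \<Rightarrow> complex \<Rightarrow> complex \<Rightarrow> bool list \<Rightarrow> complex" where
  "gam a b q t [] = 1"
| "gam a b q t (True # w) = kap a b q t w * gam (a * t) b q t w"
| "gam a b q t (False # w) = gam (a * q) b q t w"

lemma prod_reverse: "(\<Prod>k<m. f (m - 1 - k)) = (\<Prod>k<m. f k)" for f :: "nat \<Rightarrow> complex"
  using prod.nat_diff_reindex[of f m] by simp

lemma psi0_False:
  "v \<noteq> 0 \<Longrightarrow> t \<noteq> 0 \<Longrightarrow> psi0 a b q t (False # w) v = (\<Prod>i<nR w. kern a (v * t ^ i)) * psi0 (a * q) b q t w v"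
proof -
  assume nz: "v \<noteq> 0" "t \<noteq> 0"
  have "(\<Prod>i<nR w. th (a / (v * t ^ i))) = (\<Prod>i<nR w. th (a / (v * t ^ (nR w - 1 - i))))"
    by (rule prod_reverse[symmetric])
  also have "\<dots> = (\<Prod>i<nR w. th (a * t ^ i / (t ^ (nR w - 1) * v)))"
  proof (rule prod.cong[OF refl])
    fix i assume "i \<in> {..<nR w}"
    hence "t ^ (nR w - 1) = t ^ (nR w - 1 - i) * t ^ i" by (simp flip: power_add)
    thus "th (a / (v * t ^ (nR w - 1 - i))) = th (a * t ^ i / (t ^ (nR w - 1) * v))"
      using nz by (simp add: mult_ac)
  qed
  finally have 1: "(\<Prod>i<nR w. th (a / (v * t ^ i))) = (\<Prod>i<nR w. th (a * t ^ i / (t ^ (nR w - 1) * v)))" .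
  show ?thesis
    by (simp add: psi0_def prodB_False prodB_snoc_False kern_def prod.distrib 1 mult_ac)
qed

lemma th_inv_mult:
  assumes "x \<noteq> 0" "y \<noteq> 0"
  shows "th (1 / x) * th (1 / y) = th x * th y / (x * y)"
  using th_inverse[of x] th_inverse[of y] assms by simp

text \<open>The first theta factors of the boxes agree on both sides (\<open>E\<close>), apart from
  the row added to the complement. The second ones are shifted by one row and telescope in every
  column, for the diagram (\<open>T1\<close>) and its complement (\<open>T2\<close>). The end terms
  are the factors of \<open>kap\<close> and of the kernels.\<close>

lemma kap_eq:
  assumes g: "gen M a b q t" "length w + 1 \<le> M" and m: "nC w = Suc m"
    and v: "v = b * t * q ^ m"
  shows "psi0 a b q t (True # w) v * (\<Prod>k<Suc m. kern (b * q ^ k) a) =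
    kap a b q t w * psi0 (a * t) b q t w v * (\<Prod>k<Suc m. kern (b * q ^ k) (v * t ^ nR w))"
proof -
  note G = gen_dest[OF g(1)]
  define n where "n = nR w"
  have lw: "length w = Suc m + n" using length_word[of w] m by (simp add: n_def)
  have v0: "v \<noteq> 0" using G v by simp
  have hn: "hts w ! k \<le> n" if "k < Suc m" for k using hts_nth_le[of k w] that m by (simp add: n_def)
  define X where "X j s = th (a * t * q ^ j * t ^ s / (t ^ n * v))" for j s
  define Y where "Y j s = th (b * q ^ j * t ^ s / (t ^ n * v))" for j s
  define E where "E = prodB w (\<lambda>j s. th (a * q ^ j * t ^ Suc s * v)) * prodB (rev w) (\<lambda>j s. th (b * q ^ j * t ^ s * v))"
  define U where "U k = q ^ (m - k) * t ^ (hts w ! k) * b / a" for k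
  define U0 where "U0 k = q ^ (m - k) * b / a" for k
  define Z where "Z k = q ^ k * t ^ (Suc n - hts w ! k)" for k
  define Z0 where "Z0 k = q ^ k * t ^ Suc n" for k
  have qm: "q ^ m = q ^ (m - k) * q ^ k" if "k < Suc m" for k
    using that by (simp flip: power_add)
  have th0: "t ^ Suc n = t ^ (Suc n - hts w ! k) * t ^ (hts w ! k)" "t ^ n = t ^ (n - hts w ! k) * t ^ (hts w ! k)"
    if "k < Suc m" for k
    using hn[OF that] by (simp_all flip: power_add power_Suc)
  have s1: "psi0 a b q t (True # w) v = E * prodB w X * prodB (rev w) Y *
      ((\<Prod>k<Suc m. th (b * q ^ k * t ^ n * v)) * (\<Prod>k<Suc m. Y k n))"
  proof -
    have 1: "prodB (True # w) (\<lambda>j s. th (a * q ^ j * t ^ s * v) * th (a * q ^ j * t ^ s / (t ^ (nR (True # w) - 1) * v)))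
      = prodB w (\<lambda>j s. th (a * q ^ j * t ^ Suc s * v)) * prodB w X"
      unfolding prodB_True prodB_mult[symmetric]
      by (rule prodB_cong) (simp add: X_def n_def mult_ac)
    have 2: "prodB (rev (True # w)) (\<lambda>j s. th (b * q ^ j * t ^ s * v) * th (b * q ^ j * t ^ s / (t ^ (nR (True # w) - 1) * v)))
      = prodB (rev w) (\<lambda>j s. th (b * q ^ j * t ^ s * v)) * prodB (rev w) Y *
        ((\<Prod>k<Suc m. th (b * q ^ k * t ^ n * v)) * (\<Prod>k<Suc m. Y k n))"
      unfolding rev.simps prodB_snoc_True prodB_mult[symmetric] prod.distrib[symmetric]
      by (intro arg_cong2[of _ _ _ _ "(*)"] prodB_cong prod.cong) (simp_all add: Y_def n_def m)
    show ?thesis unfolding psi0_def 1 2 E_def by (simp only: mult_ac)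
  qed
  have s2: "psi0 (a * t) b q t w v = E * prodB w (\<lambda>j s. X j (Suc s)) * prodB (rev w) (\<lambda>j s. Y j (Suc s))"
  proof -
    have tt: "t ^ n = t ^ (n - 1) * t" if "s < n" for s using that by (simp flip: power_Suc2)
    have 1: "prodB w (\<lambda>j s. th (a * t * q ^ j * t ^ s * v) * th (a * t * q ^ j * t ^ s / (t ^ (nR w - 1) * v)))
      = prodB w (\<lambda>j s. th (a * q ^ j * t ^ Suc s * v)) * prodB w (\<lambda>j s. X j (Suc s))"
      unfolding prodB_mult[symmetric]
    proof (rule prodB_cong)
      fix j s assume "s < nR w"
      thus "th (a * t * q ^ j * t ^ s * v) * th (a * t * q ^ j * t ^ s / (t ^ (nR w - 1) * v)) =
         th (a * q ^ j * t ^ Suc s * v) * X j (Suc s)"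
        unfolding X_def n_def[symmetric] by (subst tt[of s]) (use G in \<open>simp_all add: n_def mult_ac\<close>)
    qed
    have 2: "prodB (rev w) (\<lambda>j s. th (b * q ^ j * t ^ s * v) * th (b * q ^ j * t ^ s / (t ^ (nR w - 1) * v)))
      = prodB (rev w) (\<lambda>j s. th (b * q ^ j * t ^ s * v)) * prodB (rev w) (\<lambda>j s. Y j (Suc s))"
      unfolding prodB_mult[symmetric]
    proof (rule prodB_cong)
      fix j s assume "s < nR (rev w)"
      thus "th (b * q ^ j * t ^ s * v) * th (b * q ^ j * t ^ s / (t ^ (nR w - 1) * v)) =
         th (b * q ^ j * t ^ s * v) * Y j (Suc s)"
        unfolding Y_def n_def[symmetric] by (subst tt[of s]) (use G in \<open>simp_all add: n_def mult_ac\<close>)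
    qed
    show ?thesis unfolding psi0_def 1 2 E_def by (simp only: mult_ac)
  qed
  have T1: "prodB w X * (\<Prod>k<Suc m. X k n) = prodB w (\<lambda>j s. X j (Suc s)) * (\<Prod>k<Suc m. X k (n - hts w ! k))"
    using prodB_telescope[of w X] unfolding m n_def .
  have T2: "prodB (rev w) Y * (\<Prod>k<Suc m. Y k n) =
      prodB (rev w) (\<lambda>j s. Y j (Suc s)) * (\<Prod>k<Suc m. Y k (n - hts (rev w) ! k))"
    using prodB_telescope[of "rev w" Y] by (simp only: count_list_rev m n_def)
  have r1: "(\<Prod>k<Suc m. X k n) = (\<Prod>k<Suc m. th (1 / U0 k))"
  proof (rule prod.cong[OF refl])
    fix k assume "k \<in> {..<Suc m}" hence k: "k < Suc m" by simp
    have "a * t * q ^ k * t ^ n / (t ^ n * v) = 1 / U0 k"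
      unfolding U0_def v qm[OF k] using G by simp
    thus "X k n = th (1 / U0 k)" unfolding X_def by simp
  qed
  have r2: "(\<Prod>k<Suc m. X k (n - hts w ! k)) = (\<Prod>k<Suc m. th (1 / U k))"
  proof (rule prod.cong[OF refl])
    fix k assume "k \<in> {..<Suc m}" hence k: "k < Suc m" by simp
    have "a * t * q ^ k * t ^ (n - hts w ! k) / (t ^ n * v) = 1 / U k"
      unfolding U_def v qm[OF k] th0(2)[OF k] using G by simp
    thus "X k (n - hts w ! k) = th (1 / U k)" unfolding X_def by simp
  qed
  have r3: "(\<Prod>k<Suc m. Y k (n - hts (rev w) ! k)) = (\<Prod>k<Suc m. th (1 / Z k))"
  proof -
    have "(\<Prod>k<Suc m. Y k (n - hts (rev w) ! k)) = (\<Prod>k<Suc m. th (1 / Z (Suc m - 1 - k)))"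
    proof (rule prod.cong[OF refl])
      fix k assume "k \<in> {..<Suc m}" hence k: "k < Suc m" by simp
      define l where "l = m - k"
      have l: "l < Suc m" "m - l = k" using k by (auto simp: l_def)
      have h: "n - hts (rev w) ! k = hts w ! l"
        using hts_rev_nth[of k w] hn[OF l(1)] k m by (simp add: l_def n_def)
      have "b * q ^ k * t ^ (hts w ! l) / (t ^ n * v) = t ^ (hts w ! l) / (q ^ l * t ^ Suc n)"
        unfolding v qm[OF l(1)] l(2) using G by simp
      also have "\<dots> = 1 / Z l" unfolding Z_def th0(1)[OF l(1)] using G by simp
      finally have "b * q ^ k * t ^ (hts w ! l) / (t ^ n * v) = 1 / Z l" .
      thus "Y k (n - hts (rev w) ! k) = th (1 / Z (Suc m - 1 - k))" unfolding Y_def h by (simp add: l_def)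
    qed
    also have "\<dots> = (\<Prod>k<Suc m. th (1 / Z k))" by (rule prod_reverse)
    finally show ?thesis .
  qed
  have r4: "(\<Prod>k<Suc m. kern (b * q ^ k) (v * t ^ n)) = (\<Prod>k<Suc m. th (b * q ^ k * t ^ n * v)) * (\<Prod>k<Suc m. th (1 / Z0 k))"
  proof -
    have "(\<Prod>k<Suc m. kern (b * q ^ k) (v * t ^ n)) = (\<Prod>k<Suc m. th (b * q ^ k * t ^ n * v) * th (1 / Z0 (Suc m - 1 - k)))"
    proof (rule prod.cong[OF refl])
      fix k assume "k \<in> {..<Suc m}" hence k: "k < Suc m" by simp
      have "b * q ^ k / (v * t ^ n) = 1 / Z0 (m - k)" unfolding Z0_def v qm[OF k] using G by simp
      thus "kern (b * q ^ k) (v * t ^ n) = th (b * q ^ k * t ^ n * v) * th (1 / Z0 (Suc m - 1 - k))"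
        unfolding kern_def by (simp add: mult_ac)
    qed
    thus ?thesis unfolding prod.distrib prod_reverse[of "\<lambda>k. th (1 / Z0 k)" "Suc m"] .
  qed
  have r5: "(\<Prod>k<Suc m. kern (b * q ^ k) a) = (\<Prod>k<Suc m. th (a * b * q ^ k)) * (\<Prod>k<Suc m. th (U0 k))"
  proof -
    have "(\<Prod>k<Suc m. kern (b * q ^ k) a) = (\<Prod>k<Suc m. th (a * b * q ^ k) * th (U0 (Suc m - 1 - k)))"
      by (rule prod.cong) (auto simp: kern_def U0_def mult_ac)
    thus ?thesis unfolding prod.distrib prod_reverse[of "\<lambda>k. th (U0 k)" "Suc m"] .
  qed
  have k: "kap a b q t w = (\<Prod>k<Suc m. th (a * b * q ^ k)) * (\<Prod>k<Suc m. th (U k) * th (Z k) / th (Z0 k))"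
    unfolding kap_def m n_def[symmetric] prod.distrib[symmetric]
    by (rule prod.cong) (auto simp: U_def Z_def Z0_def mult_ac)
  have main: "(\<Prod>k<Suc m. th (1 / U k)) * (\<Prod>k<Suc m. th (1 / Z k)) * (\<Prod>k<Suc m. th (U0 k)) =
     (\<Prod>k<Suc m. th (U k) * th (Z k) / th (Z0 k)) * (\<Prod>k<Suc m. th (1 / U0 k)) * (\<Prod>k<Suc m. th (1 / Z0 k))"
    unfolding prod.distrib[symmetric]
  proof (rule prod.cong[OF refl])
    fix k assume "k \<in> {..<Suc m}" hence k: "k < Suc m" by simp
    have nz: "U k \<noteq> 0" "Z k \<noteq> 0" "U0 k \<noteq> 0" "Z0 k \<noteq> 0" using G by (auto simp: U_def U0_def Z_def Z0_def)
    have e: "U k * Z k = U0 k * Z0 k" unfolding U_def Z_def U0_def Z0_def th0(1)[OF k] by (simp add: mult_ac)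
    have Z0n: "th (Z0 k) \<noteq> 0"
      using gqD_nat[OF G(3), of k "Suc n"] k g(2) lw by (simp add: Z0_def)
    have "th (1 / U k) * th (1 / Z k) * th (U0 k) = th (U k) * th (Z k) / (U0 k * Z0 k) * th (U0 k)"
      unfolding th_inv_mult[OF nz(1,2)] e ..
    also have "\<dots> = th (U k) * th (Z k) / th (Z0 k) * (th (1 / U0 k) * th (1 / Z0 k))"
      unfolding th_inv_mult[OF nz(3,4)] using Z0n by simp
    finally show "th (1 / U k) * th (1 / Z k) * th (U0 k) =
      th (U k) * th (Z k) / th (Z0 k) * th (1 / U0 k) * th (1 / Z0 k)" by (simp only: mult.assoc)
  qed
  have X0: "(\<Prod>k<Suc m. th (1 / U0 k)) \<noteq> 0"
  proof -
    have "th (1 / U0 k) \<noteq> 0" if "k < Suc m" for k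
    proof -
      have "th (U0 k) \<noteq> 0" using ngD_nat[OF G(9), of "m - k" 0] that g(2) lw by (simp add: U0_def)
      thus ?thesis using th_inverse_0_iff[of "U0 k"] G by (simp add: U0_def)
    qed
    thus ?thesis by simp
  qed
  have "psi0 a b q t (True # w) v * (\<Prod>k<Suc m. kern (b * q ^ k) a) * (\<Prod>k<Suc m. th (1 / U0 k)) =
    E * (prodB w X * (\<Prod>k<Suc m. X k n)) * (prodB (rev w) Y * (\<Prod>k<Suc m. Y k n)) *
      (\<Prod>k<Suc m. th (b * q ^ k * t ^ n * v)) * ((\<Prod>k<Suc m. th (a * b * q ^ k)) * (\<Prod>k<Suc m. th (U0 k)))"
    unfolding s1 r5 r1 by (simp only: mult_ac)
  also have "\<dots> = E * prodB w (\<lambda>j s. X j (Suc s)) * prodB (rev w) (\<lambda>j s. Y j (Suc s)) *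
      (\<Prod>k<Suc m. th (b * q ^ k * t ^ n * v)) * (\<Prod>k<Suc m. th (a * b * q ^ k)) *
      ((\<Prod>k<Suc m. th (1 / U k)) * (\<Prod>k<Suc m. th (1 / Z k)) * (\<Prod>k<Suc m. th (U0 k)))"
    unfolding T1 T2 r2 r3 by (simp only: mult_ac)
  also have "\<dots> = kap a b q t w * psi0 (a * t) b q t w v * (\<Prod>k<Suc m. kern (b * q ^ k) (v * t ^ n)) * (\<Prod>k<Suc m. th (1 / U0 k))"
    unfolding main k s2 r4 by (simp only: mult_ac)
  finally show ?thesis unfolding n_def by (rule mult_right_cancel[THEN iffD1, OF X0])
qed

text \<open>Needed at the start point that \<open>psi_gam\<close> uses: to cancel there, and to see
  that the interpolation functions do not vanish on all progressions.\<close>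

lemma psi0_nonzero:
  assumes g: "gen M a b q t" "4 * length w \<le> M" and v: "v = b * t * q ^ m" and m: "nC w = Suc m"
  shows "psi0 a b q t w v \<noteq> 0"
proof -
  note G = gen_dest[OF g(1)]
  define n where "n = nR w"
  have lw: "length w = Suc m + n" using length_word[of w] m by (simp add: n_def)
  have e: "th (c * q ^ j * t ^ s * v) \<noteq> 0" if "ng M q t (c * b)" "j \<le> m" "s < n" for c j s
  proof -
    have "th (q ^ (j + m) * t ^ (s + 1) * (c * b)) \<noteq> 0" using that g(2) lw by (intro ngD_nat) auto
    thus ?thesis by (simp add: v power_add mult_ac)
  qed
  have vn: "t ^ (n - 1) * v = q ^ m * t ^ n * b" if "s < n" for s
  proof -
    have "t ^ n = t ^ (n - 1) * t" using that by (simp flip: power_Suc2)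
    thus ?thesis by (simp add: v mult_ac)
  qed
  have A: "th (a * q ^ j * t ^ s / (t ^ (nR w - 1) * v)) \<noteq> 0" if "j \<le> m" "s < n" for j s
  proof -
    have "th (q ^ j * t ^ s * (a / b) / (q ^ m * t ^ n)) \<noteq> 0"
      by (rule ngD_diff[OF G(8) G(3)]) (use that g(2) lw in auto)
    thus ?thesis unfolding n_def[symmetric] vn[OF that(2)] by (simp add: mult_ac)
  qed
  have B: "th (b * q ^ j * t ^ s / (t ^ (nR w - 1) * v)) \<noteq> 0" if "j \<le> m" "s < n" for j s
  proof -
    have "th (q ^ j * t ^ s / (q ^ m * t ^ n)) \<noteq> 0"
      by (rule gqD_diff[OF G(3)]) (use that g(2) lw in auto)
    thus ?thesis unfolding n_def[symmetric] vn[OF that(2)] using G by (simp add: mult_ac)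
  qed
  have jm: "j \<le> m" if "s < nR w" "j < exps w ! s \<or> j < exps (rev w) ! s" for j s
    using that exps_nth_le[of s w] exps_nth_le[of s "rev w"] m by auto
  have bb: "ng M q t (b * b)" using G(5) by (simp add: power2_eq_square)
  have "prodB w (\<lambda>j s. th (a * q ^ j * t ^ s * v) * th (a * q ^ j * t ^ s / (t ^ (nR w - 1) * v))) \<noteq> 0"
    by (rule prodB_nonzero) (use jm e[OF G(6)] A n_def in auto)
  moreover have "prodB (rev w) (\<lambda>j s. th (b * q ^ j * t ^ s * v) * th (b * q ^ j * t ^ s / (t ^ (nR w - 1) * v))) \<noteq> 0"
    by (rule prodB_nonzero) (use jm e[OF bb] B n_def in auto)
  ultimately show ?thesis by (simp add: psi0_def)
qed

lemma psi_gam: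
  assumes "gen M a b q t" "6 * length w + 4 \<le> M" "v \<noteq> 0"
  shows "gam a b q t w * psi a b q t w v = psi0 a b q t w v"
  using assms
proof (induction w arbitrary: a v M)
  case Nil
  have "P a b q t [] [] = 1" using P_IntN[OF Nil.prems(1), of "[]"] by simp
  thus ?case by (simp add: psi_def psi0_def)
next
  case (Cons c w)
  note G = gen_dest[OF Cons.prems(1)]
  have M: "M - 2 + 2 = M" "6 * length w + 4 \<le> M - 2" using Cons.prems(2) by auto
  show ?case
  proof (cases c)
    case False
    have g: "gen (M - 2) (a * q) b q t" using gen_shift_q[of "M - 2" a b q t] Cons.prems(1) M by simp
    have "psi a b q t (False # w) v = (\<Prod>i<nR w. kern a (v * t ^ i)) * psi (a * q) b q t w v"
      using P_False_Cons[OF Cons.prems(1) _ length_strg strg_nonzero[OF Cons.prems(3) G(11)]] Cons.prems(2)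
      unfolding psi_def prod_strg by simp
    thus ?thesis using False Cons.IH[OF g M(2) Cons.prems(3)] psi0_False[OF Cons.prems(3) G(11), of a b q w]
      by (simp add: mult_ac)
  next
    case True
    define n where "n = nR w"
    have g: "gen (M - 2) (a * t) b q t" using gen_shift_t[of "M - 2" a b q t] Cons.prems(1) M by simp
    have L: "2 * length (c # w) \<le> M" using Cons.prems(2) by simp
    note I = P_IntN[OF Cons.prems(1) L]
    have lw: "length w = nC w + n" using length_word[of w] by (simp add: n_def)
    show ?thesis
    proof (cases "nC w")
      case 0
      have P1: "psi a b q t (c # w) v = 1" unfolding psi_def
        by (rule IntN_degree_0[OF I]) (use 0 True G Cons.prems(3) in \<open>simp_all add: strg_nonzero del: strg.simps\<close>)
      have P2: "psi (a * t) b q t w v = 1" unfolding psi_def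
        by (rule IntN_degree_0[OF P_IntN[OF g]]) (use 0 G M(2) Cons.prems(3) in \<open>simp_all add: strg_nonzero\<close>)
      have B: "bxw (c # w) = []" "bxw (rev (c # w)) = []" "bxw w = []" "bxw (rev w) = []"
        using length_bxw_rev[of "c # w"] length_bxw_rev[of w] 0 True by auto
      show ?thesis using Cons.IH[OF g M(2) Cons.prems(3)] P1 P2 True 0 unfolding psi0_def prodB_def B
        by (simp add: kap_def)
    next
      case (Suc m)
      \<comment> \<open>The progression from \<open>v0\<close> consists of points of the grid at
        \<open>b\<close> with maximal exponent \<open>m\<close>, so any first exponent
        \<open>k \<le> m\<close> completes it to a grid point. This produces the
        \<open>m + 1\<close> zeros in the first entry.\<close>
      define v0 where "v0 = b * t * q ^ m"
      have v0: "v0 \<noteq> 0" using G by (simp add: v0_def)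
      have W: "W (Suc n) (Suc m) (P a b q t (True # w))" using IntN_W[OF I] G True Suc n_def by simp
      have s0: "0 \<notin> set (strg v0 t n)" by (rule strg_nonzero[OF v0 G(11)])
      have V: "V (Suc m) (\<lambda>z. P a b q t (True # w) (z # strg v0 t n))" by (rule W_head[OF W]) (use s0 in auto)
      have z: "P a b q t (True # w) (b * q ^ k # strg v0 t n) = 0" if k: "k < Suc m" for k
      proof -
        have "\<exists>w'\<in>words m (length (k # replicate n m)). exps w' = k # replicate n m"
          by (rule exps_surj) (use k in \<open>simp_all add: less_Suc_eq_le sorted_replicate, linarith?\<close>)
        then obtain w' where w': "w' \<in> words m (Suc n)" "exps w' = k # replicate n m" by auto
        have "pts b q t w' = b * q ^ k # strg v0 t n"
          unfolding pts_eq_apt w'(2) v0_def by (simp add: apt_replicate mult_ac)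
        thus ?thesis using I True w'(1) Suc n_def by auto
      qed
      define zs where "zs = map (\<lambda>k. b * q ^ k) [0..<Suc m]"
      have "ok zs" unfolding zs_def
      proof (rule ok_map)
        fix k assume "k \<in> set [0..<Suc m]" hence k: "k < Suc m" by (simp del: upt_Suc)
        have "th (q ^ (k + k) * t ^ 0 * b\<^sup>2) \<noteq> 0" using k Cons.prems(2) lw Suc by (intro ngD_nat[OF G(5)]) auto
        thus "b * q ^ k \<noteq> 0 \<and> th ((b * q ^ k)\<^sup>2) \<noteq> 0" using G by (simp add: power_add power2_eq_square mult_ac)
      next
        fix k l assume "k \<in> set [0..<Suc m]" "l \<in> set [0..<Suc m]" and kl: "k \<noteq> l" hence k: "k < Suc m" "l < Suc m" by (simp_all del: upt_Suc)
        have "th (q ^ (k + l) * t ^ 0 * b\<^sup>2) \<noteq> 0" using k Cons.prems(2) lw Suc by (intro ngD_nat[OF G(5)]) auto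
        moreover have "th (q ^ k * t ^ 0 / (q ^ l * t ^ 0)) \<noteq> 0"
          by (rule gqD_diff[OF G(3)]) (use k kl Cons.prems(2) lw Suc in auto)
        ultimately show "kern (b * q ^ k) (b * q ^ l) \<noteq> 0"
          unfolding kern_def using G by (simp add: power_add power2_eq_square mult_ac)
      qed simp
      moreover have "length zs = Suc m" by (simp add: zs_def)
      moreover have "P a b q t (True # w) (x # strg v0 t n) = 0" if "x \<in> set zs" for x
      proof -
        from that obtain k where "k < Suc m" "x = b * q ^ k" unfolding zs_def set_map set_upt by force
        thus ?thesis using z by simp
      qed
      ultimately obtain C' where C': "\<And>u. u \<noteq> 0 \<Longrightarrow>
          P a b q t (True # w) (u # strg v0 t n) = C' * (\<Prod>z\<leftarrow>zs. kern z u)"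
        using V_zeros[of zs "\<lambda>z. P a b q t (True # w) (z # strg v0 t n)"] V by auto
      have zp: "(\<Prod>z\<leftarrow>zs. kern z u) = (\<Prod>k<Suc m. kern (b * q ^ k) u)" for u
      proof -
        have "(\<Prod>s\<leftarrow>[0..<n]. g s) = (\<Prod>s<n. g s)" for n and g :: "nat \<Rightarrow> complex"
          by (induction n) (auto simp: mult_ac)
        thus ?thesis unfolding zs_def map_map o_def .
      qed
      define Ka where "Ka = (\<Prod>k<Suc m. kern (b * q ^ k) a)"
      define Kz where "Kz = (\<Prod>k<Suc m. kern (b * q ^ k) (v0 * t ^ n))"
      have a: "psi (a * t) b q t w v0 = C' * Ka"
      proof -
        have "P a b q t (True # w) (a # strg v0 t n) = psi (a * t) b q t w v0"
          unfolding psi_def n_def by (rule P_True_Cons[OF Cons.prems(1)])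
            (use L strg_nonzero[OF v0 G(11)] in auto)
        thus ?thesis using C'[OF G(1)] unfolding zp Ka_def by simp
      qed
      have z0: "psi a b q t (True # w) v0 = C' * Kz"
      proof -
        have "psi a b q t (True # w) v0 = P a b q t (True # w) (strg v0 t (Suc n))"
          unfolding psi_def n_def by simp
        also have "\<dots> = P a b q t (True # w) (v0 * t ^ n # strg v0 t n)"
          by (rule W_mset[OF W]) (use v0 G s0 in \<open>auto simp: strg_snoc simp del: strg.simps\<close>)
        also have "\<dots> = C' * Kz" using C'[of "v0 * t ^ n"] v0 G unfolding zp Kz_def by simp
        finally show ?thesis .
      qed
      obtain C where C: "\<And>v. v \<noteq> 0 \<Longrightarrow> psi a b q t (True # w) v = C * psi0 a b q t (True # w) v"
        using psi_proportional[OF Cons.prems(1), of "True # w"] Cons.prems(2) by auto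
      have kq: "psi0 a b q t (True # w) v0 * Ka = kap a b q t w * psi0 (a * t) b q t w v0 * Kz"
        unfolding Ka_def Kz_def n_def by (rule kap_eq[OF Cons.prems(1) _ Suc v0_def]) (use Cons.prems(2) in simp)
      have Ka0: "Ka \<noteq> 0"
      proof -
        have "kern (b * q ^ k) a \<noteq> 0" if "k < Suc m" for k
        proof -
          have "th (q ^ k * t ^ 0 * (b * a)) \<noteq> 0" "th (q ^ k * t ^ 0 * (b / a)) \<noteq> 0"
            using that Cons.prems(2) lw Suc by (intro ngD_nat[OF G(7)] ngD_nat[OF G(9)]; simp)+
          thus ?thesis unfolding kern_def by (simp add: mult_ac)
        qed
        thus ?thesis unfolding Ka_def by simp
      qed
      have p0: "psi0 a b q t (True # w) v0 \<noteq> 0"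
        by (rule psi0_nonzero[OF Cons.prems(1) _ v0_def]) (use Cons.prems(2) Suc in auto)
      have "gam a b q t (True # w) * C * psi0 a b q t (True # w) v0 * Ka =
        kap a b q t w * (gam (a * t) b q t w * psi (a * t) b q t w v0) * Kz"
        using C[OF v0] z0 a by (simp add: mult_ac)
      also have "gam (a * t) b q t w * psi (a * t) b q t w v0 = psi0 (a * t) b q t w v0"
        by (rule Cons.IH[OF g M(2) v0])
      also have "kap a b q t w * psi0 (a * t) b q t w v0 * Kz = 1 * psi0 a b q t (True # w) v0 * Ka" using kq by simp
      finally have 1: "gam a b q t (True # w) * C = 1"
        by (rule mult_right_cancel[THEN iffD1, OF p0, OF mult_right_cancel[THEN iffD1, OF Ka0]])
      have "gam a b q t (True # w) * psi a b q t (True # w) v = (gam a b q t (True # w) * C) * psi0 a b q t (True # w) v"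
        unfolding C[OF Cons.prems(3)] by (rule mult.assoc[symmetric])
      also have "\<dots> = psi0 a b q t (True # w) v" unfolding 1 by (rule mult_1)
      finally show ?thesis using True by (simp only:)
    qed
  qed
qed

end

section \<open>Vanishing points and uniqueness\<close>

text \<open>Used after a first difference at which the path of \<mu> has the smaller part:
  coordinates are based at \<open>a\<close> until only full rows remain (no \<open>False\<close>
  left), and those are based at \<open>b\<close>, as the case \<open>l\<^sub>1\<close> of
  \<open>split_index\<close> prescribes.\<close>

fun Upt :: "complex \<Rightarrow> complex \<Rightarrow> complex \<Rightarrow> complex \<Rightarrow> bool list \<Rightarrow> complex list" where
  "Upt a b q t [] = []"
| "Upt a b q t (True # w) = (if nC w = 0 then pts b q t (rev (True # w)) else a # Upt (a * t) b q t w)"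
| "Upt a b q t (False # w) = Upt (a * q) b q t w"

text \<open>The vanishing points, with coordinates in some order, obtained by walking along the two boundary
  paths simultaneously; their first difference decides which coordinates are based at \<open>b\<close>.\<close>

fun Xpt :: "complex \<Rightarrow> complex \<Rightarrow> complex \<Rightarrow> complex \<Rightarrow> bool list \<Rightarrow> bool list \<Rightarrow> complex list" where
  "Xpt a b q t (False # w') (False # w) = Xpt (a * q) b q t w' w"
| "Xpt a b q t (True # w') (True # w) = a # Xpt (a * t) b q t w' w"
| "Xpt a b q t (True # w') (False # w) = Upt a b q t (True # w')"
| "Xpt a b q t (False # w') (True # w) = pts b q t (rev w')"
| "Xpt a b q t w' w = []"

lemma Xpt_same: "Xpt a b q t w w = pts a q t w"
  by (induction a q t w rule: pts.induct) auto

context nome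
begin

text \<open>The induction of \<open>GW_pts_zero\<close> again. Once no \<open>False\<close> is left
  the degree is 0, a single point suffices, and it may as well be based at \<open>b\<close>.\<close>

lemma GW_Upt_zero:
  assumes "gen M a b q t" "2 * (m + n) \<le> M"
    and "\<And>y i j. y \<in> set S \<Longrightarrow> i \<le> m \<Longrightarrow> j \<le> n \<Longrightarrow> kern (a * q ^ i * t ^ j) y \<noteq> 0 \<and> kern (b * q ^ i * t ^ j) y \<noteq> 0"
    and "GW S n m F" "\<And>w. w \<in> words m n \<Longrightarrow> F (Upt a b q t w) = 0"
    and "length xs = n" "ok (xs @ S)"
  shows "F xs = 0"
  using assms
proof (induction "m + n" arbitrary: m n a S F M xs rule: less_induct)
  case less
  note G = gen_dest[OF less.prems(1)]
  consider "n = 0" | "m = 0" | n' m' where "n = Suc n'" "m = Suc m'" by (cases n; cases m) auto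
  thus ?case
  proof cases
    case 1
    have "Upt c b q t (replicate m False) = []" for c by (induction m arbitrary: c) auto
    thus ?thesis using less.prems(5)[of "replicate m False"] less.prems(6) 1 by (simp add: words_0_right)
  next
    case 2
    show ?thesis
    proof (rule GW_pts_zero[OF G(3,5) less.prems(2) G(2) _ less.prems(4) _ less.prems(6,7)])
      fix w assume w: "w \<in> words m n"
      hence r: "w = replicate n True" using 2 by (simp add: words_0_left)
      have "Upt a b q t w = pts b q t w"
      proof (cases w)
        case (Cons c v)
        moreover have "rev w = w" "nC w = 0" using r w 2 by (simp_all add: words_def)
        ultimately show ?thesis using r by (cases n) auto
      qed simp
      thus "F (pts b q t w) = 0" using less.prems(5)[OF w] by simp
    qed (use less.prems(3) in blast)
  next
    case (3 n' m')
    have th2: "th (a\<^sup>2) \<noteq> 0" using G(4) ng_th_nonzero by blast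
    have kaS: "kern a y \<noteq> 0" if "y \<in> set S" for y using less.prems(3)[OF that, of 0 0] by simp
    have okaS: "ok (a # S)" using th2 G(1) kaS less.prems(7) by (auto simp: ok_append)
    have M2: "M - 2 + 2 = M" "2 * (m + n') \<le> M - 2" "2 * (m' + n) \<le> M - 2" using less.prems(2) 3 by auto
    show ?thesis
    proof (rule GW_step[where n = n' and S = S and F = F and a = a and m = m])
      show "GW S (Suc n') m F" using less.prems(4) 3 by simp
      show "ok (a # S)" by fact
      fix xs :: "complex list" assume xs: "length xs = n'" "ok (xs @ a # S)"
      show "F (a # xs) = 0"
      proof (rule less.hyps[where m = m and n = n' and a = "a * t" and S = "a # S" and F = "\<lambda>xs. F (a # xs)" and M = "M - 2"])
        show "gen (M - 2) (a * t) b q t" using gen_shift_t[of "M - 2" a b q t] less.prems(1) M2 by simp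
        show "GW (a # S) n' m (\<lambda>xs. F (a # xs))" using less.prems(4) 3 by (intro GW_restrict) auto
        fix w assume "w \<in> words m n'"
        thus "F (a # Upt (a * t) b q t w) = 0" using less.prems(5)[of "True # w"] 3 by (simp add: words_def)
      next
        fix y i j assume y: "y \<in> set (a # S)" and ij: "i \<le> m" "j \<le> n'"
        have "kern (a * q ^ i * t ^ Suc j) y \<noteq> 0 \<and> kern (b * q ^ i * t ^ j) y \<noteq> 0"
        proof (cases "y \<in> set S")
          case True thus ?thesis using less.prems(3)[OF True, of i "Suc j"] less.prems(3)[OF True, of i j] ij 3 by auto
        next
          case False
          thus ?thesis using kern_nonzero_grid_self[OF G(4,3), of i "Suc j"] gen_kern_ba[OF less.prems(1), of i j]
            ij 3 less.prems(2) y by auto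
        qed
        thus "kern (a * t * q ^ i * t ^ j) y \<noteq> 0 \<and> kern (b * q ^ i * t ^ j) y \<noteq> 0" by (simp add: mult_ac)
      qed (use xs M2 3 in auto)
    next
      fix m'' H and xs :: "complex list"
      assume m: "m = Suc m''" and H: "GW (a # S) (Suc n') m'' H" and F0: "\<And>ys. F ys = 0 \<Longrightarrow> H ys = 0"
        and xs: "length xs = Suc n'" "ok (xs @ a # S)"
      show "H xs = 0"
      proof (rule less.hyps[where m = m' and n = n and a = "a * q" and S = "a # S" and F = H and M = "M - 2"])
        show "gen (M - 2) (a * q) b q t" using gen_shift_q[of "M - 2" a b q t] less.prems(1) M2 by simp
        fix w assume "w \<in> words m' n"
        thus "H (Upt (a * q) b q t w) = 0" using less.prems(5)[of "False # w"] 3 by (intro F0) simp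
      next
        fix y i j assume y: "y \<in> set (a # S)" and ij: "i \<le> m'" "j \<le> n"
        have "kern (a * q ^ Suc i * t ^ j) y \<noteq> 0 \<and> kern (b * q ^ i * t ^ j) y \<noteq> 0"
        proof (cases "y \<in> set S")
          case True thus ?thesis using less.prems(3)[OF True, of "Suc i" j] less.prems(3)[OF True, of i j] ij 3 by auto
        next
          case False
          thus ?thesis using kern_nonzero_grid_self[OF G(4,3), of "Suc i" j] gen_kern_ba[OF less.prems(1), of i j]
            ij 3 less.prems(2) y by auto
        qed
        thus "kern (a * q * q ^ i * t ^ j) y \<noteq> 0 \<and> kern (b * q ^ i * t ^ j) y \<noteq> 0" by (simp add: mult_ac)
      qed (use xs M2 3 H m in auto)
    qed (use less.prems 3 in auto)
  qed
qed

text \<open>The induction follows \<open>w\<close>. At a \<open>True\<close> of \<open>w\<close>,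
  agreeing paths control the restriction to \<open>a\<close>, and differing ones run over the full
  grid at \<open>b\<close> in one degree less. At a \<open>False\<close> of \<open>w\<close>,
  differing paths control the restriction through \<open>Upt\<close>, and agreeing ones control the
  quotient.\<close>

lemma GW_Xpt_zero:
  assumes "gen M a b q t" "2 * length w \<le> M"
    and "\<And>y i j. y \<in> set S \<Longrightarrow> i \<le> nC w \<Longrightarrow> j \<le> nR w \<Longrightarrow> kern (a * q ^ i * t ^ j) y \<noteq> 0 \<and> kern (b * q ^ i * t ^ j) y \<noteq> 0"
    and "GW S (nR w) (nC w) F" "\<And>w'. w' \<in> words (nC w) (nR w) \<Longrightarrow> F (Xpt a b q t w' w) = 0"
    and "length xs = nR w" "ok (xs @ S)"
  shows "F xs = 0"
  using assms
proof (induction w arbitrary: a S F M xs)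
  case Nil
  thus ?case using Nil.prems(5)[of "[]"] by (simp add: words_def)
next
  case (Cons c w)
  note G = gen_dest[OF Cons.prems(1)]
  have th2: "th (a\<^sup>2) \<noteq> 0" using G(4) ng_th_nonzero by blast
  have kaS: "kern a y \<noteq> 0" if "y \<in> set S" for y using Cons.prems(3)[OF that, of 0 0] by simp
  have okaS: "ok (a # S)" using th2 G(1) kaS Cons.prems(7) by (auto simp: ok_append)
  have M2: "M - 2 + 2 = M" "2 * length w \<le> M - 2" using Cons.prems(2) by auto
  have lw: "length w = nC w + nR w" by (rule length_word)
  define m n where "m = nC (c # w)" and "n = nR (c # w)"
  have mn: "2 * (m + n) \<le> M" using Cons.prems(2) lw by (auto simp: m_def n_def)
  have grid: "kern (a * q ^ i * t ^ j) y \<noteq> 0" if "y \<in> set (a # S)" "i \<le> m" "j \<le> n" "(i, j) \<noteq> (0, 0)" for y i j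
    using kern_nonzero_grid_self[OF G(4,3), of i j] Cons.prems(3)[of y i j] that mn by (auto simp: m_def n_def)
  have grib: "kern (b * q ^ i * t ^ j) y \<noteq> 0" if "y \<in> set (a # S)" "i \<le> m" "j \<le> n" for y i j
    using gen_kern_ba[OF Cons.prems(1), of i j] Cons.prems(3)[of y i j] that mn by (auto simp: m_def n_def)
  show ?case
  proof (cases c)
    case True
    have R: "F (a # xs) = 0" if xs: "length xs = nR w" "ok (xs @ a # S)" for xs
    proof (rule Cons.IH[where a = "a * t" and S = "a # S" and F = "\<lambda>xs. F (a # xs)" and M = "M - 2"])
      show "gen (M - 2) (a * t) b q t" using gen_shift_t[of "M - 2" a b q t] Cons.prems(1) M2 by simp
      show "GW (a # S) (nR w) (nC w) (\<lambda>xs. F (a # xs))" using Cons.prems(4) True by (intro GW_restrict) auto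
      show "F (a # Xpt (a * t) b q t w' w) = 0" if "w' \<in> words (nC w) (nR w)" for w'
        using Cons.prems(5)[of "True # w'"] that True by simp
      show "kern (a * t * q ^ i * t ^ j) y \<noteq> 0 \<and> kern (b * q ^ i * t ^ j) y \<noteq> 0"
        if "y \<in> set (a # S)" "i \<le> nC w" "j \<le> nR w" for y i j
        using grid[of y i "Suc j"] grib[of y i j] that True by (simp add: m_def n_def mult_ac)
    qed (use xs M2 in auto)
    show ?thesis
    proof (rule GW_two_grids_zero[where S = S and F = F and a = a and m = m and n = "nR w" and b = b and M = M and q = q and t = t])
      show "GW S (Suc (nR w)) m F" using Cons.prems(4) True by (simp add: m_def)
      show "2 * (m + nR w) \<le> M" using mn True by (simp add: n_def)
      show "F (pts b q t w') = 0" if "m = Suc m'" "w' \<in> words m' (Suc (nR w))" for w' m'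
        using Cons.prems(5)[of "False # rev w'"] that True m_def by simp
      show "F (a # xs) = 0" if "length xs = nR w" "ok (xs @ a # S)" for xs by (rule R[OF that])
    qed (use grib True Cons.prems G okaS in \<open>auto simp: n_def\<close>)
  next
    case False
    show ?thesis
    proof (cases "nR w")
      case 0
      have "Xpt a b q t (c # w) (c # w) = []"
        unfolding Xpt_same length_0_conv[symmetric] using 0 False by simp
      thus ?thesis using Cons.prems(5)[of "c # w"] False Cons.prems(6) 0 by (simp add: words_def)
    next
      case (Suc n')
      have mn': "m = Suc (nC w)" "n = Suc n'" using False Suc by (simp_all add: m_def n_def)
      show ?thesis
      proof (rule GW_step[where n = n' and S = S and F = F and a = a and m = m])
        show "GW S (Suc n') m F" using Cons.prems(4) Suc False by (simp add: m_def)
        show "ok (a # S)" by fact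
        fix xs :: "complex list" assume xs: "length xs = n'" "ok (xs @ a # S)"
        show "F (a # xs) = 0"
        proof (rule GW_Upt_zero[where m = m and n = n' and a = "a * t" and S = "a # S" and F = "\<lambda>xs. F (a # xs)" and M = "M - 2"])
          show "gen (M - 2) (a * t) b q t" using gen_shift_t[of "M - 2" a b q t] Cons.prems(1) M2 by simp
          show "GW (a # S) n' m (\<lambda>xs. F (a # xs))" using Cons.prems(4) Suc False by (intro GW_restrict) (simp add: m_def)
          show "F (a # Upt (a * t) b q t w') = 0" if "w' \<in> words m n'" for w'
            using Cons.prems(5)[of "True # w'"] that False Suc mn' by (simp add: words_def)
          show "kern (a * t * q ^ i * t ^ j) y \<noteq> 0 \<and> kern (b * q ^ i * t ^ j) y \<noteq> 0"
            if "y \<in> set (a # S)" "i \<le> m" "j \<le> n'" for y i j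
            using grid[of y i "Suc j"] grib[of y i j] that mn' by (simp add: mult_ac)
        qed (use xs mn mn' in auto)
      next
        fix m'' H and xs :: "complex list"
        assume m: "m = Suc m''" and H: "GW (a # S) (Suc n') m'' H" and F0: "\<And>ys. F ys = 0 \<Longrightarrow> H ys = 0"
          and xs: "length xs = Suc n'" "ok (xs @ a # S)"
        show "H xs = 0"
        proof (rule Cons.IH[where a = "a * q" and S = "a # S" and F = H and M = "M - 2"])
          show "gen (M - 2) (a * q) b q t" using gen_shift_q[of "M - 2" a b q t] Cons.prems(1) M2 by simp
          show "H (Xpt (a * q) b q t w' w) = 0" if "w' \<in> words (nC w) (nR w)" for w'
            using Cons.prems(5)[of "False # w'"] that False by (intro F0) simp
          show "kern (a * q * q ^ i * t ^ j) y \<noteq> 0 \<and> kern (b * q ^ i * t ^ j) y \<noteq> 0"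
            if "y \<in> set (a # S)" "i \<le> nC w" "j \<le> nR w" for y i j
            using grid[of y "Suc i" j] grib[of y i j] that False mn' Suc by (simp add: mult_ac)
        qed (use xs M2 m H mn' Suc in auto)
      qed (use Cons.prems Suc False in auto)
    qed
  qed
qed

lemma W_Xpt_zero:
  assumes g: "gen M a b q t" "2 * length w \<le> M" and f: "W (nR w) (nC w) f"
    and 0: "\<And>w'. w' \<in> words (nC w) (nR w) \<Longrightarrow> f (Xpt a b q t w' w) = 0"
    and xs: "length xs = nR w" "0 \<notin> set xs"
  shows "f xs = 0"
proof (rule W_zero[OF f _ xs])
  fix xs :: "complex list" assume "length xs = nR w" "ok xs"
  thus "f xs = 0" by (intro GW_Xpt_zero[OF g _ W_imp_GW[OF f, of "[]"] 0]) auto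
qed

lemma length_Upt: "length (Upt a b q t w) = nR w"
  by (induction a b q t w rule: Upt.induct) auto

lemma Upt_nonzero: "a \<noteq> 0 \<Longrightarrow> b \<noteq> 0 \<Longrightarrow> q \<noteq> 0 \<Longrightarrow> t \<noteq> 0 \<Longrightarrow> 0 \<notin> set (Upt a b q t w)"
proof (induction a b q t w rule: Upt.induct)
  case (2 a b q t w)
  have "0 \<notin> set (pts b q t (rev (True # w)))" using 2 by (intro pts_nonzero) auto
  thus ?case using 2 by (simp del: rev.simps)
qed auto

lemma length_Xpt: "w' \<in> words (nC w) (nR w) \<Longrightarrow> length (Xpt a b q t w' w) = nR w"
  by (induction a b q t w' w rule: Xpt.induct) (auto simp: length_Upt words_def)

lemma Xpt_nonzero: "a \<noteq> 0 \<Longrightarrow> b \<noteq> 0 \<Longrightarrow> q \<noteq> 0 \<Longrightarrow> t \<noteq> 0 \<Longrightarrow> 0 \<notin> set (Xpt a b q t w' w)"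
proof (induction a b q t w' w rule: Xpt.induct)
  case (3 a b q t w' w)
  thus ?case using Upt_nonzero[of a b q t "True # w'"] by (simp del: Upt.simps)
qed (auto simp: pts_nonzero)

text \<open>If the paths first differ with \<open>w\<close> at \<open>False\<close>, the point has
  an entry \<open>a\<close>, because a \<open>False\<close> is still to come in \<open>w'\<close>,
  and the factor \<open>kern a\<close> vanishes. If they differ with \<open>w\<close> at
  \<open>True\<close>, the remaining entries form a point of the grid at \<open>b\<close>.\<close>

lemma IntN_Xpt:
  assumes "IntN w a b q t f" "w' \<in> words (nC w) (nR w)" "w' \<noteq> w" "a \<noteq> 0" "b \<noteq> 0" "q \<noteq> 0" "t \<noteq> 0"
  shows "f (Xpt a b q t w' w) = 0"
  using assms
proof (induction w arbitrary: w' a f)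
  case (Cons c w)
  obtain c' v where w': "w' = c' # v" using Cons.prems(2,3) by (cases w') (auto simp: words_def split: if_splits)
  show ?case
  proof (cases c)
    case True
    show ?thesis
    proof (cases c')
      case c': True
      show ?thesis using Cons.IH[of "a * t" "\<lambda>xs. f (a # xs)" v] Cons.prems w' True c' by simp
    next
      case False
      then obtain m' where "nC w = Suc m'" "v \<in> words m' (Suc (nR w))" using Cons.prems(2) w' True by auto
      hence "f (pts b q t (rev v)) = 0" using Cons.prems(1) True by auto
      thus ?thesis using w' True False by simp
    qed
  next
    case False
    then obtain g where g: "IntN w (a * q) b q t g"
      "\<And>xs. length xs = nR w \<Longrightarrow> 0 \<notin> set xs \<Longrightarrow> f xs = (\<Prod>x\<leftarrow>xs. kern a x) * g xs"
      using Cons.prems(1) by auto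
    have e: "f (Xpt a b q t w' (c # w)) = (\<Prod>x\<leftarrow>Xpt a b q t w' (c # w). kern a x) * g (Xpt a b q t w' (c # w))"
      by (rule g(2)) (use length_Xpt[OF Cons.prems(2)] Xpt_nonzero[OF Cons.prems(4-7)] False in auto)
    show ?thesis
    proof (cases c')
      case True
      have "nC v \<noteq> 0" using Cons.prems(2) w' True False by (simp add: words_def)
      hence "(\<Prod>x\<leftarrow>Xpt a b q t w' (c # w). kern a x) = 0"
        using w' True False Cons.prems(4) by (simp add: kern_def)
      thus ?thesis unfolding e by simp
    next
      case c': False
      have "g (Xpt (a * q) b q t v w) = 0"
        by (rule Cons.IH[OF g(1)]) (use Cons.prems w' False c' in auto)
      thus ?thesis unfolding e using w' False c' by simp
    qed
  qed
next
  case Nil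
  have "length w' = 0" using length_word[of w'] Nil.prems(2) by (simp add: words_def)
  thus ?case using Nil.prems(3) by simp
qed

lemma gam_nonzero:
  assumes g: "gen M a b q t" "6 * length w + 4 \<le> M" and m: "nC w \<noteq> 0"
  shows "gam a b q t w \<noteq> 0" "\<exists>v. v \<noteq> 0 \<and> psi a b q t w v \<noteq> 0"
proof -
  obtain m' where m': "nC w = Suc m'" using m by (cases "nC w") auto
  have "b * t * q ^ m' \<noteq> 0" using gen_dest[OF g(1)] by simp
  moreover from psi_gam[OF g this] have 1: "gam a b q t w * psi a b q t w (b * t * q ^ m') \<noteq> 0"
    using psi0_nonzero[OF g(1) _ refl m'] g(2) by simp
  hence "gam a b q t w \<noteq> 0" "psi a b q t w (b * t * q ^ m') \<noteq> 0" by (auto simp only: mult_zero_left mult_zero_right)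
  ultimately show "gam a b q t w \<noteq> 0" "\<exists>v. v \<noteq> 0 \<and> psi a b q t w v \<noteq> 0" by blast+
qed

text \<open>The zeros leave a space of dimension one, since the additional point with
  \<open>w' = w\<close> would determine the function. The scalar is then read off at a progression
  where \<open>P\<close> is nonzero.\<close>

lemma P_unique:
  assumes g: "gen M a b q t" "6 * length w + 4 \<le> M" and m: "nC w \<noteq> 0"
    and f: "W (nR w) (nC w) f"
    and 0: "\<And>w'. w' \<in> words (nC w) (nR w) \<Longrightarrow> w' \<noteq> w \<Longrightarrow> f (Xpt a b q t w' w) = 0"
    and v: "\<And>v. v \<noteq> 0 \<Longrightarrow> f (strg v t (nR w)) = psi0 a b q t w v"
    and xs: "length xs = nR w" "0 \<notin> set xs"
  shows "f xs = gam a b q t w * P a b q t w xs"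
proof -
  note G = gen_dest[OF g(1)]
  have L: "2 * length w \<le> M" using g(2) by simp
  note I = P_IntN[OF g(1) L]
  have WP: "W (nR w) (nC w) (P a b q t w)" by (rule IntN_W[OF I G(1,10,11)])
  have ww: "w \<in> words (nC w) (nR w)" by (simp add: words_def)
  obtain v where v0: "v \<noteq> 0" "psi a b q t w v \<noteq> 0" using gam_nonzero(2)[OF g m] by blast
  have st: "0 \<notin> set (strg v t (nR w))" by (rule strg_nonzero[OF v0(1) G(11)])
  have P0: "P a b q t w (Xpt a b q t w w) \<noteq> 0"
  proof
    assume z: "P a b q t w (Xpt a b q t w w) = 0"
    have "P a b q t w (strg v t (nR w)) = 0"
    proof (rule W_Xpt_zero[OF g(1) L WP _ length_strg st])
      fix w' assume "w' \<in> words (nC w) (nR w)"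
      thus "P a b q t w (Xpt a b q t w' w) = 0"
        using z IntN_Xpt[OF I _ _ G(1,2,10,11)] by (cases "w' = w") auto
    qed
    thus False using v0(2) by (simp add: psi_def)
  qed
  define c where "c = f (Xpt a b q t w w) / P a b q t w (Xpt a b q t w w)"
  have e: "f xs - c * P a b q t w xs = 0" if xs: "length xs = nR w" "0 \<notin> set xs" for xs
  proof (rule W_Xpt_zero[OF g(1) L W_diff[OF f W_cmult[OF WP]] _ xs])
    fix w' assume "w' \<in> words (nC w) (nR w)"
    thus "f (Xpt a b q t w' w) - c * P a b q t w (Xpt a b q t w' w) = 0"
      using P0 0 IntN_Xpt[OF I _ _ G(1,2,10,11)] by (cases "w' = w") (auto simp: c_def)
  qed
  have "c * psi a b q t w v = gam a b q t w * psi a b q t w v"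
    using e[OF length_strg st] v[OF v0(1)] psi_gam[OF g v0(1)] by (auto simp: psi_def)
  hence "c = gam a b q t w" by (rule mult_right_cancel[THEN iffD1, OF v0(2)])
  thus ?thesis using e[OF xs] by simp
qed

end

section \<open>Words and partitions\<close>

text \<open>A \<open>False\<close> adds one box to each row that ends later in the word, which are
  the upper rows \<open>1\<close> to \<open>nR w\<close>.\<close>

fun pw :: "bool list \<Rightarrow> nat \<Rightarrow> nat" where
  "pw [] = (\<lambda>i. 0)"
| "pw (True # w) = pw w"
| "pw (False # w) = (\<lambda>i. if i \<in> {1..nR w} then Suc (pw w i) else 0)"

lemma pw_out: "i \<notin> {1..nR w} \<Longrightarrow> pw w i = 0"
  by (induction w rule: pw.induct) auto

lemma pw_exps: "s < nR w \<Longrightarrow> pw w (nR w - s) = exps w ! s"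
proof (induction w arbitrary: s)
  case (Cons c w)
  show ?case
  proof (cases c)
    case True
    show ?thesis
    proof (cases s)
      case 0 thus ?thesis using True pw_out[of "Suc (nR w)" w] by simp
    next
      case (Suc s') thus ?thesis using True Cons by simp
    qed
  next
    case False
    thus ?thesis using Cons by auto
  qed
qed simp

lemma pw_eq_exps: "pw w i = (if i \<in> {1..nR w} then exps w ! (nR w - i) else 0)"
  using pw_exps[of "nR w - i" w] pw_out[of i w] by auto

lemma exps_inj: "exps w = exps w' \<Longrightarrow> nC w = nC w' \<Longrightarrow> w = w'"
proof (induction w arbitrary: w')
  case Nil
  hence "nR w' = 0" using length_exps[of w'] by simp
  thus ?case using Nil(2) length_word[of w'] by simp
next
  case (Cons c w)
  show ?case
  proof (cases w')
    case Nil
    hence "nR (c # w) = 0" using Cons.prems(1) length_exps[of "c # w"] by simp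
    thus ?thesis using Cons.prems(2) Nil length_word[of "c # w"] by simp
  next
    case (Cons c' v)
    have "c = c'" using Cons.prems Cons
      by (cases c; cases c') (auto simp: Cons_eq_map_conv map_eq_Cons_conv)
    thus ?thesis using Cons.IH[of v] Cons.prems Cons by (cases c) (auto simp: inj_map_eq_map)
  qed
qed

lemma bij_betw_pw: "bij_betw pw (words m n) (partitions_in m n)"
  unfolding bij_betw_def
proof
  have e: "exps w = map (\<lambda>s. pw w (n - s)) [0..<n]" if "w \<in> words m n" for w
    by (rule nth_equalityI) (use that pw_exps in \<open>auto simp: words_def\<close>)
  show "inj_on pw (words m n)"
  proof (rule inj_onI)
    fix v w assume "v \<in> words m n" "w \<in> words m n" "pw v = pw w"
    thus "v = w" using e[of v] e[of w] by (intro exps_inj) (auto simp: words_def)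
  qed
  show "pw ` words m n = partitions_in m n"
  proof (intro equalityI subsetI)
    fix \<mu> assume "\<mu> \<in> pw ` words m n"
    then obtain w where w: "w \<in> words m n" "\<mu> = pw w" by blast
    have s: "sorted (exps w)"
      by (induction w rule: exps.induct) (auto simp: sorted_map)
    have "pw w j \<le> pw w i" if "1 \<le> i" "i \<le> j" for i j
    proof (cases "j \<le> nR w")
      case True
      thus ?thesis unfolding pw_eq_exps using that s by (auto intro!: sorted_nth_mono)
    qed (simp add: pw_out)
    moreover have "pw w i \<le> m" if "i \<in> {1..n}" for i
      using that w exps_nth_le[of "n - i" w] unfolding pw_eq_exps by (auto simp: words_def)
    ultimately show "\<mu> \<in> partitions_in m n"
      using w pw_out[of _ w] by (auto simp: partitions_in_def words_def)
  next
    fix \<mu> assume \<mu>: "\<mu> \<in> partitions_in m n"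
    define ks where "ks = map (\<lambda>s. \<mu> (n - s)) [0..<n]"
    have "\<exists>w\<in>words m (length ks). exps w = ks"
    proof (rule exps_surj)
      show "sorted ks" unfolding ks_def sorted_iff_nth_mono
      proof (intro allI impI)
        fix i j assume "i \<le> j" "j < length (map (\<lambda>s. \<mu> (n - s)) [0..<n])"
        moreover have "\<mu> (n - i) \<le> \<mu> (n - j)" if "i \<le> j" "j < n"
          using \<mu> that unfolding partitions_in_def mem_Collect_eq by (metis One_nat_def Suc_leI diff_le_mono2 zero_less_diff)
        ultimately show "map (\<lambda>s. \<mu> (n - s)) [0..<n] ! i \<le> map (\<lambda>s. \<mu> (n - s)) [0..<n] ! j" by simp
      qed
      show "k \<le> m" if "k \<in> set ks" for k using that \<mu> by (auto simp: ks_def partitions_in_def)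
    qed
    then obtain w where w: "w \<in> words m n" "exps w = ks" by (auto simp: ks_def)
    have "pw w i = \<mu> i" for i
      using w \<mu> unfolding pw_eq_exps by (auto simp: words_def ks_def partitions_in_def)
    thus "\<mu> \<in> pw ` words m n" using w by (intro image_eqI[of _ _ w]) auto
  qed
qed

lemma rect_complement_pw: "rect_complement (nC w) (nR w) (pw w) = pw (rev w)"
proof
  fix i
  have "i \<in> {1..nR w} \<Longrightarrow> nR w - Suc (nR w - i) = i - 1" by auto
  thus "rect_complement (nC w) (nR w) (pw w) i = pw (rev w) i"
    using exps_rev_nth[of "nR w - i" w]
    unfolding rect_complement_def pw_eq_exps by (auto simp: Suc_diff_le)
qed

text \<open>Membership of a box in the diagram, read once from its row and once from its
  column.\<close>

lemma exps_hts: "s < nR w \<Longrightarrow> k < nC w \<Longrightarrow> k < exps w ! s \<longleftrightarrow> nR w - s \<le> hts w ! k"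
proof (induction w arbitrary: s k rule: exps.induct)
  case (2 w)
  thus ?case using hts_nth_le[of k w] by (cases s) auto
next
  case (3 w)
  thus ?case by (cases k) auto
qed auto

lemma conjugate_pw: "1 \<le> j \<Longrightarrow> j \<le> nC w \<Longrightarrow> conjugate (pw w) j = hts w ! (j - 1)"
proof -
  assume j: "1 \<le> j" "j \<le> nC w"
  have "{i. 1 \<le> i \<and> j \<le> pw w i} = {1..hts w ! (j - 1)}"
  proof (intro set_eqI)
    fix i
    have "j \<le> pw w i \<longleftrightarrow> i \<le> hts w ! (j - 1)" if "1 \<le> i"
    proof (cases "i \<le> nR w")
      case True
      thus ?thesis using exps_hts[of "nR w - i" w "j - 1"] that j by (cases j) (auto simp: pw_eq_exps Suc_le_eq)
    next
      case False
      have "j - 1 < nC w" using j by linarith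
      from hts_nth_le[OF this] show ?thesis using False j by (auto simp: pw_eq_exps)
    qed
    thus "i \<in> {i. 1 \<le> i \<and> j \<le> pw w i} \<longleftrightarrow> i \<in> {1..hts w ! (j - 1)}" by auto
  qed
  thus ?thesis using j by (simp add: conjugate_def)
qed

lemma nR_map_Not [simp]: "nR (map Not w) = nC w" and nC_map_Not [simp]: "nC (map Not w) = nR w"
  by (induction w) auto

lemma exps_map_Not: "k < nC w \<Longrightarrow> exps (map Not w) ! k = nR w - hts w ! k"
proof (induction w arbitrary: k rule: exps.induct)
  case (2 w)
  thus ?case using hts_nth_le[of k w] by (simp add: Suc_diff_le)
next
  case (3 w)
  thus ?case by (cases k) auto
qed auto

lemma rect_complement_conjugate_pw:
  "rect_complement (nR w) (nC w) (conjugate (pw w)) = pw (map Not w)"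
proof
  fix i
  show "rect_complement (nR w) (nC w) (conjugate (pw w)) i = pw (map Not w) i"
    using conjugate_pw[of "nC w + 1 - i" w] exps_map_Not[of "nC w - i" w]
    by (auto simp: rect_complement_def pw_eq_exps)
qed

lemma prod_diagram_pw: "(\<Prod>(i, j)\<in>diagram (pw w). F i j) = prodB w (\<lambda>j s. F (nR w - s) (Suc j))"
proof -
  have "prodB w (\<lambda>j s. F (nR w - s) (Suc j)) = (\<Prod>x\<in>set (bxw w). F (nR w - snd x) (Suc (fst x)))"
    unfolding prodB_def by (rule prod.distinct_set_conv_list[OF distinct_bxw, symmetric])
  also have "\<dots> = (\<Prod>(i, j)\<in>diagram (pw w). F i j)"
  proof (rule prod.reindex_bij_witness[where j = "\<lambda>(j, s). (nR w - s, Suc j)" and i = "\<lambda>(i, j). (j - 1, nR w - i)"])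
    fix x assume x: "x \<in> set (bxw w)"
    obtain j s where "x = (j, s)" by (cases x)
    with x show "(case x of (j, s) \<Rightarrow> (nR w - s, Suc j)) \<in> diagram (pw w)"
      by (auto simp: set_bxw diagram_def pw_exps)
  next
    fix y assume "y \<in> diagram (pw w)"
    then obtain i j where y: "y = (i, j)" "1 \<le> i" "1 \<le> j" "j \<le> pw w i" by (auto simp: diagram_def)
    hence "i \<le> nR w" using pw_out[of i w] by (cases "i \<le> nR w") auto
    thus "(case y of (i, j) \<Rightarrow> (j - 1, nR w - i)) \<in> set (bxw w)"
      and "(\<lambda>(j, s). (nR w - s, Suc j)) (case y of (i, j) \<Rightarrow> (j - 1, nR w - i)) = y"
      using y by (auto simp: set_bxw pw_eq_exps)
  qed (auto simp: set_bxw)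
  finally show ?thesis ..
qed

text \<open>The number \<open>l\<^sub>1\<close> of \<open>split_index\<close>; as the parts
  decrease, it counts the full rows.\<close>

definition trail :: "bool list \<Rightarrow> nat"
  where "trail w = Max ({0} \<union> {i\<in>{1..nR w}. pw w i = nC w})"

lemma trail_True: "trail (True # w) = (if nC w = 0 then Suc (nR w) else trail w)"
proof (cases "nC w = 0")
  case True
  have "pw w i = 0" for i
    using exps_nth_le[of "nR w - i" w] True by (auto simp: pw_eq_exps)
  hence "{0} \<union> {i\<in>{1..nR (True # w)}. pw (True # w) i = nC (True # w)} = {0..Suc (nR w)}" using True by auto
  moreover have "Max {0..Suc (nR w)} = Suc (nR w)" by (rule Max_eqI) auto
  ultimately have "trail (True # w) = Suc (nR w)" by (simp only: trail_def)
  thus ?thesis using True by simp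
next
  case False
  have "pw w (Suc (nR w)) = 0" by (rule pw_out) simp
  hence "{i\<in>{1..nR (True # w)}. pw (True # w) i = nC (True # w)} = {i\<in>{1..nR w}. pw w i = nC w}"
    using False by (auto simp: le_Suc_eq)
  thus ?thesis using False by (simp only: trail_def if_False)
qed

lemma trail_False: "trail (False # w) = trail w"
proof -
  have "{i\<in>{1..nR (False # w)}. pw (False # w) i = nC (False # w)} = {i\<in>{1..nR w}. pw w i = nC w}" by auto
  thus ?thesis by (simp only: trail_def)
qed

lemma trail_le: "trail w \<le> nR w"
  unfolding trail_def by (subst Max_le_iff) auto

lemma mset_Upt: "mset (Upt a b q t w) =
  mset (take (nR w - trail w) (pts a q t w)) + mset (take (trail w) (pts b q t (rev w)))"
proof (induction w arbitrary: a)
  case (Cons c w)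
  show ?case
  proof (cases c)
    case True
    show ?thesis
    proof (cases "nC w = 0")
      case z: True
      thus ?thesis using True trail_True[of w] by (simp add: pts_append del: rev.simps)
    next
      case False
      have "take (trail w) (pts b q t (rev w @ [True])) = take (trail w) (pts b q t (rev w))"
        using trail_le[of w] by (simp add: pts_append)
      thus ?thesis using True False Cons.IH[of "a * t"] trail_True[of w] trail_le[of w] by (simp add: Suc_diff_le)
    qed
  next
    case False
    thus ?thesis using Cons.IH[of "a * q"] by (simp add: trail_False pts_append)
  qed
qed simp

text \<open>\<open>split_index\<close> computed along both paths: as words are read from the last
  row upwards, their first difference is met at the largest index where the partitions
  differ.\<close>

fun spl :: "bool list \<Rightarrow> bool list \<Rightarrow> nat" where
  "spl (False # w') (False # w) = spl w' w"
| "spl (True # w') (True # w) = spl w' w"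
| "spl (True # w') (False # w) = trail (True # w')"
| "spl (False # w') (True # w) = nR w'"
| "spl w' w = 0"

lemma spl_le: "spl w' w \<le> nR w'"
  by (induction w' w rule: spl.induct) (auto simp: trail_False intro: trail_le le_SucI trail_le[THEN order_trans])

lemma words_length_eq: "w' \<in> words (nC w) (nR w) \<Longrightarrow> length w' = length w"
  by (simp add: words_def length_word)

lemma mset_Xpt:
  assumes "w' \<in> words (nC w) (nR w)" "w' \<noteq> w"
  shows "mset (Xpt a b q t w' w) =
    mset (take (nR w - spl w' w) (pts a q t w')) + mset (take (spl w' w) (pts b q t (rev w')))"
  using assms
proof (induction a b q t w' w rule: Xpt.induct)
  case (1 a b q t w' w)
  thus ?case by (simp add: pts_append)
next
  case (2 a b q t w' w)
  have w: "nR w' = nR w" using 2 by (simp add: words_def)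
  have s: "spl w' w \<le> nR w" using spl_le[of w' w] w by simp
  have "take (spl w' w) (pts b q t (rev w' @ [True])) = take (spl w' w) (pts b q t (rev w'))"
    using s w by (simp add: pts_append)
  thus ?case using 2 s by (simp add: Suc_diff_le)
next
  case (3 a b q t w' w)
  have "nR (True # w') = nR (False # w)" using 3 by (simp add: words_def)
  thus ?case using mset_Upt[of a b q t "True # w'"] by (simp only: Xpt.simps spl.simps)
next
  case (4 a b q t w' w)
  have "nR w' = Suc (nR w)" using 4 by (simp add: words_def)
  thus ?case by (simp add: pts_append)
qed (auto dest: words_length_eq)

lemma split_index_pw:
  assumes "w' \<in> words (nC w) (nR w)" "w' \<noteq> w"
  shows "split_index (nC w) (nR w) (pw w') (pw w) = spl w' w"
  using assms
proof (induction w' w rule: spl.induct)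
  case (1 w' w)
  have n: "nR w' = nR w" "nC w' = nC w" using 1 by (simp_all add: words_def)
  have "{i \<in> {1..nR w}. pw (False # w') i \<noteq> pw (False # w) i} = {i \<in> {1..nR w}. pw w' i \<noteq> pw w i}"
    "{i \<in> {1..nR w}. pw (False # w') i = Suc (nC w)} = {i \<in> {1..nR w}. pw w' i = nC w}" using n by auto
  moreover define l0 where "l0 = Max {i \<in> {1..nR w}. pw w' i \<noteq> pw w i}"
  moreover have "pw (False # w') l0 < pw (False # w) l0 \<longleftrightarrow> pw w' l0 < pw w l0"
    using n pw_out[of l0 w] pw_out[of l0 w'] by auto
  ultimately have "split_index (nC (False # w)) (nR (False # w)) (pw (False # w')) (pw (False # w)) =
    split_index (nC w) (nR w) (pw w') (pw w)"
    unfolding split_index_def Let_def by simp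
  thus ?case using 1 by simp
next
  case (2 w' w)
  have n: "nR w' = nR w" "nC w' = nC w" using 2 by (simp_all add: words_def)
  have z: "pw w' (Suc (nR w)) = 0" "pw w (Suc (nR w)) = 0" using pw_out[of "Suc (nR w)"] n by auto
  have "nC w \<noteq> 0"
  proof
    assume "nC w = 0"
    hence "w \<in> words 0 (nR w)" "w' \<in> words 0 (nR w)" using n by (simp_all add: words_def)
    hence "w' = w" unfolding words_0_left by (metis singletonD)
    thus False using "2.prems"(2) by simp
  qed
  hence "{i \<in> {1..Suc (nR w)}. pw w' i \<noteq> pw w i} = {i \<in> {1..nR w}. pw w' i \<noteq> pw w i}"
    "{i \<in> {1..Suc (nR w)}. pw w' i = nC w} = {i \<in> {1..nR w}. pw w' i = nC w}" using z by (auto simp: le_Suc_eq)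
  hence "split_index (nC (True # w)) (nR (True # w)) (pw (True # w')) (pw (True # w)) =
    split_index (nC w) (nR w) (pw w') (pw w)"
    unfolding split_index_def Let_def by simp
  thus ?case using 2 by simp
next
  case (3 w' w)
  have n: "nR w = Suc (nR w')" "nC w' = Suc (nC w)" using 3 by (simp_all add: words_def)
  have z: "pw w' (Suc (nR w')) = 0" using pw_out[of "Suc (nR w')"] by auto
  have "Max {i \<in> {1..nR w}. pw w' i \<noteq> pw (False # w) i} = nR w"
    by (rule Max_eqI) (use n z in auto)
  thus ?case using n z trail_def[of "True # w'"] by (simp add: split_index_def Let_def)
next
  case (4 w' w)
  have n: "nR w' = Suc (nR w)" "nC w = Suc (nC w')" using 4 by (simp_all add: words_def)
  have z: "pw w (Suc (nR w)) = 0" using pw_out[of "Suc (nR w)"] by auto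
  have "Max {i \<in> {1..Suc (nR w)}. pw (False # w') i \<noteq> pw w i} = Suc (nR w)"
    by (rule Max_eqI) (use n z in auto)
  thus ?case using n z by (simp add: split_index_def Let_def)
qed (drule words_length_eq, simp)+

lemma pts_nth: "s < nR w \<Longrightarrow> pts a q t w ! s = a * q ^ (exps w ! s) * t ^ s"
proof (induction w arbitrary: a s)
  case (Cons c w) thus ?case by (cases c; cases s) (auto simp: mult_ac)
qed simp

text \<open>The walk lists the coordinates based at \<open>a\<close> from the last index downwards
  and those based at \<open>b\<close> from the first index upwards. Comparing multisets is enough,
  because the functions evaluated there are symmetric.\<close>

lemma image_mset_vanishing_point:
  assumes "w' \<in> words (nC w) (nR w)" "w' \<noteq> w"
  shows "image_mset (vanishing_point (nC w) (nR w) (pw w') (pw w) a b q t) (mset_set {1..nR w}) =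
    mset (Xpt a b q t w' w)"
proof -
  define n where "n = nR w"
  have n: "nR w' = n" "nC w' = nC w" using assms by (simp_all add: words_def n_def)
  define l where "l = spl w' w"
  have ln: "l \<le> n" using spl_le[of w' w] n by (simp add: l_def)
  define v where "v = vanishing_point (nC w) n (pw w') (pw w) a b q t"
  have v: "v i = (if i \<le> l then b * q ^ (nC w - pw w' i) * t ^ (i - 1) else a * q ^ pw w' i * t ^ (n - i))"
    if "i \<in> {1..n}" for i
    using that split_index_pw[OF assms] unfolding v_def vanishing_point_def by (simp add: l_def n_def)
  have b: "take l (pts b q t (rev w')) = map v [1..<Suc l]"
  proof (rule nth_equalityI)
    fix i assume "i < length (take l (pts b q t (rev w')))"
    hence i: "i < l" by simp
    have "take l (pts b q t (rev w')) ! i = b * q ^ (nC w - exps w' ! (n - 1 - i)) * t ^ i"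
      using i ln n by (simp add: pts_nth exps_rev_nth)
    also have "\<dots> = map v [1..<Suc l] ! i" using i ln n by (simp add: v pw_eq_exps del: upt_Suc)
    finally show "take l (pts b q t (rev w')) ! i = map v [1..<Suc l] ! i" .
  qed (use ln n in simp)
  have a: "take (n - l) (pts a q t w') = rev (map v [Suc l..<Suc n])"
  proof (rule nth_equalityI)
    fix i assume "i < length (take (n - l) (pts a q t w'))"
    hence i: "i < n - l" by simp
    have "take (n - l) (pts a q t w') ! i = a * q ^ (exps w' ! i) * t ^ i"
      using i ln n by (simp add: pts_nth)
    also have "\<dots> = v (n - i)" using i ln n by (auto simp: v pw_eq_exps)
    also have "n - i = Suc (n - Suc i)" using i by simp
    also have "v \<dots> = rev (map v [Suc l..<Suc n]) ! i" using i ln by (simp add: rev_nth del: upt_Suc)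
    finally show "take (n - l) (pts a q t w') ! i = rev (map v [Suc l..<Suc n]) ! i" .
  qed (use ln n in \<open>simp del: upt_Suc\<close>)
  have "[1..<Suc n] = [1..<Suc l] @ [Suc l..<Suc n]" using upt_add_eq_append[of 1 "Suc l" "n - l"] ln by simp
  moreover have "mset_set {1..n} = mset [1..<Suc n]"
    by (metis mset_upt atLeastLessThanSuc_atLeastAtMost)
  ultimately have "image_mset v (mset_set {1..n}) = mset (map v [1..<Suc l]) + mset (map v [Suc l..<Suc n])" by simp
  also have "\<dots> = mset (Xpt a b q t w' w)"
    unfolding mset_Xpt[OF assms] l_def[symmetric] n_def[symmetric] a b by simp
  finally show ?thesis by (simp only: v_def n_def)
qed

section \<open>Comparison with the interpolation theta functions\<close>

text \<open>The list of coordinates runs from \<open>x n\<close> down to \<open>x 1\<close>, so that \<open>v * t ^ (n - i)\<close> becomes an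
  ascending geometric progression.\<close>

definition coords :: "nat \<Rightarrow> (nat \<Rightarrow> complex) \<Rightarrow> complex list"
  where "coords n x = rev (map x [1..<Suc n])"

definition point :: "nat \<Rightarrow> complex list \<Rightarrow> nat \<Rightarrow> complex"
  where "point n xs = (\<lambda>i\<in>{1..n}. xs ! (n - i))"

lemma length_coords [simp]: "length (coords n x) = n"
  by (simp add: coords_def)

lemma coords_nth: "s < n \<Longrightarrow> coords n x ! s = x (n - s)"
  by (simp add: coords_def rev_nth Suc_diff_Suc del: upt_Suc)

lemma mset_coords: "mset (coords n x) = image_mset x (mset_set {1..n})"
  unfolding coords_def mset_rev mset_map by (simp only: mset_upt atLeastLessThanSuc_atLeastAtMost)

lemma prod_coords: "(\<Prod>z\<leftarrow>coords n x. h z) = (\<Prod>i\<in>{1..n}. h (x i))" for h :: "complex \<Rightarrow> complex"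
proof -
  have "(\<Prod>z\<leftarrow>coords n x. h z) = prod_mset (image_mset h (mset (coords n x)))"
    by (metis mset_map prod_mset_prod_list)
  thus ?thesis unfolding mset_coords by (simp add: image_mset.compositionality o_def prod_unfold_prod_mset)
qed

lemma coords_nonzero: "x \<in> torus n \<Longrightarrow> 0 \<notin> set (coords n x)"
  by (auto simp: coords_def torus_def PiE_iff simp del: upt_Suc)

lemma coords_point: "length xs = n \<Longrightarrow> coords n (point n xs) = xs"
  by (rule nth_equalityI) (auto simp: coords_nth point_def)

lemma point_coords: "x \<in> torus n \<Longrightarrow> point n (coords n x) = x"
  by (rule ext) (auto simp: point_def coords_nth torus_def PiE_iff extensional_def)

lemma point_torus: "length xs = n \<Longrightarrow> 0 \<notin> set xs \<Longrightarrow> point n xs \<in> torus n"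
  by (auto simp: torus_def point_def in_set_conv_nth)

lemma torus_upd: "x \<in> torus n \<Longrightarrow> i \<in> {1..n} \<Longrightarrow> z \<noteq> 0 \<Longrightarrow> x(i := z) \<in> torus n"
  by (auto simp: torus_def PiE_iff extensional_def)

lemma coords_upd:
  assumes "x \<in> torus n" "i \<in> {1..n}"
  obtains R where "Suc (length R) = n" "0 \<notin> set R" "\<And>z. mset (coords n (x(i := z))) = mset (z # R)"
proof -
  obtain R where R: "mset R = image_mset x (mset_set ({1..n} - {i}))" using ex_mset by blast
  have "set R = x ` ({1..n} - {i})" using arg_cong[OF R, of set_mset] by simp
  hence 1: "0 \<notin> set R" using assms by (auto simp: torus_def PiE_iff)
  have "size (mset R) = n - 1" unfolding R using assms(2) by simp
  hence 2: "Suc (length R) = n" using assms(2) by auto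
  have "mset (coords n (x(i := z))) = mset (z # R)" for z
  proof -
    have "mset_set {1..n} = add_mset i (mset_set ({1..n} - {i}))" using assms(2) by (simp add: mset_set.remove)
    moreover have "image_mset (x(i := z)) (mset_set ({1..n} - {i})) = image_mset x (mset_set ({1..n} - {i}))"
      by (rule image_mset_cong) auto
    ultimately show ?thesis by (simp add: mset_coords R)
  qed
  from that[OF 2 1 this] show ?thesis .
qed

lemma coords_permute: "\<pi> permutes {1..n} \<Longrightarrow> mset (coords n (x \<circ> \<pi>)) = mset (coords n x)"
proof -
  assume p: "\<pi> permutes {1..n}"
  have "image_mset \<pi> (mset_set {1..n}) = mset_set {1..n}"
    using image_mset_mset_set[OF permutes_inj_on[OF p, of "{1..n}"]] permutes_image[OF p] by simp
  thus ?thesis unfolding mset_coords image_mset.comp[symmetric] by (simp add: o_def)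
qed

context nome
begin

lemma C0_pw:
  assumes "q \<noteq> 0" "t \<noteq> 0"
  shows "C0 (pw w) [x] q t p = prodB w (\<lambda>j s. th (q ^ j * t ^ s * x / t ^ (nR w - 1)))"
proof -
  have "q powi (int (Suc j) - 1) * t powi (1 - int (nR w - s)) * x = q ^ j * t ^ s * x / t ^ (nR w - 1)"
    if "s < nR w" for j s
  proof -
    have "1 - int (nR w - s) = int s - int (nR w - 1)" using that by simp
    hence "t powi (1 - int (nR w - s)) = t ^ s / t ^ (nR w - 1)" using assms by (simp add: power_int_diff)
    thus ?thesis by simp
  qed
  thus ?thesis unfolding C0_def by (simp add: prod_diagram_pw th_def cong: prodB_cong)
qed

lemma C0_Cons: "C0 \<mu> (x # xs) q t p = C0 \<mu> [x] q t p * C0 \<mu> xs q t p"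
  by (simp add: C0_def)

lemma psi0_C0:
  assumes "q \<noteq> 0" "t \<noteq> 0" "v \<noteq> 0"
  shows "C0 (pw w) [t ^ (nR w - 1) * a * v, a / v] q t p *
    C0 (rect_complement (nC w) (nR w) (pw w)) [t ^ (nR w - 1) * b * v, b / v] q t p = psi0 a b q t w v"
  unfolding rect_complement_pw C0_Cons[of _ _ "[_]"] C0_pw[OF assms(1,2)] psi0_def prodB_mult
  using assms by (simp add: mult_ac)

text \<open>The first list entry is coordinate \<open>n\<close>, whereas quasi-periodicity is given
  in coordinate 1; the transposition of the two moves it.\<close>

lemma BC_theta_W:
  assumes f: "BC_theta p n m f" and n: "1 \<le> n"
  shows "W n m (\<lambda>xs. f (point n xs))"
  unfolding W_def
proof (intro conjI allI impI)
  fix xs ys :: "complex list" assume xs: "length xs = n" "0 \<notin> set xs" and m: "mset ys = mset xs"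
  have l: "length ys = n" using m xs(1) by (metis size_mset)
  have "image_mset (point n xs) (mset_set {1..n}) = image_mset (point n ys) (mset_set {1..n})"
    unfolding mset_coords[symmetric] coords_point[OF xs(1)] coords_point[OF l] by (rule m[symmetric])
  then obtain \<pi> where \<pi>: "\<pi> permutes {1..n}" "\<forall>i\<in>{1..n}. point n ys i = point n xs (\<pi> i)"
    using image_mset_eq_implies_permutes[of "{1..n}" "point n ys" "point n xs"] by (metis finite_atLeastAtMost)
  have "point n ys = point n xs \<circ> \<pi>"
  proof
    fix i show "point n ys i = (point n xs \<circ> \<pi>) i"
      using \<pi> permutes_not_in[OF \<pi>(1), of i] by (cases "i \<in> {1..n}") (auto simp: point_def)
  qed
  thus "f (point n ys) = f (point n xs)"
    using f \<pi>(1) point_torus[OF xs] by (simp add: BC_theta_def)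
next
  fix xs :: "complex list" assume xs: "Suc (length xs) = n" "0 \<notin> set xs"
  have u: "point n (z # xs) = (point n (y # xs))(n := z)" for z y
    using xs(1) n by (auto simp: point_def fun_eq_iff nth_Cons')
  have tor: "point n (z # xs) \<in> torus n" if "z \<noteq> 0" for z using that xs by (intro point_torus) auto
  have nth: "point n (z # xs) n = z" for z using n by (simp add: point_def)
  have nn: "n \<in> {1..n}" using n by simp
  show "V m (\<lambda>z. f (point n (z # xs)))"
    unfolding V_def
  proof (intro conjI allI impI)
    have "(\<lambda>z. f ((point n (1 # xs))(n := z))) holomorphic_on - {0}"
      using f tor[OF one_neq_zero] nn unfolding BC_theta_def holomorphic_on_torus_def by blast
    thus "(\<lambda>z. f (point n (z # xs))) holomorphic_on - {0}" by (simp only: u[of _ 1, symmetric])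
  next
    fix z :: complex assume z: "z \<noteq> 0"
    have inv: "f (x(i := 1 / x i)) = f x" if "x \<in> torus n" "i \<in> {1..n}" for x i
      using f that by (simp add: BC_theta_def)
    have perm: "f (x \<circ> \<pi>) = f x" if "x \<in> torus n" "\<pi> permutes {1..n}" for x \<pi>
      using f that by (simp add: BC_theta_def)
    have per: "f (x(1 := p * x 1)) = (p * (x 1)\<^sup>2) powi (- int m) * f x" if "x \<in> torus n" for x
      using f that by (simp add: BC_theta_def)
    show "f (point n (1 / z # xs)) = f (point n (z # xs))"
      using inv[OF tor[OF z] nn] by (simp only: nth u[of "1 / z" z])
    define \<sigma> where "\<sigma> = Transposition.transpose 1 n"
    have \<sigma>: "\<sigma> permutes {1..n}" unfolding \<sigma>_def using n by (intro permutes_swap_id) auto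
    define x where "x = point n (z # xs)"
    have x: "x \<in> torus n" using tor[OF z] by (simp add: x_def)
    define y where "y = x \<circ> \<sigma>"
    have y: "y \<in> torus n"
    proof -
      have "y i \<noteq> 0" if "i \<in> {1..n}" for i
        using x permutes_in_image[OF \<sigma>, of i] that by (auto simp: y_def torus_def PiE_iff)
      moreover have "y i = undefined" if "i \<notin> {1..n}" for i
        using x permutes_not_in[OF \<sigma> that] that by (auto simp: y_def torus_def PiE_iff extensional_def)
      ultimately show ?thesis by (auto simp: torus_def PiE_iff extensional_def)
    qed
    have y1: "y 1 = z" by (simp add: y_def \<sigma>_def x_def nth)
    have "y(1 := p * z) \<circ> \<sigma> = x(n := p * z)"
      by (auto simp: y_def \<sigma>_def fun_eq_iff Transposition.transpose_def)
    moreover have "y(1 := p * z) \<in> torus n" using torus_upd[OF y, of 1] n z p_nz by simp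
    ultimately have "f (x(n := p * z)) = f (y(1 := p * z))" using perm[OF _ \<sigma>] by metis
    also have "\<dots> = (p * z\<^sup>2) powi (- int m) * f y" using per[OF y] y1 by simp
    also have "f y = f x" unfolding y_def by (rule perm[OF x \<sigma>])
    finally have "f (point n (p * z # xs)) = (p * z\<^sup>2) powi (- int m) * f (point n (z # xs))"
      by (simp only: x_def u[of "p * z" z])
    thus "f (point n (p * z # xs)) * (p * z\<^sup>2) ^ m = f (point n (z # xs))"
      using z p_nz by (simp add: power_int_minus field_simps)
  qed
qed

text \<open>Joint continuity is the one property that the class \<open>W\<close> does not contain;
  it follows from the expansion into products over the single coordinates.\<close>

lemma BC_theta_P:
  assumes g: "gen M a b q t" "2 * (m + n) \<le> M" and w: "w \<in> words m n" and n: "1 \<le> n"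
  shows "BC_theta p n m (\<lambda>x\<in>torus n. c * P a b q t w (coords n x))"
proof -
  note G = gen_dest[OF g(1)]
  have mn: "nC w = m" "nR w = n" using w by (simp_all add: words_def)
  have lw: "2 * length w \<le> M" using g(2) mn by (simp add: length_word)
  define F where "F xs = c * P a b q t w xs" for xs
  have W: "W n m F" unfolding F_def
    using W_cmult[OF IntN_W[OF P_IntN[OF g(1) lw] G(1,10,11)], of c] mn by simp
  obtain \<gamma> where \<gamma>: "\<And>xs. length xs = n \<Longrightarrow> 0 \<notin> set xs \<Longrightarrow>
      F xs = (\<Sum>v\<in>words m n. \<gamma> v * KK xs (pts a t q (map Not v)))"
    using W_expand[OF G(3,4) g(2) W] by blast
  have sym: "F (coords n y) = F (z # R)" if "y \<in> torus n" "mset (coords n y) = mset (z # R)" for y z R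
  proof -
    have "length (z # R) = n" using that(2) by (metis size_mset length_coords)
    moreover have "0 \<notin> set (z # R)" using that(2) coords_nonzero[OF that(1)] by (metis mset_eq_setD)
    ultimately show ?thesis by (rule W_mset[OF W _ _ that(2)])
  qed
  have eq: "restrict (\<lambda>x. c * P a b q t w (coords n x)) (torus n) x = F (coords n x)" if "x \<in> torus n" for x
    using that by (simp add: F_def)
  have cont: "continuous_on (torus n) (\<lambda>x. F (coords n x))"
  proof -
    have "continuous_on (torus n) (\<lambda>x. \<Sum>v\<in>words m n. \<gamma> v * (\<Prod>i\<in>{1..n}. \<Prod>y\<leftarrow>pts a t q (map Not v). kern y (x i)))"
    proof (intro continuous_intros)
      fix v i assume i: "i \<in> {1..n}"
      have "continuous_on (- {0}) (\<lambda>z. \<Prod>y\<leftarrow>pts a t q (map Not v). kern y z)"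
      proof (rule holomorphic_on_imp_continuous_on, rule holomorphic_on_prod_list)
        fix y assume "y \<in> set (pts a t q (map Not v))"
        hence "y \<noteq> 0" using pts_nonzero[OF G(1,11,10)] by metis
        thus "(\<lambda>z. kern y z) holomorphic_on - {0}" by (intro kern_holomorphic holomorphic_on_ident) auto
      qed
      moreover have "continuous_on (torus n) (\<lambda>x. x i)"
        by (rule continuous_on_subset[OF continuous_on_product_coordinates]) auto
      ultimately show "continuous_on (torus n) (\<lambda>x. \<Prod>y\<leftarrow>pts a t q (map Not v). kern y (x i))"
        by (rule continuous_on_compose2) (use i in \<open>auto simp: torus_def PiE_iff\<close>)
    qed
    moreover have "(\<Sum>v\<in>words m n. \<gamma> v * (\<Prod>i\<in>{1..n}. \<Prod>y\<leftarrow>pts a t q (map Not v). kern y (x i))) = F (coords n x)"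
      if "x \<in> torus n" for x
      using \<gamma>[OF length_coords coords_nonzero[OF that]] by (simp add: KK_def prod_coords)
    ultimately show ?thesis by (simp cong: continuous_on_cong)
  qed
  show ?thesis
    unfolding BC_theta_def holomorphic_on_torus_def
  proof (intro conjI ballI allI impI)
    show "continuous_on (torus n) (\<lambda>x\<in>torus n. c * P a b q t w (coords n x))"
      using cont by (simp add: F_def cong: continuous_on_cong)
  next
    fix x i assume x: "x \<in> torus n" and i: "i \<in> {1..n}"
    obtain R where R: "Suc (length R) = n" "0 \<notin> set R" "\<And>z. mset (coords n (x(i := z))) = mset (z # R)"
      using coords_upd[OF x i] by blast
    have e: "restrict (\<lambda>x. c * P a b q t w (coords n x)) (torus n) (x(i := z)) = F (z # R)" if "z \<noteq> 0" for z
      using eq[OF torus_upd[OF x i that]] sym[OF torus_upd[OF x i that] R(3)] by simp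
    have V: "V m (\<lambda>z. F (z # R))" by (rule W_head[OF W R(1,2)])
    have xi: "x i \<noteq> 0" using x i by (auto simp: torus_def PiE_iff)
    show "(\<lambda>z. restrict (\<lambda>x. c * P a b q t w (coords n x)) (torus n) (x(i := z))) holomorphic_on - {0}"
      by (rule holomorphic_transform[of "\<lambda>z. F (z # R)"]) (use V e in \<open>auto simp: V_def\<close>)
    show "restrict (\<lambda>x. c * P a b q t w (coords n x)) (torus n) (x(i := 1 / x i)) =
      restrict (\<lambda>x. c * P a b q t w (coords n x)) (torus n) x"
      using e[of "1 / x i"] e[of "x i"] V_inverse[OF V xi] xi by simp
  next
    fix x assume x: "x \<in> torus n"
    have i: "1 \<in> {1..n}" using n by simp
    obtain R where R: "Suc (length R) = n" "0 \<notin> set R" "\<And>z. mset (coords n (x(1 := z))) = mset (z # R)"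
      using coords_upd[OF x i] by blast
    have e: "restrict (\<lambda>x. c * P a b q t w (coords n x)) (torus n) (x(1 := z)) = F (z # R)" if "z \<noteq> 0" for z
      using eq[OF torus_upd[OF x i that]] sym[OF torus_upd[OF x i that] R(3)] by simp
    have V: "V m (\<lambda>z. F (z # R))" by (rule W_head[OF W R(1,2)])
    have xi: "x 1 \<noteq> 0" using x i by (auto simp: torus_def PiE_iff)
    have "F (p * x 1 # R) * (p * (x 1)\<^sup>2) ^ m = F (x 1 # R)" by (rule V_p_mult[OF V xi])
    hence "F (p * x 1 # R) = (p * (x 1)\<^sup>2) powi (- int m) * F (x 1 # R)"
      using xi p_nz by (simp add: power_int_minus field_simps)
    thus "restrict (\<lambda>x. c * P a b q t w (coords n x)) (torus n) (x(1 := p * x 1)) =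
      (p * (x 1)\<^sup>2) powi (- int m) * restrict (\<lambda>x. c * P a b q t w (coords n x)) (torus n) x"
      using e[of "p * x 1"] e[of "x 1"] xi p_nz by simp
  next
    fix x \<pi> assume x: "x \<in> torus n" and \<pi>: "\<pi> permutes {1..n}"
    have "x \<circ> \<pi> \<in> torus n"
    proof -
      have "x (\<pi> i) \<noteq> 0" if "i \<in> {1..n}" for i
        using x permutes_in_image[OF \<pi>, of i] that by (auto simp: torus_def PiE_iff)
      moreover have "x (\<pi> i) = undefined" if "i \<notin> {1..n}" for i
        using x permutes_not_in[OF \<pi> that] that by (auto simp: torus_def PiE_iff extensional_def)
      ultimately show ?thesis by (auto simp: torus_def PiE_iff extensional_def)
    qed
    thus "restrict (\<lambda>x. c * P a b q t w (coords n x)) (torus n) (x \<circ> \<pi>) =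
      restrict (\<lambda>x. c * P a b q t w (coords n x)) (torus n) x"
      using eq x W_mset[OF W length_coords coords_nonzero[OF x] coords_permute[OF \<pi>]] by metis
  qed
qed

text \<open>The candidate vanishes where required by \<open>IntN_Xpt\<close> and is normalised by
  \<open>psi_gam\<close>; any other solution belongs to the class \<open>W\<close>, where
  \<open>P_unique\<close> applies.\<close>

lemma interpolation_theta_eq:
  assumes g: "gen M a b q t" "6 * (m + n) + 4 \<le> M" and w: "w \<in> words m n" and mn: "1 \<le> m" "1 \<le> n"
    and x: "x \<in> torus n"
  shows "interpolation_theta m n (pw w) x a b q t p = gam a b q t w * P a b q t w (coords n x)"
proof -
  note G = gen_dest[OF g(1)]
  have w': "nC w = m" "nR w = n" using w by (simp_all add: words_def)
  have M: "2 * (m + n) \<le> M" "6 * length w + 4 \<le> M" "2 * length w \<le> M" using g(2) w' by (simp_all add: length_word)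
  define f0 where "f0 = (\<lambda>x\<in>torus n. gam a b q t w * P a b q t w (coords n x))"
  note I = P_IntN[OF g(1) M(3)]
  have WP: "W n m (P a b q t w)" using IntN_W[OF I G(1,10,11)] w' by simp
  have vp: "vanishing_point m n \<mu> \<kappa> a b q t \<in> torus n" for \<mu> \<kappa>
    using G by (auto simp: vanishing_point_def torus_def)
  have mv: "mset (Xpt a b q t w' w) = mset (coords n (vanishing_point m n (pw w') (pw w) a b q t))"
    if "w' \<in> words m n" "w' \<noteq> w" for w'
    using image_mset_vanishing_point[of w' w a b q t] that w' by (simp add: mset_coords)
  have st: "(\<lambda>i\<in>{1..n}. v * t ^ (n - i)) = point n (strg v t n)" for v
    by (auto simp: point_def strg_nth fun_eq_iff)
  have nrm: "C0 (pw w) [t ^ (n - 1) * a * v, a / v] q t p *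
        C0 (rect_complement m n (pw w)) [t ^ (n - 1) * b * v, b / v] q t p = psi0 a b q t w v" if "v \<noteq> 0" for v
    using psi0_C0[OF G(10,11) that, of w a b] w' by simp
  have "f0 \<in> extensional (torus n) \<and> is_interpolation_theta m n (pw w) a b q t p f0"
    unfolding is_interpolation_theta_def
  proof (intro conjI ballI impI allI)
    show "f0 \<in> extensional (torus n)" by (simp add: f0_def)
    show "BC_theta p n m f0" unfolding f0_def by (rule BC_theta_P[OF g(1) M(1) w mn(2)])
  next
    fix \<mu> assume "\<mu> \<in> partitions_in m n" "\<mu> \<noteq> pw w"
    then obtain w1 where w1: "w1 \<in> words m n" "\<mu> = pw w1" "w1 \<noteq> w"
      using bij_betw_pw[of m n] by (auto simp: bij_betw_def)
    have "P a b q t w (coords n (vanishing_point m n \<mu> (pw w) a b q t)) = P a b q t w (Xpt a b q t w1 w)"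
      unfolding w1(2) by (rule W_mset[OF WP length_coords coords_nonzero[OF vp] mv[OF w1(1,3)], symmetric])
    also have "\<dots> = 0" by (rule IntN_Xpt[OF I _ w1(3) G(1,2,10,11)]) (use w1 w' in simp)
    finally show "f0 (vanishing_point m n \<mu> (pw w) a b q t) = 0" using vp by (simp add: f0_def)
  next
    fix v :: complex assume v: "v \<noteq> 0"
    have "point n (strg v t n) \<in> torus n" by (rule point_torus[OF length_strg strg_nonzero[OF v G(11)]])
    hence "f0 (point n (strg v t n)) = gam a b q t w * psi a b q t w v"
      by (simp add: f0_def coords_point psi_def w')
    thus "f0 (\<lambda>i\<in>{1..n}. v * t ^ (n - i)) = C0 (pw w) [t ^ (n - 1) * a * v, a / v] q t p *
        C0 (rect_complement m n (pw w)) [t ^ (n - 1) * b * v, b / v] q t p"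
      unfolding st nrm[OF v] psi_gam[OF g(1) M(2) v] .
  qed
  moreover have "f = f0" if f: "f \<in> extensional (torus n) \<and> is_interpolation_theta m n (pw w) a b q t p f" for f
  proof
    fix y show "f y = f0 y"
    proof (cases "y \<in> torus n")
      case False thus ?thesis using f by (auto simp: f0_def extensional_def)
    next
      case y: True
      have W: "W n m (\<lambda>xs. f (point n xs))" using f mn(2) by (intro BC_theta_W) (auto simp: is_interpolation_theta_def)
      have "f (point n (coords n y)) = gam a b q t w * P a b q t w (coords n y)"
      proof (rule P_unique[OF g(1) M(2)])
        show "W (nR w) (nC w) (\<lambda>xs. f (point n xs))" using W w' by simp
        show "nC w \<noteq> 0" using w' mn by simp
        show "length (coords n y) = nR w" "0 \<notin> set (coords n y)" using coords_nonzero[OF y] w' by simp_all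
        fix w1 assume "w1 \<in> words (nC w) (nR w)" and w1': "w1 \<noteq> w"
        hence w1: "w1 \<in> words m n" by (simp add: w')
        have "pw w1 \<in> partitions_in m n" "pw w1 \<noteq> pw w"
          using bij_betw_pw[of m n] w1 w1' w by (auto simp: bij_betw_def inj_on_def)
        hence "f (vanishing_point m n (pw w1) (pw w) a b q t) = 0" using f by (simp add: is_interpolation_theta_def)
        thus "f (point n (Xpt a b q t w1 w)) = 0"
          using W_mset[OF W length_coords coords_nonzero[OF vp] mv[OF w1 w1']] point_coords[OF vp] by simp
      next
        fix v :: complex assume v: "v \<noteq> 0"
        have "f (\<lambda>i\<in>{1..n}. v * t ^ (n - i)) = C0 (pw w) [t ^ (n - 1) * a * v, a / v] q t p *
          C0 (rect_complement m n (pw w)) [t ^ (n - 1) * b * v, b / v] q t p"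
          using f v unfolding is_interpolation_theta_def by blast
        thus "f (point n (strg v t (nR w))) = psi0 a b q t w v" unfolding st nrm[OF v] w' .
      qed
      thus ?thesis using y by (simp add: point_coords f0_def)
    qed
  qed
  ultimately have "(THE f. f \<in> extensional (torus n) \<and> is_interpolation_theta m n (pw w) a b q t p f) = f0"
    by (rule the_equality)
  thus ?thesis unfolding interpolation_theta_def using x by (simp add: f0_def)
qed

end

section \<open>The \<open>\<Delta>\<close> symbol\<close>

lemma hts_map_Not: "k < nR w \<Longrightarrow> hts (map Not w) ! k = nC w - exps w ! k"
proof (induction w arbitrary: k rule: exps.induct)
  case (2 w)
  thus ?case by (cases k) auto
qed auto

text \<open>Row \<open>s\<close> occupies the columns \<open>0\<close> to
  \<open>exps w ! s - 1\<close>, so a shift of the column index alters its product only at the two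
  ends.\<close>

lemma prodB_row_telescope:
  "prodB w (\<lambda>j s. G (Suc j) s) * (\<Prod>s<nR w. G 0 s) = prodB w G * (\<Prod>s<nR w. G (exps w ! s) s)"
proof (induction w arbitrary: G rule: bxw.induct)
  case (2 w)
  show ?case using "2.IH"[of "\<lambda>j s. G j (Suc s)"]
    by (simp add: prodB_True prod.lessThan_Suc_shift mult_ac del: prod.lessThan_Suc)
next
  case (3 w)
  have "prodB (False # w) (\<lambda>j s. G (Suc j) s) * (\<Prod>s<nR (False # w). G 0 s) =
    (\<Prod>s<nR w. G 0 s) * (prodB w (\<lambda>j s. G (Suc (Suc j)) s) * (\<Prod>s<nR w. G (Suc 0) s))"
    by (simp add: prodB_False mult_ac)
  also have "\<dots> = (\<Prod>s<nR w. G 0 s) * (prodB w (\<lambda>j s. G (Suc j) s) * (\<Prod>s<nR w. G (Suc (exps w ! s)) s))"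
    using "3.IH"[of "\<lambda>j s. G (Suc j) s"] by simp
  also have "\<dots> = prodB (False # w) G * (\<Prod>s<nR (False # w). G (exps (False # w) ! s) s)"
    by (simp add: prodB_False mult_ac)
  finally show ?case .
qed auto

lemma prod_split_at: "(\<Prod>i<n + k. f i) = (\<Prod>i<n. f i) * (\<Prod>i<k. f (n + i))" for f :: "nat \<Rightarrow> complex"
  by (induction k) (auto simp: mult_ac)

text \<open>Doubling each letter repeats every row and doubles every part, which is the passage to
  \<open>double_square\<close>.\<close>

fun dbl :: "bool list \<Rightarrow> bool list" where
  "dbl [] = []"
| "dbl (x # w) = x # x # dbl w"

lemma nR_dbl [simp]: "nR (dbl w) = 2 * nR w"
  by (induction w) auto

lemma double_square_pw: "double_square (pw w) = pw (dbl w)"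
proof (induction w)
  case (Cons c w)
  show ?case
  proof (cases c)
    case False
    show ?thesis
    proof
      fix i
      have "(i + 1) div 2 \<in> {1..nR w} \<longleftrightarrow> i \<in> {1..2 * nR w}" by auto
      moreover have "2 * pw w ((i + 1) div 2) = pw (dbl w) i"
        using fun_cong[OF Cons, of i] by (simp add: double_square_def)
      ultimately show "double_square (pw (c # w)) i = pw (dbl (c # w)) i"
        using False by (auto simp: double_square_def)
    qed
  qed (use Cons in \<open>simp add: double_square_def fun_eq_iff\<close>)
qed (simp add: double_square_def fun_eq_iff)

context nome
begin

lemma C0_pw':
  assumes "q \<noteq> 0" "t \<noteq> 0"
  shows "C0 (pw w) [x] q t p = prodB w (\<lambda>j s. th (q ^ j * t ^ Suc s * x / t ^ nR w))"
  unfolding C0_pw[OF assms]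
proof (rule prodB_cong)
  fix j s assume "s < nR w"
  hence "t ^ nR w = t ^ (nR w - 1) * t" by (simp flip: power_Suc2)
  thus "th (q ^ j * t ^ s * x / t ^ (nR w - 1)) = th (q ^ j * t ^ Suc s * x / t ^ nR w)"
    using assms by (simp add: mult_ac)
qed

lemma C0_False:
  assumes "q \<noteq> 0" "t \<noteq> 0"
  shows "C0 (pw (False # w)) [x] q t p = (\<Prod>s<nR w. th (t ^ Suc s * x / t ^ nR w)) * C0 (pw w) [q * x] q t p"
  unfolding C0_pw'[OF assms] prodB_False by (simp add: mult_ac)

lemma C0_q:
  assumes "q \<noteq> 0" "t \<noteq> 0"
  shows "C0 (pw w) [q * x] q t p * (\<Prod>s<nR w. th (t ^ Suc s * x / t ^ nR w)) =
    C0 (pw w) [x] q t p * (\<Prod>s<nR w. th (q ^ (exps w ! s) * t ^ Suc s * x / t ^ nR w))"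
  using prodB_row_telescope[of w "\<lambda>j s. th (q ^ j * t ^ Suc s * x / t ^ nR w)"]
  unfolding C0_pw'[OF assms] by (simp add: mult_ac)

lemma C0_double_square_False:
  assumes "q \<noteq> 0" "t \<noteq> 0"
  shows "C0 (double_square (pw (False # w))) [x] q t p =
    (\<Prod>s<nR w. th (t ^ Suc s * x / t ^ (2 * nR w))) * (\<Prod>s<nR w. th (t ^ Suc s * x / t ^ nR w)) *
    ((\<Prod>s<nR w. th (t ^ Suc s * (q * x) / t ^ (2 * nR w))) * (\<Prod>s<nR w. th (t ^ Suc s * (q * x) / t ^ nR w))) *
    C0 (double_square (pw w)) [q\<^sup>2 * x] q t p"
proof -
  have "(\<Prod>s<2 * nR w. th (t ^ Suc s * x / t ^ (2 * nR w))) =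
    (\<Prod>s<nR w. th (t ^ Suc s * x / t ^ (2 * nR w))) * (\<Prod>s<nR w. th (t ^ Suc s * x / t ^ nR w))" for x
    unfolding mult_2 prod_split_at using assms by (simp add: power_add mult_ac)
  note this[folded nR_dbl[of w]]
  moreover have "nR (False # dbl w) = nR (dbl w)" by simp
  ultimately show ?thesis unfolding double_square_pw dbl.simps C0_False[OF assms] nR_dbl[symmetric] power2_eq_square
    by (simp only: mult.assoc)
qed

text \<open>The natural-number subtractions do not truncate: a box has
  \<open>Suc j \<le> exps w ! s\<close>, and its column has at least \<open>nR w - s\<close>
  boxes.\<close>

lemma Cminus_pw:
  assumes "t \<noteq> 0"
  shows "Cminus (pw w) [x] q t p = prodB w (\<lambda>j s. th (q ^ (exps w ! s - Suc j) * t ^ (hts w ! j + s - nR w) * x))"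
  unfolding Cminus_def
proof (simp add: prod_diagram_pw flip: th_def, rule prodB_cong)
  fix j s assume s: "s < nR w" and j: "j < exps w ! s"
  have jm: "j < nC w" using j exps_nth_le[OF s] by simp
  have h: "nR w - s \<le> hts w ! j" using exps_hts[OF s jm] j by simp
  have "q powi (int (pw w (nR w - s)) - (1 + int j)) = q ^ (exps w ! s - Suc j)"
  proof -
    have "int (exps w ! s) - (1 + int j) = int (exps w ! s - Suc j)" using j by simp
    thus ?thesis unfolding pw_exps[OF s] by (simp only: power_int_of_nat)
  qed
  moreover have "t powi (int (conjugate (pw w) (Suc j)) - int (nR w - s)) = t ^ (hts w ! j + s - nR w)"
  proof -
    have "int (conjugate (pw w) (Suc j)) - int (nR w - s) = int (hts w ! j + s - nR w)"
      using conjugate_pw[of "Suc j" w] jm h s by simp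
    thus ?thesis by (simp only: power_int_of_nat)
  qed
  ultimately show "th (q powi (int (pw w (nR w - s)) - (1 + int j)) * t powi (int (conjugate (pw w) (Suc j)) - int (nR w - s)) * x) =
    th (q ^ (exps w ! s - Suc j) * t ^ (hts w ! j + s - nR w) * x)" by simp
qed

lemma Cminus_False:
  assumes "t \<noteq> 0"
  shows "Cminus (pw (False # w)) [x] q t p = (\<Prod>s<nR w. th (q ^ (exps w ! s) * t ^ s * x)) * Cminus (pw w) [x] q t p"
  unfolding Cminus_pw[OF assms] prodB_False
  by (intro arg_cong2[of _ _ _ _ "(*)"] prod.cong prodB_cong) auto

lemma Cplus_pw:
  assumes "q \<noteq> 0" "t \<noteq> 0"
  shows "Cplus (pw w) [x] q t p = prodB w (\<lambda>j s. th (q ^ (exps w ! s + j) * t ^ (s + 2) * x / t ^ (nR w + hts w ! j)))"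
proof -
  have *: "th (q powi (int (pw w (nR w - s)) + int (Suc j) - 1) * t powi (2 - int (conjugate (pw w) (Suc j)) - int (nR w - s)) * x) =
    th (q ^ (exps w ! s + j) * t ^ (s + 2) * x / t ^ (nR w + hts w ! j))" if s: "s < nR w" and j: "j < exps w ! s" for j s
  proof -
    have jm: "j < nC w" using j exps_nth_le[OF s] by simp
    have "int (pw w (nR w - s)) + int (Suc j) - 1 = int (exps w ! s + j)"
      unfolding pw_exps[OF s] by simp
    moreover have "2 - int (conjugate (pw w) (Suc j)) - int (nR w - s) = int (s + 2) - int (nR w + hts w ! j)"
      using conjugate_pw[of "Suc j" w] jm s by simp
    ultimately show ?thesis
      by (simp only: power_int_diff[OF disjI1[OF assms(2)]] power_int_of_nat times_divide_eq_left times_divide_eq_right)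
  qed
  show ?thesis
    unfolding Cplus_def list.map prod_list.Cons prod_list.Nil mult_1_right prod_diagram_pw th_def[symmetric]
    by (rule prodB_cong) (rule *)
qed

lemma Cplus_False:
  assumes "q \<noteq> 0" "t \<noteq> 0"
  shows "Cplus (pw (False # w)) [x] q t p =
    (\<Prod>s<nR w. th (q ^ Suc (exps w ! s) * t ^ (s + 2) * x / t ^ (2 * nR w))) * Cplus (pw w) [q\<^sup>2 * x] q t p"
  unfolding Cplus_pw[OF assms] prodB_False
  by (intro arg_cong2[of _ _ _ _ "(*)"] prod.cong prodB_cong) (auto simp: mult_2_right power2_eq_square mult_ac)

text \<open>The \<open>C0\<close> symbol of the rectangle in the denominator of the theorem,
  arranged so that a row or a column of the rectangle can be split off.\<close>

definition Rc :: "nat \<Rightarrow> nat \<Rightarrow> complex \<Rightarrow> complex \<Rightarrow> complex \<Rightarrow> complex \<Rightarrow> complex"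
  where "Rc m n a b q t = (\<Prod>j<m. \<Prod>s<n. th (q ^ j * t ^ s * (a * b))) * (\<Prod>j<m. \<Prod>s<n. th (q ^ j * b / (a * t ^ s)))"

lemma C0_rectangle:
  assumes "1 \<le> n" "t \<noteq> 0"
  shows "C0 (rectangle m n) [t ^ (n - 1) * a * b, b / a] q t p = Rc m n a b q t"
proof -
  have d: "diagram (rectangle m n) = {1..n} \<times> {1..m}" by (auto simp: diagram_def rectangle_def split: if_splits)
  have r: "C0 (rectangle m n) [x] q t p = (\<Prod>j<m. \<Prod>s<n. th (q ^ j * x / t ^ s))" for x
  proof -
    have "C0 (rectangle m n) [x] q t p = (\<Prod>i\<in>{1..n}. \<Prod>j\<in>{1..m}. th (q powi (int j - 1) * t powi (1 - int i) * x))"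
      unfolding C0_def d by (simp add: prod.cartesian_product th_def)
    also have "\<dots> = (\<Prod>s<n. \<Prod>j<m. th (q ^ j * x / t ^ s))"
    proof -
      have sh: "(\<Prod>i\<in>{1..k}. f i) = (\<Prod>i<k. f (Suc i))" for f :: "nat \<Rightarrow> complex" and k
        by (rule prod.reindex_bij_witness[of _ Suc "\<lambda>i. i - 1"]) auto
      have "t powi (1 - int (Suc s)) = 1 / t ^ s" for s
        using assms by (simp add: power_int_minus inverse_eq_divide)
      thus ?thesis unfolding sh by (simp add: mult_ac)
    qed
    also have "\<dots> = (\<Prod>j<m. \<Prod>s<n. th (q ^ j * x / t ^ s))" by (rule prod.swap)
    finally show ?thesis .
  qed
  have "(\<Prod>s<n. th (q ^ j * (t ^ (n - 1) * a * b) / t ^ s)) = (\<Prod>s<n. th (q ^ j * t ^ s * (a * b)))" for j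
  proof -
    have "(\<Prod>s<n. th (q ^ j * (t ^ (n - 1) * a * b) / t ^ s)) = (\<Prod>s<n. th (q ^ j * t ^ (n - 1 - s) * (a * b)))"
    proof (rule prod.cong[OF refl])
      fix s assume "s \<in> {..<n}"
      hence "t ^ (n - 1) = t ^ (n - 1 - s) * t ^ s" by (simp flip: power_add)
      thus "th (q ^ j * (t ^ (n - 1) * a * b) / t ^ s) = th (q ^ j * t ^ (n - 1 - s) * (a * b))"
        using assms by (simp add: mult_ac)
    qed
    also have "\<dots> = (\<Prod>s<n. th (q ^ j * t ^ s * (a * b)))" by (rule prod_reverse)
    finally show ?thesis .
  qed
  thus ?thesis unfolding C0_Cons[of _ _ "[_]"] r Rc_def by simp
qed

lemma th_p_mult_inverse: "x \<noteq> 0 \<Longrightarrow> th (p * x) = th (1 / x)"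
  using th_reflect[of "1 / x"] by simp

lemma Delta_two: "Delta \<mu> A [x, y] q t p =
    C0 \<mu> [x] q t p / C0 \<mu> [p * q * A / x] q t p * (C0 \<mu> [y] q t p / C0 \<mu> [p * q * A / y] q t p) *
    (C0 (double_square \<mu>) [p * q * A] q t p / (Cminus \<mu> [p * q] q t p * Cminus \<mu> [t] q t p *
      (Cplus \<mu> [A] q t p * Cplus \<mu> [p * q * A / t] q t p)))"
  by (simp add: Delta_def Cminus_def Cplus_def)

text \<open>A \<open>True\<close> step changes neither the partition nor \<open>A\<close>, because
  \<open>a\<close> becomes \<open>a * t\<close> while the number of rows drops by one. Only the
  argument \<open>t ^ n\<close> of \<Delta> changes, and its two \<open>C0\<close> symbols telescope
  along the columns.\<close>

lemma Delta_True:
  assumes g: "gen M a b q t" "2 * length w + 2 \<le> M" and A: "A * (t * q ^ nC w * b) = t ^ Suc (nR w) * a"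
  shows "kap a b q t w * Delta (pw w) A [t ^ Suc (nR w), y] q t p =
    Delta (pw w) A [t ^ nR w, y] q t p * (\<Prod>k<nC w. th (a * b * q ^ k) * th (q ^ k * b / a))"
proof -
  note G = gen_dest[OF g(1)]
  define m n where "m = nC w" and "n = nR w"
  have lw: "length w = m + n" by (simp add: m_def n_def length_word)
  have hn: "hts w ! k \<le> n" if "k < m" for k using hts_nth_le[of k w] that by (simp add: n_def m_def)
  define X1 X2 Y1 Y2 where "X1 = (\<Prod>k<m. th (q ^ k * t ^ Suc n))" and "X2 = (\<Prod>k<m. th (q ^ k * t ^ (Suc n - hts w ! k)))"
    and "Y1 = (\<Prod>k<m. th (q ^ (m - 1 - k) * b / a))" and "Y2 = (\<Prod>k<m. th (q ^ (m - 1 - k) * t ^ (hts w ! k) * b / a))"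
  define K where "K = (\<Prod>k<m. th (a * b * q ^ k))"
  have A': "A = t ^ n * a / (q ^ m * b)"
    using A G by (simp add: m_def n_def field_simps)
  have T1: "C0 (pw w) [t ^ n] q t p * X1 = C0 (pw w) [t ^ Suc n] q t p * X2"
  proof -
    have e1: "C0 (pw w) [t ^ n] q t p = prodB w (\<lambda>j s. th (q ^ j * t ^ Suc s))"
      and e2: "C0 (pw w) [t ^ Suc n] q t p = prodB w (\<lambda>j s. th (q ^ j * t ^ Suc (Suc s)))"
      unfolding C0_pw'[OF G(10,11)] n_def[symmetric] using G by (simp_all add: mult_ac)
    have "X2 = (\<Prod>k<m. th (q ^ k * t ^ Suc (n - hts w ! k)))"
      unfolding X2_def by (rule prod.cong) (auto simp: Suc_diff_le hn)
    thus ?thesis unfolding e1 e2 X1_def using prodB_telescope[of w "\<lambda>j s. th (q ^ j * t ^ Suc s)"]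
      by (simp only: m_def n_def)
  qed
  have T2: "C0 (pw w) [p * q * A / t ^ Suc n] q t p * Y1 = C0 (pw w) [p * q * A / t ^ n] q t p * Y2"
  proof -
    define Y where "Y j s = th (q ^ j * t ^ s * p * q * A / (t ^ n * t ^ n))" for j s
    have e1: "C0 (pw w) [p * q * A / t ^ Suc n] q t p = prodB w Y"
      and e2: "C0 (pw w) [p * q * A / t ^ n] q t p = prodB w (\<lambda>j s. Y j (Suc s))"
      unfolding C0_pw'[OF G(10,11)] n_def[symmetric] Y_def using G by (simp_all add: mult_ac)
    have Yk: "Y k (n - h) = th (q ^ (m - 1 - k) * t ^ h * b / a)" if "k < m" "h \<le> n" for k h
    proof -
      have "q ^ m = q ^ (m - 1 - k) * q ^ k * q" using that by (simp flip: power_add power_Suc2)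
      moreover have "t ^ n = t ^ (n - h) * t ^ h" using that by (simp flip: power_add)
      ultimately have "q ^ k * t ^ (n - h) * p * q * A / (t ^ n * t ^ n) = p * (a / (q ^ (m - 1 - k) * t ^ h * b))"
        unfolding A' using G by simp
      thus ?thesis unfolding Y_def using th_p_mult_inverse[of "a / (q ^ (m - 1 - k) * t ^ h * b)"] G by simp
    qed
    have y1: "Y1 = (\<Prod>k<m. Y k n)" unfolding Y1_def using Yk[of _ 0] by (intro prod.cong) auto
    have y2: "Y2 = (\<Prod>k<m. Y k (n - hts w ! k))" unfolding Y2_def using Yk hn by (intro prod.cong) auto
    show ?thesis unfolding e1 e2 y1 y2 using prodB_telescope[of w Y] by (simp only: m_def n_def)
  qed
  have k: "kap a b q t w = K * Y2 * X2 / X1"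
    unfolding kap_def K_def X1_def X2_def Y2_def m_def n_def by (simp add: prod.distrib prod_dividef)
  have r: "(\<Prod>k<m. th (a * b * q ^ k) * th (q ^ k * b / a)) = K * Y1"
    unfolding prod.distrib K_def Y1_def using prod_reverse[of "\<lambda>k. th (q ^ k * b / a)" m] by simp
  have X1n: "X1 \<noteq> 0"
  proof -
    have "th (q ^ k * t ^ Suc n) \<noteq> 0" if "k < m" for k
      by (rule gqD_nat[OF G(3)]) (use that lw g(2) in auto)
    thus ?thesis by (simp add: X1_def)
  qed
  have Yn: "Y1 \<noteq> 0" "Y2 \<noteq> 0"
  proof -
    have *: "th (q ^ (m - 1 - k) * t ^ h * b / a) \<noteq> 0" if "k < m" "h \<le> n" for k h
    proof -
      have "th (q ^ (m - 1 - k) * t ^ h * (b / a)) \<noteq> 0"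
        by (rule ngD_nat[OF G(9)]) (use that lw g(2) in auto)
      thus ?thesis by simp
    qed
    show "Y1 \<noteq> 0" using *[of _ 0] by (simp add: Y1_def)
    show "Y2 \<noteq> 0" using * hn by (simp add: Y2_def)
  qed
  have alg: "K * Y2 * X2 / X1 * (c1 / d1 * B * E) = c0 / d0 * B * E * (K * Y1)"
    if "c0 * X1 = c1 * X2" "d1 * Y1 = d0 * Y2" for c0 c1 d0 d1 B E
  proof -
    have "d1 = d0 * Y2 / Y1" "c0 = c1 * X2 / X1" using that X1n Yn by (simp_all add: field_simps)
    thus ?thesis using X1n Yn by simp
  qed
  show ?thesis unfolding Delta_two k r[unfolded m_def] n_def[symmetric] by (rule alg[OF T1 T2])
qed

text \<open>Removing the column of a \<open>False\<close> step turns \<open>A\<close> into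
  \<open>q^2 * A\<close>, and every symbol splits off a product over the rows (\<open>P1\<close> to
  \<open>P11\<close>). For the negated path this is a \<open>True\<close> step, so the compensating
  factor is \<open>kap\<close> at the dual parameters. The extra product on the left clears a
  denominator and reappears in \<open>Rc_False\<close>.\<close>

lemma Delta_False:
  assumes g: "gen M a b q t" "2 * length w + 4 \<le> M" and s: "\<sigma>\<^sup>2 = p"
    and A: "A * (t * q ^ Suc (nC w) * b) = t ^ nR w * a"
  shows "kap (\<sigma> / a) (\<sigma> / b) (1 / t) (1 / q) (map Not w) *
      Delta (pw (False # w)) A [t ^ nR w, q powi (- int (Suc (nC w)))] q t p *
      (\<Prod>s<nR w. th (b / (q * a * t ^ s))) =
    Delta (pw w) (q\<^sup>2 * A) [t ^ nR w, q powi (- int (nC w))] q t p *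
      ((\<Prod>s<nR w. th (t ^ s * (a * b))) * (\<Prod>s<nR w. th (q ^ nC w * b / (a * t ^ s))) *
       (\<Prod>s<nR w. th (q ^ nC w * b / (q * a * t ^ s))))"
proof -
  note G = gen_dest[OF g(1)]
  define m n where "m = nC w" and "n = nR w"
  have lw: "length w = m + n" by (simp add: m_def n_def length_word)
  have em: "exps w ! s \<le> m" if "s < n" for s using exps_nth_le[of s w] that by (simp add: n_def m_def)
  define Q where "Q = (\<Prod>s<n. th (t ^ s * (a * b)))"
  define P1 P2 where "P1 = (\<Prod>s<n. th (t ^ Suc s))" and "P2 = (\<Prod>s<n. th (q ^ (exps w ! s) * t ^ Suc s))"
  define P3 P4 P5 where "P3 = (\<Prod>s<n. th (t ^ Suc s * (p * q * A) / t ^ (2 * n)))"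
    and "P4 = (\<Prod>s<n. th (t ^ Suc s * (q * (p * q * A)) / t ^ (2 * n)))"
    and "P5 = (\<Prod>s<n. th (q ^ (exps w ! s) * t ^ Suc s * (q * (p * q * A)) / t ^ (2 * n)))"
  define P6 P7 where "P6 = (\<Prod>s<n. th (1 / (q ^ Suc m * t ^ s)))"
    and "P7 = (\<Prod>s<n. th (b / (q * a * t ^ s)))"
  define P8 P9 where "P8 = (\<Prod>s<n. th (q ^ m * b / (a * t ^ s)))"
    and "P9 = (\<Prod>s<n. th (q ^ m * b / (q * a * t ^ s)))"
  define P10 P11 where "P10 = (\<Prod>s<n. th (q ^ (exps w ! s) * t ^ s * (p * q)))"
    and "P11 = (\<Prod>s<n. th (q ^ Suc (exps w ! s) * t ^ (s + 2) * A / t ^ (2 * n)))"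
  have A': "A = t ^ n * a / (t * q ^ Suc m * b)"
    using A G by (simp add: m_def n_def field_simps)
  have qm: "q powi (- int (Suc m)) = 1 / q ^ Suc m" "q powi (- int m) = 1 / q ^ m"
    by (simp_all add: power_int_minus inverse_eq_divide del: of_nat_Suc power_Suc)
  have rev: "(\<Prod>s<n. th (t ^ Suc s * x / t ^ n)) = (\<Prod>s<n. th (x / t ^ s))" for x
  proof -
    have "(\<Prod>s<n. th (t ^ Suc s * x / t ^ n)) = (\<Prod>s<n. th (x / t ^ (n - 1 - s)))"
    proof (rule prod.cong[OF refl])
      fix s assume "s \<in> {..<n}"
      hence "t ^ n = t ^ (n - 1 - s) * t ^ Suc s" by (simp flip: power_add power_Suc)
      thus "th (t ^ Suc s * x / t ^ n) = th (x / t ^ (n - 1 - s))" using G by simp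
    qed
    also have "\<dots> = (\<Prod>s<n. th (x / t ^ s))" by (rule prod_reverse)
    finally show ?thesis .
  qed
  have f1: "C0 (pw (False # w)) [t ^ n] q t p = P1 * C0 (pw w) [q * t ^ n] q t p"
    unfolding C0_False[OF G(10,11)] P1_def n_def using G by simp
  have f1': "C0 (pw w) [q * t ^ n] q t p * P1 = C0 (pw w) [t ^ n] q t p * P2"
    using C0_q[OF G(10,11), of w "t ^ n"] unfolding P1_def P2_def n_def using G by simp
  have f2: "C0 (pw (False # w)) [p * q * A / t ^ n] q t p = P3 * C0 (pw w) [q * (p * q * A) / t ^ n] q t p"
    unfolding C0_False[OF G(10,11)] P3_def n_def mult_2 power_add by (simp add: mult_ac)
  have f2': "C0 (pw w) [p * q * (q\<^sup>2 * A) / t ^ n] q t p * P4 = C0 (pw w) [q * (p * q * A) / t ^ n] q t p * P5"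
    using C0_q[OF G(10,11), of w "q * (p * q * A) / t ^ n"]
    unfolding P4_def P5_def n_def mult_2 power_add by (simp add: power2_eq_square mult_ac)
  have f3: "C0 (pw (False # w)) [q powi (- int (Suc m))] q t p = P6 * C0 (pw w) [q powi (- int m)] q t p"
    unfolding C0_False[OF G(10,11)] n_def[symmetric] rev P6_def qm using G by (simp add: mult_ac)
  have f4: "C0 (pw (False # w)) [p * q * A / (q powi (- int (Suc m)))] q t p =
      P7 * C0 (pw w) [p * q * (q\<^sup>2 * A) / (q powi (- int m))] q t p"
  proof -
    have "(\<Prod>s<n. th (t ^ Suc s * (p * q * A / (q powi (- int (Suc m)))) / t ^ n)) = P7"
      unfolding P7_def
    proof (rule prod.cong[OF refl])
      fix s
      have "t ^ Suc s * (p * q * A / (q powi (- int (Suc m)))) / t ^ n = p * (q * a * t ^ s / b)"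
        unfolding qm A' using G by simp
      thus "th (t ^ Suc s * (p * q * A / (q powi (- int (Suc m)))) / t ^ n) = th (b / (q * a * t ^ s))"
        using th_p_mult_inverse[of "q * a * t ^ s / b"] G by simp
    qed
    thus ?thesis unfolding C0_False[OF G(10,11)] n_def[symmetric] qm by (simp add: power2_eq_square mult_ac)
  qed
  have f5: "C0 (double_square (pw (False # w))) [p * q * A] q t p =
      P3 * P8 * (P4 * P9) * C0 (double_square (pw w)) [p * q * (q\<^sup>2 * A)] q t p"
  proof -
    have 1: "(\<Prod>s<n. th (t ^ Suc s * (p * q * A) / t ^ n)) = P8"
      unfolding P8_def
    proof (rule prod.cong[OF refl])
      fix s
      have "t ^ Suc s * (p * q * A) / t ^ n = p * (a * t ^ s / (q ^ m * b))"
        unfolding A' using G by simp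
      thus "th (t ^ Suc s * (p * q * A) / t ^ n) = th (q ^ m * b / (a * t ^ s))"
        using th_p_mult_inverse[of "a * t ^ s / (q ^ m * b)"] G by simp
    qed
    have 2: "(\<Prod>s<n. th (t ^ Suc s * (q * (p * q * A)) / t ^ n)) = P9"
      unfolding P9_def
    proof (rule prod.cong[OF refl])
      fix s
      have "t ^ Suc s * (q * (p * q * A)) / t ^ n = p * (q * a * t ^ s / (q ^ m * b))"
        unfolding A' using G by simp
      thus "th (t ^ Suc s * (q * (p * q * A)) / t ^ n) = th (q ^ m * b / (q * a * t ^ s))"
        using th_p_mult_inverse[of "q * a * t ^ s / (q ^ m * b)"] G by simp
    qed
    show ?thesis
      using C0_double_square_False[OF G(10,11), of w "p * q * A"]
      unfolding n_def[symmetric] 1 2 P3_def[symmetric] P4_def[symmetric] by (simp add: mult_ac)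
  qed
  have f6: "Cminus (pw (False # w)) [p * q] q t p = P10 * Cminus (pw w) [p * q] q t p"
    unfolding Cminus_False[OF G(11)] P10_def n_def ..
  have f7: "Cminus (pw (False # w)) [t] q t p = P2 * Cminus (pw w) [t] q t p"
    unfolding Cminus_False[OF G(11)] P2_def n_def by (simp add: mult_ac)
  have f8: "Cplus (pw (False # w)) [A] q t p = P11 * Cplus (pw w) [q\<^sup>2 * A] q t p"
    unfolding Cplus_False[OF G(10,11)] P11_def n_def ..
  have f9: "Cplus (pw (False # w)) [p * q * A / t] q t p = P5 * Cplus (pw w) [p * q * (q\<^sup>2 * A) / t] q t p"
    unfolding Cplus_False[OF G(10,11)] P5_def n_def using G by (simp add: mult_ac)
  have k: "kap (\<sigma> / a) (\<sigma> / b) (1 / t) (1 / q) (map Not w) = Q * P11 * P10 / P6"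
  proof -
    have "kap (\<sigma> / a) (\<sigma> / b) (1 / t) (1 / q) (map Not w) = (\<Prod>k<n. th (t ^ k * (a * b)) *
      th (q ^ Suc (exps w ! k) * t ^ (k + 2) * A / t ^ (2 * n)) * th (q ^ (exps w ! k) * t ^ k * (p * q)) /
      th (1 / (q ^ Suc m * t ^ k)))"
      unfolding kap_def
    proof (rule prod.cong)
      fix k assume "k \<in> {..<n}" hence k: "k < n" by simp
      define e where "e = exps w ! k"
      have em: "e \<le> m" using em[OF k] by (simp add: e_def)
      have h: "hts (map Not w) ! k = m - e" using hts_map_Not[of k w] k by (simp add: e_def m_def n_def)
      have mm: "Suc m - (m - e) = Suc e" using em by simp
      have tn: "t ^ n = t ^ (n - 1 - k) * t ^ k * t" using k by (simp flip: power_add power_Suc2)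
      have qe: "q ^ m = q ^ (m - e) * q ^ e" using em by (simp flip: power_add)
      have 1: "th (\<sigma> / a * (\<sigma> / b) * (1 / t) ^ k) = th (t ^ k * (a * b))"
        using th_reflect[of "t ^ k * (a * b)"] G unfolding s[symmetric]
        by (simp add: power2_eq_square power_one_over mult_ac)
      have "(1 / t) ^ (n - 1 - k) * (1 / q) ^ (m - e) * (\<sigma> / b) / (\<sigma> / a) =
        q ^ Suc e * t ^ (k + 2) * A / t ^ (2 * n)"
      proof -
        have s0: "\<sigma> \<noteq> 0" using s p_nz by auto
        have "q ^ Suc e * t ^ (k + 2) * A / t ^ (2 * n) = q ^ e * t ^ k * t * a / (t ^ n * q ^ m * b)"
          unfolding A' mult_2 power_add using G by (simp add: power2_eq_square mult_ac)
        also have "\<dots> = a / (t ^ (n - 1 - k) * q ^ (m - e) * b)"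
          unfolding tn qe using G by simp
        finally show ?thesis using s0 by (simp add: power_one_over mult_ac)
      qed
      moreover have "th ((1 / t) ^ k * (1 / q) ^ Suc e) = th (q ^ e * t ^ k * (p * q))"
        using th_p_mult_inverse[of "q ^ Suc e * t ^ k"] G by (simp add: power_one_over mult_ac)
      moreover have "(1 / t) ^ k * (1 / q) ^ Suc m = 1 / (q ^ Suc m * t ^ k)"
        by (simp add: power_one_over mult_ac)
      ultimately show "th (\<sigma> / a * (\<sigma> / b) * (1 / t) ^ k) *
        th ((1 / t) ^ (nC (map Not w) - 1 - k) * (1 / q) ^ (hts (map Not w) ! k) * (\<sigma> / b) / (\<sigma> / a)) *
        th ((1 / t) ^ k * (1 / q) ^ (Suc (nR (map Not w)) - hts (map Not w) ! k)) /
        th ((1 / t) ^ k * (1 / q) ^ Suc (nR (map Not w))) =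
        th (t ^ k * (a * b)) * th (q ^ Suc (exps w ! k) * t ^ (k + 2) * A / t ^ (2 * n)) *
        th (q ^ (exps w ! k) * t ^ k * (p * q)) / th (1 / (q ^ Suc m * t ^ k))"
        unfolding 1 h nR_map_Not nC_map_Not m_def[symmetric] n_def[symmetric] mm e_def[symmetric] by (simp only:)
    qed (simp add: n_def)
    thus ?thesis unfolding Q_def P11_def P10_def P6_def by (simp only: prod.distrib prod_dividef)
  qed
  have nz: "P2 \<noteq> 0" "P3 \<noteq> 0" "P4 \<noteq> 0" "P5 \<noteq> 0" "P6 \<noteq> 0" "P7 \<noteq> 0" "P10 \<noteq> 0" "P11 \<noteq> 0"
  proof -
    have "th (q ^ (exps w ! s) * t ^ Suc s) \<noteq> 0" if "s < n" for s
      by (rule gqD_nat[OF G(3)]) (use that em[of s] lw g(2) in auto)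
    thus "P2 \<noteq> 0" by (simp add: P2_def)
    have gA: "th (q ^ i * t ^ j * A / t ^ (2 * n)) \<noteq> 0" if "i \<le> m + 2" "j \<le> n + 2" for i j
    proof -
      have "th (q ^ i * t ^ j * (a / b) / (q ^ Suc m * t ^ Suc n)) \<noteq> 0"
        by (rule ngD_diff[OF G(8,3)]) (use that lw g(2) in auto)
      thus ?thesis unfolding A' mult_2 power_add using G by (simp add: mult_ac)
    qed
    have gpA: "th (q ^ i * t ^ j * (p * A) / t ^ (2 * n)) \<noteq> 0" if "i \<le> m + 2" "j \<le> n + 2" for i j
    proof -
      have "q ^ i * t ^ j * A / t ^ (2 * n) \<noteq> 0" using G unfolding A' by simp
      from th_p_mult_0_iff[OF this] gA[OF that] show ?thesis by (simp add: mult_ac)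
    qed
    have "th (t ^ Suc s * (p * q * A) / t ^ (2 * n)) \<noteq> 0" if "s < n" for s
      using gpA[of 1 "Suc s"] that by (simp add: mult_ac)
    thus "P3 \<noteq> 0" by (simp add: P3_def)
    have "th (t ^ Suc s * (q * (p * q * A)) / t ^ (2 * n)) \<noteq> 0" if "s < n" for s
      using gpA[of 2 "Suc s"] that by (simp add: mult_ac power2_eq_square)
    thus "P4 \<noteq> 0" by (simp add: P4_def)
    have "th (q ^ (exps w ! s) * t ^ Suc s * (q * (p * q * A)) / t ^ (2 * n)) \<noteq> 0" if "s < n" for s
      using gpA[of "exps w ! s + 2" "Suc s"] that em[OF that] by (simp add: mult_ac power2_eq_square power_add)
    thus "P5 \<noteq> 0" by (simp add: P5_def)
    have "th (1 / (q ^ Suc m * t ^ s)) \<noteq> 0" if "s < n" for s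
    proof -
      have "th (q ^ Suc m * t ^ s) \<noteq> 0" by (rule gqD_nat[OF G(3)]) (use that lw g(2) in auto)
      thus ?thesis using th_inverse_0_iff[of "q ^ Suc m * t ^ s"] G by simp
    qed
    thus "P6 \<noteq> 0" by (simp add: P6_def)
    have "th (b / (q * a * t ^ s)) \<noteq> 0" if "s < n" for s
      using ngD_diff[OF G(9,3), of 0 1 0 s] that lw g(2) by (simp add: mult_ac)
    thus "P7 \<noteq> 0" by (simp add: P7_def)
    have "th (q ^ (exps w ! s) * t ^ s * (p * q)) \<noteq> 0" if "s < n" for s
    proof -
      have "th (q ^ Suc (exps w ! s) * t ^ s) \<noteq> 0"
        by (rule gqD_nat[OF G(3)]) (use that em[of s] lw g(2) in auto)
      thus ?thesis using th_p_mult_0_iff[of "q ^ Suc (exps w ! s) * t ^ s"] G by (simp add: mult_ac)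
    qed
    thus "P10 \<noteq> 0" by (simp add: P10_def)
    have "th (q ^ Suc (exps w ! s) * t ^ (s + 2) * A / t ^ (2 * n)) \<noteq> 0" if "s < n" for s
      by (rule gA) (use that em[OF that] in auto)
    thus "P11 \<noteq> 0" by (simp add: P11_def)
  qed
  \<comment> \<open>The remaining symbols have become letters, and the claim is a rational identity;
    its two hypotheses are the row telescopings \<open>f1'\<close> and \<open>f2'\<close>.\<close>
  have alg: "Q * P11 * P10 / P6 * (P1 * c1 / (P3 * d1) * (P6 * c2 / (P7 * d2)) *
      (P3 * P8 * (P4 * P9) * e / (P10 * e1 * (P2 * e2) * (P11 * e3 * (P5 * e4))))) * P7 =
     c0 / d0 * (c2 / d2) * (e / (e1 * e2 * (e3 * e4))) * (Q * P8 * P9)"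
    if "c1 * P1 = c0 * P2" "d0 * P4 = d1 * P5" for c0 c1 d0 d1 c2 d2 e e1 e2 e3 e4
  proof -
    have "c0 = P1 * c1 / P2" "d1 = d0 * P4 / P5" using that nz by (simp_all add: field_simps)
    thus ?thesis using nz by (simp add: mult_ac)
  qed
  show ?thesis
    unfolding Delta_two k m_def[symmetric] n_def[symmetric] f1 f2 f3 f4 f5 f6 f7 f8 f9
      Q_def[symmetric] P7_def[symmetric] P8_def[symmetric] P9_def[symmetric]
    by (rule alg[OF f1' f2'])
qed

lemma Rc_True:
  assumes "t \<noteq> 0"
  shows "Rc m (Suc n) a b q t = Rc m n (a * t) b q t * (\<Prod>k<m. th (a * b * q ^ k) * th (q ^ k * b / a))"
  unfolding Rc_def prod.lessThan_Suc_shift by (simp add: prod.distrib mult_ac)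

text \<open>The shift of \<open>a\<close> by \<open>q\<close> lowers the exponents in the second
  product by one, and the range is shorter by one; so the two sides differ by two factors at the
  upper end and by \<open>f 0\<close> at the lower end.\<close>

lemma Rc_False:
  assumes "q \<noteq> 0"
  shows "Rc (Suc m) n a b q t * (\<Prod>s<n. th (b / (q * a * t ^ s))) = Rc m n (a * q) b q t *
    ((\<Prod>s<n. th (t ^ s * (a * b))) * (\<Prod>s<n. th (q ^ m * b / (a * t ^ s))) * (\<Prod>s<n. th (q ^ m * b / (q * a * t ^ s))))"
proof -
  define f where "f j = (\<Prod>s<n. th (q ^ j * b / (q * a * t ^ s)))" for j
  have f: "f (Suc j) = (\<Prod>s<n. th (q ^ j * b / (a * t ^ s)))" for j
    unfolding f_def using assms by (simp add: mult_ac)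
  have "(\<Prod>j<Suc m. f (Suc j)) * f 0 = (\<Prod>j<Suc (Suc m). f j)"
    by (simp only: prod.lessThan_Suc_shift mult.commute)
  also have "\<dots> = (\<Prod>j<m. f j) * (f (Suc m) * f m)" by (simp add: mult_ac)
  finally have 1: "(\<Prod>j<Suc m. f (Suc j)) * f 0 = (\<Prod>j<m. f j) * (f (Suc m) * f m)" .
  have 2: "(\<Prod>j<Suc m. \<Prod>s<n. th (q ^ j * t ^ s * (a * b))) =
    (\<Prod>s<n. th (t ^ s * (a * b))) * (\<Prod>j<m. \<Prod>s<n. th (q ^ j * t ^ s * (a * q * b)))"
    unfolding prod.lessThan_Suc_shift by (simp add: mult_ac)
  have 3: "(\<Prod>j<m. f j) = (\<Prod>j<m. \<Prod>s<n. th (q ^ j * b / (a * q * t ^ s)))"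
    unfolding f_def by (simp add: mult_ac)
  have 4: "f 0 = (\<Prod>s<n. th (b / (q * a * t ^ s)))" unfolding f_def by simp
  have alg: "x * y * P * f0 = y * Q * (x * R * S)" if "P * f0 = Q * (R * S)" for x y P f0 Q R S :: complex
  proof -
    have "x * y * P * f0 = x * y * (P * f0)" by (simp only: mult.assoc)
    thus ?thesis unfolding that by (simp only: mult_ac)
  qed
  show ?thesis
    unfolding Rc_def 2 3[symmetric] 4[symmetric] f[symmetric] f_def[of m, symmetric]
    using alg[OF 1] by (simp only: mult.assoc)
qed

text \<open>\<Delta> with the two scalars and the rectangle symbol obey the same first-order
  recursions in both kinds of steps. Hence the coefficient in the theorem is the reciprocal of the
  product of the two scalings.\<close>

lemma Delta_gam:
  assumes "gen M a b q t" "4 * length w + 4 \<le> M" "\<sigma>\<^sup>2 = p" "A * (t * q ^ nC w * b) = t ^ nR w * a"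
  shows "gam a b q t w * gam (\<sigma> / a) (\<sigma> / b) (1 / t) (1 / q) (map Not w) *
    Delta (pw w) A [t ^ nR w, q powi (- int (nC w))] q t p = Rc (nC w) (nR w) a b q t"
  using assms
proof (induction w arbitrary: a A M)
  case Nil
  have "diagram (\<lambda>i. 0) = {}" "double_square (\<lambda>i. 0) = (\<lambda>i. 0)" by (auto simp: diagram_def double_square_def)
  thus ?case by (simp add: Delta_def C0_def Cminus_def Cplus_def Rc_def)
next
  case (Cons c w)
  note G = gen_dest[OF Cons.prems(1)]
  have M: "M - 2 + 2 = M" "4 * length w + 4 \<le> M - 2" using Cons.prems(2) by auto
  define D where "D a = gam (\<sigma> / a) (\<sigma> / b) (1 / t) (1 / q) (map Not w)" for a
  show ?case
  proof (cases c)
    case True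
    have g: "gen (M - 2) (a * t) b q t" using gen_shift_t[of "M - 2" a b q t] Cons.prems(1) M by simp
    have A: "A * (t * q ^ nC w * b) = t ^ Suc (nR w) * a" using Cons.prems(4) True by simp
    define \<rho> where "\<rho> = (\<Prod>k<nC w. th (a * b * q ^ k) * th (q ^ k * b / a))"
    have 1: "gam (a * t) b q t w * D (a * t) * Delta (pw w) A [t ^ nR w, q powi (- int (nC w))] q t p = Rc (nC w) (nR w) (a * t) b q t"
      unfolding D_def by (rule Cons.IH[OF g M(2) Cons.prems(3)]) (use A in \<open>simp add: mult_ac\<close>)
    have 2: "kap a b q t w * Delta (pw w) A [t ^ Suc (nR w), q powi (- int (nC w))] q t p =
      Delta (pw w) A [t ^ nR w, q powi (- int (nC w))] q t p * \<rho>"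
      unfolding \<rho>_def by (rule Delta_True[OF Cons.prems(1) _ A]) (use Cons.prems(2) in simp)
    have "kap a b q t w * gam (a * t) b q t w * D (a * t) * Delta (pw w) A [t ^ Suc (nR w), q powi (- int (nC w))] q t p =
      gam (a * t) b q t w * D (a * t) * (kap a b q t w * Delta (pw w) A [t ^ Suc (nR w), q powi (- int (nC w))] q t p)"
      by (simp only: mult_ac)
    also have "\<dots> = Rc (nC w) (nR w) (a * t) b q t * \<rho>" unfolding 2 1[symmetric] by (simp only: mult.assoc)
    also have "\<dots> = Rc (nC w) (Suc (nR w)) a b q t" unfolding \<rho>_def by (rule Rc_True[OF G(11), symmetric])
    finally show ?thesis using True by (simp add: D_def)
  next
    case False
    have g: "gen (M - 2) (a * q) b q t" using gen_shift_q[of "M - 2" a b q t] Cons.prems(1) M by simp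
    have A: "A * (t * q ^ Suc (nC w) * b) = t ^ nR w * a" using Cons.prems(4) False by simp
    define \<kappa> where "\<kappa> = kap (\<sigma> / a) (\<sigma> / b) (1 / t) (1 / q) (map Not w)"
    define P7 where "P7 = (\<Prod>s<nR w. th (b / (q * a * t ^ s)))"
    define \<rho> where "\<rho> = (\<Prod>s<nR w. th (t ^ s * (a * b))) * (\<Prod>s<nR w. th (q ^ nC w * b / (a * t ^ s))) *
       (\<Prod>s<nR w. th (q ^ nC w * b / (q * a * t ^ s)))"
    have 1: "gam (a * q) b q t w * D (a * q) * Delta (pw w) (q\<^sup>2 * A) [t ^ nR w, q powi (- int (nC w))] q t p = Rc (nC w) (nR w) (a * q) b q t"
      unfolding D_def
    proof (rule Cons.IH[OF g M(2) Cons.prems(3)])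
      have "q\<^sup>2 * A * (t * q ^ nC w * b) = A * (t * q ^ Suc (nC w) * b) * q" by (simp add: power2_eq_square mult_ac)
      thus "q\<^sup>2 * A * (t * q ^ nC w * b) = t ^ nR w * (a * q)" unfolding A by (simp only: mult.assoc)
    qed
    have 2: "\<kappa> * Delta (pw (False # w)) A [t ^ nR w, q powi (- int (Suc (nC w)))] q t p * P7 =
      Delta (pw w) (q\<^sup>2 * A) [t ^ nR w, q powi (- int (nC w))] q t p * \<rho>"
      unfolding \<rho>_def \<kappa>_def P7_def by (rule Delta_False[OF Cons.prems(1) _ Cons.prems(3) A]) (use Cons.prems(2) in simp)
    have 3: "Rc (Suc (nC w)) (nR w) a b q t * P7 = Rc (nC w) (nR w) (a * q) b q t * \<rho>"
      unfolding P7_def \<rho>_def by (rule Rc_False[OF G(10)])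
    have P7: "P7 \<noteq> 0"
    proof -
      have "th (b / (q * a * t ^ s)) \<noteq> 0" if "s < nR w" for s
        using ngD_diff[OF G(9,3), of 0 1 0 s] that length_word[of w] Cons.prems(2) by (simp add: mult_ac)
      thus ?thesis by (simp add: P7_def)
    qed
    have "(gam (a * q) b q t w * (\<kappa> * D (a * q)) * Delta (pw (False # w)) A [t ^ nR w, q powi (- int (Suc (nC w)))] q t p) * P7 =
      gam (a * q) b q t w * D (a * q) * (\<kappa> * Delta (pw (False # w)) A [t ^ nR w, q powi (- int (Suc (nC w)))] q t p * P7)"
      by (simp only: mult_ac)
    also have "\<dots> = Rc (Suc (nC w)) (nR w) a b q t * P7" unfolding 2 3 1[symmetric] by (simp only: mult.assoc)
    finally have 4: "gam (a * q) b q t w * (\<kappa> * D (a * q)) * Delta (pw (False # w)) A [t ^ nR w, q powi (- int (Suc (nC w)))] q t p =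
      Rc (Suc (nC w)) (nR w) a b q t" by (rule mult_right_cancel[THEN iffD1, OF P7])
    have "gam (\<sigma> / a) (\<sigma> / b) (1 / t) (1 / q) (map Not (False # w)) = \<kappa> * D (a * q)"
      by (simp add: \<kappa>_def D_def)
    moreover have "nC (False # w) = Suc (nC w)" "nR (False # w) = nR w" "gam a b q t (False # w) = gam (a * q) b q t w" by simp_all
    ultimately have "gam a b q t (False # w) * gam (\<sigma> / a) (\<sigma> / b) (1 / t) (1 / q) (map Not (False # w)) *
      Delta (pw (False # w)) A [t ^ nR (False # w), q powi (- int (nC (False # w)))] q t p =
      Rc (nC (False # w)) (nR (False # w)) a b q t" using 4 by (simp only:)
    thus ?thesis using False by simp
  qed
qed

lemma Rc_nonzero:
  assumes g: "gen M a b q t" "m + n \<le> M"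
  shows "Rc m n a b q t \<noteq> 0"
proof -
  note G = gen_dest[OF g(1)]
  have "th (q ^ j * t ^ s * (a * b)) \<noteq> 0" if "j < m" "s < n" for j s
    by (rule ngD_nat[OF G(6)]) (use that g(2) in auto)
  moreover have "th (q ^ j * b / (a * t ^ s)) \<noteq> 0" if "j < m" "s < n" for j s
    using ngD_diff[OF G(9,3), of j 0 0 s] that g(2) by (simp add: mult_ac)
  ultimately show ?thesis by (simp add: Rc_def)
qed

end

section \<open>Generic parameters and the theorem\<close>

lemma holomorphic_on_torus_coord:
  assumes "k \<in> {1..n}"
  shows "holomorphic_on_torus n (\<lambda>z. z k)"
  unfolding holomorphic_on_torus_def
proof (intro conjI ballI)
  show "continuous_on (torus n) (\<lambda>z. z k)"
    by (rule continuous_on_subset[OF continuous_on_product_coordinates]) auto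
  fix x i assume "i \<in> {1..n}"
  show "(\<lambda>z. (x(i := z)) k) holomorphic_on - {0}"
    by (cases "k = i") (auto intro: holomorphic_intros)
qed

lemma holomorphic_on_torus_mult:
  "holomorphic_on_torus n f \<Longrightarrow> holomorphic_on_torus n g \<Longrightarrow> holomorphic_on_torus n (\<lambda>z. f z * g z)"
  unfolding holomorphic_on_torus_def by (auto intro!: continuous_intros holomorphic_intros)

lemma holomorphic_on_torus_one: "holomorphic_on_torus n (\<lambda>z. 1)"
  unfolding holomorphic_on_torus_def by (auto intro!: continuous_intros holomorphic_intros)

lemma holomorphic_on_torus_prod:
  "(\<And>i. i \<in> I \<Longrightarrow> holomorphic_on_torus n (f i)) \<Longrightarrow> holomorphic_on_torus n (\<lambda>z. \<Prod>i\<in>I. f i z)"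
  by (induction I rule: infinite_finite_induct)
    (auto intro: holomorphic_on_torus_one holomorphic_on_torus_mult)

lemma holomorphic_on_torus_powi:
  assumes f: "holomorphic_on_torus n f" and 0: "\<And>z. z \<in> torus n \<Longrightarrow> f z \<noteq> 0"
  shows "holomorphic_on_torus n (\<lambda>z. f z powi k)"
  unfolding holomorphic_on_torus_def
proof (intro conjI ballI)
  show "continuous_on (torus n) (\<lambda>z. f z powi k)"
    using f 0 unfolding holomorphic_on_torus_def by (intro continuous_intros) auto
  fix x i assume x: "x \<in> torus n" "i \<in> {1..n}"
  show "(\<lambda>z. f (x(i := z)) powi k) holomorphic_on - {0}"
    using f x 0 torus_upd[OF x] unfolding holomorphic_on_torus_def by (intro holomorphic_intros) auto
qed

context nome
begin

lemma holomorphic_on_torus_th: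
  assumes f: "holomorphic_on_torus n f" and 0: "\<And>z. z \<in> torus n \<Longrightarrow> f z \<noteq> 0"
  shows "holomorphic_on_torus n (\<lambda>z. th (f z))"
  unfolding holomorphic_on_torus_def
proof (intro conjI ballI)
  have "th holomorphic_on - {0}" using th_holomorphic'[of "\<lambda>z. z" "- {0}"] by (auto intro: holomorphic_on_ident)
  hence th: "continuous_on (- {0}) th" by (rule holomorphic_on_imp_continuous_on)
  have "continuous_on (torus n) f" using f unfolding holomorphic_on_torus_def by blast
  moreover have "f ` torus n \<subseteq> - {0}"
  proof (rule image_subsetI)
    fix z assume "z \<in> torus n"
    from 0[OF this] show "f z \<in> - {0}" by simp
  qed
  ultimately show "continuous_on (torus n) (\<lambda>z. th (f z))" by (rule continuous_on_compose2[OF th])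
  fix x i assume x: "x \<in> torus n" "i \<in> {1..n}"
  show "(\<lambda>z. th (f (x(i := z)))) holomorphic_on - {0}"
    using f x 0 torus_upd[OF x] unfolding holomorphic_on_torus_def by (intro holomorphic_intros) auto
qed

text \<open>One factor for each inequality in \<open>gen\<close>, built from products and integer
  powers only, so that holomorphy follows factor by factor.\<close>

definition genF :: "nat \<Rightarrow> (nat \<Rightarrow> complex) \<Rightarrow> complex"
  where "genF M z = (\<Prod>i\<in>{- int M..int M}. \<Prod>j\<in>{- int M..int M}.
    th (z 3 powi i * z 4 powi j * (z 1 * z 1)) * th (z 3 powi i * z 4 powi j * (z 2 * z 2)) *
    th (z 3 powi i * z 4 powi j * (z 1 * z 2)) * th (z 3 powi i * z 4 powi j * (z 1 * z 2 powi (- 1))) *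
    (if (i, j) = (0, 0) then 1 else th (z 3 powi i * z 4 powi j)))"

lemma holomorphic_genF: "holomorphic_on_torus 4 (genF M)"
proof -
  have nz: "z k \<noteq> 0" if "z \<in> torus 4" "k \<in> {1..4}" for z :: "nat \<Rightarrow> complex" and k
    using that by (auto simp: torus_def PiE_iff)
  have "holomorphic_on_torus 4 (\<lambda>z. if (i, j) = (0, 0) then 1 else th (z 3 powi i * z 4 powi j))" for i j :: int
    by (cases "(i, j) = (0, 0)") (auto intro!: holomorphic_on_torus_one holomorphic_on_torus_th
      holomorphic_on_torus_mult holomorphic_on_torus_powi holomorphic_on_torus_coord simp: nz)
  thus ?thesis unfolding genF_def
    by (intro holomorphic_on_torus_prod holomorphic_on_torus_mult holomorphic_on_torus_th
      holomorphic_on_torus_powi holomorphic_on_torus_coord) (auto simp: nz)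
qed

lemma genF_gen:
  assumes z: "z \<in> torus 4" and F: "genF M z \<noteq> 0"
  shows "gen M (z 1) (z 2) (z 3) (z 4)"
proof -
  have nz: "z k \<noteq> 0" if "k \<in> {1..4}" for k
    using that z by (auto simp: torus_def PiE_iff)
  have f: "th (z 3 powi i * z 4 powi j * (z 1 * z 1)) \<noteq> 0" "th (z 3 powi i * z 4 powi j * (z 2 * z 2)) \<noteq> 0"
    "th (z 3 powi i * z 4 powi j * (z 1 * z 2)) \<noteq> 0" "th (z 3 powi i * z 4 powi j * (z 1 * z 2 powi (- 1))) \<noteq> 0"
    "(if (i, j) = (0, 0) then 1 else th (z 3 powi i * z 4 powi j)) \<noteq> 0"
    if "\<bar>i\<bar> \<le> int M" "\<bar>j\<bar> \<le> int M" for i j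
  proof -
    have "i \<in> {- int M..int M}" "j \<in> {- int M..int M}" using that by auto
    with F have "th (z 3 powi i * z 4 powi j * (z 1 * z 1)) * th (z 3 powi i * z 4 powi j * (z 2 * z 2)) *
      th (z 3 powi i * z 4 powi j * (z 1 * z 2)) * th (z 3 powi i * z 4 powi j * (z 1 * z 2 powi (- 1))) *
      (if (i, j) = (0, 0) then 1 else th (z 3 powi i * z 4 powi j)) \<noteq> 0"
      unfolding genF_def by (simp only: prod_zero_iff finite_atLeastAtMost_int) blast
    thus "th (z 3 powi i * z 4 powi j * (z 1 * z 1)) \<noteq> 0" "th (z 3 powi i * z 4 powi j * (z 2 * z 2)) \<noteq> 0"
      "th (z 3 powi i * z 4 powi j * (z 1 * z 2)) \<noteq> 0" "th (z 3 powi i * z 4 powi j * (z 1 * z 2 powi (- 1))) \<noteq> 0"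
      "(if (i, j) = (0, 0) then 1 else th (z 3 powi i * z 4 powi j)) \<noteq> 0"
      by (simp_all only: mult_eq_0_iff de_Morgan_disj simp_thms)
  qed
  have f5: "th (z 3 powi i * z 4 powi j) \<noteq> 0" if "\<bar>i\<bar> \<le> int M" "\<bar>j\<bar> \<le> int M" "(i, j) \<noteq> (0, 0)" for i j
    using f(5)[OF that(1,2)] that(3) by (simp only: if_False simp_thms)
  have nz34: "z 3 \<noteq> 0" "z 4 \<noteq> 0" using nz by auto
  have "gq M (z 3) (z 4)" unfolding gq_def using nz34 f5 by blast
  moreover have "ng M (z 3) (z 4) ((z 1)\<^sup>2)" "ng M (z 3) (z 4) ((z 2)\<^sup>2)" "ng M (z 3) (z 4) (z 1 * z 2)"
    using f(1-3) nz[of 1] nz[of 2] by (auto simp: ng_def power2_eq_square)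
  moreover have "ng M (z 3) (z 4) (z 1 / z 2)"
    using f(4) nz[of 1] nz[of 2] by (auto simp: ng_def power_int_minus divide_inverse)
  ultimately show ?thesis unfolding gen_def using nz[of 1] nz[of 2] by simp
qed

text \<open>Moduli that are suitable powers of \<open>norm p\<close> keep all arguments away from the powers of \<open>p\<close>.\<close>

lemma genF_nontrivial: "\<exists>z\<in>torus 4. genF M z \<noteq> 0"
proof -
  define e where "e u = complex_of_real (norm p powr u)" for u
  have p0: "norm p > 0" by simp
  have e0: "e u \<noteq> 0" for u using p0 by (simp add: e_def)
  have em: "e u * e v = e (u + v)" for u v by (simp add: e_def powr_add)
  have ei: "e u powi i = e (real_of_int i * u)" for u i
  proof -
    have en: "e u ^ n = e (real n * u)" for n
      by (induction n) (simp_all add: em algebra_simps, simp add: e_def)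
    show ?thesis
    proof (cases i)
      case (nonneg n) thus ?thesis using en[of n] by simp
    next
      case (neg n)
      have "e (real (Suc n) * u) * e (- (real (Suc n) * u)) = 1" unfolding em by (simp add: e_def)
      hence "inverse (e (real (Suc n) * u)) = e (- (real (Suc n) * u))" using e0 by (simp add: field_simps)
      moreover have "- (real (Suc n) * u) = real_of_int (- int (Suc n)) * u" by (simp add: algebra_simps)
      ultimately show ?thesis unfolding neg power_int_minus power_int_of_nat en by (simp only:)
    qed
  qed
  have te: "th (e u) \<noteq> 0" if "\<And>k::int. u \<noteq> real_of_int k" for u
  proof
    assume "th (e u) = 0"
    then obtain k :: int where "e u = p powi k" using th_eq_0_iff[OF e0] by blast
    hence "norm (e u) = norm p powi k" by (simp add: norm_power_int)
    hence "norm p powr u = norm p powr real_of_int k" using p0 by (simp add: e_def powr_real_of_int')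
    hence "u = real_of_int k" using p0 p_less by (simp add: powr_inj)
    thus False using that by blast
  qed
  have frac: "u \<noteq> real_of_int k" if "real_of_int l < u" "u < real_of_int l + 1" for u l k
  proof
    assume "u = real_of_int k"
    with that have "real_of_int l < real_of_int k" "real_of_int k < real_of_int (l + 1)" by simp_all
    thus False unfolding of_int_less_iff by simp
  qed
  \<comment> \<open>\<open>q\<close> and \<open>t\<close> will have exponents \<delta> and
    \<open>N * \<delta>\<close>. As \<open>N\<close> exceeds the range, \<open>i + N * j\<close> is
    0 only for \<open>i = j = 0\<close>, and \<delta> is small enough to keep the exponents of all
    these monomials below \<open>1 / 10\<close> in modulus.\<close>
  define N where "N = 2 * int M + 1"
  define \<delta> where "\<delta> = 1 / (20 * (real M + 1)\<^sup>2)"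
  have \<delta>0: "\<delta> > 0" by (simp add: \<delta>_def)
  have small: "\<bar>real_of_int (i + N * j) * \<delta>\<bar> < 1 / 10" if "\<bar>i\<bar> \<le> int M" "\<bar>j\<bar> \<le> int M" for i j
  proof -
    have "\<bar>i + N * j\<bar> \<le> \<bar>i\<bar> + N * \<bar>j\<bar>"
      using abs_triangle_ineq[of i "N * j"] by (simp add: abs_mult N_def)
    also have "\<dots> \<le> int M + N * int M" using that by (intro add_mono mult_left_mono) (auto simp: N_def)
    also have "\<dots> < 2 * (int M + 1)\<^sup>2" by (simp add: N_def power2_eq_square algebra_simps)
    finally have "real_of_int \<bar>i + N * j\<bar> < real_of_int (2 * (int M + 1)\<^sup>2)" by (simp only: of_int_less_iff)
    hence "\<bar>real_of_int (i + N * j)\<bar> < 2 * (real M + 1)\<^sup>2" by simp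
    hence "\<bar>real_of_int (i + N * j)\<bar> * \<delta> < 2 * (real M + 1)\<^sup>2 * \<delta>" using \<delta>0 by (rule mult_strict_right_mono)
    also have "\<dots> = 1 / 10" by (simp add: \<delta>_def)
    finally show ?thesis using \<delta>0 by (simp add: abs_mult)
  qed
  have nonz: "i + N * j \<noteq> 0" if "\<bar>i\<bar> \<le> int M" "\<bar>j\<bar> \<le> int M" "(i, j) \<noteq> (0, 0)" for i j
  proof
    assume 0: "i + N * j = 0"
    show False
    proof (cases "j = 0")
      case True thus False using 0 that(3) by simp
    next
      case False
      hence "N * 1 \<le> N * \<bar>j\<bar>" by (intro mult_left_mono) (auto simp: N_def)
      moreover have "\<bar>i\<bar> = N * \<bar>j\<bar>" using 0 by (simp add: abs_mult N_def eq_neg_iff_add_eq_0[symmetric])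
      ultimately have "N \<le> int M" using that(1) by simp
      thus False by (simp add: N_def)
    qed
  qed
  \<comment> \<open>The exponents of \<open>a^2\<close>, \<open>b^2\<close>, \<open>a * b\<close>
    and \<open>a / b\<close> are then 6/10, 3/10, 9/20 and 3/20; a perturbation below 1/10 leaves
    them strictly between 0 and 1, so they are no integers.\<close>
  define z where "z = (\<lambda>k\<in>{1..4::nat}. if k = 1 then e (3 / 10) else if k = 2 then e (3 / 20) else
    if k = 3 then e \<delta> else e (real_of_int N * \<delta>))"
  have zk: "z 1 = e (3 / 10)" "z 2 = e (3 / 20)" "z 3 = e \<delta>" "z 4 = e (real_of_int N * \<delta>)"
    by (simp_all add: z_def)
  have "z \<in> torus 4" using e0 by (auto simp: z_def torus_def)
  moreover have "genF M z \<noteq> 0"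
  proof -
    have m: "z 3 powi i * z 4 powi j = e (real_of_int (i + N * j) * \<delta>)" for i j
      unfolding zk ei em by (simp add: algebra_simps)
    have "th (z 3 powi i * z 4 powi j * (z 1 * z 1)) * th (z 3 powi i * z 4 powi j * (z 2 * z 2)) *
      th (z 3 powi i * z 4 powi j * (z 1 * z 2)) * th (z 3 powi i * z 4 powi j * (z 1 * z 2 powi (- 1))) *
      (if (i, j) = (0, 0) then 1 else th (z 3 powi i * z 4 powi j)) \<noteq> 0"
      if ij: "i \<in> {- int M..int M}" "j \<in> {- int M..int M}" for i j
    proof -
      have ij': "\<bar>i\<bar> \<le> int M" "\<bar>j\<bar> \<le> int M" using ij by auto
      note s = small[OF ij']
      have A: "th (e (real_of_int (i + N * j) * \<delta> + c)) \<noteq> 0" if "1 / 10 \<le> c" "c \<le> 9 / 10" for c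
        by (intro te frac[of 0]) (use s that in \<open>auto simp: abs_less_iff\<close>)
      have B: "th (e (real_of_int (i + N * j) * \<delta>)) \<noteq> 0" if "(i, j) \<noteq> (0, 0)"
      proof -
        define u where "u = real_of_int (i + N * j) * \<delta>"
        have "real_of_int (i + N * j) \<noteq> 0" using nonz[OF ij' that] by (simp only: of_int_eq_0_iff not_False_eq_True)
        hence "u \<noteq> 0" using \<delta>0 by (simp add: u_def)
        moreover have "\<bar>u\<bar> < 1 / 10" using s by (simp add: u_def)
        ultimately have "(real_of_int 0 < u \<and> u < real_of_int 0 + 1) \<or> (real_of_int (-1) < u \<and> u < real_of_int (-1) + 1)"
          by (auto simp: abs_less_iff)
        hence "th (e u) \<noteq> 0" using te frac by blast
        thus ?thesis unfolding u_def .
      qed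
      have C: "(if (i, j) = (0, 0) then 1 else th (e (real_of_int (i + N * j) * \<delta>))) \<noteq> 0"
      proof (cases "(i, j) = (0, 0)")
        case True thus ?thesis by (simp only: if_True one_neq_zero simp_thms)
      next
        case False thus ?thesis unfolding if_not_P[OF False] by (rule B)
      qed
      show ?thesis unfolding m unfolding zk ei em mult_eq_0_iff de_Morgan_disj
        by (intro conjI A C) auto
    qed
    thus ?thesis unfolding genF_def by (simp only: prod_zero_iff finite_atLeastAtMost_int) blast
  qed
  ultimately show ?thesis by blast
qed

text \<open>In the identity with coefficients \<open>1\<close> each \<open>P\<close> is its
  normalised function divided by a scalar, and \<open>Delta_gam\<close> turns the two scalars into
  the stated coefficient. The budget is the one under which both normalisations are known.\<close>

lemma cauchy_expansion:
  assumes s: "\<sigma>\<^sup>2 = p" and mn: "1 \<le> m" "1 \<le> n" and g: "gen M a b q t" "6 * (m + n) + 4 \<le> M"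
    and x: "x \<in> torus n" and y: "y \<in> torus m"
  shows "(\<Prod>i\<in>{1..n}. \<Prod>j\<in>{1..m}. theta [y j * x i, y j / x i] p) =
    (\<Sum>\<mu>\<in>partitions_in m n.
      Delta \<mu> (t ^ (n - 1) * a / (q ^ m * b)) [t ^ n, q powi (- int m)] q t p /
      C0 (rectangle m n) [t ^ (n - 1) * a * b, b / a] q t p *
      interpolation_theta m n \<mu> x a b q t p *
      interpolation_theta n m (rect_complement n m (conjugate \<mu>))
        (\<lambda>j\<in>{1..m}. \<sigma> / y j) (\<sigma> / a) (\<sigma> / b) (1 / t) (1 / q) p)"
proof -
  note G = gen_dest[OF g(1)]
  have s0: "\<sigma> \<noteq> 0" using s by auto
  define \<zeta> where "\<zeta> = (\<lambda>j\<in>{1..m}. \<sigma> / y j)"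
  have yj: "y j \<noteq> 0" if "j \<in> {1..m}" for j using y that by (auto simp: torus_def PiE_iff)
  have \<zeta>: "\<zeta> \<in> torus m" using yj s0 by (auto simp: \<zeta>_def torus_def)
  have "(\<Prod>i\<in>{1..n}. \<Prod>j\<in>{1..m}. theta [y j * x i, y j / x i] p) = cauchy_kernel \<sigma> (coords n x) (coords m \<zeta>)"
    unfolding cauchy_kernel_def prod_coords
  proof (intro prod.cong refl)
    fix i j assume "i \<in> {1..n}" and j: "j \<in> {1..m}"
    have "\<sigma> * x i / \<zeta> j = y j * x i" "\<sigma> / (x i * \<zeta> j) = y j / x i"
      using j yj[OF j] s0 by (simp_all add: \<zeta>_def)
    thus "theta [y j * x i, y j / x i] p = th (\<sigma> * x i / \<zeta> j) * th (\<sigma> / (x i * \<zeta> j))"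
      by (simp add: theta_Cons theta_Nil)
  qed
  also have "\<dots> = (\<Sum>w\<in>words m n. P a b q t w (coords n x) *
      P (\<sigma> / a) (\<sigma> / b) (1 / t) (1 / q) (map Not w) (coords m \<zeta>))"
    by (rule cauchy_identity[OF g(1) _ s]) (use g(2) coords_nonzero[OF x] coords_nonzero[OF \<zeta>] in auto)
  also have "\<dots> = (\<Sum>w\<in>words m n.
      Delta (pw w) (t ^ (n - 1) * a / (q ^ m * b)) [t ^ n, q powi (- int m)] q t p /
      C0 (rectangle m n) [t ^ (n - 1) * a * b, b / a] q t p *
      interpolation_theta m n (pw w) x a b q t p *
      interpolation_theta n m (rect_complement n m (conjugate (pw w))) \<zeta> (\<sigma> / a) (\<sigma> / b) (1 / t) (1 / q) p)"
  proof (rule sum.cong[OF refl])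
    fix w assume w: "w \<in> words m n"
    have w': "nC w = m" "nR w = n" using w by (simp_all add: words_def)
    define A where "A = t ^ (n - 1) * a / (q ^ m * b)"
    define R where "R = C0 (rectangle m n) [t ^ (n - 1) * a * b, b / a] q t p"
    define D where "D = Delta (pw w) A [t ^ n, q powi (- int m)] q t p"
    define c d where "c = gam a b q t w" and "d = gam (\<sigma> / a) (\<sigma> / b) (1 / t) (1 / q) (map Not w)"
    have R: "R = Rc m n a b q t" unfolding R_def by (rule C0_rectangle[OF mn(2) G(11)])
    have R0: "R \<noteq> 0" unfolding R by (rule Rc_nonzero[OF g(1)]) (use g(2) in simp)
    have "t ^ n = t ^ (n - 1) * t" using mn(2) by (simp flip: power_Suc2)
    hence A: "A * (t * q ^ m * b) = t ^ n * a" using G by (simp add: A_def)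
    have D: "c * d * D = R" unfolding c_def d_def D_def R
      using Delta_gam[OF g(1) _ s, of w A] A w' g(2) by (simp add: length_word)
    have 1: "interpolation_theta m n (pw w) x a b q t p = c * P a b q t w (coords n x)"
      unfolding c_def by (rule interpolation_theta_eq[OF g w mn x])
    have 2: "interpolation_theta n m (rect_complement n m (conjugate (pw w))) \<zeta> (\<sigma> / a) (\<sigma> / b) (1 / t) (1 / q) p =
        d * P (\<sigma> / a) (\<sigma> / b) (1 / t) (1 / q) (map Not w) (coords m \<zeta>)"
      unfolding d_def rect_complement_conjugate_pw[of w, unfolded w']
      by (rule interpolation_theta_eq[OF gen_dual[OF g(1) s] _ _ mn(2,1) \<zeta>]) (use g(2) w in auto)
    have "u * v = D / R * (c * u) * (d * v)" for u v
    proof -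
      have "D / R * (c * u) * (d * v) = c * d * D / R * (u * v)" by simp
      thus ?thesis unfolding D using R0 by simp
    qed
    thus "P a b q t w (coords n x) * P (\<sigma> / a) (\<sigma> / b) (1 / t) (1 / q) (map Not w) (coords m \<zeta>) =
      Delta (pw w) (t ^ (n - 1) * a / (q ^ m * b)) [t ^ n, q powi (- int m)] q t p /
      C0 (rectangle m n) [t ^ (n - 1) * a * b, b / a] q t p *
      interpolation_theta m n (pw w) x a b q t p *
      interpolation_theta n m (rect_complement n m (conjugate (pw w))) \<zeta> (\<sigma> / a) (\<sigma> / b) (1 / t) (1 / q) p"
      unfolding 1 2 R_def[symmetric] A_def[symmetric] D_def[symmetric] .
  qed
  also have "\<dots> = (\<Sum>\<mu>\<in>partitions_in m n.
      Delta \<mu> (t ^ (n - 1) * a / (q ^ m * b)) [t ^ n, q powi (- int m)] q t p /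
      C0 (rectangle m n) [t ^ (n - 1) * a * b, b / a] q t p *
      interpolation_theta m n \<mu> x a b q t p *
      interpolation_theta n m (rect_complement n m (conjugate \<mu>)) \<zeta> (\<sigma> / a) (\<sigma> / b) (1 / t) (1 / q) p)"
    by (rule sum.reindex_bij_betw[OF bij_betw_pw])
  finally show ?thesis unfolding \<zeta>_def .
qed

end

theorem theorem4p18:
  fixes p sqrt_p :: complex and m n :: nat
  assumes "0 < norm p" and "norm p < 1" and "sqrt_p\<^sup>2 = p"
    and "m \<ge> 1" and "n \<ge> 1"
  shows "generically (\<lambda>a b q t. \<forall>x\<in>torus n. \<forall>y\<in>torus m.
    (\<Prod>i\<in>{1..n}. \<Prod>j\<in>{1..m}. theta [y j * x i, y j / x i] p) =
    (\<Sum>\<mu>\<in>partitions_in m n.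
      Delta \<mu> (t ^ (n - 1) * a / (q ^ m * b)) [t ^ n, q powi (- int m)] q t p /
      C0 (rectangle m n) [t ^ (n - 1) * a * b, b / a] q t p *
      interpolation_theta m n \<mu> x a b q t p *
      interpolation_theta n m (rect_complement n m (conjugate \<mu>))
        (\<lambda>j\<in>{1..m}. sqrt_p / y j) (sqrt_p / a) (sqrt_p / b) (1 / t) (1 / q) p))"
proof -
  interpret nome p by unfold_locales (use assms in auto)
  show ?thesis unfolding generically_def
  proof (intro exI[of _ "genF (6 * (m + n) + 4)"] conjI ballI impI)
    show "holomorphic_on_torus 4 (genF (6 * (m + n) + 4))" by (rule holomorphic_genF)
    show "\<exists>z\<in>torus 4. genF (6 * (m + n) + 4) z \<noteq> 0" by (rule genF_nontrivial)
  qed (rule cauchy_expansion[OF assms(3-5) genF_gen order_refl])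
qed

end
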